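(* Consider on $[0,T]$ the separable SDE $$dX^{(1)}(t)=g_0^{(1)}(X^{(2)}(t))\,dt+\sum_{m=1}^M g_m^{(1)}(X^{(2)}(t))\star dW_m(t),\qquad dX^{(2)}(t)=g_0^{(2)}(X^{(1)}(t))\,dt,$$ with deterministic initial values, where the stochastic integrals are interpreted either in the Itô or in the Stratonovich sense. Let it be solved by the stochastic partitioned Runge–Kutta method which, in a step of size $h$ from $t_n$ to $t_{n+1}=t_n+h$, computes, with $$a_m=\frac{3J_{(m,0)}}{2h}-\frac{\Delta W_m}{2},\qquad b_m=-\frac{3J_{(m,0)}}{2h}+\frac{3\Delta W_m}{2},$$ the stage values $$H^{(2)}_1=Y^{(2)}_n,\qquad H^{(1)}_1=Y^{(1)}_n+\tfrac h4 g^{(1)}_0(H^{(2)}_1)+\sum_{m=1}^M a_m\,g^{(1)}_m(H^{(2)}_1),$$ $$H^{(2)}_2=Y^{(2)}_n+\tfrac{2h}{3}g^{(2)}_0(H^{(1)}_1),$$ $$H^{(1)}_2=Y^{(1)}_n+\tfrac h4 g^{(1)}_0(H^{(2)}_1)+\tfrac{3h}4 g^{(1)}_0(H^{(2)}_2)+\sum_{m=1}^M\Big(a_m\,g^{(1)}_m(H^{(2)}_1)+b_m\,g^{(1)}_m(H^{(2)}_2)\Big),$$ and then $$Y^{(1)}_{n+1}=Y^{(1)}_n+\tfrac h4 g^{(1)}_0(H^{(2)}_1)+\tfrac{3h}4 g^{(1)}_0(H^{(2)}_2)+\sum_{m=1}^M\Big(a_m\,g^{(1)}_m(H^{(2)}_1)+b_m\,g^{(1)}_m(H^{(2)}_2)\Big),$$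 $$Y^{(2)}_{n+1}=Y^{(2)}_n+\tfrac{2h}3 g^{(2)}_0(H^{(1)}_1)+\tfrac h3 g^{(2)}_0(H^{(1)}_2).$$ Then, both for Stratonovich and for Itô SDEs, the method is of strong order $1.5$.
   Context: $W_1,\dots,W_M$ are independent one-dimensional Wiener processes, $\Delta W_m=W_m(t_{n}+h)-W_m(t_n)$ and $J_{(m,0)}=\int_{t_n}^{t_n+h}(W_m(s)-W_m(t_n))\,ds$. $X^{(q)}$ takes values in $\mathbb R^{d_q}$; the symbol $\star\,dW_m$ denotes either the Itô or the Stratonovich integral. The coefficients are assumed sufficiently smooth, understood here as: all $g^{(q)}_m$ are $C^\infty$ with all partial derivatives of order $\ge1$ bounded. $Y_0^{(q)}=X^{(q)}(0)$. For a grid $0=t_0<\dots<t_N=T$ with maximal step size $h$, write $X=(X^{(1)},X^{(2)})$, $Y_n=(Y^{(1)}_n,Y^{(2)}_n)$. Strong (mean square) order $p$ means $\max_{n}\big(E\|Y_n-X(t_n)\|^2\big)^{1/2}=\mathcal O(h^p)$ as $h\to0$. *)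

theory Defs
  imports "HOL-Probability.Probability"
begin

subsection \<open>Wiener processes\<close>

definition wiener_process :: "'a measure \<Rightarrow> (real \<Rightarrow> 'a \<Rightarrow> real) \<Rightarrow> bool" where
  "wiener_process P W \<longleftrightarrow>
     prob_space P \<and>
     (\<forall>t\<ge>0. W t \<in> borel_measurable P) \<and>
     (AE \<omega> in P. W 0 \<omega> = 0) \<and>
     (\<forall>\<omega>\<in>space P. continuous_on {0..} (\<lambda>t. W t \<omega>)) \<and>
     (\<forall>s t. 0 \<le> s \<and> s < t \<longrightarrow>
        distributed P lborel (\<lambda>\<omega>. W t \<omega> - W s \<omega>) (normal_density 0 (sqrt (t - s)))) \<and>
     (\<forall>(n::nat) \<tau>. 0 \<le> \<tau> 0 \<and> (\<forall>i<n. \<tau> i < \<tau> (Suc i)) \<longrightarrow>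
        prob_space.indep_vars P (\<lambda>_. borel) (\<lambda>i \<omega>. W (\<tau> (Suc i)) \<omega> - W (\<tau> i) \<omega>) {..<n})"

text \<open>
  Independence of the processes is independence of the path-valued random variables, with the
  product sigma-algebra on the space of paths over the time axis \<open>{0..}\<close>.
\<close>

definition independent_wiener_processes ::
    "'a measure \<Rightarrow> nat \<Rightarrow> (nat \<Rightarrow> real \<Rightarrow> 'a \<Rightarrow> real) \<Rightarrow> bool" where
  "independent_wiener_processes P M W \<longleftrightarrow>
     prob_space P \<and>
     (\<forall>m\<in>{1..M}. wiener_process P (W m)) \<and>
     prob_space.indep_vars P (\<lambda>_. PiM {0..} (\<lambda>_. borel))
       (\<lambda>m \<omega>. \<lambda>t\<in>{0..}. W m t \<omega>) {1..M}"

text \<open>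
  Compatibility with the filtration that carries the solution: the driving processes are adapted
  and their joint increments after time \<open>s\<close> are independent of the information at time \<open>s\<close>.  The
  filtration generated by the Wiener processes is the special case usually meant.
\<close>

definition wiener_filtration ::
    "'a measure \<Rightarrow> (real \<Rightarrow> 'a measure) \<Rightarrow> nat \<Rightarrow> (nat \<Rightarrow> real \<Rightarrow> 'a \<Rightarrow> real) \<Rightarrow> bool" where
  "wiener_filtration P F M W \<longleftrightarrow>
     filtration (space P) F \<and>
     (\<forall>t. sets (F t) \<subseteq> sets P) \<and>
     (\<forall>m\<in>{1..M}. \<forall>t\<ge>0. W m t \<in> borel_measurable (F t)) \<and>
     (\<forall>s t. 0 \<le> s \<and> s < t \<longrightarrow>
        prob_space.indep_set P (sets (F s))
          (sets (vimage_algebra (space P) (\<lambda>\<omega>. \<lambda>m\<in>{1..M}. W m t \<omega> - W m s \<omega>)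
             (PiM {1..M} (\<lambda>_. borel)))))"


subsection \<open>Grids\<close>

definition grid :: "real \<Rightarrow> nat \<Rightarrow> (nat \<Rightarrow> real) \<Rightarrow> bool" where
  "grid T N \<tau> \<longleftrightarrow> \<tau> 0 = 0 \<and> \<tau> N = T \<and> (\<forall>n<N. \<tau> n < \<tau> (Suc n))"

text \<open>The inserted \<open>0\<close> only matters for the one-point grid of \<open>[0,0]\<close>.\<close>

definition mesh :: "nat \<Rightarrow> (nat \<Rightarrow> real) \<Rightarrow> real" where
  "mesh N \<tau> = Max (insert 0 ((\<lambda>n. \<tau> (Suc n) - \<tau> n) ` {..<N}))"


subsection \<open>Stochastic integrals\<close>

definition tendsto_in_prob ::
    "'a measure \<Rightarrow> (nat \<Rightarrow> 'a \<Rightarrow> 'b::euclidean_space) \<Rightarrow> ('a \<Rightarrow> 'b) \<Rightarrow> bool" where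
  "tendsto_in_prob P f g \<longleftrightarrow>
     (\<forall>k. f k \<in> borel_measurable P) \<and> g \<in> borel_measurable P \<and>
     (\<forall>\<epsilon>>0. (\<lambda>k. measure P {\<omega>\<in>space P. norm (f k \<omega> - g \<omega>) > \<epsilon>}) \<longlonglongrightarrow> 0)"

definition progressively_measurable ::
    "(real \<Rightarrow> 'a measure) \<Rightarrow> real \<Rightarrow> (real \<Rightarrow> 'a \<Rightarrow> 'b::euclidean_space) \<Rightarrow> bool" where
  "progressively_measurable F t H \<longleftrightarrow>
     (\<forall>u\<in>{0..t}. (\<lambda>(s, \<omega>). H s \<omega>) \<in> borel_measurable (restrict_space borel {0..u} \<Otimes>\<^sub>M F u))"

text \<open>
  A simple process on \<open>[0,t]\<close> is given by a grid \<open>\<tau>\<close> with \<open>n\<close> subintervals and by bounded values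
  \<open>\<xi> i\<close> on \<open>(\<tau> i, \<tau> (i+1)]\<close> that are known at time \<open>\<tau> i\<close>.
\<close>

definition is_simple ::
    "(real \<Rightarrow> 'a measure) \<Rightarrow> real \<Rightarrow> nat \<Rightarrow> (nat \<Rightarrow> real) \<Rightarrow>
      (nat \<Rightarrow> 'a \<Rightarrow> 'b::euclidean_space) \<Rightarrow> bool" where
  "is_simple F t n \<tau> \<xi> \<longleftrightarrow>
     grid t n \<tau> \<and>
     (\<forall>i<n. \<xi> i \<in> borel_measurable (F (\<tau> i))) \<and>
     (\<exists>B. \<forall>i<n. \<forall>\<omega>\<in>space (F (\<tau> i)). norm (\<xi> i \<omega>) \<le> B)"

definition simple_process ::
    "nat \<Rightarrow> (nat \<Rightarrow> real) \<Rightarrow> (nat \<Rightarrow> 'a \<Rightarrow> 'b::euclidean_space) \<Rightarrow> real \<Rightarrow> 'a \<Rightarrow> 'b" where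
  "simple_process n \<tau> \<xi> s \<omega> = (\<Sum>i<n. indicat_real {\<tau> i<..\<tau> (Suc i)} s *\<^sub>R \<xi> i \<omega>)"

definition simple_integral ::
    "(real \<Rightarrow> 'a \<Rightarrow> real) \<Rightarrow> nat \<Rightarrow> (nat \<Rightarrow> real) \<Rightarrow> (nat \<Rightarrow> 'a \<Rightarrow> 'b::euclidean_space) \<Rightarrow> 'a \<Rightarrow> 'b" where
  "simple_integral W n \<tau> \<xi> \<omega> = (\<Sum>i<n. (W (\<tau> (Suc i)) \<omega> - W (\<tau> i) \<omega>) *\<^sub>R \<xi> i \<omega>)"

text \<open>
  Ito integral over \<open>[0,t]\<close> of a progressively measurable integrand with almost surely square
  integrable paths, by approximation with simple processes.  Square integrability of the paths is
  implied, because the approximation error is measured by an extended nonnegative integral.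
\<close>

definition has_ito_integral ::
    "'a measure \<Rightarrow> (real \<Rightarrow> 'a measure) \<Rightarrow> (real \<Rightarrow> 'a \<Rightarrow> real) \<Rightarrow>
      (real \<Rightarrow> 'a \<Rightarrow> 'b::euclidean_space) \<Rightarrow> real \<Rightarrow> ('a \<Rightarrow> 'b) \<Rightarrow> bool" where
  "has_ito_integral P F W H t I \<longleftrightarrow>
     progressively_measurable F t H \<and>
     (\<exists>n \<tau> \<xi>. (\<forall>k. is_simple F t (n k) (\<tau> k) (\<xi> k)) \<and>
        (\<forall>\<epsilon>>0. (\<lambda>k. measure P {\<omega>\<in>space P.
            (\<integral>\<^sup>+ s\<in>{0..t}. ennreal ((norm (H s \<omega> - simple_process (n k) (\<tau> k) (\<xi> k) s \<omega>))\<^sup>2) \<partial>lborel)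
              > ennreal \<epsilon>}) \<longlonglongrightarrow> 0) \<and>
        tendsto_in_prob P (\<lambda>k. simple_integral W (n k) (\<tau> k) (\<xi> k)) I)"

definition has_stratonovich_integral ::
    "'a measure \<Rightarrow> (real \<Rightarrow> 'a \<Rightarrow> real) \<Rightarrow>
      (real \<Rightarrow> 'a \<Rightarrow> 'b::euclidean_space) \<Rightarrow> real \<Rightarrow> ('a \<Rightarrow> 'b) \<Rightarrow> bool" where
  "has_stratonovich_integral P W H t I \<longleftrightarrow>
     (\<forall>n \<tau>. (\<forall>k. grid t (n k) (\<tau> k)) \<and> (\<lambda>k. mesh (n k) (\<tau> k)) \<longlonglongrightarrow> 0 \<longrightarrow>
        tendsto_in_prob P
          (\<lambda>k \<omega>. \<Sum>i<n k. (W (\<tau> k (Suc i)) \<omega> - W (\<tau> k i) \<omega>) *\<^sub>R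
                   ((1/2) *\<^sub>R (H (\<tau> k i) \<omega> + H (\<tau> k (Suc i)) \<omega>))) I)"

datatype calculus = Ito | Stratonovich

primrec has_stoch_integral ::
    "calculus \<Rightarrow> 'a measure \<Rightarrow> (real \<Rightarrow> 'a measure) \<Rightarrow> (real \<Rightarrow> 'a \<Rightarrow> real) \<Rightarrow>
      (real \<Rightarrow> 'a \<Rightarrow> 'b::euclidean_space) \<Rightarrow> real \<Rightarrow> ('a \<Rightarrow> 'b) \<Rightarrow> bool" where
  "has_stoch_integral Ito P F W H t I = has_ito_integral P F W H t I"
| "has_stoch_integral Stratonovich P F W H t I = has_stratonovich_integral P W H t I"


subsection \<open>Coefficients\<close>

primrec iter_partial ::
    "'b list \<Rightarrow> ('b::euclidean_space \<Rightarrow> 'c::euclidean_space) \<Rightarrow> 'b \<Rightarrow> 'c" where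
  "iter_partial [] f = f"
| "iter_partial (b # bs) f = (\<lambda>x. frechet_derivative (iter_partial bs f) (at x) b)"

text \<open>
  Infinitely differentiable, with all partial derivatives of order at least 1 bounded.
  The function itself may be unbounded.
\<close>

definition smooth_bounded_derivs :: "('b::euclidean_space \<Rightarrow> 'c::euclidean_space) \<Rightarrow> bool" where
  "smooth_bounded_derivs f \<longleftrightarrow>
     (\<forall>bs. set bs \<subseteq> Basis \<longrightarrow>
        (\<forall>x. iter_partial bs f differentiable (at x)) \<and>
        (bs \<noteq> [] \<longrightarrow> bounded (range (iter_partial bs f))))"


subsection \<open>The separable SDE\<close>

text \<open>\<open>g1 0\<close> is the drift and \<open>g1 m\<close>, \<open>m \<ge> 1\<close>, are the diffusion coefficients of the first block.\<close>

definition separable_sde_solution ::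
    "calculus \<Rightarrow> 'a measure \<Rightarrow> (real \<Rightarrow> 'a measure) \<Rightarrow> nat \<Rightarrow> (nat \<Rightarrow> real \<Rightarrow> 'a \<Rightarrow> real) \<Rightarrow>
      (nat \<Rightarrow> 'y \<Rightarrow> 'x) \<Rightarrow> ('x \<Rightarrow> 'y) \<Rightarrow> 'x \<Rightarrow> 'y \<Rightarrow> real \<Rightarrow>
      (real \<Rightarrow> 'a \<Rightarrow> 'x::euclidean_space) \<Rightarrow> (real \<Rightarrow> 'a \<Rightarrow> 'y::euclidean_space) \<Rightarrow> bool" where
  "separable_sde_solution calc P F M W g1 g2 x1 x2 T X1 X2 \<longleftrightarrow>
     (\<forall>t\<in>{0..T}. X1 t \<in> borel_measurable (F t) \<and> X2 t \<in> borel_measurable (F t)) \<and>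
     (\<forall>\<omega>\<in>space P. continuous_on {0..T} (\<lambda>t. X1 t \<omega>) \<and> continuous_on {0..T} (\<lambda>t. X2 t \<omega>)) \<and>
     (AE \<omega> in P. X1 0 \<omega> = x1 \<and> X2 0 \<omega> = x2) \<and>
     (\<exists>I. \<forall>t\<in>{0..T}.
        (\<forall>m\<in>{1..M}. has_stoch_integral calc P F (W m) (\<lambda>s \<omega>. g1 m (X2 s \<omega>)) t (I m t)) \<and>
        (AE \<omega> in P. X1 t \<omega> = x1 + integral {0..t} (\<lambda>s. g1 0 (X2 s \<omega>)) + (\<Sum>m=1..M. I m t \<omega>)) \<and>
        (AE \<omega> in P. X2 t \<omega> = x2 + integral {0..t} (\<lambda>s. g2 (X1 s \<omega>))))"


subsection \<open>The stochastic partitioned Runge--Kutta method\<close>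

definition dW :: "(real \<Rightarrow> 'a \<Rightarrow> real) \<Rightarrow> real \<Rightarrow> real \<Rightarrow> 'a \<Rightarrow> real" where
  "dW W t h \<omega> = W (t + h) \<omega> - W t \<omega>"

definition J0 :: "(real \<Rightarrow> 'a \<Rightarrow> real) \<Rightarrow> real \<Rightarrow> real \<Rightarrow> 'a \<Rightarrow> real" where
  "J0 W t h \<omega> = integral {t..t + h} (\<lambda>s. W s \<omega> - W t \<omega>)"

definition coeff_a :: "(real \<Rightarrow> 'a \<Rightarrow> real) \<Rightarrow> real \<Rightarrow> real \<Rightarrow> 'a \<Rightarrow> real" where
  "coeff_a W t h \<omega> = 3 * J0 W t h \<omega> / (2 * h) - dW W t h \<omega> / 2"

definition coeff_b :: "(real \<Rightarrow> 'a \<Rightarrow> real) \<Rightarrow> real \<Rightarrow> real \<Rightarrow> 'a \<Rightarrow> real" where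
  "coeff_b W t h \<omega> = - (3 * J0 W t h \<omega> / (2 * h)) + 3 * dW W t h \<omega> / 2"

definition sprk_step ::
    "nat \<Rightarrow> (nat \<Rightarrow> real \<Rightarrow> 'a \<Rightarrow> real) \<Rightarrow>
      (nat \<Rightarrow> 'y::euclidean_space \<Rightarrow> 'x::euclidean_space) \<Rightarrow> ('x \<Rightarrow> 'y) \<Rightarrow>
      real \<Rightarrow> real \<Rightarrow> 'a \<Rightarrow> 'x \<times> 'y \<Rightarrow> 'x \<times> 'y" where
  "sprk_step M W g1 g2 t h \<omega> Y =
     (let Y1 = fst Y; Y2 = snd Y;
          a = (\<lambda>m. coeff_a (W m) t h \<omega>);
          b = (\<lambda>m. coeff_b (W m) t h \<omega>);
          H21 = Y2;
          H11 = Y1 + (h/4) *\<^sub>R g1 0 H21 + (\<Sum>m=1..M. a m *\<^sub>R g1 m H21);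
          H22 = Y2 + (2*h/3) *\<^sub>R g2 H11;
          H12 = Y1 + (h/4) *\<^sub>R g1 0 H21 + (3*h/4) *\<^sub>R g1 0 H22
                + (\<Sum>m=1..M. a m *\<^sub>R g1 m H21 + b m *\<^sub>R g1 m H22)
      in (Y1 + (h/4) *\<^sub>R g1 0 H21 + (3*h/4) *\<^sub>R g1 0 H22
            + (\<Sum>m=1..M. a m *\<^sub>R g1 m H21 + b m *\<^sub>R g1 m H22),
          Y2 + (2*h/3) *\<^sub>R g2 H11 + (h/3) *\<^sub>R g2 H12))"

primrec sprk ::
    "nat \<Rightarrow> (nat \<Rightarrow> real \<Rightarrow> 'a \<Rightarrow> real) \<Rightarrow>
      (nat \<Rightarrow> 'y::euclidean_space \<Rightarrow> 'x::euclidean_space) \<Rightarrow> ('x \<Rightarrow> 'y) \<Rightarrow> 'x \<times> 'y \<Rightarrow>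
      (nat \<Rightarrow> real) \<Rightarrow> nat \<Rightarrow> 'a \<Rightarrow> 'x \<times> 'y" where
  "sprk M W g1 g2 x0 \<tau> 0 \<omega> = x0"
| "sprk M W g1 g2 x0 \<tau> (Suc n) \<omega> =
     sprk_step M W g1 g2 (\<tau> n) (\<tau> (Suc n) - \<tau> n) \<omega> (sprk M W g1 g2 x0 \<tau> n \<omega>)"


subsection \<open>Strong convergence\<close>

text \<open>
  \<open>Y \<tau> n\<close> is the approximation at the \<open>n\<close>-th point of the grid \<open>\<tau>\<close>.  Integrability is stated
  separately because the Bochner integral of a non-integrable function is \<open>0\<close>.
  The constant is uniform over all (not necessarily equidistant) grids of small maximal step.
\<close>

definition strong_order ::
    "'a measure \<Rightarrow> real \<Rightarrow> (real \<Rightarrow> 'a \<Rightarrow> 'b::euclidean_space) \<Rightarrow>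
      ((nat \<Rightarrow> real) \<Rightarrow> nat \<Rightarrow> 'a \<Rightarrow> 'b) \<Rightarrow> real \<Rightarrow> bool" where
  "strong_order P T X Y p \<longleftrightarrow>
     (\<exists>C. \<exists>h0>0. \<forall>N \<tau>. grid T N \<tau> \<and> mesh N \<tau> \<le> h0 \<longrightarrow>
        (\<forall>n\<le>N. integrable P (\<lambda>\<omega>. (norm (Y \<tau> n \<omega> - X (\<tau> n) \<omega>))\<^sup>2)) \<and>
        (MAX n\<in>{..N}. sqrt (\<integral>\<omega>. (norm (Y \<tau> n \<omega> - X (\<tau> n) \<omega>))\<^sup>2 \<partial>P))
          \<le> C * mesh N \<tau> powr p)"

end

theory Submission
  imports Defs
begin

text \<open>
  Since \<open>X2\<close> is continuously differentiable along almost every path, each integrand \<open>g1 m (X2 s)\<close> has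
  finite variation, and integration by parts identifies both the Ito and the Stratonovich integral
  with a pathwise integral: the two equations coincide and can be expanded by ordinary calculus.
  Pathwise Taylor expansion gives a local error \<open>M + R\<close>.  The remainder \<open>R\<close> is \<open>O(h powr (5/2))\<close>, times
  exponentials of the oscillation of the driving paths, whose moments are finite by Doob's inequality.
  The term \<open>M\<close> is \<open>O(h\<^sup>2)\<close> and has conditional mean zero at the beginning of the step: this is
  what the weights \<open>a\<^sub>m\<close> and \<open>b\<^sub>m\<close> achieve.  Hence the mean square error \<open>e\<close> satisfies
  \<open>e (n+1) \<le> (1 + C h) e n + C h ^ 4\<close>, and summation yields \<open>e n = O(h ^ 3)\<close>.
\<close>

subsection \<open>Taylor expansion of the coefficients\<close>

text \<open>Noise enters \<open>X1\<close> only, and \<open>X2\<close> moves by order h within a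
  step. Hence no double integral of two Wiener processes of order h occurs, and dW and J0 carry all
  the noise up to order 3/2. The weights solve a + b = dW and (2h/3) a + (h/3) dW = J0, whence
  (2h/3) b = h dW - J0; with these identities all noise terms up to order 3/2 cancel along every
  path. The products of order 2 cancel only in conditional mean, because a a has mean h/4 and b a
  has mean 0 for equal indices, and both have mean 0 for different ones. The obstacle is dependence.
  The Gronwall constant of a path is exponential in its oscillation over the whole interval, and it
  is not independent of the error accumulated so far. The factor of the error may involve the
  increments of the current step alone, whose moments given the past are controlled.\<close>

abbreviation D1 :: "('b::euclidean_space \<Rightarrow> 'c::euclidean_space) \<Rightarrow> 'b \<Rightarrow> 'b \<Rightarrow> 'c" where
  "D1 f x v \<equiv> frechet_derivative f (at x) v"

text \<open>The hypotheses speak of iterated partial derivatives, so the second derivative is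
  assembled from differentials of partials: linear in \<open>v\<close> by construction, and in
  \<open>w\<close> because each partial derivative is itself differentiable.\<close>

definition D2 :: "('b::euclidean_space \<Rightarrow> 'c::euclidean_space) \<Rightarrow> 'b \<Rightarrow> 'b \<Rightarrow> 'b \<Rightarrow> 'c" where
  "D2 f x v w = (\<Sum>i\<in>Basis. (v \<bullet> i) *\<^sub>R D1 (\<lambda>z. D1 f z i) x w)"

lemma iter_partial_append: "iter_partial (bs @ cs) f = iter_partial bs (iter_partial cs f)"
  by (induction bs) auto

text \<open>\<open>iter_partial\<close> applies the end of the list first, so differentiating
  beforehand amounts to appending \<open>i\<close>. The class is thus closed under partial
  derivatives, and every estimate proved for \<open>f\<close> can be repeated for its
  partials.\<close>

lemma smooth_partial:
  assumes "smooth_bounded_derivs f" "i \<in> Basis"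
  shows "smooth_bounded_derivs (\<lambda>x. D1 f x i)"
proof -
  have eq: "iter_partial bs (\<lambda>x. D1 f x i) = iter_partial (bs @ [i]) f" for bs
    by (simp add: iter_partial_append)
  show ?thesis
    unfolding smooth_bounded_derivs_def eq
    using assms unfolding smooth_bounded_derivs_def by fastforce
qed

lemma smooth_deriv:
  assumes "smooth_bounded_derivs f"
  shows "(f has_derivative D1 f x) (at x)"
proof -
  have "iter_partial [] f differentiable (at x)"
    using assms unfolding smooth_bounded_derivs_def by (metis empty_set empty_subsetI)
  then show ?thesis by (simp add: frechet_derivative_works)
qed

lemma smooth_linear: "smooth_bounded_derivs f \<Longrightarrow> linear (D1 f x)"
  using has_derivative_linear smooth_deriv by blast

lemma smooth_continuous: "smooth_bounded_derivs f \<Longrightarrow> continuous_on S f"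
  by (meson continuous_at_imp_continuous_on has_derivative_continuous smooth_deriv)

lemma D1_sum:
  assumes "smooth_bounded_derivs f"
  shows "D1 f x v = (\<Sum>i\<in>Basis. (v \<bullet> i) *\<^sub>R D1 f x i)"
proof -
  have "D1 f x v = D1 f x (\<Sum>i\<in>Basis. (v \<bullet> i) *\<^sub>R i)"
    by (simp add: euclidean_representation)
  also have "\<dots> = (\<Sum>i\<in>Basis. (v \<bullet> i) *\<^sub>R D1 f x i)"
    using smooth_linear[OF assms, of x] by (simp add: linear_sum linear_cmul)
  finally show ?thesis .
qed

lemma smooth_D1_bound:
  fixes f :: "'b::euclidean_space \<Rightarrow> 'c::euclidean_space"
  assumes "smooth_bounded_derivs f"
  obtains L where "L \<ge> 0" "\<And>x v. norm (D1 f x v) \<le> L * norm v"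
proof -
  have "\<exists>B. \<forall>x. norm (D1 f x i) \<le> B" if "i \<in> Basis" for i :: 'b
  proof -
    have "bounded (range (iter_partial [i] f))"
      using assms that unfolding smooth_bounded_derivs_def
      by (metis list.distinct(1) empty_set empty_subsetI insert_subset list.set(2))
    then show ?thesis by (auto simp: bounded_iff)
  qed
  then obtain B where B: "\<And>i x. i \<in> (Basis :: 'b set) \<Longrightarrow> norm (D1 f x i) \<le> B i" by metis
  have B0: "B i \<ge> 0" if "i \<in> Basis" for i using B[OF that, of 0] norm_ge_zero order_trans by blast
  show thesis
  proof
    show "(\<Sum>i\<in>(Basis::'b set). B i) \<ge> 0" using B0 by (simp add: sum_nonneg)
    fix x v
    have "norm (D1 f x v) \<le> (\<Sum>i\<in>Basis. norm ((v \<bullet> i) *\<^sub>R D1 f x i))"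
      by (subst D1_sum[OF assms]) (rule norm_sum)
    also have "\<dots> \<le> (\<Sum>i\<in>Basis. norm v * B i)"
      using B B0 by (intro sum_mono) (auto intro!: mult_mono simp: Basis_le_norm)
    finally show "norm (D1 f x v) \<le> (\<Sum>i\<in>(Basis::'b set). B i) * norm v"
      by (simp add: sum_distrib_left mult.commute)
  qed
qed

text \<open>Mean value inequality. The Lipschitz and Taylor estimates below come from it by
  restricting a function to a segment and subtracting the matching Taylor polynomial.\<close>

lemma unit_interval_bound:
  fixes p :: "real \<Rightarrow> 'c::euclidean_space"
  assumes "\<And>t. t \<in> {0..1} \<Longrightarrow> (p has_vector_derivative p' t) (at t)"
    and "\<And>t. t \<in> {0..1} \<Longrightarrow> norm (p' t) \<le> B"
  shows "norm (p 1 - p 0) \<le> B"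
proof -
  have "norm (p 1 - p 0) \<le> B * norm (1 - 0 :: real)"
  proof (rule differentiable_bound[of "{0..1}"])
    fix t :: real assume t: "t \<in> {0..1}"
    show "(p has_derivative (\<lambda>s. s *\<^sub>R p' t)) (at t within {0..1})"
      using assms(1)[OF t] unfolding has_vector_derivative_def
      using has_derivative_at_withinI by blast
    show "onorm (\<lambda>s. s *\<^sub>R p' t) \<le> B"
      using assms(2)[OF t]
      by (intro onorm_le) (simp add: mult.commute[of B] mult_left_mono)
  qed auto
  then show ?thesis by simp
qed

lemma smooth_line_deriv:
  assumes "smooth_bounded_derivs f"
  shows "((\<lambda>t. f (x + t *\<^sub>R v)) has_vector_derivative D1 f (x + t *\<^sub>R v) v) (at t)"
proof -
  have "((\<lambda>t. x + t *\<^sub>R v) has_derivative (\<lambda>t. t *\<^sub>R v)) (at t)"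
    by (auto intro!: derivative_eq_intros)
  from has_derivative_compose[OF this smooth_deriv[OF assms]]
  have "((\<lambda>t. f (x + t *\<^sub>R v)) has_derivative (\<lambda>s. D1 f (x + t *\<^sub>R v) (s *\<^sub>R v))) (at t)" .
  then show ?thesis
    unfolding has_vector_derivative_def using linear_cmul[OF smooth_linear[OF assms]] by simp
qed

lemma smooth_lipschitz:
  fixes f :: "'b::euclidean_space \<Rightarrow> 'c::euclidean_space"
  assumes "smooth_bounded_derivs f"
  obtains L where "L \<ge> 0" "\<And>x v. norm (f (x + v) - f x) \<le> L * norm v"
proof -
  obtain L where L: "L \<ge> 0" "\<And>x v. norm (D1 f x v) \<le> L * norm v"
    using smooth_D1_bound[OF assms] by blast
  show thesis
  proof (rule that[OF L(1)])
    fix x v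
    show "norm (f (x + v) - f x) \<le> L * norm v"
      using unit_interval_bound[of "\<lambda>t. f (x + t *\<^sub>R v)" "\<lambda>t. D1 f (x + t *\<^sub>R v) v" "L * norm v"]
        smooth_line_deriv[OF assms] L by auto
  qed
qed

lemma smooth_D1_lipschitz:
  fixes f :: "'b::euclidean_space \<Rightarrow> 'c::euclidean_space"
  assumes "smooth_bounded_derivs f"
  obtains L where "L \<ge> 0" "\<And>x k v. norm (D1 f (x + k) v - D1 f x v) \<le> L * norm k * norm v"
proof -
  have "\<forall>i\<in>(Basis::'b set). \<exists>L\<ge>0. \<forall>x k. norm (D1 f (x + k) i - D1 f x i) \<le> L * norm k"
    using smooth_lipschitz[OF smooth_partial[OF assms]] by metis
  then obtain B where B: "\<And>i. i \<in> (Basis::'b set) \<Longrightarrow> B i \<ge> 0"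
    "\<And>i x k. i \<in> (Basis::'b set) \<Longrightarrow> norm (D1 f (x + k) i - D1 f x i) \<le> B i * norm k" by metis
  show thesis
  proof
    show "(\<Sum>i\<in>(Basis::'b set). B i) \<ge> 0" using B by (simp add: sum_nonneg)
    fix x k v
    have "D1 f (x + k) v - D1 f x v = (\<Sum>i\<in>Basis. (v \<bullet> i) *\<^sub>R (D1 f (x + k) i - D1 f x i))"
      by (subst (1 2) D1_sum[OF assms]) (simp add: sum_subtractf scaleR_diff_right)
    also have "norm \<dots> \<le> (\<Sum>i\<in>Basis. norm ((v \<bullet> i) *\<^sub>R (D1 f (x + k) i - D1 f x i)))"
      by (rule norm_sum)
    also have "\<dots> \<le> (\<Sum>i\<in>Basis. norm v * (B i * norm k))"
      using B by (intro sum_mono) (auto intro!: mult_mono simp: Basis_le_norm)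
    also have "\<dots> = (\<Sum>i\<in>(Basis::'b set). B i) * norm k * norm v"
      by (simp add: sum_distrib_left sum_distrib_right algebra_simps)
    finally show "norm (D1 f (x + k) v - D1 f x v) \<le> (\<Sum>i\<in>(Basis::'b set). B i) * norm k * norm v" .
  qed
qed

lemma smooth_taylor1:
  fixes f :: "'b::euclidean_space \<Rightarrow> 'c::euclidean_space"
  assumes "smooth_bounded_derivs f"
  obtains L where "L \<ge> 0" "\<And>x v. norm (f (x + v) - f x - D1 f x v) \<le> L * (norm v)\<^sup>2"
proof -
  obtain L where L: "L \<ge> 0" "\<And>x k v. norm (D1 f (x + k) v - D1 f x v) \<le> L * norm k * norm v"
    using smooth_D1_lipschitz[OF assms] by blast
  show thesis
  proof (rule that[OF L(1)])
    fix x v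
    have "norm ((\<lambda>t. f (x + t *\<^sub>R v) - t *\<^sub>R D1 f x v) 1 - (\<lambda>t. f (x + t *\<^sub>R v) - t *\<^sub>R D1 f x v) 0)
        \<le> L * (norm v)\<^sup>2"
    proof (rule unit_interval_bound)
      fix t :: real assume t: "t \<in> {0..1}"
      show "((\<lambda>t. f (x + t *\<^sub>R v) - t *\<^sub>R D1 f x v) has_vector_derivative
          D1 f (x + t *\<^sub>R v) v - D1 f x v) (at t)"
        by (rule smooth_line_deriv[OF assms] derivative_eq_intros | simp)+
      have "norm (D1 f (x + t *\<^sub>R v) v - D1 f x v) \<le> L * norm (t *\<^sub>R v) * norm v" by (rule L)
      also have "\<dots> \<le> L * norm v * norm v"
        using t L(1) by (intro mult_right_mono mult_left_mono) (auto intro: mult_left_le_one_le)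
      finally show "norm (D1 f (x + t *\<^sub>R v) v - D1 f x v) \<le> L * (norm v)\<^sup>2"
        by (simp add: power2_eq_square mult.assoc)
    qed
    then show "norm (f (x + v) - f x - D1 f x v) \<le> L * (norm v)\<^sup>2"
      by (simp add: algebra_simps)
  qed
qed

text \<open>Once the quadratic polynomial is subtracted along a segment, the derivative in
  \<open>t\<close> is a combination of first-order remainders of the partial derivatives.
  \<open>smooth_taylor1\<close> for the partials bounds these quadratically, and the direction
  itself supplies the third factor.\<close>

lemma smooth_taylor2:
  fixes f :: "'b::euclidean_space \<Rightarrow> 'c::euclidean_space"
  assumes "smooth_bounded_derivs f"
  obtains L where "L \<ge> 0"
    "\<And>x v. norm (f (x + v) - f x - D1 f x v - (1/2) *\<^sub>R D2 f x v v) \<le> L * (norm v) ^ 3"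
proof -
  have "\<forall>i\<in>(Basis::'b set). \<exists>L\<ge>0. \<forall>x k. norm (D1 f (x + k) i - D1 f x i - D1 (\<lambda>z. D1 f z i) x k)
      \<le> L * (norm k)\<^sup>2"
    using smooth_taylor1[OF smooth_partial[OF assms]] by metis
  then obtain B where B: "\<And>i. i \<in> (Basis::'b set) \<Longrightarrow> B i \<ge> 0"
    "\<And>i x k. i \<in> (Basis::'b set) \<Longrightarrow> norm (D1 f (x + k) i - D1 f x i - D1 (\<lambda>z. D1 f z i) x k)
      \<le> B i * (norm k)\<^sup>2" by metis
  show thesis
  proof
    show "(\<Sum>i\<in>(Basis::'b set). B i) \<ge> 0" using B by (simp add: sum_nonneg)
    fix x v
    define p where "p = (\<lambda>t. f (x + t *\<^sub>R v) - t *\<^sub>R D1 f x v - (t\<^sup>2/2) *\<^sub>R D2 f x v v)"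
    have "norm (p 1 - p 0) \<le> (\<Sum>i\<in>(Basis::'b set). B i) * (norm v) ^ 3"
    proof (rule unit_interval_bound)
      fix t :: real assume t: "t \<in> {0..1}"
      show "(p has_vector_derivative D1 f (x + t *\<^sub>R v) v - D1 f x v - t *\<^sub>R D2 f x v v) (at t)"
        unfolding p_def
        by (rule smooth_line_deriv[OF assms] derivative_eq_intros | simp)+
      have eq: "D1 f (x + t *\<^sub>R v) v - D1 f x v - t *\<^sub>R D2 f x v v
          = (\<Sum>i\<in>Basis. (v \<bullet> i) *\<^sub>R (D1 f (x + t *\<^sub>R v) i - D1 f x i - D1 (\<lambda>z. D1 f z i) x (t *\<^sub>R v)))"
      proof -
        have "t *\<^sub>R D2 f x v v = (\<Sum>i\<in>Basis. (v \<bullet> i) *\<^sub>R D1 (\<lambda>z. D1 f z i) x (t *\<^sub>R v))"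
          unfolding D2_def scaleR_sum_right
          by (intro sum.cong refl)
            (simp only: linear_cmul[OF smooth_linear[OF smooth_partial[OF assms]]] scaleR_left_commute)
        then show ?thesis
          by (simp only: D1_sum[OF assms, of _ v] sum_subtractf[symmetric] scaleR_diff_right)
      qed
      have "norm (D1 f (x + t *\<^sub>R v) v - D1 f x v - t *\<^sub>R D2 f x v v)
        \<le> (\<Sum>i\<in>Basis. norm ((v \<bullet> i) *\<^sub>R (D1 f (x + t *\<^sub>R v) i - D1 f x i - D1 (\<lambda>z. D1 f z i) x (t *\<^sub>R v))))"
        unfolding eq by (rule norm_sum)
      also have "\<dots> \<le> (\<Sum>i\<in>Basis. norm v * (B i * (norm v)\<^sup>2))"
      proof (rule sum_mono)
        fix i :: 'b assume i: "i \<in> Basis"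
        have "norm (D1 f (x + t *\<^sub>R v) i - D1 f x i - D1 (\<lambda>z. D1 f z i) x (t *\<^sub>R v)) \<le> B i * (norm (t *\<^sub>R v))\<^sup>2"
          by (rule B(2)[OF i])
        also have "\<dots> \<le> B i * (norm v)\<^sup>2"
          using t by (intro mult_left_mono[OF power_mono B(1)[OF i]]) (simp_all add: mult_left_le_one_le)
        finally show "norm ((v \<bullet> i) *\<^sub>R (D1 f (x + t *\<^sub>R v) i - D1 f x i - D1 (\<lambda>z. D1 f z i) x (t *\<^sub>R v)))
           \<le> norm v * (B i * (norm v)\<^sup>2)"
          using i by (auto intro!: mult_mono simp: Basis_le_norm)
      qed
      also have "\<dots> = (\<Sum>i\<in>(Basis::'b set). B i) * (norm v) ^ 3"
        by (simp add: sum_distrib_left sum_distrib_right algebra_simps power2_eq_square power3_eq_cube)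
      finally show "norm (D1 f (x + t *\<^sub>R v) v - D1 f x v - t *\<^sub>R D2 f x v v)
        \<le> (\<Sum>i\<in>(Basis::'b set). B i) * (norm v) ^ 3" .
    qed
    then show "norm (f (x + v) - f x - D1 f x v - (1/2) *\<^sub>R D2 f x v v) \<le> (\<Sum>i\<in>(Basis::'b set). B i) * (norm v) ^ 3"
      by (simp add: p_def algebra_simps)
  qed
qed

lemma bilinear_D2:
  assumes "smooth_bounded_derivs f"
  shows "bilinear (D2 f x)"
  unfolding bilinear_def
proof (intro conjI allI)
  show "linear (D2 f x v)" for v
    unfolding D2_def
    by (intro linear_compose_sum ballI linear_compose_scale_right
        smooth_linear[OF smooth_partial[OF assms]])
  show "linear (\<lambda>v. D2 f x v w)" for w
    unfolding D2_def
    by (intro linearI)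
      (auto simp: inner_add_left scaleR_left_distrib sum.distrib scaleR_sum_right)
qed

lemma smooth_D2_bound:
  fixes f :: "'b::euclidean_space \<Rightarrow> 'c::euclidean_space"
  assumes "smooth_bounded_derivs f"
  obtains L where "L \<ge> 0" "\<And>x v w. norm (D2 f x v w) \<le> L * norm v * norm w"
proof -
  have "\<forall>i\<in>(Basis::'b set). \<exists>L\<ge>0. \<forall>x k. norm (D1 (\<lambda>z. D1 f z i) x k) \<le> L * norm k"
    using smooth_D1_bound[OF smooth_partial[OF assms]] by metis
  then obtain B where B: "\<And>i. i \<in> (Basis::'b set) \<Longrightarrow> B i \<ge> 0"
    "\<And>i x k. i \<in> (Basis::'b set) \<Longrightarrow> norm (D1 (\<lambda>z. D1 f z i) x k) \<le> B i * norm k" by metis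
  show thesis
  proof
    show "(\<Sum>i\<in>(Basis::'b set). B i) \<ge> 0" using B by (simp add: sum_nonneg)
    fix x v w
    have "norm (D2 f x v w) \<le> (\<Sum>i\<in>Basis. norm ((v \<bullet> i) *\<^sub>R D1 (\<lambda>z. D1 f z i) x w))"
      unfolding D2_def by (rule norm_sum)
    also have "\<dots> \<le> (\<Sum>i\<in>Basis. norm v * (B i * norm w))"
      using B by (intro sum_mono) (auto intro!: mult_mono simp: Basis_le_norm)
    also have "\<dots> = (\<Sum>i\<in>(Basis::'b set). B i) * norm v * norm w"
      by (simp add: sum_distrib_left sum_distrib_right algebra_simps)
    finally show "norm (D2 f x v w) \<le> (\<Sum>i\<in>(Basis::'b set). B i) * norm v * norm w" .
  qed
qed

text \<open>One constant for all growth, Lipschitz and remainder estimates, so that the order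
  calculus never has to track which coefficient a bound came from. The first bound is linear growth,
  since the coefficients themselves may be unbounded.\<close>

definition taylor_bounded :: "real \<Rightarrow> ('b::euclidean_space \<Rightarrow> 'c::euclidean_space) \<Rightarrow> bool" where
  "taylor_bounded L f \<longleftrightarrow>
     smooth_bounded_derivs f \<and>
     (\<forall>x. norm (f x) \<le> L * (1 + norm x)) \<and>
     (\<forall>x y. norm (f x - f y) \<le> L * norm (x - y)) \<and>
     (\<forall>x v. norm (D1 f x v) \<le> L * norm v) \<and>
     (\<forall>x y v. norm (D1 f x v - D1 f y v) \<le> L * norm (x - y) * norm v) \<and>
     (\<forall>x v w. norm (D2 f x v w) \<le> L * norm v * norm w) \<and>
     (\<forall>x v. norm (f (x + v) - f x - D1 f x v) \<le> L * (norm v)\<^sup>2) \<and>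
     (\<forall>x v. norm (f (x + v) - f x - D1 f x v - (1/2) *\<^sub>R D2 f x v v) \<le> L * (norm v) ^ 3)"

lemma taylor_bounded_mono:
  assumes "taylor_bounded L f" "L \<le> L'"
  shows "taylor_bounded L' f"
proof -
  have m: "a \<le> L * b \<Longrightarrow> 0 \<le> b \<Longrightarrow> a \<le> L' * b" for a b :: real
    using assms(2) mult_right_mono order_trans by blast
  have m2: "a \<le> L * b * c \<Longrightarrow> 0 \<le> b \<Longrightarrow> 0 \<le> c \<Longrightarrow> a \<le> L' * b * c" for a b c :: real
    using m[of a "b * c"] by (simp add: mult.assoc)
  show ?thesis
    using assms(1) unfolding taylor_bounded_def by (simp add: m m2)
qed

lemma smooth_imp_taylor_bounded:
  fixes f :: "'b::euclidean_space \<Rightarrow> 'c::euclidean_space"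
  assumes f: "smooth_bounded_derivs f"
  obtains L where "taylor_bounded L f"
proof -
  obtain L1 where L1: "L1 \<ge> 0" "\<And>x v. norm (f (x + v) - f x) \<le> L1 * norm v"
    using smooth_lipschitz[OF f] by blast
  obtain L2 where L2: "L2 \<ge> 0" "\<And>x v. norm (D1 f x v) \<le> L2 * norm v"
    using smooth_D1_bound[OF f] by blast
  obtain L3 where L3: "L3 \<ge> 0" "\<And>x k v. norm (D1 f (x + k) v - D1 f x v) \<le> L3 * norm k * norm v"
    using smooth_D1_lipschitz[OF f] by blast
  obtain L4 where L4: "L4 \<ge> 0" "\<And>x v w. norm (D2 f x v w) \<le> L4 * norm v * norm w"
    using smooth_D2_bound[OF f] by blast
  obtain L5 where L5: "L5 \<ge> 0" "\<And>x v. norm (f (x + v) - f x - D1 f x v) \<le> L5 * (norm v)\<^sup>2"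
    using smooth_taylor1[OF f] by blast
  obtain L6 where L6: "L6 \<ge> 0"
    "\<And>x v. norm (f (x + v) - f x - D1 f x v - (1/2) *\<^sub>R D2 f x v v) \<le> L6 * (norm v) ^ 3"
    using smooth_taylor2[OF f] by blast
  define L where "L = norm (f 0) + L1 + L2 + L3 + L4 + L5 + L6"
  have le: "norm (f 0) + L1 \<le> L" "L1 \<le> L" "L2 \<le> L" "L3 \<le> L" "L4 \<le> L" "L5 \<le> L" "L6 \<le> L"
    unfolding L_def using L1 L2 L3 L4 L5 L6 norm_ge_zero[of "f 0"] by linarith+
  have m: "a \<le> K * b \<Longrightarrow> K \<le> L \<Longrightarrow> 0 \<le> b \<Longrightarrow> a \<le> L * b" for a b K :: real
    using mult_right_mono order_trans by blast
  have m2: "a \<le> K * b * c \<Longrightarrow> K \<le> L \<Longrightarrow> 0 \<le> b \<Longrightarrow> 0 \<le> c \<Longrightarrow> a \<le> L * b * c" for a b c K :: real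
    using m[of a K "b * c"] by (simp add: mult.assoc)
  have "norm (f x) \<le> L * (1 + norm x)" for x
  proof -
    have "norm (f x) \<le> norm (f 0) + L1 * norm x"
      using L1(2)[of 0 x] norm_triangle_ineq2[of "f x" "f 0"] by simp
    also have "\<dots> \<le> (norm (f 0) + L1) * (1 + norm x)"
      using L1(1) by (simp add: algebra_simps)
    finally show ?thesis using le(1) by (rule m) simp
  qed
  moreover have "norm (f x - f y) \<le> L * norm (x - y)" for x y
    using m[OF L1(2)[of y "x - y"] le(2)] by simp
  moreover have "norm (D1 f x v - D1 f y v) \<le> L * norm (x - y) * norm v" for x y v
    using m2[OF L3(2)[of y "x - y" v] le(4)] by simp
  ultimately have "taylor_bounded L f"
    unfolding taylor_bounded_def
    using f m[OF L2(2) le(3)] m2[OF L4(2) le(5)] m[OF L5(2) le(6)] m[OF L6(2) le(7)] by simp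
  then show thesis ..
qed

lemma borel_measurable_D1_D2:
  assumes f: "smooth_bounded_derivs (f :: 'b::euclidean_space \<Rightarrow> 'c::euclidean_space)"
    and [measurable]: "x \<in> borel_measurable N" "v \<in> borel_measurable N" "w \<in> borel_measurable N"
  shows "(\<lambda>\<omega>. f (x \<omega>)) \<in> borel_measurable N"
    and "(\<lambda>\<omega>. D1 f (x \<omega>) (v \<omega>)) \<in> borel_measurable N"
    and "(\<lambda>\<omega>. D2 f (x \<omega>) (v \<omega>) (w \<omega>)) \<in> borel_measurable N"
proof -
  have [measurable]: "f \<in> borel_measurable borel"
    using smooth_continuous[OF f] by (rule borel_measurable_continuous_onI)
  show "(\<lambda>\<omega>. f (x \<omega>)) \<in> borel_measurable N" by measurable
  have D1: "(\<lambda>\<omega>. D1 h (x \<omega>) (u \<omega>)) \<in> borel_measurable N"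
    if h: "smooth_bounded_derivs h" and [measurable]: "u \<in> borel_measurable N"
    for h :: "'b \<Rightarrow> 'c" and u
  proof -
    have [measurable]: "(\<lambda>x. D1 h x i) \<in> borel_measurable borel" if "i \<in> Basis" for i
      using smooth_continuous[OF smooth_partial[OF h that]] by (rule borel_measurable_continuous_onI)
    have "(\<lambda>\<omega>. \<Sum>i\<in>Basis. (u \<omega> \<bullet> i) *\<^sub>R D1 h (x \<omega>) i) \<in> borel_measurable N"
      by measurable
    then show ?thesis by (subst D1_sum[OF h])
  qed
  show "(\<lambda>\<omega>. D1 f (x \<omega>) (v \<omega>)) \<in> borel_measurable N" by (rule D1[OF f]) fact
  have [measurable]: "(\<lambda>\<omega>. D1 (\<lambda>z. D1 f z i) (x \<omega>) (w \<omega>)) \<in> borel_measurable N" if "i \<in> Basis" for i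
    by (rule D1[OF smooth_partial[OF f that]]) fact
  show "(\<lambda>\<omega>. D2 f (x \<omega>) (v \<omega>) (w \<omega>)) \<in> borel_measurable N"
    unfolding D2_def by measurable
qed

lemma continuous_on_D1:
  assumes f: "smooth_bounded_derivs f"
    and c: "continuous_on S x" "continuous_on S v"
  shows "continuous_on S (\<lambda>s. D1 f (x s) (v s))"
proof -
  have "continuous_on S (\<lambda>s. D1 f (x s) i)" if "i \<in> Basis" for i
    using continuous_on_compose2[OF smooth_continuous[OF smooth_partial[OF f that], of UNIV] c(1)] by auto
  then have "continuous_on S (\<lambda>s. \<Sum>i\<in>Basis. (v s \<bullet> i) *\<^sub>R D1 f (x s) i)"
    by (intro continuous_intros c)
  then show ?thesis by (subst D1_sum[OF f])
qed

subsection \<open>Increments of the driving processes\<close>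

text \<open>Completing the square: the factor \<open>exp (c * x)\<close> shifts the mean of the
  Gaussian density and leaves a constant in front.\<close>

lemma normal_density_exp:
  assumes "\<sigma> > 0"
  shows "integrable lborel (\<lambda>x. normal_density 0 \<sigma> x * exp (c * x))"
    and "(\<integral>x. normal_density 0 \<sigma> x * exp (c * x) \<partial>lborel) = exp (c\<^sup>2 * \<sigma>\<^sup>2 / 2)"
proof -
  have eq: "normal_density 0 \<sigma> x * exp (c * x) = exp (c\<^sup>2 * \<sigma>\<^sup>2 / 2) * normal_density (c * \<sigma>\<^sup>2) \<sigma> x" for x
  proof -
    have "- x\<^sup>2 / (2 * \<sigma>\<^sup>2) + c * x = c\<^sup>2 * \<sigma>\<^sup>2 / 2 + (- (x - c * \<sigma>\<^sup>2)\<^sup>2 / (2 * \<sigma>\<^sup>2))"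
      using assms by (simp add: field_simps power2_eq_square)
    then have "exp (- x\<^sup>2 / (2 * \<sigma>\<^sup>2)) * exp (c * x)
        = exp (c\<^sup>2 * \<sigma>\<^sup>2 / 2) * exp (- (x - c * \<sigma>\<^sup>2)\<^sup>2 / (2 * \<sigma>\<^sup>2))"
      by (simp only: exp_add[symmetric])
    then show ?thesis by (simp add: normal_density_def)
  qed
  show "integrable lborel (\<lambda>x. normal_density 0 \<sigma> x * exp (c * x))"
    unfolding eq using assms by simp
  show "(\<integral>x. normal_density 0 \<sigma> x * exp (c * x) \<partial>lborel) = exp (c\<^sup>2 * \<sigma>\<^sup>2 / 2)"
    unfolding eq using assms by simp
qed

locale wiener_setup =
  fixes P :: "'a measure" and F :: "real \<Rightarrow> 'a measure"
    and M :: nat and W :: "nat \<Rightarrow> real \<Rightarrow> 'a \<Rightarrow> real"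
  assumes independent: "independent_wiener_processes P M W"
    and filtered: "wiener_filtration P F M W"
begin

sublocale prob_space P
  using independent unfolding independent_wiener_processes_def by blast

lemma space_F: "space (F t) = space P"
  using filtered unfolding wiener_filtration_def filtration_def by blast

lemma sets_F_mono: "s \<le> t \<Longrightarrow> sets (F s) \<subseteq> sets (F t)"
  using filtered unfolding wiener_filtration_def filtration_def by blast

lemma sets_F: "sets (F t) \<subseteq> sets P"
  using filtered unfolding wiener_filtration_def by blast

lemma measurable_F_mono: "\<xi> \<in> F s \<rightarrow>\<^sub>M N \<Longrightarrow> s \<le> t \<Longrightarrow> \<xi> \<in> F t \<rightarrow>\<^sub>M N"
  using sets_F_mono[of s t] unfolding measurable_def space_F by auto

lemma measurable_F: "\<xi> \<in> F s \<rightarrow>\<^sub>M N \<Longrightarrow> \<xi> \<in> P \<rightarrow>\<^sub>M N"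
  using sets_F[of s] unfolding measurable_def space_F by auto

lemma W_F: "m \<in> {1..M} \<Longrightarrow> 0 \<le> t \<Longrightarrow> W m t \<in> borel_measurable (F t)"
  using filtered unfolding wiener_filtration_def by blast

lemma W_F_le: "m \<in> {1..M} \<Longrightarrow> 0 \<le> t \<Longrightarrow> t \<le> u \<Longrightarrow> W m t \<in> borel_measurable (F u)"
  using W_F measurable_F_mono by blast

lemma W_meas: "m \<in> {1..M} \<Longrightarrow> 0 \<le> t \<Longrightarrow> W m t \<in> borel_measurable P"
  using W_F measurable_F by blast

lemma wiener: "m \<in> {1..M} \<Longrightarrow> wiener_process P (W m)"
  using independent unfolding independent_wiener_processes_def by blast

lemma W_0: "m \<in> {1..M} \<Longrightarrow> AE \<omega> in P. W m 0 \<omega> = 0"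
  using wiener unfolding wiener_process_def by blast

lemma W_cont: "m \<in> {1..M} \<Longrightarrow> \<omega> \<in> space P \<Longrightarrow> S \<subseteq> {0..} \<Longrightarrow> continuous_on S (\<lambda>t. W m t \<omega>)"
  using wiener continuous_on_subset unfolding wiener_process_def by blast

lemma W_normal: "m \<in> {1..M} \<Longrightarrow> 0 \<le> s \<Longrightarrow> s < t \<Longrightarrow>
    distributed P lborel (\<lambda>\<omega>. W m t \<omega> - W m s \<omega>) (normal_density 0 (sqrt (t - s)))"
  using wiener unfolding wiener_process_def by blast

text \<open>A Borel function of the increment vector generates a sub-sigma-algebra of the one in
  \<open>wiener_filtration\<close>, and independence passes to sub-sigma-algebras. Working with the
  whole vector makes products of increments of two different processes available.\<close>

lemma increment_indep:
  assumes st: "0 \<le> s" "s < t" and xi: "(\<xi> :: 'a \<Rightarrow> real) \<in> borel_measurable (F s)"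
    and g: "(g :: _ \<Rightarrow> real) \<in> borel_measurable (PiM {1..M} (\<lambda>_. borel))"
  shows "indep_var borel \<xi> borel (\<lambda>\<omega>. g (\<lambda>m\<in>{1..M}. W m t \<omega> - W m s \<omega>))"
proof -
  let ?V = "\<lambda>\<omega>. \<lambda>m\<in>{1..M}. W m t \<omega> - W m s \<omega>"
  have ind: "indep_set (sets (F s)) (sets (vimage_algebra (space P) ?V (PiM {1..M} (\<lambda>_. borel))))"
    using filtered st unfolding wiener_filtration_def by blast
  have V: "?V \<in> P \<rightarrow>\<^sub>M PiM {1..M} (\<lambda>_. borel)"
    using st W_meas by (intro measurable_restrict borel_measurable_diff) auto
  let ?A = "vimage_algebra (space P) ?V (PiM {1..M} (\<lambda>_. borel))"
  have gV: "(\<lambda>\<omega>. g (?V \<omega>)) \<in> borel_measurable ?A"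
    by (rule measurable_compose[OF measurable_vimage_algebra1 g]) (use measurable_space[OF V] in blast)
  have sub: "sigma_sets (space P) {f -` A \<inter> space P |A. A \<in> sets borel} \<subseteq> sets N"
    if f: "f \<in> borel_measurable N" and N: "space N = space P" for f :: "'a \<Rightarrow> real" and N
  proof -
    have "{f -` A \<inter> space P |A. A \<in> sets borel} \<subseteq> sets N"
      using measurable_sets[OF f] N by auto
    from sets.sigma_sets_subset[OF this] N show ?thesis by simp
  qed
  show ?thesis
    unfolding indep_var_eq
  proof (intro conjI)
    show "\<xi> \<in> borel_measurable P" using measurable_F xi by blast
    show "(\<lambda>\<omega>. g (?V \<omega>)) \<in> borel_measurable P" using measurable_compose[OF V g] .
    show "indep_set (sigma_sets (space P) {\<xi> -` A \<inter> space P |A. A \<in> sets borel})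
     (sigma_sets (space P) {(\<lambda>\<omega>. g (?V \<omega>)) -` A \<inter> space P |A. A \<in> sets borel})"
      using ind sub[OF xi space_F] sub[OF gV space_vimage_algebra] unfolding indep_sets2_eq
      by (meson order_trans subsetD)
  qed
qed

lemma increment_fun_indep:
  assumes "0 \<le> s" "s < t" and "(\<xi> :: 'a \<Rightarrow> real) \<in> borel_measurable (F s)" and m: "m \<in> {1..M}" "l \<in> {1..M}"
    and g: "(\<lambda>(x, y). g x y :: real) \<in> borel_measurable (borel \<Otimes>\<^sub>M borel)"
  shows "indep_var borel \<xi> borel (\<lambda>\<omega>. g (W m t \<omega> - W m s \<omega>) (W l t \<omega> - W l s \<omega>))"
proof -
  have "(\<lambda>v. (v m, v l)) \<in> PiM {1..M} (\<lambda>_. borel) \<rightarrow>\<^sub>M borel \<Otimes>\<^sub>M borel"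
    using m by (intro measurable_Pair measurable_component_singleton) auto
  from measurable_compose[OF this g]
  have "(\<lambda>v. g (v m) (v l)) \<in> borel_measurable (PiM {1..M} (\<lambda>_. borel))" by simp
  from increment_indep[OF assms(1-3) this] show ?thesis using m by simp
qed

lemma increment_moments:
  assumes st: "0 \<le> s" "s < t" and m: "m \<in> {1..M}"
  shows "integrable P (\<lambda>\<omega>. W m t \<omega> - W m s \<omega>)"
    and "expectation (\<lambda>\<omega>. W m t \<omega> - W m s \<omega>) = 0"
    and "integrable P (\<lambda>\<omega>. (W m t \<omega> - W m s \<omega>)\<^sup>2)"
    and "expectation (\<lambda>\<omega>. (W m t \<omega> - W m s \<omega>)\<^sup>2) = t - s"
    and "integrable P (\<lambda>\<omega>. exp (c * (W m t \<omega> - W m s \<omega>)))"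
    and "expectation (\<lambda>\<omega>. exp (c * (W m t \<omega> - W m s \<omega>))) = exp (c\<^sup>2 * (t - s) / 2)"
proof -
  note D = W_normal[OF m st]
  have pos: "sqrt (t - s) > 0" using st by simp
  show "integrable P (\<lambda>\<omega>. W m t \<omega> - W m s \<omega>)"
    using distributed_integrable[OF D, of "\<lambda>x. x"] integrable_normal_moment_nz_1[OF pos, of 0] by simp
  show e: "expectation (\<lambda>\<omega>. W m t \<omega> - W m s \<omega>) = 0"
    using normal_distributed_expectation[OF pos D] .
  show "integrable P (\<lambda>\<omega>. (W m t \<omega> - W m s \<omega>)\<^sup>2)"
    using distributed_integrable[OF D, of "\<lambda>x. x\<^sup>2"] integrable_normal_moment[OF pos, of 0 2] by simp
  show "expectation (\<lambda>\<omega>. (W m t \<omega> - W m s \<omega>)\<^sup>2) = t - s"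
    using normal_distributed_variance[OF pos D] st by (simp add: e)
  show "integrable P (\<lambda>\<omega>. exp (c * (W m t \<omega> - W m s \<omega>)))"
    using distributed_integrable[OF D, of "\<lambda>x. exp (c * x)"] normal_density_exp(1)[OF pos] by simp
  show "expectation (\<lambda>\<omega>. exp (c * (W m t \<omega> - W m s \<omega>))) = exp (c\<^sup>2 * (t - s) / 2)"
    using distributed_integral[OF D, of "\<lambda>x. exp (c * x)"] normal_density_exp(2)[OF pos, of c] st by simp
qed

text \<open>Evaluating the paths at two times turns independence of the path-valued variables into
  independence of the increments.\<close>

lemma increment_cross_moment:
  assumes st: "0 \<le> s" "s < t" and m: "m \<in> {1..M}" "l \<in> {1..M}" "m \<noteq> l"
  shows "integrable P (\<lambda>\<omega>. (W m t \<omega> - W m s \<omega>) * (W l t \<omega> - W l s \<omega>))"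
    and "expectation (\<lambda>\<omega>. (W m t \<omega> - W m s \<omega>) * (W l t \<omega> - W l s \<omega>)) = 0"
proof -
  let ?V = "\<lambda>m \<omega>. W m t \<omega> - W m s \<omega>"
  have "indep_vars (\<lambda>_. PiM {0..} (\<lambda>_. borel)) (\<lambda>m \<omega>. \<lambda>t\<in>{0..}. W m t \<omega>) {1..M}"
    using independent unfolding independent_wiener_processes_def by blast
  from indep_vars_compose2[OF this, of "\<lambda>_ p. p t - p s" "\<lambda>_. borel"]
  have "indep_vars (\<lambda>_. borel) (\<lambda>m \<omega>. (\<lambda>t\<in>{0..}. W m t \<omega>) t - (\<lambda>t\<in>{0..}. W m t \<omega>) s) {1..M}"
    using st by (auto intro!: borel_measurable_diff measurable_component_singleton)
  then have "indep_vars (\<lambda>_. borel) ?V {1..M}" using st by simp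
  then have ind: "indep_vars (\<lambda>_. borel) ?V {m, l}"
    by (rule indep_vars_subset) (use m in auto)
  have int: "integrable P (?V i)" if "i \<in> {m, l}" for i
    using that m st increment_moments(1) by blast
  have "integrable P (\<lambda>\<omega>. \<Prod>i\<in>{m, l}. ?V i \<omega>)"
    by (rule indep_vars_integrable[OF _ ind int]) auto
  then show "integrable P (\<lambda>\<omega>. (W m t \<omega> - W m s \<omega>) * (W l t \<omega> - W l s \<omega>))" using m by simp
  have "expectation (\<lambda>\<omega>. \<Prod>i\<in>{m, l}. ?V i \<omega>) = (\<Prod>i\<in>{m, l}. expectation (?V i))"
    by (rule indep_vars_lebesgue_integral[OF _ ind int]) auto
  then show "expectation (\<lambda>\<omega>. (W m t \<omega> - W m s \<omega>) * (W l t \<omega> - W l s \<omega>)) = 0"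
    using m st increment_moments(2) by simp
qed

text \<open>Conditional mean and conditional exponential moment of an increment given
  \<open>F s\<close>, expressed by testing against integrable \<open>F s\<close>-measurable weights.
  This weak form takes the place of conditional expectations throughout. The case
  \<open>s = t\<close> is treated apart, as the independence assumption concerns proper
  increments.\<close>

lemma weighted_increment:
  assumes st: "0 \<le> s" "s \<le> t" and xi: "\<xi> \<in> borel_measurable (F s)" "integrable P \<xi>" and m: "m \<in> {1..M}"
  shows "integrable P (\<lambda>\<omega>. \<xi> \<omega> * (W m t \<omega> - W m s \<omega>))"
    and "expectation (\<lambda>\<omega>. \<xi> \<omega> * (W m t \<omega> - W m s \<omega>)) = 0"
    and "integrable P (\<lambda>\<omega>. \<xi> \<omega> * exp (c * (W m t \<omega> - W m s \<omega>)))"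
    and "expectation (\<lambda>\<omega>. \<xi> \<omega> * exp (c * (W m t \<omega> - W m s \<omega>))) = expectation \<xi> * exp (c\<^sup>2 * (t - s) / 2)"
proof -
  have "integrable P (\<lambda>\<omega>. \<xi> \<omega> * (W m t \<omega> - W m s \<omega>)) \<and>
     expectation (\<lambda>\<omega>. \<xi> \<omega> * (W m t \<omega> - W m s \<omega>)) = 0 \<and>
     integrable P (\<lambda>\<omega>. \<xi> \<omega> * exp (c * (W m t \<omega> - W m s \<omega>))) \<and>
     expectation (\<lambda>\<omega>. \<xi> \<omega> * exp (c * (W m t \<omega> - W m s \<omega>))) = expectation \<xi> * exp (c\<^sup>2 * (t - s) / 2)"
  proof (cases "s = t")
    case True
    then show ?thesis using xi by simp
  next
    case False
    with st have st': "s < t" by simp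
    have 1: "indep_var borel \<xi> borel (\<lambda>\<omega>. W m t \<omega> - W m s \<omega>)"
      using increment_fun_indep[OF st(1) st' xi(1) m m, of "\<lambda>x y. x"] by simp
    have 2: "indep_var borel \<xi> borel (\<lambda>\<omega>. exp (c * (W m t \<omega> - W m s \<omega>)))"
      using increment_fun_indep[OF st(1) st' xi(1) m m, of "\<lambda>x y. exp (c * x)"] by simp
    note mom = increment_moments[OF st(1) st' m]
    show ?thesis
      using indep_var_integrable[OF 1 xi(2) mom(1)] indep_var_lebesgue_integral[OF 1 xi(2) mom(1)]
        indep_var_integrable[OF 2 xi(2) mom(5)] indep_var_lebesgue_integral[OF 2 xi(2) mom(5)] mom
      by simp
  qed
  then show "integrable P (\<lambda>\<omega>. \<xi> \<omega> * (W m t \<omega> - W m s \<omega>))"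
    "expectation (\<lambda>\<omega>. \<xi> \<omega> * (W m t \<omega> - W m s \<omega>)) = 0"
    "integrable P (\<lambda>\<omega>. \<xi> \<omega> * exp (c * (W m t \<omega> - W m s \<omega>)))"
    "expectation (\<lambda>\<omega>. \<xi> \<omega> * exp (c * (W m t \<omega> - W m s \<omega>))) = expectation \<xi> * exp (c\<^sup>2 * (t - s) / 2)"
    by blast+
qed

lemma weighted_increment_product:
  assumes st: "0 \<le> s" "s \<le> t" and xi: "\<xi> \<in> borel_measurable (F s)" "integrable P \<xi>"
    and m: "m \<in> {1..M}" "l \<in> {1..M}"
  shows "integrable P (\<lambda>\<omega>. \<xi> \<omega> * ((W m t \<omega> - W m s \<omega>) * (W l t \<omega> - W l s \<omega>)))"
    and "expectation (\<lambda>\<omega>. \<xi> \<omega> * ((W m t \<omega> - W m s \<omega>) * (W l t \<omega> - W l s \<omega>)))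
          = (if m = l then (t - s) * expectation \<xi> else 0)"
proof -
  have "integrable P (\<lambda>\<omega>. \<xi> \<omega> * ((W m t \<omega> - W m s \<omega>) * (W l t \<omega> - W l s \<omega>))) \<and>
     expectation (\<lambda>\<omega>. \<xi> \<omega> * ((W m t \<omega> - W m s \<omega>) * (W l t \<omega> - W l s \<omega>)))
          = (if m = l then (t - s) * expectation \<xi> else 0)"
  proof (cases "s = t")
    case True
    then show ?thesis by simp
  next
    case False
    with st have st': "s < t" by simp
    have 1: "indep_var borel \<xi> borel (\<lambda>\<omega>. (W m t \<omega> - W m s \<omega>) * (W l t \<omega> - W l s \<omega>))"
      using increment_fun_indep[OF st(1) st' xi(1) m, of "\<lambda>x y. x * y"] by simp
    have int: "integrable P (\<lambda>\<omega>. (W m t \<omega> - W m s \<omega>) * (W l t \<omega> - W l s \<omega>))"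
      and ex: "expectation (\<lambda>\<omega>. (W m t \<omega> - W m s \<omega>) * (W l t \<omega> - W l s \<omega>)) = (if m = l then t - s else 0)"
      using increment_moments(3,4)[OF st(1) st' m(1)] increment_cross_moment[OF st(1) st' m]
      by (auto simp: power2_eq_square)
    show ?thesis
      using indep_var_integrable[OF 1 xi(2) int] indep_var_lebesgue_integral[OF 1 xi(2) int] ex
      by simp
  qed
  then show "integrable P (\<lambda>\<omega>. \<xi> \<omega> * ((W m t \<omega> - W m s \<omega>) * (W l t \<omega> - W l s \<omega>)))"
    "expectation (\<lambda>\<omega>. \<xi> \<omega> * ((W m t \<omega> - W m s \<omega>) * (W l t \<omega> - W l s \<omega>)))
          = (if m = l then (t - s) * expectation \<xi> else 0)"
    by blast+
qed

end

subsection \<open>Exponential moments of the oscillation\<close>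

definition osc :: "(real \<Rightarrow> 'a \<Rightarrow> real) \<Rightarrow> real \<Rightarrow> real \<Rightarrow> 'a \<Rightarrow> real" where
  "osc w t h \<omega> = (SUP s\<in>{t..t+h}. \<bar>w s \<omega> - w t \<omega>\<bar>)"

text \<open>The oscillation sampled at \<open>k\<close> equal subintervals: a finite maximum, hence
  measurable and within reach of a discrete maximal inequality.\<close>

definition grid_osc :: "(real \<Rightarrow> 'a \<Rightarrow> real) \<Rightarrow> real \<Rightarrow> real \<Rightarrow> nat \<Rightarrow> 'a \<Rightarrow> real" where
  "grid_osc w t h k \<omega> = Max ((\<lambda>i. \<bar>w (t + real i * (h / real k)) \<omega> - w t \<omega>\<bar>) ` {..k})"

lemma osc_ge:
  assumes "continuous_on {t..t+h} (\<lambda>s. w s \<omega>)" "s \<in> {t..t+h}"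
  shows "\<bar>w s \<omega> - w t \<omega>\<bar> \<le> osc w t h \<omega>"
  unfolding osc_def
proof (rule cSUP_upper[OF assms(2)])
  have "compact ((\<lambda>s. \<bar>w s \<omega> - w t \<omega>\<bar>) ` {t..t+h})"
    by (intro compact_continuous_image continuous_intros assms(1)) simp
  then show "bdd_above ((\<lambda>s. \<bar>w s \<omega> - w t \<omega>\<bar>) ` {t..t+h})"
    by (intro bounded_imp_bdd_above compact_imp_bounded)
qed

lemma osc_nonneg:
  assumes "continuous_on {t..t+h} (\<lambda>s. w s \<omega>)" "0 \<le> h"
  shows "0 \<le> osc w t h \<omega>"
  using osc_ge[where w=w and \<omega>=\<omega>, OF assms(1), of t] assms(2) by simp

lemma osc_le:
  assumes "0 \<le> h" "\<And>s. s \<in> {t..t+h} \<Longrightarrow> \<bar>w s \<omega> - w t \<omega>\<bar> \<le> K"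
  shows "osc w t h \<omega> \<le> K"
  unfolding osc_def using assms by (intro cSUP_least) auto

text \<open>By continuity the supremum is attained at some \<open>s\<close>. The grid points just
  below \<open>s\<close> converge to it, so the sampled maximum is squeezed between the value at
  these points and the supremum.\<close>

lemma grid_osc_tendsto:
  assumes c: "continuous_on {t..t+h} (\<lambda>s. w s \<omega>)" and h: "0 \<le> h"
  shows "(\<lambda>k. grid_osc w t h (Suc k) \<omega>) \<longlonglongrightarrow> osc w t h \<omega>"
proof -
  obtain s where s: "s \<in> {t..t+h}" and smax: "\<And>r. r \<in> {t..t+h} \<Longrightarrow> \<bar>w r \<omega> - w t \<omega>\<bar> \<le> \<bar>w s \<omega> - w t \<omega>\<bar>"
  proof -
    have "continuous_on {t..t+h} (\<lambda>s. \<bar>w s \<omega> - w t \<omega>\<bar>)" by (intro continuous_intros c)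
    then have "\<exists>s\<in>{t..t+h}. \<forall>r\<in>{t..t+h}. \<bar>w r \<omega> - w t \<omega>\<bar> \<le> \<bar>w s \<omega> - w t \<omega>\<bar>"
      using h by (intro continuous_attains_sup) auto
    then show ?thesis using that by blast
  qed
  have osc: "osc w t h \<omega> = \<bar>w s \<omega> - w t \<omega>\<bar>"
    using osc_le[where w=w and \<omega>=\<omega>, OF h smax] osc_ge[where w=w and \<omega>=\<omega>, OF c s] by force
  \<comment> \<open>The last grid point not beyond \<open>s\<close>. For \<open>h = 0\<close> the
    quotient is \<open>0\<close> by convention, and so is the index.\<close>
  define i where "i k = nat \<lfloor>(s - t) * real (Suc k) / h\<rfloor>" for k
  define p where "p k = t + real (i k) * (h / real (Suc k))" for k
  have i_le: "i k \<le> Suc k" for k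
  proof (cases "h = 0")
    case False
    have "(s - t) * real (Suc k) / h \<le> real (Suc k)"
      using False h s mult_right_mono[of "s - t" h "real (Suc k)"]
      by (simp add: pos_divide_le_eq mult.commute)
    then show ?thesis unfolding i_def
      by (metis floor_mono floor_of_nat nat_int nat_mono)
  qed (simp add: i_def)
  have p: "s - h / real (Suc k) \<le> p k" "p k \<le> s" "t \<le> p k" for k
  proof -
    have "s - h / real (Suc k) \<le> p k \<and> p k \<le> s"
    proof (cases "h = 0")
      case True then show ?thesis using s by (simp add: p_def)
    next
      case False
      let ?x = "(s - t) * real (Suc k) / h"
      have x0: "?x \<ge> 0" using s h by simp
      then have "real (i k) \<le> ?x" "?x - 1 \<le> real (i k)"
        unfolding i_def by linarith+
      moreover have e: "?x * (h / real (Suc k)) = s - t" using False by simp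
      ultimately have "real (i k) * (h / real (Suc k)) \<le> ?x * (h / real (Suc k))"
        "(?x - 1) * (h / real (Suc k)) \<le> real (i k) * (h / real (Suc k))"
        using h by (intro mult_right_mono; simp)+
      then have "real (i k) * (h / real (Suc k)) \<le> s - t"
        "s - t - h / real (Suc k) \<le> real (i k) * (h / real (Suc k))"
        by (simp_all only: left_diff_distrib[of ?x 1] e mult_1)
      then show ?thesis unfolding p_def by linarith
    qed
    then show "s - h / real (Suc k) \<le> p k" "p k \<le> s" by auto
    show "t \<le> p k" unfolding p_def using h by simp
  qed
  have "p \<longlonglongrightarrow> s"
  proof (rule real_tendsto_sandwich[of "\<lambda>k. s - h / real (Suc k)" _ _ "\<lambda>_. s"])
    have "(\<lambda>k. s - h / real (Suc k)) \<longlonglongrightarrow> s - 0"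
      by (intro tendsto_intros LIMSEQ_Suc[OF lim_const_over_n])
    then show "(\<lambda>k. s - h / real (Suc k)) \<longlonglongrightarrow> s" by simp
  qed (use p in auto)
  moreover have "\<forall>\<^sub>F k in sequentially. p k \<in> {t..t+h}"
    using p s by (intro always_eventually) (auto intro: order_trans)
  ultimately have lim: "(\<lambda>k. \<bar>w (p k) \<omega> - w t \<omega>\<bar>) \<longlonglongrightarrow> \<bar>w s \<omega> - w t \<omega>\<bar>"
    using continuous_on_tendsto_compose[OF c, of p s sequentially] s
    by (intro tendsto_intros) simp
  show ?thesis unfolding osc
  proof (rule real_tendsto_sandwich[OF _ _ lim tendsto_const])
    show "\<forall>\<^sub>F k in sequentially. \<bar>w (p k) \<omega> - w t \<omega>\<bar> \<le> grid_osc w t h (Suc k) \<omega>"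
      unfolding grid_osc_def p_def using i_le by (intro always_eventually allI Max_ge) auto
    have "t + real j * (h / real (Suc k)) \<in> {t..t+h}" if "j \<le> Suc k" for j k
    proof -
      have "real j * (h / real (Suc k)) \<le> real (Suc k) * (h / real (Suc k))"
        using that h by (intro mult_right_mono) auto
      then show ?thesis using h by simp
    qed
    then show "\<forall>\<^sub>F k in sequentially. grid_osc w t h (Suc k) \<omega> \<le> \<bar>w s \<omega> - w t \<omega>\<bar>"
      unfolding grid_osc_def using smax by (intro always_eventually allI Max.boundedI) auto
  qed
qed

context wiener_setup
begin

text \<open>As a function of x, the expression x z - x^2/2 peaks at x = z. Updating the running
  maximum either leaves \<open>r\<close> alone or moves it exactly to that peak.\<close>

lemma doob_step: "r * z - r\<^sup>2 / 2 \<le> max r z * z - (max r z)\<^sup>2 / 2" for r z :: real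
proof (cases "z \<le> r")
  case False
  then show ?thesis
    using zero_le_power2[of "r - z"] by (simp add: max_absorb2 power2_diff) (simp add: power2_eq_square)
qed (simp add: max_absorb1)

text \<open>
  Doob's maximal inequality in \<open>L\<^sup>2\<close> for the submartingale \<open>exp (c S) + exp (- c S)\<close>, by a pathwise
  argument: the running maximum \<open>R\<close> of a sequence \<open>Z\<close> makes \<open>R Z - R\<^sup>2 / 2\<close> grow by at least
  \<open>R\<close> times the increment of \<open>Z\<close>.
\<close>

lemma doob_exp:
  fixes c :: real
  assumes t: "0 \<le> t" and xi: "\<xi> \<in> borel_measurable (F t)" "integrable P \<xi>" "\<And>\<omega>. 0 \<le> \<xi> \<omega>"
    and m: "m \<in> {1..M}" and u: "u 0 = t" "\<And>i. u i \<le> u (Suc i)"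
  defines "S \<equiv> \<lambda>i \<omega>. W m (u i) \<omega> - W m t \<omega>"
  defines "R \<equiv> \<lambda>n \<omega>. Max ((\<lambda>i. exp (c * S i \<omega>) + exp (- c * S i \<omega>)) ` {..n})"
  shows "integrable P (\<lambda>\<omega>. \<xi> \<omega> * (R n \<omega>)\<^sup>2)"
    and "expectation (\<lambda>\<omega>. \<xi> \<omega> * (R n \<omega>)\<^sup>2) \<le> 16 * exp (2 * c\<^sup>2 * (u n - t)) * expectation \<xi>"
proof -
  define Z where "Z = (\<lambda>i \<omega>. exp (c * S i \<omega>) + exp (- c * S i \<omega>))"
  have R: "R n \<omega> = Max ((\<lambda>i. Z i \<omega>) ` {..n})" for n \<omega> by (simp add: R_def Z_def)
  have u_mono: "u i \<le> u j" if "i \<le> j" for i j using lift_Suc_mono_le[of u, OF u(2) that] .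
  have tu: "t \<le> u i" for i using u_mono[of 0 i] u(1) by simp
  have R_0: "R 0 = Z 0" by (simp add: R fun_eq_iff)
  have R_Suc: "R (Suc k) \<omega> = max (R k \<omega>) (Z (Suc k) \<omega>)" for k \<omega>
    unfolding R atMost_Suc image_insert by (subst Max_insert) (auto simp: max.commute)
  have Zpos: "0 \<le> Z i \<omega>" for i \<omega> by (simp add: Z_def add_nonneg_nonneg)
  have Rge: "Z i \<omega> \<le> R k \<omega>" if "i \<le> k" for i k \<omega> unfolding R using that by (intro Max_ge) auto
  have Rpos: "0 \<le> R k \<omega>" for k \<omega> using Rge[of 0 k] Zpos[of 0] by (meson le0 order_trans)
  have SF: "S i \<in> borel_measurable (F (u i))" for i
    unfolding S_def using t tu[of i] by (intro borel_measurable_diff W_F_le m) auto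
  have ZF: "Z i \<in> borel_measurable (F (u i))" for i
    unfolding Z_def using SF[of i] by measurable
  have RF: "R k \<in> borel_measurable (F (u k))" for k
  proof (induction k)
    case 0 then show ?case using ZF[of 0] R_0 by simp
  next
    case (Suc k)
    have "R (Suc k) = (\<lambda>\<omega>. max (R k \<omega>) (Z (Suc k) \<omega>))" using R_Suc by blast
    then show ?case
      using measurable_F_mono[OF Suc u(2)] ZF[of "Suc k"] by simp
  qed
  have xiF: "\<xi> \<in> borel_measurable (F (u k))" for k using measurable_F_mono[OF xi(1) tu] .
  have [measurable]: "\<xi> \<in> borel_measurable P" "Z i \<in> borel_measurable P" "S i \<in> borel_measurable P"
     "R i \<in> borel_measurable P" for i
    using measurable_F xi(1) ZF RF SF by blast+
  have Z2: "(Z i \<omega>)\<^sup>2 = exp ((2 * c) * S i \<omega>) + exp ((- 2 * c) * S i \<omega>) + 2" for i \<omega>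
    using exp_double[of "c * S i \<omega>"] exp_double[of "- c * S i \<omega>"] exp_add[of "c * S i \<omega>" "- c * S i \<omega>"]
    unfolding Z_def power2_sum by (simp add: mult.assoc)
  have intZ2: "integrable P (\<lambda>\<omega>. \<xi> \<omega> * (Z i \<omega>)\<^sup>2)" for i
    unfolding Z2 distrib_left S_def
    by (intro Bochner_Integration.integrable_add weighted_increment(3)[OF t tu xi(1,2) m] Bochner_Integration.integrable_mult_left xi(2))
  \<comment> \<open>A crude bound of the maximum by a sum, used only for integrability.\<close>
  have R2: "(R k \<omega>)\<^sup>2 \<le> (\<Sum>i\<le>k. (Z i \<omega>)\<^sup>2)" for k \<omega>
  proof -
    have "R k \<omega> \<in> (\<lambda>i. Z i \<omega>) ` {..k}" unfolding R by (intro Max_in) auto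
    then obtain i where "i \<le> k" "R k \<omega> = Z i \<omega>" by auto
    then show ?thesis using member_le_sum[of i "{..k}" "\<lambda>i. (Z i \<omega>)\<^sup>2"] by simp
  qed
  have intR2: "integrable P (\<lambda>\<omega>. \<xi> \<omega> * (R k \<omega>)\<^sup>2)" for k
  proof (rule Bochner_Integration.integrable_bound)
    show "integrable P (\<lambda>\<omega>. \<Sum>i\<le>k. \<xi> \<omega> * (Z i \<omega>)\<^sup>2)" using intZ2 by (intro Bochner_Integration.integrable_sum)
    show "AE \<omega> in P. norm (\<xi> \<omega> * (R k \<omega>)\<^sup>2) \<le> norm (\<Sum>i\<le>k. \<xi> \<omega> * (Z i \<omega>)\<^sup>2)"
      using R2 xi(3) by (auto simp: sum_distrib_left[symmetric] abs_mult sum_nonneg intro!: mult_left_mono)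
  qed measurable
  have prod_int: "integrable P (\<lambda>\<omega>. \<xi> \<omega> * (R k \<omega> * Z i \<omega>))" for k i
  proof (rule Bochner_Integration.integrable_bound)
    show "integrable P (\<lambda>\<omega>. \<xi> \<omega> * (R k \<omega>)\<^sup>2 + \<xi> \<omega> * (Z i \<omega>)\<^sup>2)" using intZ2 intR2 by simp
    have "R k \<omega> * Z i \<omega> \<le> (R k \<omega>)\<^sup>2 + (Z i \<omega>)\<^sup>2" for \<omega>
      using sum_squares_bound[of "R k \<omega>" "Z i \<omega>"] mult_nonneg_nonneg[OF Rpos[of k \<omega>] Zpos[of i \<omega>]] by linarith
    then have "\<xi> \<omega> * (R k \<omega> * Z i \<omega>) \<le> \<xi> \<omega> * ((R k \<omega>)\<^sup>2 + (Z i \<omega>)\<^sup>2)" for \<omega>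
      using xi(3) by (intro mult_left_mono)
    then show "AE \<omega> in P. norm (\<xi> \<omega> * (R k \<omega> * Z i \<omega>)) \<le> norm (\<xi> \<omega> * (R k \<omega>)\<^sup>2 + \<xi> \<omega> * (Z i \<omega>)\<^sup>2)"
      using xi(3) Rpos Zpos by (simp add: distrib_left abs_mult)
  qed measurable
  have exp_prod: "integrable P (\<lambda>\<omega>. \<xi> \<omega> * R k \<omega> * exp (d * S k \<omega>))" if "d = c \<or> d = - c" for d k
  proof (rule Bochner_Integration.integrable_bound[OF prod_int[of k k]])
    show "(\<lambda>\<omega>. \<xi> \<omega> * R k \<omega> * exp (d * S k \<omega>)) \<in> borel_measurable P" by measurable
    have "exp (d * S k \<omega>) \<le> Z k \<omega>" for \<omega> using that by (auto simp: Z_def)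
    then show "AE \<omega> in P. norm (\<xi> \<omega> * R k \<omega> * exp (d * S k \<omega>)) \<le> norm (\<xi> \<omega> * (R k \<omega> * Z k \<omega>))"
      using xi(3) Rpos Zpos by (auto simp: abs_mult mult.assoc intro!: mult_left_mono)
  qed
  have sub_exp: "expectation (\<lambda>\<omega>. \<xi> \<omega> * R k \<omega> * exp (d * S k \<omega>)) \<le> expectation (\<lambda>\<omega>. \<xi> \<omega> * R k \<omega> * exp (d * S (Suc k) \<omega>))"
    and sub_int: "integrable P (\<lambda>\<omega>. \<xi> \<omega> * R k \<omega> * exp (d * S (Suc k) \<omega>))"
    if d: "d = c \<or> d = - c" for d k
  proof -
    \<comment> \<open>Everything known at time \<open>u k\<close> is collected in one weight. The
      remaining increment then contributes a Gaussian exponential moment, which is at least 1: this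
      is the submartingale property.\<close>
    define \<eta> where "\<eta> = (\<lambda>\<omega>. \<xi> \<omega> * R k \<omega> * exp (d * S k \<omega>))"
    have eta: "\<eta> \<in> borel_measurable (F (u k))" unfolding \<eta>_def
      using xiF[of k] RF[of k] SF[of k] by measurable
    have uk: "0 \<le> u k" using t tu[of k] by simp
    have int: "integrable P \<eta>" unfolding \<eta>_def by (rule exp_prod[OF d])
    have eq: "\<eta> \<omega> * exp (d * (W m (u (Suc k)) \<omega> - W m (u k) \<omega>)) = \<xi> \<omega> * R k \<omega> * exp (d * S (Suc k) \<omega>)" for \<omega>
    proof -
      have "d * S k \<omega> + d * (W m (u (Suc k)) \<omega> - W m (u k) \<omega>) = d * S (Suc k) \<omega>"
        by (simp add: S_def algebra_simps)
      then show ?thesis unfolding \<eta>_def by (metis exp_add mult.assoc)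
    qed
    show "integrable P (\<lambda>\<omega>. \<xi> \<omega> * R k \<omega> * exp (d * S (Suc k) \<omega>))"
      using weighted_increment(3)[OF uk u(2) eta int m, of d] unfolding eq .
    have "expectation \<eta> \<ge> 0" unfolding \<eta>_def using xi(3) Rpos by (intro integral_nonneg_AE) auto
    then have "expectation \<eta> * 1 \<le> expectation \<eta> * exp (d\<^sup>2 * (u (Suc k) - u k) / 2)"
      using u(2)[of k] by (intro mult_left_mono) auto
    also have "\<dots> = expectation (\<lambda>\<omega>. \<xi> \<omega> * R k \<omega> * exp (d * S (Suc k) \<omega>))"
      using weighted_increment(4)[OF uk u(2) eta int m, of d] unfolding eq by simp
    finally show "expectation (\<lambda>\<omega>. \<xi> \<omega> * R k \<omega> * exp (d * S k \<omega>)) \<le> expectation (\<lambda>\<omega>. \<xi> \<omega> * R k \<omega> * exp (d * S (Suc k) \<omega>))"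
      by (simp add: \<eta>_def)
  qed
  have sub: "expectation (\<lambda>\<omega>. \<xi> \<omega> * (R k \<omega> * Z k \<omega>)) \<le> expectation (\<lambda>\<omega>. \<xi> \<omega> * (R k \<omega> * Z (Suc k) \<omega>))" for k
  proof -
    have eq: "\<xi> \<omega> * (R k \<omega> * Z i \<omega>) = \<xi> \<omega> * R k \<omega> * exp (c * S i \<omega>) + \<xi> \<omega> * R k \<omega> * exp (- c * S i \<omega>)" for i \<omega>
      unfolding Z_def by (simp add: algebra_simps)
    show ?thesis unfolding eq
      using sub_exp[of c k] sub_exp[of "- c" k] sub_int[of c k] sub_int[of "- c" k] exp_prod[of c k] exp_prod[of "- c" k]
      by simp
  qed
  have key: "0 \<le> expectation (\<lambda>\<omega>. \<xi> \<omega> * (R k \<omega> * Z k \<omega> - (R k \<omega>)\<^sup>2 / 2))" for k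
  proof (induction k)
    case 0
    have "R 0 \<omega> * Z 0 \<omega> - (R 0 \<omega>)\<^sup>2 / 2 \<ge> 0" for \<omega> by (simp add: R_0 power2_eq_square)
    then show ?case using xi(3) by (intro integral_nonneg_AE) auto
  next
    case (Suc k)
    have i1: "integrable P (\<lambda>\<omega>. \<xi> \<omega> * (R k \<omega> * Z j \<omega> - (R k \<omega>)\<^sup>2 / 2))" for j k
      using prod_int[of k j] intR2[of k] unfolding right_diff_distrib times_divide_eq_right by simp
    have "0 \<le> expectation (\<lambda>\<omega>. \<xi> \<omega> * (R k \<omega> * Z k \<omega> - (R k \<omega>)\<^sup>2 / 2))" by (rule Suc)
    also have "\<dots> \<le> expectation (\<lambda>\<omega>. \<xi> \<omega> * (R k \<omega> * Z (Suc k) \<omega> - (R k \<omega>)\<^sup>2 / 2))"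
      using sub[of k] prod_int[of k k] prod_int[of k "Suc k"] intR2[of k]
      unfolding right_diff_distrib times_divide_eq_right by simp
    also have "\<dots> \<le> expectation (\<lambda>\<omega>. \<xi> \<omega> * (R (Suc k) \<omega> * Z (Suc k) \<omega> - (R (Suc k) \<omega>)\<^sup>2 / 2))"
      using xi(3) doob_step by (intro integral_mono i1 mult_left_mono) (auto simp: R_Suc)
    finally show ?case .
  qed
  show "integrable P (\<lambda>\<omega>. \<xi> \<omega> * (R n \<omega>)\<^sup>2)" by (rule intR2)
  have "expectation (\<lambda>\<omega>. \<xi> \<omega> * (R n \<omega>)\<^sup>2) \<le> 4 * expectation (\<lambda>\<omega>. \<xi> \<omega> * (Z n \<omega>)\<^sup>2)"
  proof -
    \<comment> \<open>This is (Z - R/2)^2 \<ge> 0 rearranged. Together with \<open>key\<close> it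
      gives the constant 4 of Doob's inequality in L^2.\<close>
    have "R n \<omega> * Z n \<omega> - (R n \<omega>)\<^sup>2 / 2 \<le> (Z n \<omega>)\<^sup>2 - (R n \<omega>)\<^sup>2 / 4" for \<omega>
      using sum_power2_ge_zero[of "Z n \<omega> - R n \<omega> / 2" 0] by (simp add: power2_eq_square algebra_simps)
    then have "expectation (\<lambda>\<omega>. \<xi> \<omega> * (R n \<omega> * Z n \<omega> - (R n \<omega>)\<^sup>2 / 2)) \<le> expectation (\<lambda>\<omega>. \<xi> \<omega> * ((Z n \<omega>)\<^sup>2 - (R n \<omega>)\<^sup>2 / 4))"
    proof (intro integral_mono mult_left_mono xi(3))
      show "integrable P (\<lambda>\<omega>. \<xi> \<omega> * (R n \<omega> * Z n \<omega> - (R n \<omega>)\<^sup>2 / 2))"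
        "integrable P (\<lambda>\<omega>. \<xi> \<omega> * ((Z n \<omega>)\<^sup>2 - (R n \<omega>)\<^sup>2 / 4))"
        using prod_int[of n n] intR2[of n] intZ2[of n] unfolding right_diff_distrib times_divide_eq_right by simp_all
    qed
    with key[of n] have "0 \<le> expectation (\<lambda>\<omega>. \<xi> \<omega> * ((Z n \<omega>)\<^sup>2 - (R n \<omega>)\<^sup>2 / 4))" by linarith
    also have "\<dots> = expectation (\<lambda>\<omega>. \<xi> \<omega> * (Z n \<omega>)\<^sup>2) - expectation (\<lambda>\<omega>. \<xi> \<omega> * (R n \<omega>)\<^sup>2) / 4"
      using intR2[of n] intZ2[of n] unfolding right_diff_distrib times_divide_eq_right by simp
    finally show ?thesis by simp
  qed
  also have "expectation (\<lambda>\<omega>. \<xi> \<omega> * (Z n \<omega>)\<^sup>2) = expectation \<xi> * (2 * exp (2 * c\<^sup>2 * (u n - t)) + 2)"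
  proof -
    have "expectation (\<lambda>\<omega>. \<xi> \<omega> * (Z n \<omega>)\<^sup>2) =
      expectation (\<lambda>\<omega>. \<xi> \<omega> * exp ((2 * c) * S n \<omega>)) + expectation (\<lambda>\<omega>. \<xi> \<omega> * exp ((- 2 * c) * S n \<omega>)) + expectation (\<lambda>\<omega>. \<xi> \<omega> * 2)"
      unfolding Z2 distrib_left S_def
      by (subst Bochner_Integration.integral_add; (intro Bochner_Integration.integrable_add weighted_increment(3)[OF t tu xi(1,2) m] Bochner_Integration.integrable_mult_left xi(2))?)+ simp
    also have "expectation (\<lambda>\<omega>. \<xi> \<omega> * exp ((2 * c) * S n \<omega>)) = expectation \<xi> * exp (2 * c\<^sup>2 * (u n - t))"
      unfolding S_def by (subst weighted_increment(4)[OF t tu xi(1,2) m]) (simp add: power2_eq_square)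
    also have "expectation (\<lambda>\<omega>. \<xi> \<omega> * exp ((- 2 * c) * S n \<omega>)) = expectation \<xi> * exp (2 * c\<^sup>2 * (u n - t))"
      unfolding S_def by (subst weighted_increment(4)[OF t tu xi(1,2) m]) (simp add: power2_eq_square)
    finally show ?thesis by (simp add: algebra_simps)
  qed
  \<comment> \<open>The additive 2 is replaced by twice the exponential, which is at least 1; the
    factor 16 is 4 * (2 + 2).\<close>
  also have "4 * (expectation \<xi> * (2 * exp (2 * c\<^sup>2 * (u n - t)) + 2)) \<le> 16 * exp (2 * c\<^sup>2 * (u n - t)) * expectation \<xi>"
  proof -
    have "expectation \<xi> \<ge> 0" using xi(3) by (intro integral_nonneg_AE) auto
    moreover have "1 \<le> exp (2 * c\<^sup>2 * (u n - t))" using tu[of n] by simp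
    ultimately have "expectation \<xi> * 1 \<le> expectation \<xi> * exp (2 * c\<^sup>2 * (u n - t))" by (rule mult_left_mono[rotated])
    then show ?thesis by (simp add: algebra_simps)
  qed
  finally show "expectation (\<lambda>\<omega>. \<xi> \<omega> * (R n \<omega>)\<^sup>2) \<le> 16 * exp (2 * c\<^sup>2 * (u n - t)) * expectation \<xi>" by simp
qed

lemma osc_meas:
  assumes "0 \<le> t" "0 \<le> h" "m \<in> {1..M}"
  shows "osc (W m) t h \<in> borel_measurable P"
proof (rule borel_measurable_LIMSEQ_real)
  fix \<omega> assume "\<omega> \<in> space P"
  then show "(\<lambda>k. grid_osc (W m) t h (Suc k) \<omega>) \<longlonglongrightarrow> osc (W m) t h \<omega>"
    using assms by (intro grid_osc_tendsto W_cont) auto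
next
  fix k
  have "(\<lambda>\<omega>. \<bar>W m (t + real i * (h / real (Suc k))) \<omega> - W m t \<omega>\<bar>) \<in> borel_measurable P" for i
    using assms by (intro borel_measurable_abs borel_measurable_diff W_meas) auto
  then show "grid_osc (W m) t h (Suc k) \<in> borel_measurable P"
    unfolding grid_osc_def by (intro borel_measurable_Max) auto
qed

text \<open>\<open>doob_exp\<close> with \<open>c/2\<close> on ever finer grids: for x equal to c/2
  times the modulus of an increment, exp x is at most the sum of the two exponentials, and its
  square is the exponential wanted. Fatou's lemma carries the bound over to the continuous supremum.
  The exponent depends on \<open>c\<close> and \<open>h\<close> only through
  \<open>c\<^sup>2 * h\<close>, which later permits scaling by \<open>sqrt h\<close>.\<close>

lemma weighted_osc:
  assumes t: "0 \<le> t" "0 \<le> h" and xi: "\<xi> \<in> borel_measurable (F t)" "integrable P \<xi>" "\<And>\<omega>. 0 \<le> \<xi> \<omega>"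
    and m: "m \<in> {1..M}" and c: "0 \<le> c"
  shows "integrable P (\<lambda>\<omega>. \<xi> \<omega> * exp (c * osc (W m) t h \<omega>))"
    and "expectation (\<lambda>\<omega>. \<xi> \<omega> * exp (c * osc (W m) t h \<omega>)) \<le> 16 * exp (c\<^sup>2 * h / 2) * expectation \<xi>"
proof -
  let ?K = "16 * exp (c\<^sup>2 * h / 2) * expectation \<xi>"
  have K0: "0 \<le> ?K" using xi(3) by (intro mult_nonneg_nonneg integral_nonneg_AE) auto
  have [measurable]: "\<xi> \<in> borel_measurable P" "osc (W m) t h \<in> borel_measurable P"
    using measurable_F xi(1) osc_meas t m by blast+
  have gm[measurable]: "grid_osc (W m) t h (Suc k) \<in> borel_measurable P" for k
  proof -
    have "(\<lambda>\<omega>. \<bar>W m (t + real i * (h / real (Suc k))) \<omega> - W m t \<omega>\<bar>) \<in> borel_measurable P" for i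
      using assms by (intro borel_measurable_abs borel_measurable_diff W_meas) auto
    then show ?thesis unfolding grid_osc_def by (intro borel_measurable_Max) auto
  qed
  have step: "(\<integral>\<^sup>+\<omega>. ennreal (\<xi> \<omega> * exp (c * grid_osc (W m) t h (Suc k) \<omega>)) \<partial>P) \<le> ennreal ?K" for k
  proof -
    define u where "u i = t + real i * (h / real (Suc k))" for i
    have u: "u 0 = t" "u i \<le> u (Suc i)" for i unfolding u_def using t by (auto intro!: divide_right_mono mult_right_mono)
    let ?S = "\<lambda>i \<omega>. W m (u i) \<omega> - W m t \<omega>"
    let ?R = "\<lambda>n \<omega>. Max ((\<lambda>i. exp (c/2 * ?S i \<omega>) + exp (- (c/2) * ?S i \<omega>)) ` {..n})"
    note D = doob_exp[OF t(1) xi m u, of "c/2" "Suc k"]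
    have le: "exp (c * grid_osc (W m) t h (Suc k) \<omega>) \<le> (?R (Suc k) \<omega>)\<^sup>2" for \<omega>
    proof -
      have "grid_osc (W m) t h (Suc k) \<omega> \<in> (\<lambda>i. \<bar>?S i \<omega>\<bar>) ` {..Suc k}"
        unfolding grid_osc_def u_def by (intro Max_in) auto
      then obtain i where i: "i \<le> Suc k" "grid_osc (W m) t h (Suc k) \<omega> = \<bar>?S i \<omega>\<bar>" by auto
      have "c/2 * \<bar>?S i \<omega>\<bar> = c/2 * ?S i \<omega> \<or> c/2 * \<bar>?S i \<omega>\<bar> = - (c/2) * ?S i \<omega>"
        by (simp add: abs_if algebra_simps)
      then have "exp (c/2 * \<bar>?S i \<omega>\<bar>) \<le> exp (c/2 * ?S i \<omega>) + exp (- (c/2) * ?S i \<omega>)"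
        by (elim disjE) (simp_all only: add_increasing add_increasing2 exp_ge_zero order_refl)
      also have "\<dots> \<le> ?R (Suc k) \<omega>" using i by (intro Max_ge) auto
      finally have "(exp (c/2 * \<bar>?S i \<omega>\<bar>))\<^sup>2 \<le> (?R (Suc k) \<omega>)\<^sup>2" by (intro power_mono) auto
      then show ?thesis using i by (simp add: exp_double[symmetric])
    qed
    have "(\<integral>\<^sup>+\<omega>. ennreal (\<xi> \<omega> * exp (c * grid_osc (W m) t h (Suc k) \<omega>)) \<partial>P) \<le> (\<integral>\<^sup>+\<omega>. ennreal (\<xi> \<omega> * (?R (Suc k) \<omega>)\<^sup>2) \<partial>P)"
      using le xi(3) by (intro nn_integral_mono ennreal_leI mult_left_mono)
    also have "\<dots> = ennreal (expectation (\<lambda>\<omega>. \<xi> \<omega> * (?R (Suc k) \<omega>)\<^sup>2))"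
      using D(1) xi(3) by (intro nn_integral_eq_integral) auto
    also have "\<dots> \<le> ennreal ?K"
      using D(2) by (intro ennreal_leI) (simp add: u_def power2_eq_square)
    finally show ?thesis .
  qed
  have "(\<integral>\<^sup>+\<omega>. ennreal (\<xi> \<omega> * exp (c * osc (W m) t h \<omega>)) \<partial>P)
      = (\<integral>\<^sup>+\<omega>. liminf (\<lambda>k. ennreal (\<xi> \<omega> * exp (c * grid_osc (W m) t h (Suc k) \<omega>))) \<partial>P)"
  proof (rule nn_integral_cong)
    fix \<omega> assume "\<omega> \<in> space P"
    then have "(\<lambda>k. grid_osc (W m) t h (Suc k) \<omega>) \<longlonglongrightarrow> osc (W m) t h \<omega>"
      using t m by (intro grid_osc_tendsto W_cont) auto
    then have "(\<lambda>k. ennreal (\<xi> \<omega> * exp (c * grid_osc (W m) t h (Suc k) \<omega>))) \<longlonglongrightarrow> ennreal (\<xi> \<omega> * exp (c * osc (W m) t h \<omega>))"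
      by (intro tendsto_intros)
    then show "ennreal (\<xi> \<omega> * exp (c * osc (W m) t h \<omega>)) = liminf (\<lambda>k. ennreal (\<xi> \<omega> * exp (c * grid_osc (W m) t h (Suc k) \<omega>)))"
      by (simp add: lim_imp_Liminf)
  qed
  also have "\<dots> \<le> liminf (\<lambda>k. \<integral>\<^sup>+\<omega>. ennreal (\<xi> \<omega> * exp (c * grid_osc (W m) t h (Suc k) \<omega>)) \<partial>P)"
    by (rule nn_integral_liminf) measurable
  also have "\<dots> \<le> liminf (\<lambda>k::nat. ennreal ?K)"
    using step by (intro Liminf_mono always_eventually) blast
  also have "\<dots> = ennreal ?K" by (simp add: Liminf_const)
  finally have le: "(\<integral>\<^sup>+\<omega>. ennreal (\<xi> \<omega> * exp (c * osc (W m) t h \<omega>)) \<partial>P) \<le> ennreal ?K" .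
  show int: "integrable P (\<lambda>\<omega>. \<xi> \<omega> * exp (c * osc (W m) t h \<omega>))"
    using le xi(3) by (intro integrableI_nonneg) (auto intro: le_less_trans)
  have "ennreal (expectation (\<lambda>\<omega>. \<xi> \<omega> * exp (c * osc (W m) t h \<omega>))) \<le> ennreal ?K"
    using le xi(3) nn_integral_eq_integral[OF int] by simp
  then show "expectation (\<lambda>\<omega>. \<xi> \<omega> * exp (c * osc (W m) t h \<omega>)) \<le> ?K"
    using K0 by simp
qed

end

subsection \<open>Integrals of continuous processes\<close>

text \<open>Sampling at the largest multiple of 1/(k+1) below \<open>s\<close> gives processes that
  take countably many time values and are therefore jointly measurable; continuity in time makes
  them converge.\<close>

lemma borel_measurable_caratheodory:
  fixes Z :: "real \<Rightarrow> 'a \<Rightarrow> 'b::euclidean_space"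
  assumes meas: "\<And>s. Z s \<in> borel_measurable N"
    and cont: "\<And>\<omega>. \<omega> \<in> space N \<Longrightarrow> continuous_on UNIV (\<lambda>s. Z s \<omega>)"
  shows "(\<lambda>(s, \<omega>). Z s \<omega>) \<in> borel_measurable ((borel :: real measure) \<Otimes>\<^sub>M N)"
proof (rule borel_measurable_LIMSEQ_metric)
  fix k :: nat
  have "(\<lambda>p. Z (real_of_int \<lfloor>fst p * real (Suc k)\<rfloor> / real (Suc k)) (snd p)) \<in> borel_measurable ((borel :: real measure) \<Otimes>\<^sub>M N)"
  proof (rule measurable_compose_countable[where f="\<lambda>i p. Z (real_of_int i / real (Suc k)) (snd p)"])
    show "(\<lambda>p. Z (real_of_int i / real (Suc k)) (snd p)) \<in> borel_measurable ((borel :: real measure) \<Otimes>\<^sub>M N)" for i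
      by (rule measurable_compose[OF measurable_snd meas])
    show "(\<lambda>p. \<lfloor>fst p * real (Suc k)\<rfloor>) \<in> (borel :: real measure) \<Otimes>\<^sub>M N \<rightarrow>\<^sub>M count_space UNIV" by measurable
  qed
  then show "(\<lambda>(s, \<omega>). Z (real_of_int \<lfloor>s * real (Suc k)\<rfloor> / real (Suc k)) \<omega>) \<in> borel_measurable ((borel :: real measure) \<Otimes>\<^sub>M N)"
    by (simp add: case_prod_beta')
next
  fix p assume p: "p \<in> space ((borel :: real measure) \<Otimes>\<^sub>M N)"
  obtain s \<omega> where s: "p = (s, \<omega>)" "\<omega> \<in> space N" using p by (cases p) (auto simp: space_pair_measure)
  let ?p = "\<lambda>k. real_of_int \<lfloor>s * real (Suc k)\<rfloor> / real (Suc k)"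
  have "?p \<longlonglongrightarrow> s"
  proof (rule real_tendsto_sandwich[of "\<lambda>k. s - 1 / real (Suc k)" _ _ "\<lambda>_. s"])
    have "(\<lambda>k. s - 1 / real (Suc k)) \<longlonglongrightarrow> s - 0"
      by (intro tendsto_intros LIMSEQ_Suc[OF lim_const_over_n])
    then show "(\<lambda>k. s - 1 / real (Suc k)) \<longlonglongrightarrow> s" by simp
    have "s - 1 / real (Suc k) \<le> ?p k" for k
    proof -
      have "s * real (Suc k) - 1 \<le> real_of_int \<lfloor>s * real (Suc k)\<rfloor>" by linarith
      then have "(s * real (Suc k) - 1) / real (Suc k) \<le> ?p k" by (intro divide_right_mono) auto
      then show ?thesis by (simp add: diff_divide_distrib)
    qed
    then show "\<forall>\<^sub>F k in sequentially. s - 1 / real (Suc k) \<le> ?p k" by (intro always_eventually allI)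
    have "?p k \<le> s" for k
    proof -
      have "?p k \<le> (s * real (Suc k)) / real (Suc k)" by (intro divide_right_mono) auto
      then show ?thesis by simp
    qed
    then show "\<forall>\<^sub>F k in sequentially. ?p k \<le> s" by (intro always_eventually allI)
  qed simp
  then have "(\<lambda>k. Z (?p k) \<omega>) \<longlonglongrightarrow> Z s \<omega>"
    using continuous_on_tendsto_compose[OF cont[OF s(2)]] by simp
  then show "(\<lambda>k. case p of (s, \<omega>) \<Rightarrow> Z (real_of_int \<lfloor>s * real (Suc k)\<rfloor> / real (Suc k)) \<omega>)
      \<longlonglongrightarrow> (case p of (s, \<omega>) \<Rightarrow> Z s \<omega>)" by (simp add: s)
qed

text \<open>Clamping the time to \<open>{a..b}\<close> extends the process continuously to the whole
  line.\<close>

lemma borel_measurable_caratheodory_interval: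
  fixes Z :: "real \<Rightarrow> 'a \<Rightarrow> 'b::euclidean_space"
  assumes "a \<le> b" and meas: "\<And>s. s \<in> {a..b} \<Longrightarrow> Z s \<in> borel_measurable N"
    and cont: "\<And>\<omega>. \<omega> \<in> space N \<Longrightarrow> continuous_on {a..b} (\<lambda>s. Z s \<omega>)"
  shows "(\<lambda>(s, \<omega>). Z (max a (min b s)) \<omega>) \<in> borel_measurable (borel \<Otimes>\<^sub>M N)"
proof (rule borel_measurable_caratheodory)
  have c: "max a (min b s) \<in> {a..b}" for s using assms(1) by auto
  then show "Z (max a (min b s)) \<in> borel_measurable N" for s using meas by blast
  fix \<omega> assume "\<omega> \<in> space N"
  then show "continuous_on UNIV (\<lambda>s. Z (max a (min b s)) \<omega>)"
    using c by (intro continuous_on_compose2[OF cont]) (auto intro!: continuous_intros)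
qed

lemma continuous_integral_lebesgue:
  fixes z :: "real \<Rightarrow> 'b::euclidean_space"
  assumes "continuous_on {a..b} z"
  shows "integrable lborel (\<lambda>s. indicator {a..b} s *\<^sub>R z s)"
    and "integral {a..b} z = (\<integral>s. indicator {a..b} s *\<^sub>R z s \<partial>lborel)"
  using borel_integrable_atLeastAtMost'[OF assms] set_borel_integral_eq_integral(2)[of "{a..b}" z]
  unfolding set_integrable_def set_lebesgue_integral_def by auto

lemma borel_measurable_time_integral:
  fixes Z :: "real \<Rightarrow> 'a \<Rightarrow> 'b::euclidean_space"
  assumes meas: "\<And>s. s \<in> {a..b} \<Longrightarrow> Z s \<in> borel_measurable N"
    and cont: "\<And>\<omega>. \<omega> \<in> space N \<Longrightarrow> continuous_on {a..b} (\<lambda>s. Z s \<omega>)"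
  shows "(\<lambda>\<omega>. integral {a..b} (\<lambda>s. Z s \<omega>)) \<in> borel_measurable N"
proof (cases "a \<le> b")
  case True
  note m = borel_measurable_caratheodory_interval[OF True meas cont]
  have "(\<lambda>\<omega>. \<integral>s. indicator {a..b} s *\<^sub>R Z (max a (min b s)) \<omega> \<partial>lborel) \<in> borel_measurable N"
  proof (rule lborel.borel_measurable_lebesgue_integral)
    have "(\<lambda>(\<omega>, s). Z (max a (min b s)) \<omega>) \<in> borel_measurable (N \<Otimes>\<^sub>M lborel)"
      using measurable_compose[OF measurable_pair_swap' m] by (simp add: case_prod_beta' measurable_lborel1 cong: measurable_cong_sets sets_pair_measure_cong)
    then show "(\<lambda>(\<omega>, s). indicator {a..b} s *\<^sub>R Z (max a (min b s)) \<omega>) \<in> borel_measurable (N \<Otimes>\<^sub>M lborel)"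
      by measurable
  qed
  also have "?this \<longleftrightarrow> ?thesis"
  proof (rule measurable_cong)
    fix \<omega> assume "\<omega> \<in> space N"
    have "(\<integral>s. indicator {a..b} s *\<^sub>R Z (max a (min b s)) \<omega> \<partial>lborel) = (\<integral>s. indicator {a..b} s *\<^sub>R Z s \<omega> \<partial>lborel)"
      by (intro Bochner_Integration.integral_cong) (auto simp: indicator_def)
    then show "(\<integral>s. indicator {a..b} s *\<^sub>R Z (max a (min b s)) \<omega> \<partial>lborel) = integral {a..b} (\<lambda>s. Z s \<omega>)"
      using continuous_integral_lebesgue(2)[OF cont[OF \<open>\<omega> \<in> space N\<close>]] by simp
  qed
  finally show ?thesis .
qed simp

text \<open>Fubini's theorem. A dominating variable that is uniform in time and integrable over the
  probability space gives joint integrability, because the time interval is bounded.\<close>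

lemma (in prob_space) expectation_time_integral:
  fixes Z :: "real \<Rightarrow> 'a \<Rightarrow> real"
  assumes meas: "\<And>s. s \<in> {a..b} \<Longrightarrow> Z s \<in> borel_measurable M"
    and cont: "\<And>\<omega>. \<omega> \<in> space M \<Longrightarrow> continuous_on {a..b} (\<lambda>s. Z s \<omega>)"
    and G: "integrable M G" "\<And>s \<omega>. s \<in> {a..b} \<Longrightarrow> \<omega> \<in> space M \<Longrightarrow> \<bar>Z s \<omega>\<bar> \<le> G \<omega>"
  shows "integrable M (\<lambda>\<omega>. integral {a..b} (\<lambda>s. Z s \<omega>))"
    and "expectation (\<lambda>\<omega>. integral {a..b} (\<lambda>s. Z s \<omega>)) = integral {a..b} (\<lambda>s. expectation (Z s))"
proof -
  have "integrable M (\<lambda>\<omega>. integral {a..b} (\<lambda>s. Z s \<omega>)) \<and>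
    expectation (\<lambda>\<omega>. integral {a..b} (\<lambda>s. Z s \<omega>)) = integral {a..b} (\<lambda>s. expectation (Z s))"
  proof (cases "a \<le> b")
    case True
    interpret pair_sigma_finite M lborel ..
    let ?Z = "\<lambda>\<omega> s. indicator {a..b} s *\<^sub>R Z (max a (min b s)) \<omega>"
    note m = borel_measurable_caratheodory_interval[OF True meas cont]
    have "(\<lambda>(\<omega>, s). Z (max a (min b s)) \<omega>) \<in> borel_measurable (M \<Otimes>\<^sub>M lborel)"
      using measurable_compose[OF measurable_pair_swap' m] by (simp add: case_prod_beta' measurable_lborel1 cong: measurable_cong_sets sets_pair_measure_cong)
    then have Zm[measurable]: "(\<lambda>(\<omega>, s). ?Z \<omega> s) \<in> borel_measurable (M \<Otimes>\<^sub>M lborel)"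
      by measurable
    have i: "integrable lborel (?Z \<omega>) \<and> (\<integral>s. ?Z \<omega> s \<partial>lborel) = integral {a..b} (\<lambda>s. Z s \<omega>)"
      if "\<omega> \<in> space M" for \<omega>
    proof -
      have "?Z \<omega> = (\<lambda>s. indicator {a..b} s *\<^sub>R Z s \<omega>)" by (auto simp: indicator_def fun_eq_iff)
      then show ?thesis using continuous_integral_lebesgue[OF cont[OF that]] by simp
    qed
    have bound: "norm (?Z \<omega> s) \<le> indicator {a..b} s * G \<omega>" if "\<omega> \<in> space M" for \<omega> s
      using G(2)[of s \<omega>] that by (auto simp: indicator_def)
    have int: "integrable (M \<Otimes>\<^sub>M lborel) (\<lambda>(\<omega>, s). ?Z \<omega> s)"
    proof (rule Fubini_integrable)
      show "AE \<omega> in M. integrable lborel (\<lambda>s. case (\<omega>, s) of (\<omega>, s) \<Rightarrow> ?Z \<omega> s)" using i by simp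
      show "integrable M (\<lambda>\<omega>. \<integral>s. norm (case (\<omega>, s) of (\<omega>, s) \<Rightarrow> ?Z \<omega> s) \<partial>lborel)"
      proof (rule Bochner_Integration.integrable_bound)
        show "integrable M (\<lambda>\<omega>. (b - a) * G \<omega>)" using G(1) by simp
        show "AE \<omega> in M. norm (\<integral>s. norm (case (\<omega>, s) of (\<omega>, s) \<Rightarrow> ?Z \<omega> s) \<partial>lborel) \<le> norm ((b - a) * G \<omega>)"
        proof (rule AE_I2)
          fix \<omega> assume w: "\<omega> \<in> space M"
          have "(\<integral>s. norm (?Z \<omega> s) \<partial>lborel) \<le> (\<integral>s. indicator {a..b} s * G \<omega> \<partial>lborel)"
          proof (rule integral_mono)
            show "integrable lborel (\<lambda>s. indicator {a..b} s * G \<omega>)"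
              by (intro Bochner_Integration.integrable_mult_left integrable_real_indicator)
                (auto simp: emeasure_lborel_Icc_eq)
          qed (use i[OF w] bound[OF w] in auto)
          also have "\<dots> = (b - a) * G \<omega>" using True by simp
          finally show "norm (\<integral>s. norm (case (\<omega>, s) of (\<omega>, s) \<Rightarrow> ?Z \<omega> s) \<partial>lborel) \<le> norm ((b - a) * G \<omega>)"
            by simp
        qed
      qed measurable
    qed measurable
    have "integrable M (\<lambda>\<omega>. \<integral>s. ?Z \<omega> s \<partial>lborel)" using integrable_fst[OF int] .
    also have "?this \<longleftrightarrow> integrable M (\<lambda>\<omega>. integral {a..b} (\<lambda>s. Z s \<omega>))"
      using i by (intro Bochner_Integration.integrable_cong) auto
    finally have 1: "integrable M (\<lambda>\<omega>. integral {a..b} (\<lambda>s. Z s \<omega>))" .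
    have E: "(\<integral>\<omega>. ?Z \<omega> s \<partial>M) = indicator {a..b} s *\<^sub>R expectation (Z s)" for s
      by (auto simp: indicator_def)
    have ints: "integrable lborel (\<lambda>s. indicator {a..b} s *\<^sub>R expectation (Z s))"
      using integrable_snd[OF int] unfolding E .
    have "expectation (\<lambda>\<omega>. integral {a..b} (\<lambda>s. Z s \<omega>)) = (\<integral>\<omega>. \<integral>s. ?Z \<omega> s \<partial>lborel \<partial>M)"
      using i by (intro Bochner_Integration.integral_cong) auto
    also have "\<dots> = (\<integral>s. \<integral>\<omega>. ?Z \<omega> s \<partial>M \<partial>lborel)" using Fubini_integral[OF int] by simp
    also have "\<dots> = integral {a..b} (\<lambda>s. expectation (Z s))"
      unfolding E using set_borel_integral_eq_integral(2)[of "{a..b}" "\<lambda>s. expectation (Z s)"] ints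
      unfolding set_integrable_def set_lebesgue_integral_def by simp
    finally show ?thesis using 1 by blast
  qed simp
  then show "integrable M (\<lambda>\<omega>. integral {a..b} (\<lambda>s. Z s \<omega>))"
    "expectation (\<lambda>\<omega>. integral {a..b} (\<lambda>s. Z s \<omega>)) = integral {a..b} (\<lambda>s. expectation (Z s))" by blast+
qed

subsection \<open>Convergence in probability\<close>

lemma (in prob_space) AE_imp_tendsto_in_prob:
  fixes f :: "nat \<Rightarrow> 'a \<Rightarrow> 'b::euclidean_space"
  assumes [measurable]: "\<And>k. f k \<in> borel_measurable M" "g \<in> borel_measurable M"
    and lim: "AE \<omega> in M. (\<lambda>k. f k \<omega>) \<longlonglongrightarrow> g \<omega>"
  shows "tendsto_in_prob M f g"
  unfolding tendsto_in_prob_def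
proof (intro conjI allI impI assms(1,2))
  fix \<epsilon> :: real assume e: "\<epsilon> > 0"
  let ?A = "\<lambda>k. {\<omega> \<in> space M. norm (f k \<omega> - g \<omega>) > \<epsilon>}"
  have "(\<lambda>k. expectation (indicator (?A k))) \<longlonglongrightarrow> expectation (\<lambda>_. 0 :: real)"
  proof (rule integral_dominated_convergence[where w="\<lambda>_. 1"])
    show "AE \<omega> in M. (\<lambda>k. indicator (?A k) \<omega> :: real) \<longlonglongrightarrow> 0"
      using lim
    proof eventually_elim
      case (elim \<omega>)
      have "\<forall>\<^sub>F k in sequentially. dist (f k \<omega>) (g \<omega>) < \<epsilon>" using elim e by (simp add: tendsto_iff)
      then have "\<forall>\<^sub>F k in sequentially. indicator (?A k) \<omega> = (0::real)"
        by eventually_elim (simp add: dist_norm indicator_def)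
      then show ?case by (rule tendsto_eventually)
    qed
  qed (auto simp: indicator_def)
  then show "(\<lambda>k. prob (?A k)) \<longlonglongrightarrow> 0" by simp
qed

lemma (in prob_space) tendsto_in_prob_unique:
  fixes f :: "nat \<Rightarrow> 'a \<Rightarrow> 'b::euclidean_space"
  assumes f: "tendsto_in_prob M f g" and h: "tendsto_in_prob M f h"
  shows "AE \<omega> in M. g \<omega> = h \<omega>"
proof -
  have [measurable]: "f k \<in> borel_measurable M" "g \<in> borel_measurable M" "h \<in> borel_measurable M" for k
    using f h unfolding tendsto_in_prob_def by auto
  have z: "prob {\<omega> \<in> space M. norm (g \<omega> - h \<omega>) > 2 * \<epsilon>} = 0" if e: "\<epsilon> > 0" for \<epsilon>
  proof -
    let ?A = "\<lambda>k. {\<omega> \<in> space M. norm (f k \<omega> - g \<omega>) > \<epsilon>}" and ?B = "\<lambda>k. {\<omega> \<in> space M. norm (f k \<omega> - h \<omega>) > \<epsilon>}"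
    have "prob {\<omega> \<in> space M. norm (g \<omega> - h \<omega>) > 2 * \<epsilon>} \<le> prob (?A k) + prob (?B k)" for k
    proof -
      have "norm (g \<omega> - h \<omega>) \<le> norm (f k \<omega> - g \<omega>) + norm (f k \<omega> - h \<omega>)" for \<omega>
        using norm_triangle_ineq4[of "f k \<omega> - h \<omega>" "f k \<omega> - g \<omega>"] by (simp add: add.commute)
      then have "{\<omega> \<in> space M. norm (g \<omega> - h \<omega>) > 2 * \<epsilon>} \<subseteq> ?A k \<union> ?B k"
        by (auto simp: not_less) (smt (verit))
      then have "prob {\<omega> \<in> space M. norm (g \<omega> - h \<omega>) > 2 * \<epsilon>} \<le> prob (?A k \<union> ?B k)"
        by (intro finite_measure_mono) auto
      also have "\<dots> \<le> prob (?A k) + prob (?B k)" by (intro measure_Un_le) auto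
      finally show ?thesis .
    qed
    moreover have "(\<lambda>k. prob (?A k) + prob (?B k)) \<longlonglongrightarrow> 0 + 0"
      using f h e unfolding tendsto_in_prob_def by (intro tendsto_add) auto
    ultimately have "prob {\<omega> \<in> space M. norm (g \<omega> - h \<omega>) > 2 * \<epsilon>} \<le> 0"
      by (intro LIMSEQ_le_const) auto
    then show ?thesis by (simp add: measure_le_0_iff)
  qed
  have "AE \<omega> in M. \<forall>n::nat. norm (g \<omega> - h \<omega>) \<le> 2 * (1 / real (Suc n))"
    unfolding AE_all_countable
  proof
    fix n :: nat
    have "{\<omega> \<in> space M. norm (g \<omega> - h \<omega>) > 2 * (1 / real (Suc n))} \<in> null_sets M"
      using z[of "1 / real (Suc n)"] by (auto intro!: null_setsI simp: emeasure_eq_measure)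
    from AE_not_in[OF this] AE_space
    show "AE \<omega> in M. norm (g \<omega> - h \<omega>) \<le> 2 * (1 / real (Suc n))"
      by eventually_elim (auto simp: not_less)
  qed
  then show ?thesis
  proof eventually_elim
    case (elim \<omega>)
    have "(\<lambda>n. 2 * (1 / real (Suc n))) \<longlonglongrightarrow> 2 * 0"
      by (intro tendsto_intros LIMSEQ_Suc[OF lim_const_over_n])
    then have "norm (g \<omega> - h \<omega>) \<le> 2 * 0"
      by (rule LIMSEQ_le_const) (use elim in blast)
    then show ?case by simp
  qed
qed

context wiener_setup
begin

text \<open>
  The estimate behind the construction of the Ito integral: stop the simple integrand as soon as its
  quadratic sum exceeds \<open>\<delta>\<close>, and apply the isometry to what is left.
\<close>

lemma bounded_simple_isometry:
  fixes \<psi> :: "nat \<Rightarrow> 'a \<Rightarrow> 'b::euclidean_space"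
  assumes m: "m \<in> {1..M}" and tau: "0 \<le> \<tau> 0" "\<And>i. i < n \<Longrightarrow> \<tau> i \<le> \<tau> (Suc i)"
    and meas: "\<And>i. i < n \<Longrightarrow> \<psi> i \<in> borel_measurable (F (\<tau> i))"
    and bdd: "\<And>i \<omega>. i < n \<Longrightarrow> norm (\<psi> i \<omega>) \<le> C i"
  defines "S \<equiv> \<lambda>k \<omega>. \<Sum>i<k. (W m (\<tau> (Suc i)) \<omega> - W m (\<tau> i) \<omega>) *\<^sub>R \<psi> i \<omega>"
  shows "k \<le> n \<Longrightarrow> S k \<in> borel_measurable (F (\<tau> k)) \<and> integrable P (\<lambda>\<omega>. (norm (S k \<omega>))\<^sup>2) \<and>
     expectation (\<lambda>\<omega>. (norm (S k \<omega>))\<^sup>2) = (\<Sum>i<k. expectation (\<lambda>\<omega>. (norm (\<psi> i \<omega>))\<^sup>2) * (\<tau> (Suc i) - \<tau> i))"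
proof (induction k)
  case 0
  then show ?case by (simp add: S_def)
next
  case (Suc k)
  have k: "k < n" using Suc by simp
  have tau0: "j \<le> n \<Longrightarrow> 0 \<le> \<tau> j" for j
    by (induction j) (use tau in \<open>auto intro: order_trans\<close>)
  note IH = Suc.IH[OF less_imp_le[OF k]]
  have SF: "S k \<in> borel_measurable (F (\<tau> k))" and Si: "integrable P (\<lambda>\<omega>. (norm (S k \<omega>))\<^sup>2)" using IH by auto
  let ?D = "\<lambda>\<omega>. W m (\<tau> (Suc k)) \<omega> - W m (\<tau> k) \<omega>"
  have t: "0 \<le> \<tau> k" "\<tau> k \<le> \<tau> (Suc k)" using tau0 k tau by auto
  have DF: "?D \<in> borel_measurable (F (\<tau> (Suc k)))"
    using t m by (intro borel_measurable_diff W_F_le) auto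
  have psiF: "\<psi> k \<in> borel_measurable (F (\<tau> k))" using meas k by blast
  have [measurable]: "S k \<in> borel_measurable P" "\<psi> k \<in> borel_measurable P"
    using measurable_F SF psiF by blast+
  have S_Suc: "S (Suc k) = (\<lambda>\<omega>. S k \<omega> + ?D \<omega> *\<^sub>R \<psi> k \<omega>)" by (simp add: S_def fun_eq_iff)
  have 1: "S (Suc k) \<in> borel_measurable (F (\<tau> (Suc k)))"
    unfolding S_Suc using measurable_F_mono[OF SF t(2)] measurable_F_mono[OF psiF t(2)] DF
    by (intro borel_measurable_add borel_measurable_scaleR)
  have psi2: "integrable P (\<lambda>\<omega>. (norm (\<psi> k \<omega>))\<^sup>2)"
    using bdd[OF k] by (intro integrable_const_bound[where B="(C k)\<^sup>2"]) (auto intro!: power_mono)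
  have inner: "integrable P (\<lambda>\<omega>. 2 * (S k \<omega> \<bullet> \<psi> k \<omega>))"
  proof (rule Bochner_Integration.integrable_bound)
    show "integrable P (\<lambda>\<omega>. (norm (S k \<omega>))\<^sup>2 + (norm (\<psi> k \<omega>))\<^sup>2)" using Si psi2 by simp
    have "\<bar>2 * (S k \<omega> \<bullet> \<psi> k \<omega>)\<bar> \<le> (norm (S k \<omega>))\<^sup>2 + (norm (\<psi> k \<omega>))\<^sup>2" for \<omega>
      using Cauchy_Schwarz_ineq2[of "S k \<omega>" "\<psi> k \<omega>"] sum_squares_bound[of "norm (S k \<omega>)" "norm (\<psi> k \<omega>)"]
      by (simp add: abs_mult)
    then show "AE \<omega> in P. norm (2 * (S k \<omega> \<bullet> \<psi> k \<omega>)) \<le> norm ((norm (S k \<omega>))\<^sup>2 + (norm (\<psi> k \<omega>))\<^sup>2)"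
      by simp
  qed measurable
  have innerF: "(\<lambda>\<omega>. 2 * (S k \<omega> \<bullet> \<psi> k \<omega>)) \<in> borel_measurable (F (\<tau> k))" using SF psiF by measurable
  have psi2F: "(\<lambda>\<omega>. (norm (\<psi> k \<omega>))\<^sup>2) \<in> borel_measurable (F (\<tau> k))" using psiF by measurable
  note A = weighted_increment(1,2)[OF t innerF inner m]
  note B = weighted_increment_product[OF t psi2F psi2 m m]
  \<comment> \<open>Given \<open>F (\<tau> k)\<close>, the middle term has mean zero by
    \<open>A\<close>, and the last has the conditional mean of an isometry by
    \<open>B\<close>.\<close>
  have sq: "(norm (S (Suc k) \<omega>))\<^sup>2 = (norm (S k \<omega>))\<^sup>2 + 2 * (S k \<omega> \<bullet> \<psi> k \<omega>) * ?D \<omega> + (norm (\<psi> k \<omega>))\<^sup>2 * (?D \<omega> * ?D \<omega>)" for \<omega>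
    unfolding S_Suc power2_norm_eq_inner by (simp add: inner_add_left inner_add_right inner_commute algebra_simps)
  show ?case
    unfolding sq using 1 Si A B IH by simp
qed

lemma simple_integral_tail:
  fixes \<phi> :: "nat \<Rightarrow> 'a \<Rightarrow> 'b::euclidean_space"
  assumes m: "m \<in> {1..M}" and tau: "0 \<le> \<tau> 0" "\<And>i. i < n \<Longrightarrow> \<tau> i < \<tau> (Suc i)"
    and meas: "\<And>i. i < n \<Longrightarrow> \<phi> i \<in> borel_measurable (F (\<tau> i))"
    and pos: "\<epsilon> > 0" "\<delta> > 0"
  shows "prob {\<omega> \<in> space P. norm (\<Sum>i<n. (W m (\<tau> (Suc i)) \<omega> - W m (\<tau> i) \<omega>) *\<^sub>R \<phi> i \<omega>) > \<epsilon>}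
    \<le> \<delta> / \<epsilon>\<^sup>2 + prob {\<omega> \<in> space P. (\<Sum>i<n. (norm (\<phi> i \<omega>))\<^sup>2 * (\<tau> (Suc i) - \<tau> i)) > \<delta>}"
proof -
  define Q where "Q k \<omega> = (\<Sum>i<k. (norm (\<phi> i \<omega>))\<^sup>2 * (\<tau> (Suc i) - \<tau> i))" for k \<omega>
  \<comment> \<open>The sum includes the term \<open>i\<close> itself. It is nevertheless known at
    time \<open>\<tau> i\<close>, as \<open>\<phi> i\<close> is, so the integrand is switched off
    before the sum exceeds \<open>\<delta>\<close> rather than after.\<close>
  define \<psi> where "\<psi> i \<omega> = (if Q (Suc i) \<omega> \<le> \<delta> then \<phi> i \<omega> else 0)" for i \<omega>
  have tau_mono: "i \<le> j \<Longrightarrow> j \<le> n \<Longrightarrow> \<tau> i \<le> \<tau> j" for i j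
    by (induction j rule: dec_induct) (simp, metis Suc_le_lessD less_imp_le order_trans tau(2))
  have tau0: "j \<le> n \<Longrightarrow> 0 \<le> \<tau> j" for j using tau_mono[of 0 j] tau(1) by simp
  have term0: "i < n \<Longrightarrow> 0 \<le> (norm (\<phi> i \<omega>))\<^sup>2 * (\<tau> (Suc i) - \<tau> i)" for i \<omega>
    using tau(2)[of i] by simp
  have Q_mono: "k \<le> n \<Longrightarrow> j \<le> k \<Longrightarrow> Q j \<omega> \<le> Q k \<omega>" for j k \<omega>
    unfolding Q_def using term0 by (intro sum_mono2) auto
  have QF: "i < n \<Longrightarrow> Q (Suc i) \<in> borel_measurable (F (\<tau> i))" for i
  proof -
    assume i: "i < n"
    have "(\<lambda>\<omega>. (norm (\<phi> j \<omega>))\<^sup>2) \<in> borel_measurable (F (\<tau> i))" if "j \<in> {..<Suc i}" for j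
    proof -
      have "\<phi> j \<in> borel_measurable (F (\<tau> i))"
        using that i meas[of j] measurable_F_mono tau_mono[of j i] by auto
      then show ?thesis by measurable
    qed
    then show "Q (Suc i) \<in> borel_measurable (F (\<tau> i))"
      unfolding Q_def by (intro borel_measurable_sum borel_measurable_times borel_measurable_const)
  qed
  have psiF: "i < n \<Longrightarrow> \<psi> i \<in> borel_measurable (F (\<tau> i))" for i
    unfolding \<psi>_def using QF[of i] meas[of i] by measurable
  \<comment> \<open>Stopping also bounds the integrand: while it is switched on, each single term of
    the quadratic sum is at most \<open>\<delta>\<close>.\<close>
  have bdd: "norm (\<psi> i \<omega>) \<le> sqrt (\<delta> / (\<tau> (Suc i) - \<tau> i))" if i: "i < n" for i \<omega>
  proof (cases "Q (Suc i) \<omega> \<le> \<delta>")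
    case True
    have "0 \<le> Q i \<omega>" unfolding Q_def using term0 i by (intro sum_nonneg) auto
    then have "(norm (\<phi> i \<omega>))\<^sup>2 * (\<tau> (Suc i) - \<tau> i) \<le> \<delta>" using True by (simp add: Q_def)
    then have "(norm (\<phi> i \<omega>))\<^sup>2 \<le> \<delta> / (\<tau> (Suc i) - \<tau> i)" using tau(2)[OF i] by (simp add: field_simps)
    then show ?thesis using True by (simp add: \<psi>_def real_le_rsqrt)
  next
    case False
    then show ?thesis using pos tau(2)[OF i] by (simp add: \<psi>_def)
  qed
  let ?S = "\<lambda>\<omega>. \<Sum>i<n. (W m (\<tau> (Suc i)) \<omega> - W m (\<tau> i) \<omega>) *\<^sub>R \<psi> i \<omega>"
  have iso: "?S \<in> borel_measurable (F (\<tau> n)) \<and> integrable P (\<lambda>\<omega>. (norm (?S \<omega>))\<^sup>2) \<and>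
     expectation (\<lambda>\<omega>. (norm (?S \<omega>))\<^sup>2) = (\<Sum>i<n. expectation (\<lambda>\<omega>. (norm (\<psi> i \<omega>))\<^sup>2) * (\<tau> (Suc i) - \<tau> i))"
    by (rule bounded_simple_isometry[where n=n and C="\<lambda>i. sqrt (\<delta> / (\<tau> (Suc i) - \<tau> i))", OF m tau(1) _ psiF bdd])
      (use tau(2) less_imp_le in auto)
  have [measurable]: "?S \<in> borel_measurable P" using iso measurable_F by blast
  have psi2: "i < n \<Longrightarrow> integrable P (\<lambda>\<omega>. (norm (\<psi> i \<omega>))\<^sup>2)" for i
    using bdd[of i] measurable_F[OF psiF[of i]] pos tau(2)[of i]
    by (intro integrable_const_bound[where B="(sqrt (\<delta> / (\<tau> (Suc i) - \<tau> i)))\<^sup>2"])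
      (auto intro!: AE_I2 power_mono simp del: real_sqrt_pow2 real_sqrt_pow2_iff)
  have psiQ: "(\<Sum>i<k. (norm (\<psi> i \<omega>))\<^sup>2 * (\<tau> (Suc i) - \<tau> i)) \<le> \<delta>" if "k \<le> n" for k \<omega>
  proof (cases "Q k \<omega> \<le> \<delta>")
    case True
    have "(\<Sum>i<k. (norm (\<psi> i \<omega>))\<^sup>2 * (\<tau> (Suc i) - \<tau> i)) \<le> Q k \<omega>"
      unfolding Q_def using that tau(2) by (intro sum_mono) (auto simp: \<psi>_def less_imp_le)
    then show ?thesis using True by simp
  next
    case False
    then show ?thesis using that
    proof (induction k)
      case 0 then show ?case using pos by (simp add: Q_def)
    next
      case (Suc k)
      have "\<psi> k \<omega> = 0" using Suc by (simp add: \<psi>_def)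
      moreover have "(\<Sum>i<k. (norm (\<psi> i \<omega>))\<^sup>2 * (\<tau> (Suc i) - \<tau> i)) \<le> \<delta>"
      proof (cases "Q k \<omega> \<le> \<delta>")
        case True
        have "(\<Sum>i<k. (norm (\<psi> i \<omega>))\<^sup>2 * (\<tau> (Suc i) - \<tau> i)) \<le> Q k \<omega>"
          unfolding Q_def using Suc.prems tau(2) by (intro sum_mono) (auto simp: \<psi>_def less_imp_le)
        then show ?thesis using True by simp
      qed (use Suc in auto)
      ultimately show ?case by simp
    qed
  qed
  have "expectation (\<lambda>\<omega>. (norm (?S \<omega>))\<^sup>2) = expectation (\<lambda>\<omega>. \<Sum>i<n. (norm (\<psi> i \<omega>))\<^sup>2 * (\<tau> (Suc i) - \<tau> i))"
    using iso psi2 by (subst Bochner_Integration.integral_sum) auto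
  also have "\<dots> \<le> expectation (\<lambda>_. \<delta>)"
    using psi2 psiQ by (intro integral_mono) auto
  finally have E: "expectation (\<lambda>\<omega>. (norm (?S \<omega>))\<^sup>2) \<le> \<delta>" by (simp add: prob_space)
  have markov: "prob {\<omega> \<in> space P. \<epsilon>\<^sup>2 \<le> (norm (?S \<omega>))\<^sup>2} \<le> expectation (\<lambda>\<omega>. (norm (?S \<omega>))\<^sup>2) / \<epsilon>\<^sup>2"
    using iso pos by (intro integral_Markov_inequality_measure[where A="{}"]) auto
  let ?A = "{\<omega> \<in> space P. \<epsilon>\<^sup>2 \<le> (norm (?S \<omega>))\<^sup>2}" and ?B = "{\<omega> \<in> space P. Q n \<omega> > \<delta>}"
  have [measurable]: "Q n \<in> borel_measurable P"
  proof -
    have "(\<lambda>\<omega>. (norm (\<phi> j \<omega>))\<^sup>2) \<in> borel_measurable P" if "j \<in> {..<n}" for j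
    proof -
      have "\<phi> j \<in> borel_measurable P" using that meas measurable_F by auto
      then show ?thesis by measurable
    qed
    then show ?thesis unfolding Q_def by (intro borel_measurable_sum borel_measurable_times borel_measurable_const)
  qed
  \<comment> \<open>Where the full quadratic sum stays below \<open>\<delta>\<close> nothing is
    switched off, and both integrals agree.\<close>
  have sub: "{\<omega> \<in> space P. norm (\<Sum>i<n. (W m (\<tau> (Suc i)) \<omega> - W m (\<tau> i) \<omega>) *\<^sub>R \<phi> i \<omega>) > \<epsilon>} \<subseteq> ?A \<union> ?B"
  proof safe
    fix \<omega> assume w: "\<omega> \<in> space P" "norm (\<Sum>i<n. (W m (\<tau> (Suc i)) \<omega> - W m (\<tau> i) \<omega>) *\<^sub>R \<phi> i \<omega>) > \<epsilon>" "\<not> \<delta> < Q n \<omega>"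
    have "\<psi> i \<omega> = \<phi> i \<omega>" if "i < n" for i
      using Q_mono[of n "Suc i" \<omega>] that w(3) by (simp add: \<psi>_def)
    then have "?S \<omega> = (\<Sum>i<n. (W m (\<tau> (Suc i)) \<omega> - W m (\<tau> i) \<omega>) *\<^sub>R \<phi> i \<omega>)" by simp
    then show "\<epsilon>\<^sup>2 \<le> (norm (?S \<omega>))\<^sup>2" using w(2) pos(1) by (intro power_mono) auto
  qed
  have "prob {\<omega> \<in> space P. norm (\<Sum>i<n. (W m (\<tau> (Suc i)) \<omega> - W m (\<tau> i) \<omega>) *\<^sub>R \<phi> i \<omega>) > \<epsilon>} \<le> prob (?A \<union> ?B)"
    by (intro finite_measure_mono sub) measurable
  also have "\<dots> \<le> prob ?A + prob ?B" by (intro measure_Un_le) measurable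
  also have "prob ?A \<le> \<delta> / \<epsilon>\<^sup>2"
    using markov divide_right_mono[OF E, of "\<epsilon>\<^sup>2"] by simp
  finally show ?thesis by (simp add: Q_def)
qed

end

subsection \<open>Stochastic integrals of continuously differentiable processes\<close>

lemma telescope_close:
  fixes c :: "nat \<Rightarrow> 'b::real_normed_vector" and G :: "real \<Rightarrow> 'b"
  assumes "\<And>i. i < n \<Longrightarrow> norm (c i - (G (\<tau> (Suc i)) - G (\<tau> i))) \<le> e * (\<tau> (Suc i) - \<tau> i)"
  shows "norm ((\<Sum>i<n. c i) - (G (\<tau> n) - G (\<tau> 0))) \<le> e * (\<tau> n - \<tau> 0)"
proof -
  have "(\<Sum>i<n. c i) - (G (\<tau> n) - G (\<tau> 0)) = (\<Sum>i<n. c i - (G (\<tau> (Suc i)) - G (\<tau> i)))"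
    unfolding sum_subtractf[of c] by (simp only: sum_lessThan_telescope[of "\<lambda>i. G (\<tau> i)"])
  also have "norm \<dots> \<le> (\<Sum>i<n. e * (\<tau> (Suc i) - \<tau> i))"
    using assms by (intro sum_norm_le) auto
  also have "\<dots> = e * (\<tau> n - \<tau> 0)"
    by (simp add: sum_distrib_left[symmetric] sum_lessThan_telescope)
  finally show ?thesis .
qed

section \<open>Grids and their mesh\<close>

lemma grid_mono:
  assumes "grid t n \<tau>" "i \<le> j" "j \<le> n"
  shows "\<tau> i \<le> \<tau> j"
  using assms(2,3)
proof (induction j rule: dec_induct)
  case (step k)
  then show ?case using assms(1) unfolding grid_def by (metis Suc_le_lessD less_imp_le order_trans)
qed simp

lemma grid_range: "grid t n \<tau> \<Longrightarrow> i \<le> n \<Longrightarrow> \<tau> i \<in> {0..t}"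
  using grid_mono[of t n \<tau> 0 i] grid_mono[of t n \<tau> i n] by (auto simp: grid_def)

lemma grid_gap_le_mesh: "i < n \<Longrightarrow> \<tau> (Suc i) - \<tau> i \<le> mesh n \<tau>"
  unfolding mesh_def by (intro Max_ge) auto

lemma mesh_le: "0 \<le> e \<Longrightarrow> (\<And>i. i < n \<Longrightarrow> \<tau> (Suc i) - \<tau> i \<le> e) \<Longrightarrow> mesh n \<tau> \<le> e"
  unfolding mesh_def by (intro Max.boundedI) auto

lemma mesh_nonneg: "0 \<le> mesh n \<tau>"
  unfolding mesh_def by (intro Max_ge) auto

section \<open>Integration by parts along a path\<close>

definition primitive_on :: "real \<Rightarrow> (real \<Rightarrow> 'b::euclidean_space) \<Rightarrow> (real \<Rightarrow> 'b) \<Rightarrow> bool" where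
  "primitive_on t H H' \<longleftrightarrow>
     continuous_on {0..t} H' \<and> (\<forall>s\<in>{0..t}. H s = H 0 + integral {0..s} H')"

lemma primitive_on_diff:
  assumes "primitive_on t H H'" "0 \<le> a" "a \<le> b" "b \<le> t"
  shows "integral {a..b} H' = H b - H a"
proof -
  have "continuous_on {0..b} H'" using assms unfolding primitive_on_def
    by (auto intro: continuous_on_subset)
  then have "integral {0..a} H' + integral {a..b} H' = integral {0..b} H'"
    using assms by (intro Henstock_Kurzweil_Integration.integral_combine integrable_continuous_real) auto
  moreover have eq: "\<forall>s\<in>{0..t}. H s = H 0 + integral {0..s} H'"
    using assms(1) unfolding primitive_on_def by blast
  have "H b = H 0 + integral {0..b} H'" "H a = H 0 + integral {0..a} H'"
    by (rule bspec[OF eq], use assms in simp)+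
  ultimately show ?thesis using \<open>H b = _\<close> \<open>H a = _\<close> by (metis add_diff_cancel_left add_diff_cancel_left')
qed

text \<open>The Riemann-Stieltjes integral of \<open>H\<close> against \<open>w\<close> after
  integration by parts. Since only the derivative of \<open>H\<close> is integrated,
  \<open>w\<close> may have infinite variation.\<close>

definition parts_integral :: "(real \<Rightarrow> real) \<Rightarrow> (real \<Rightarrow> 'b::euclidean_space) \<Rightarrow> (real \<Rightarrow> 'b) \<Rightarrow> real \<Rightarrow> 'b" where
  "parts_integral w H H' t = w t *\<^sub>R H t - w 0 *\<^sub>R H 0 - integral {0..t} (\<lambda>s. w s *\<^sub>R H' s)"

lemma parts_integral_increment:
  assumes w: "continuous_on {0..t} w" and H: "primitive_on t H H'" and ab: "0 \<le> a" "a \<le> b" "b \<le> t"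
  shows "parts_integral w H H' b - parts_integral w H H' a
    = w b *\<^sub>R H b - w a *\<^sub>R H a - integral {a..b} (\<lambda>s. w s *\<^sub>R H' s)"
proof -
  have "continuous_on {0..b} (\<lambda>s. w s *\<^sub>R H' s)" using assms unfolding primitive_on_def
    by (intro continuous_intros) (auto intro: continuous_on_subset)
  then have "integral {0..a} (\<lambda>s. w s *\<^sub>R H' s) + integral {a..b} (\<lambda>s. w s *\<^sub>R H' s) = integral {0..b} (\<lambda>s. w s *\<^sub>R H' s)"
    using ab by (intro Henstock_Kurzweil_Integration.integral_combine integrable_continuous_real) auto
  then show ?thesis by (simp add: parts_integral_def algebra_simps)
qed

lemma parts_integral_step:
  assumes w: "continuous_on {0..t} w" and H: "primitive_on t H H'" and ab: "0 \<le> a" "a \<le> b" "b \<le> t"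
    and c: "c \<in> {a, b}" and e: "\<And>s. s \<in> {a..b} \<Longrightarrow> \<bar>w s - w a\<bar> \<le> e \<and> \<bar>w s - w b\<bar> \<le> e"
    and K: "\<And>s. s \<in> {a..b} \<Longrightarrow> norm (H' s) \<le> K"
  shows "norm ((w b - w a) *\<^sub>R H c - (parts_integral w H H' b - parts_integral w H H' a)) \<le> e * K * (b - a)"
proof -
  define d where "d = (if c = a then b else a)"
  have d: "(c = a \<and> d = b) \<or> (c = b \<and> d = a)" using c by (auto simp: d_def)
  have "0 \<le> e" using e[of a] ab by auto
  have cw: "continuous_on {a..b} w" and cH: "continuous_on {a..b} H'"
    using assms unfolding primitive_on_def by (auto intro: continuous_on_subset)
  have cwH: "(\<lambda>s. w s *\<^sub>R H' s) integrable_on {a..b}" and cdH: "(\<lambda>s. w d *\<^sub>R H' s) integrable_on {a..b}"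
    by (auto intro!: integrable_continuous_real continuous_intros cw cH)
  have "(w b - w a) *\<^sub>R H c - (parts_integral w H H' b - parts_integral w H H' a)
      = integral {a..b} (\<lambda>s. w s *\<^sub>R H' s) - w d *\<^sub>R (H b - H a)"
    unfolding parts_integral_increment[OF w H ab] using d by (auto simp: algebra_simps)
  also have "\<dots> = integral {a..b} (\<lambda>s. w s *\<^sub>R H' s - w d *\<^sub>R H' s)"
    unfolding primitive_on_diff[OF H ab, symmetric] using Henstock_Kurzweil_Integration.integral_diff[OF cwH cdH]
    by (simp add: integral_cmul)
  also have "norm \<dots> \<le> e * K * (b - a)"
  proof (rule integral_bound[OF ab(2)])
    show "continuous_on {a..b} (\<lambda>s. w s *\<^sub>R H' s - w d *\<^sub>R H' s)" by (intro continuous_intros cw cH)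
    fix s assume s: "s \<in> {a..b}"
    have "norm (w s *\<^sub>R H' s - w d *\<^sub>R H' s) = \<bar>w s - w d\<bar> * norm (H' s)"
      by (simp flip: scaleR_left_diff_distrib)
    also have "\<dots> \<le> e * K" using e[OF s] K[OF s] d \<open>0 \<le> e\<close> by (intro mult_mono) auto
    finally show "norm (w s *\<^sub>R H' s - w d *\<^sub>R H' s) \<le> e * K" .
  qed
  finally show ?thesis .
qed

text \<open>Uniform continuity of \<open>w\<close> makes all step errors small relative to the
  lengths, so they add up to little. Left and right sums have the same limit, and this is why no Ito
  correction arises.\<close>

lemma parts_integral_limit:
  assumes w: "continuous_on {0..t} w" and H: "primitive_on t H H'" and t: "0 \<le> t"
    and grid: "\<And>k. grid t (n k) (\<tau> k)" and mesh: "(\<lambda>k. mesh (n k) (\<tau> k)) \<longlonglongrightarrow> 0"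
    and c: "\<And>k i. c k i = \<tau> k i \<or> c k i = \<tau> k (Suc i)"
  shows "(\<lambda>k. \<Sum>i<n k. (w (\<tau> k (Suc i)) - w (\<tau> k i)) *\<^sub>R H (c k i)) \<longlonglongrightarrow> parts_integral w H H' t"
proof (rule LIMSEQ_I)
  fix r :: real assume r: "r > 0"
  have "bounded (H' ` {0..t})" using H unfolding primitive_on_def
    by (intro compact_imp_bounded compact_continuous_image) auto
  then obtain K where K: "K > 0" "\<And>s. s \<in> {0..t} \<Longrightarrow> norm (H' s) \<le> K"
    unfolding bounded_pos by auto
  \<comment> \<open>\<open>t + 1\<close> in place of \<open>t\<close> keeps the denominator positive
    for \<open>t = 0\<close>.\<close>
  define e where "e = r / (2 * K * (t + 1))"
  have e: "e > 0" unfolding e_def using r K t by simp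
  have "uniformly_continuous_on {0..t} w" by (rule compact_uniformly_continuous[OF w]) simp
  then obtain d where d: "d > 0" "\<And>s s'. s \<in> {0..t} \<Longrightarrow> s' \<in> {0..t} \<Longrightarrow> dist s' s < d \<Longrightarrow> dist (w s') (w s) < e"
    unfolding uniformly_continuous_on_def using e by metis
  obtain k0 where k0: "\<And>k. k \<ge> k0 \<Longrightarrow> mesh (n k) (\<tau> k) < d"
    using order_tendstoD(2)[OF mesh d(1)] unfolding eventually_sequentially by blast
  have "norm ((\<Sum>i<n k. (w (\<tau> k (Suc i)) - w (\<tau> k i)) *\<^sub>R H (c k i)) - parts_integral w H H' t) < r" if k: "k \<ge> k0" for k
  proof -
    note g = grid[of k]
    have t0: "\<tau> k 0 = 0" "\<tau> k (n k) = t" using g by (auto simp: grid_def)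
    have "norm ((\<Sum>i<n k. (w (\<tau> k (Suc i)) - w (\<tau> k i)) *\<^sub>R H (c k i)) -
        (parts_integral w H H' (\<tau> k (n k)) - parts_integral w H H' (\<tau> k 0))) \<le> e * K * (\<tau> k (n k) - \<tau> k 0)"
    proof (rule telescope_close)
      fix i assume i: "i < n k"
      have r1: "\<tau> k i \<in> {0..t}" "\<tau> k (Suc i) \<in> {0..t}" using grid_range[OF g] i by auto
      have r2: "\<tau> k i \<le> \<tau> k (Suc i)" using grid_mono[OF g, of i "Suc i"] i by auto
      have gap: "\<tau> k (Suc i) - \<tau> k i < d" using grid_gap_le_mesh[OF i, of "\<tau> k"] k0[OF k] by simp
      show "norm ((w (\<tau> k (Suc i)) - w (\<tau> k i)) *\<^sub>R H (c k i) -
        (parts_integral w H H' (\<tau> k (Suc i)) - parts_integral w H H' (\<tau> k i))) \<le> e * K * (\<tau> k (Suc i) - \<tau> k i)"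
      proof (rule parts_integral_step[OF w H])
        fix s assume s: "s \<in> {\<tau> k i..\<tau> k (Suc i)}"
        then have st: "s \<in> {0..t}" using r1 by auto
        show "norm (H' s) \<le> K" using K(2)[OF st] .
        show "\<bar>w s - w (\<tau> k i)\<bar> \<le> e \<and> \<bar>w s - w (\<tau> k (Suc i))\<bar> \<le> e"
          using d(2)[OF r1(1) st] d(2)[OF r1(2) st] s gap by (auto simp: dist_real_def)
      qed (use r1 r2 c in auto)
    qed
    also have "e * K * (\<tau> k (n k) - \<tau> k 0) < r"
    proof -
      have "e * K * t = r * (t / (2 * (t + 1)))" unfolding e_def using K by simp
      also have "\<dots> < r * 1" using r t by (intro mult_strict_left_mono) (auto simp: field_simps)
      finally show ?thesis by (simp add: t0)
    qed
    finally show ?thesis by (simp add: t0 parts_integral_def)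
  qed
  then show "\<exists>k0. \<forall>k\<ge>k0. norm ((\<Sum>i<n k. (w (\<tau> k (Suc i)) - w (\<tau> k i)) *\<^sub>R H (c k i)) - parts_integral w H H' t) < r"
    by blast
qed

text \<open>Each interval is cut into \<open>K\<close> equal pieces; quotient and remainder by
  \<open>K\<close> are the coarse interval and the position inside it. The approximating simple
  processes live on grids over which there is no control; refining them allows the integrand to be
  sampled finely while the simple process stays a simple process on the same grid.\<close>

definition refine_grid :: "nat \<Rightarrow> (nat \<Rightarrow> real) \<Rightarrow> nat \<Rightarrow> real" where
  "refine_grid K \<tau> r = \<tau> (r div K) + real (r mod K) * ((\<tau> (Suc (r div K)) - \<tau> (r div K)) / real K)"

lemma refine_grid_gap:
  assumes "K > 0"
  shows "refine_grid K \<tau> (Suc r) - refine_grid K \<tau> r = (\<tau> (Suc (r div K)) - \<tau> (r div K)) / real K"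
proof (cases "Suc (r mod K) = K")
  case True
  then have 1: "Suc r mod K = 0" "Suc r div K = Suc (r div K)" by (simp_all add: mod_Suc div_Suc)
  have 2: "real (r mod K) = real K - 1" using True by linarith
  show ?thesis unfolding refine_grid_def 1 2 using assms by (simp add: field_simps)
next
  case False
  then have 1: "Suc r mod K = Suc (r mod K)" "Suc r div K = r div K" by (simp_all add: mod_Suc div_Suc)
  have "x + real (Suc k) * d - (x + real k * d) = d" for x d :: real and k by (simp add: algebra_simps)
  then show ?thesis unfolding refine_grid_def 1 .
qed

lemma refine_grid_block: "j < K \<Longrightarrow> refine_grid K \<tau> (i * K + j) = \<tau> i + real j * ((\<tau> (Suc i) - \<tau> i) / real K)"
  by (simp add: refine_grid_def)

lemma refine_grid_multiple: "K > 0 \<Longrightarrow> refine_grid K \<tau> (i * K) = \<tau> i"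
  by (simp add: refine_grid_def)

lemma grid_refine:
  assumes g: "grid t n \<tau>" and K: "K > 0"
  shows "grid t (n * K) (refine_grid K \<tau>)"
    and "mesh (n * K) (refine_grid K \<tau>) \<le> t / real K"
proof -
  have "refine_grid K \<tau> r < refine_grid K \<tau> (Suc r)" if "r < n * K" for r
  proof -
    have "r div K < n" using that by (simp add: less_mult_imp_div_less)
    then have "(\<tau> (Suc (r div K)) - \<tau> (r div K)) / real K > 0" using g K by (simp add: grid_def)
    then show ?thesis using refine_grid_gap[OF K, of \<tau> r] by simp
  qed
  then show "grid t (n * K) (refine_grid K \<tau>)"
    using g refine_grid_multiple[OF K, of \<tau> 0] refine_grid_multiple[OF K, of \<tau> n] unfolding grid_def by simp
  have "\<tau> n = t" using g by (simp add: grid_def)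
  then have "0 \<le> t" using grid_range[OF g, of n] by simp
  then show "mesh (n * K) (refine_grid K \<tau>) \<le> t / real K"
  proof (intro mesh_le)
    fix r assume r: "r < n * K"
    then have "r div K < n" by (simp add: less_mult_imp_div_less)
    then have "\<tau> (Suc (r div K)) - \<tau> (r div K) \<le> t"
      using grid_range[OF g, of "r div K"] grid_range[OF g, of "Suc (r div K)"] by auto
    then show "refine_grid K \<tau> (Suc r) - refine_grid K \<tau> r \<le> t / real K"
      unfolding refine_grid_gap[OF K] by (intro divide_right_mono) auto
  qed simp
qed

text \<open>The simple integrand is constant on each block of \<open>K\<close> fine intervals, where
  the increments of the driving path telescope.\<close>

lemma simple_integral_refine:
  assumes K: "K > 0"
  shows "simple_integral w n \<tau> \<xi> \<omega>
    = (\<Sum>r<n * K. (w (refine_grid K \<tau> (Suc r)) \<omega> - w (refine_grid K \<tau> r) \<omega>) *\<^sub>R \<xi> (r div K) \<omega>)"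
proof -
  let ?f = "\<lambda>r. w (refine_grid K \<tau> r) \<omega>"
  have "(\<Sum>r<n * K. (?f (Suc r) - ?f r) *\<^sub>R \<xi> (r div K) \<omega>)
      = (\<Sum>i<n. \<Sum>r\<in>{i * K..<i * K + K}. (?f (Suc r) - ?f r) *\<^sub>R \<xi> (r div K) \<omega>)"
    by (rule sum.nat_group[symmetric])
  also have "\<dots> = (\<Sum>i<n. (w (\<tau> (Suc i)) \<omega> - w (\<tau> i) \<omega>) *\<^sub>R \<xi> i \<omega>)"
  proof (rule sum.cong[OF refl])
    fix i
    have "(\<Sum>r\<in>{i * K..<i * K + K}. (?f (Suc r) - ?f r) *\<^sub>R \<xi> (r div K) \<omega>)
        = (\<Sum>r\<in>{i * K..<i * K + K}. (?f (Suc r) - ?f r) *\<^sub>R \<xi> i \<omega>)"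
    proof (rule sum.cong[OF refl])
      fix r assume "r \<in> {i * K..<i * K + K}"
      then have "r div K = i" by (metis atLeastLessThan_iff div_nat_eqI mult.commute mult_Suc_right add.commute)
      then show "(?f (Suc r) - ?f r) *\<^sub>R \<xi> (r div K) \<omega> = (?f (Suc r) - ?f r) *\<^sub>R \<xi> i \<omega>" by simp
    qed
    also have "\<dots> = (?f (i * K + K) - ?f (i * K)) *\<^sub>R \<xi> i \<omega>"
      unfolding scaleR_sum_left[symmetric] by (subst sum_Suc_diff'[of "i * K" "i * K + K" ?f]) simp_all
    also have "\<dots> = (w (\<tau> (Suc i)) \<omega> - w (\<tau> i) \<omega>) *\<^sub>R \<xi> i \<omega>"
      using refine_grid_multiple[OF K, of \<tau> i] refine_grid_multiple[OF K, of \<tau> "Suc i"] by (simp add: add.commute)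
    finally show "(\<Sum>r\<in>{i * K..<i * K + K}. (?f (Suc r) - ?f r) *\<^sub>R \<xi> (r div K) \<omega>) = (w (\<tau> (Suc i)) \<omega> - w (\<tau> i) \<omega>) *\<^sub>R \<xi> i \<omega>" .
  qed
  finally show ?thesis by (simp add: simple_integral_def)
qed

lemma uniform_riemann_sum:
  fixes \<phi> :: "real \<Rightarrow> real"
  assumes c: "continuous_on {a..b} \<phi>" and ab: "a \<le> b"
  shows "(\<lambda>K. \<Sum>j<Suc K. \<phi> (a + real j * ((b - a) / real (Suc K))) * ((b - a) / real (Suc K))) \<longlonglongrightarrow> integral {a..b} \<phi>"
proof (rule LIMSEQ_I)
  fix r :: real assume r: "r > 0"
  define e where "e = r / (2 * (b - a + 1))"
  have e: "e > 0" unfolding e_def using r ab by simp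
  have "uniformly_continuous_on {a..b} \<phi>" by (rule compact_uniformly_continuous[OF c]) simp
  then obtain d where d: "d > 0" "\<And>s s'. s \<in> {a..b} \<Longrightarrow> s' \<in> {a..b} \<Longrightarrow> dist s' s < d \<Longrightarrow> dist (\<phi> s') (\<phi> s) < e"
    unfolding uniformly_continuous_on_def using e by metis
  have "(\<lambda>K. (b - a) / real (Suc K)) \<longlonglongrightarrow> 0" by (rule LIMSEQ_Suc[OF lim_const_over_n])
  from order_tendstoD(2)[OF this d(1)] obtain k0 where k0: "\<And>K. K \<ge> k0 \<Longrightarrow> (b - a) / real (Suc K) < d"
    unfolding eventually_sequentially by blast
  have "norm ((\<Sum>j<Suc K. \<phi> (a + real j * ((b - a) / real (Suc K))) * ((b - a) / real (Suc K))) - integral {a..b} \<phi>) < r"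
    if K: "K \<ge> k0" for K
  proof -
    define \<tau> where "\<tau> j = a + real j * ((b - a) / real (Suc K))" for j
    have ends: "\<tau> 0 = a" "\<tau> (Suc K) = b" by (simp_all add: \<tau>_def)
    have gap: "\<tau> (Suc j) - \<tau> j = (b - a) / real (Suc K)" for j
    proof -
      have "x + real (Suc k) * d - (x + real k * d) = d" for x d :: real and k by (simp add: algebra_simps)
      then show ?thesis unfolding \<tau>_def .
    qed
    have mono: "\<tau> i \<le> \<tau> j" if "i \<le> j" for i j using that ab by (auto simp: \<tau>_def intro!: divide_right_mono mult_right_mono)
    have "norm ((\<Sum>j<Suc K. \<phi> (\<tau> j) * (\<tau> (Suc j) - \<tau> j)) - (integral {a..\<tau> (Suc K)} \<phi> - integral {a..\<tau> 0} \<phi>)) \<le> e * (\<tau> (Suc K) - \<tau> 0)"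
    proof (rule telescope_close)
      fix j assume j: "j < Suc K"
      have tj: "a \<le> \<tau> j" "\<tau> j \<le> \<tau> (Suc j)" "\<tau> (Suc j) \<le> b"
        using mono[of 0 j] mono[of j "Suc j"] mono[of "Suc j" "Suc K"] j ends by auto
      have cj: "continuous_on {\<tau> j..\<tau> (Suc j)} \<phi>" using c tj by (auto intro: continuous_on_subset)
      have "integral {a..\<tau> j} \<phi> + integral {\<tau> j..\<tau> (Suc j)} \<phi> = integral {a..\<tau> (Suc j)} \<phi>"
        using tj c by (intro Henstock_Kurzweil_Integration.integral_combine integrable_continuous_real)
          (auto intro: continuous_on_subset)
      then have "\<phi> (\<tau> j) * (\<tau> (Suc j) - \<tau> j) - (integral {a..\<tau> (Suc j)} \<phi> - integral {a..\<tau> j} \<phi>)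
          = integral {\<tau> j..\<tau> (Suc j)} (\<lambda>s. \<phi> (\<tau> j) - \<phi> s)"
        using tj cj by (subst Henstock_Kurzweil_Integration.integral_diff) (auto intro: integrable_continuous_real simp: mult.commute)
      also have "norm \<dots> \<le> e * (\<tau> (Suc j) - \<tau> j)"
      proof (rule integral_bound[OF tj(2)])
        show "continuous_on {\<tau> j..\<tau> (Suc j)} (\<lambda>s. \<phi> (\<tau> j) - \<phi> s)" by (intro continuous_intros cj)
        fix s assume s: "s \<in> {\<tau> j..\<tau> (Suc j)}"
        have "dist (\<tau> j) s < d" using s gap[of j] k0[OF K] by (auto simp: dist_real_def)
        then show "norm (\<phi> (\<tau> j) - \<phi> s) \<le> e" using d(2)[of s "\<tau> j"] s tj by (auto simp: dist_real_def)
      qed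
      finally show "norm (\<phi> (\<tau> j) * (\<tau> (Suc j) - \<tau> j) - (integral {a..\<tau> (Suc j)} \<phi> - integral {a..\<tau> j} \<phi>)) \<le> e * (\<tau> (Suc j) - \<tau> j)" .
    qed
    then have "norm ((\<Sum>j<Suc K. \<phi> (\<tau> j) * ((b - a) / real (Suc K))) - integral {a..b} \<phi>) \<le> e * (b - a)"
      unfolding ends gap by simp
    also have "\<dots> < r"
    proof -
      have "e * (b - a) = r * ((b - a) / (2 * (b - a + 1)))" unfolding e_def by simp
      also have "\<dots> < r * 1" using r ab by (intro mult_strict_left_mono) (auto simp: field_simps)
      finally show ?thesis by simp
    qed
    finally show ?thesis by (simp add: \<tau>_def)
  qed
  then show "\<exists>k0. \<forall>K\<ge>k0. norm ((\<Sum>j<Suc K. \<phi> (a + real j * ((b - a) / real (Suc K))) * ((b - a) / real (Suc K))) - integral {a..b} \<phi>) < r"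
    by blast
qed

text \<open>The integrand may jump at the coarse grid points, as the squared distance to a simple
  process does, so the Riemann sums are taken separately on each coarse interval.\<close>

lemma refine_grid_quadratic_limit:
  fixes \<phi> :: "nat \<Rightarrow> real \<Rightarrow> real"
  assumes g: "grid t n \<tau>" and c: "\<And>i. i < n \<Longrightarrow> continuous_on {\<tau> i..\<tau> (Suc i)} (\<phi> i)"
  shows "(\<lambda>K. \<Sum>r<n * Suc K. \<phi> (r div Suc K) (refine_grid (Suc K) \<tau> r) * (refine_grid (Suc K) \<tau> (Suc r) - refine_grid (Suc K) \<tau> r))
    \<longlonglongrightarrow> (\<Sum>i<n. integral {\<tau> i..\<tau> (Suc i)} (\<phi> i))"
proof -
  have eq: "(\<Sum>r<n * Suc K. \<phi> (r div Suc K) (refine_grid (Suc K) \<tau> r) * (refine_grid (Suc K) \<tau> (Suc r) - refine_grid (Suc K) \<tau> r))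
    = (\<Sum>i<n. \<Sum>j<Suc K. \<phi> i (\<tau> i + real j * ((\<tau> (Suc i) - \<tau> i) / real (Suc K))) * ((\<tau> (Suc i) - \<tau> i) / real (Suc K)))" (is "?L = ?R") for K
  proof -
    let ?h = "\<lambda>r. \<phi> (r div Suc K) (refine_grid (Suc K) \<tau> r) * (refine_grid (Suc K) \<tau> (Suc r) - refine_grid (Suc K) \<tau> r)"
    have "?L = (\<Sum>i<n. \<Sum>r\<in>{i * Suc K..<i * Suc K + Suc K}. ?h r)"
      by (rule sum.nat_group[symmetric])
    also have "\<dots> = (\<Sum>i<n. \<Sum>j<Suc K. ?h (i * Suc K + j))"
    proof (rule sum.cong[OF refl])
      fix i
      show "(\<Sum>r\<in>{i * Suc K..<i * Suc K + Suc K}. ?h r) = (\<Sum>j<Suc K. ?h (i * Suc K + j))"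
        by (rule sum.reindex_bij_witness[of _ "\<lambda>j. i * Suc K + j" "\<lambda>r. r - i * Suc K"]) auto
    qed
    also have "\<dots> = ?R"
    proof (intro sum.cong refl)
      fix i j assume "j \<in> {..<Suc K}"
      then have j: "j < Suc K" by simp
      then have d: "(i * Suc K + j) div Suc K = i"
        by (subst add.commute, subst div_mult_self1) simp_all
      show "?h (i * Suc K + j) = \<phi> i (\<tau> i + real j * ((\<tau> (Suc i) - \<tau> i) / real (Suc K))) * ((\<tau> (Suc i) - \<tau> i) / real (Suc K))"
        by (simp only: refine_grid_gap[OF zero_less_Suc] d refine_grid_block[OF j, of \<tau> i, symmetric])
    qed
    finally show ?thesis .
  qed
  show ?thesis unfolding eq
  proof (rule tendsto_sum)
    fix i assume "i \<in> {..<n}"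
    then have i: "i < n" by simp
    show "(\<lambda>K. \<Sum>j<Suc K. \<phi> i (\<tau> i + real j * ((\<tau> (Suc i) - \<tau> i) / real (Suc K))) * ((\<tau> (Suc i) - \<tau> i) / real (Suc K)))
        \<longlonglongrightarrow> integral {\<tau> i..\<tau> (Suc i)} (\<phi> i)"
      by (rule uniform_riemann_sum[OF c[OF i]]) (use g i in \<open>simp add: grid_def less_imp_le\<close>)
  qed
qed

text \<open>Translates the extended integral in \<open>has_ito_integral\<close> into ordinary
  integrals of continuous functions: on the interval with index \<open>i\<close> the simple process
  equals \<open>\<xi> i\<close>, and open and closed endpoints differ by a null set.\<close>

lemma simple_process_error_ge:
  fixes H :: "real \<Rightarrow> 'b::euclidean_space"
  assumes g: "grid t n \<tau>" and c: "continuous_on {0..t} H"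
  shows "ennreal (\<Sum>i<n. integral {\<tau> i..\<tau> (Suc i)} (\<lambda>s. (norm (H s - \<xi> i \<omega>))\<^sup>2))
    \<le> (\<integral>\<^sup>+ s\<in>{0..t}. ennreal ((norm (H s - simple_process n \<tau> \<xi> s \<omega>))\<^sup>2) \<partial>lborel)"
proof -
  let ?f = "\<lambda>i s. (norm (H s - \<xi> i \<omega>))\<^sup>2"
  have tt: "\<tau> i \<le> \<tau> (Suc i)" "\<tau> i \<in> {0..t}" "\<tau> (Suc i) \<in> {0..t}" if "i < n" for i
    using that grid_range[OF g] grid_mono[OF g, of i "Suc i"] by auto
  have cf: "continuous_on {\<tau> i..\<tau> (Suc i)} (?f i)" if "i < n" for i
    using tt[OF that] by (intro continuous_intros continuous_on_subset[OF c]) auto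
  have eq: "ennreal (integral {\<tau> i..\<tau> (Suc i)} (?f i)) = (\<integral>\<^sup>+ s. ennreal (?f i s) * indicator {\<tau> i<..\<tau> (Suc i)} s \<partial>lborel)" if i: "i < n" for i
  proof -
    have "(?f i has_integral integral {\<tau> i..\<tau> (Suc i)} (?f i)) {\<tau> i..\<tau> (Suc i)}"
      using cf[OF i] by (simp add: integrable_continuous_real integrable_integral)
    then have "(\<integral>\<^sup>+ s. ennreal (indicator {\<tau> i..\<tau> (Suc i)} s *\<^sub>R ?f i s) \<partial>lborel) = ennreal (integral {\<tau> i..\<tau> (Suc i)} (?f i))"
      using continuous_integral_lebesgue[OF cf[OF i]] by (subst nn_integral_eq_integral) auto
    also have "(\<integral>\<^sup>+ s. ennreal (indicator {\<tau> i..\<tau> (Suc i)} s *\<^sub>R ?f i s) \<partial>lborel) = (\<integral>\<^sup>+ s. ennreal (?f i s) * indicator {\<tau> i<..\<tau> (Suc i)} s \<partial>lborel)"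
    proof (rule nn_integral_cong_AE)
      show "AE s in lborel. ennreal (indicator {\<tau> i..\<tau> (Suc i)} s *\<^sub>R ?f i s) = ennreal (?f i s) * indicator {\<tau> i<..\<tau> (Suc i)} s"
        using AE_lborel_singleton[of "\<tau> i"] by eventually_elim (auto simp: indicator_def)
    qed
    finally show ?thesis by simp
  qed
  have nn: "0 \<le> integral {\<tau> i..\<tau> (Suc i)} (?f i)" if "i < n" for i
    by (intro Henstock_Kurzweil_Integration.integral_nonneg integrable_continuous_real cf that) auto
  have "ennreal (\<Sum>i<n. integral {\<tau> i..\<tau> (Suc i)} (?f i)) = (\<Sum>i<n. ennreal (integral {\<tau> i..\<tau> (Suc i)} (?f i)))"
    using nn by (subst sum_ennreal) auto
  also have "\<dots> = (\<Sum>i<n. \<integral>\<^sup>+ s. ennreal (?f i s) * indicator {\<tau> i<..\<tau> (Suc i)} s \<partial>lborel)"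
    using eq by (intro sum.cong) auto
  also have "\<dots> = (\<integral>\<^sup>+ s. (\<Sum>i<n. ennreal (?f i s) * indicator {\<tau> i<..\<tau> (Suc i)} s) \<partial>lborel)"
  proof (rule nn_integral_sum[symmetric])
    fix i assume "i \<in> {..<n}"
    then have i: "i < n" by simp
    have "(\<lambda>s. indicator {\<tau> i..\<tau> (Suc i)} s *\<^sub>R ?f i s) \<in> borel_measurable lborel"
      using continuous_integral_lebesgue(1)[OF cf[OF i]] by (rule borel_measurable_integrable)
    then have "(\<lambda>s. ennreal (indicator {\<tau> i..\<tau> (Suc i)} s *\<^sub>R ?f i s) * indicator {\<tau> i<..\<tau> (Suc i)} s) \<in> borel_measurable lborel"
      by measurable
    also have "(\<lambda>s. ennreal (indicator {\<tau> i..\<tau> (Suc i)} s *\<^sub>R ?f i s) * indicator {\<tau> i<..\<tau> (Suc i)} s)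
        = (\<lambda>s. ennreal (?f i s) * indicator {\<tau> i<..\<tau> (Suc i)} s)" by (auto simp: indicator_def fun_eq_iff)
    finally show "(\<lambda>s. ennreal (?f i s) * indicator {\<tau> i<..\<tau> (Suc i)} s) \<in> borel_measurable lborel" .
  qed
  also have "\<dots> \<le> (\<integral>\<^sup>+ s\<in>{0..t}. ennreal ((norm (H s - simple_process n \<tau> \<xi> s \<omega>))\<^sup>2) \<partial>lborel)"
  proof (rule nn_integral_mono)
    fix s
    show "(\<Sum>i<n. ennreal (?f i s) * indicator {\<tau> i<..\<tau> (Suc i)} s) \<le> ennreal ((norm (H s - simple_process n \<tau> \<xi> s \<omega>))\<^sup>2) * indicator {0..t} s"
    proof (cases "\<exists>i<n. s \<in> {\<tau> i<..\<tau> (Suc i)}")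
      case True
      then obtain i where i: "i < n" "s \<in> {\<tau> i<..\<tau> (Suc i)}" by blast
      have other: "s \<notin> {\<tau> j<..\<tau> (Suc j)}" if "j < n" "j \<noteq> i" for j
      proof (cases "j < i")
        case True
        then have "\<tau> (Suc j) \<le> \<tau> i" using grid_mono[OF g, of "Suc j" i] i by simp
        then show ?thesis using i by auto
      next
        case False
        then have "\<tau> (Suc i) \<le> \<tau> j" using grid_mono[OF g, of "Suc i" j] that by simp
        then show ?thesis using i by auto
      qed
      have "(\<Sum>j<n. ennreal (?f j s) * indicator {\<tau> j<..\<tau> (Suc j)} s) = (\<Sum>j<n. if j = i then ennreal (?f i s) else 0)"
        using other i by (intro sum.cong) auto
      also have "\<dots> = ennreal (?f i s)" using i by simp
      also have "\<xi> i \<omega> = simple_process n \<tau> \<xi> s \<omega>"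
      proof -
        have "simple_process n \<tau> \<xi> s \<omega> = (\<Sum>j<n. if j = i then \<xi> i \<omega> else 0)"
          unfolding simple_process_def using other i by (intro sum.cong) auto
        then show ?thesis using i by simp
      qed
      finally show ?thesis using i tt[OF i(1)] by (simp add: indicator_def)
    next
      case False
      then have "(\<Sum>i<n. ennreal (?f i s) * indicator {\<tau> i<..\<tau> (Suc i)} s) = (\<Sum>i<n. 0)"
        by (intro sum.cong) (auto simp: indicator_def)
      then show ?thesis by simp
    qed
  qed
  finally show ?thesis .
qed

lemma refine_mesh_tendsto:
  assumes "grid t n \<tau>"
  shows "(\<lambda>K. mesh (n * Suc K) (refine_grid (Suc K) \<tau>)) \<longlonglongrightarrow> 0"
proof (rule real_tendsto_sandwich[of "\<lambda>_. 0" _ _ "\<lambda>K. t / real (Suc K)"])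
  show "(\<lambda>K. t / real (Suc K)) \<longlonglongrightarrow> 0" by (rule LIMSEQ_Suc[OF lim_const_over_n])
  show "\<forall>\<^sub>F K in sequentially. mesh (n * Suc K) (refine_grid (Suc K) \<tau>) \<le> t / real (Suc K)"
    using grid_refine(2)[OF assms zero_less_Suc] by (intro always_eventually allI)
qed (auto intro: always_eventually mesh_nonneg)

section \<open>Identification of both stochastic integrals with the pathwise one\<close>

context wiener_setup
begin

lemma borel_measurable_parts_integral:
  assumes m: "m \<in> {1..M}" and t: "0 \<le> t"
    and H: "\<And>s. s \<in> {0..t} \<Longrightarrow> H s \<in> borel_measurable P"
    and H': "\<And>s. s \<in> {0..t} \<Longrightarrow> H' s \<in> borel_measurable P"
      "\<And>\<omega>. \<omega> \<in> space P \<Longrightarrow> continuous_on {0..t} (\<lambda>s. H' s \<omega>)"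
  shows "(\<lambda>\<omega>. parts_integral (\<lambda>s. W m s \<omega>) (\<lambda>s. H s \<omega>) (\<lambda>s. H' s \<omega>) t) \<in> borel_measurable P"
proof -
  have [measurable]: "W m t \<in> borel_measurable P" "W m 0 \<in> borel_measurable P" "H t \<in> borel_measurable P" "H 0 \<in> borel_measurable P"
    using W_meas m t H by auto
  have [measurable]: "(\<lambda>\<omega>. integral {0..t} (\<lambda>s. W m s \<omega> *\<^sub>R H' s \<omega>)) \<in> borel_measurable P"
  proof (rule borel_measurable_time_integral)
    show "(\<lambda>\<omega>. W m s \<omega> *\<^sub>R H' s \<omega>) \<in> borel_measurable P" if "s \<in> {0..t}" for s
      using W_meas[OF m, of s] H'(1)[OF that] that by (intro borel_measurable_scaleR) auto
    show "continuous_on {0..t} (\<lambda>s. W m s \<omega> *\<^sub>R H' s \<omega>)" if "\<omega> \<in> space P" for \<omega>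
      by (intro continuous_intros H'(2) that W_cont[OF m that]) auto
  qed
  show ?thesis unfolding parts_integral_def by measurable
qed

text \<open>The trapezoidal sums are the mean of left and right sums, which converge along almost
  every path to the integral by parts; limits in probability are unique.\<close>

lemma stratonovich_integral_eq_parts:
  fixes H :: "real \<Rightarrow> 'a \<Rightarrow> 'b::euclidean_space"
  assumes m: "m \<in> {1..M}" and t: "0 \<le> t"
    and H: "\<And>s. s \<in> {0..t} \<Longrightarrow> H s \<in> borel_measurable P"
    and H': "\<And>s. s \<in> {0..t} \<Longrightarrow> H' s \<in> borel_measurable P"
      "\<And>\<omega>. \<omega> \<in> space P \<Longrightarrow> continuous_on {0..t} (\<lambda>s. H' s \<omega>)"
    and prim: "AE \<omega> in P. primitive_on t (\<lambda>s. H s \<omega>) (\<lambda>s. H' s \<omega>)"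
    and int: "has_stratonovich_integral P (W m) H t I"
  shows "AE \<omega> in P. I \<omega> = parts_integral (\<lambda>s. W m s \<omega>) (\<lambda>s. H s \<omega>) (\<lambda>s. H' s \<omega>) t"
proof -
  \<comment> \<open>The definition quantifies over all sequences of grids, so a single one may be
    chosen. For \<open>t = 0\<close> it is the grid without intervals.\<close>
  have "\<exists>n \<tau>. grid t n \<tau>"
  proof (cases "t = 0")
    case True
    then have "grid t 0 (\<lambda>_. 0)" by (simp add: grid_def)
    then show ?thesis by blast
  next
    case False
    with t have "grid t 1 (\<lambda>i. real i * t)" by (simp add: grid_def)
    then show ?thesis by blast
  qed
  then obtain n0 \<tau>0 where g0: "grid t n0 \<tau>0" by blast
  define n where "n K = n0 * Suc K" for K
  define \<tau> where "\<tau> K = refine_grid (Suc K) \<tau>0" for K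
  have g: "grid t (n K) (\<tau> K)" for K unfolding n_def \<tau>_def by (rule grid_refine(1)[OF g0]) simp
  have mesh: "(\<lambda>K. mesh (n K) (\<tau> K)) \<longlonglongrightarrow> 0" unfolding n_def \<tau>_def by (rule refine_mesh_tendsto[OF g0])
  let ?f = "\<lambda>k \<omega>. \<Sum>i<n k. (W m (\<tau> k (Suc i)) \<omega> - W m (\<tau> k i) \<omega>) *\<^sub>R ((1/2) *\<^sub>R (H (\<tau> k i) \<omega> + H (\<tau> k (Suc i)) \<omega>))"
  let ?T = "\<lambda>\<omega>. parts_integral (\<lambda>s. W m s \<omega>) (\<lambda>s. H s \<omega>) (\<lambda>s. H' s \<omega>) t"
  have 1: "tendsto_in_prob P ?f I"
    using int g mesh unfolding has_stratonovich_integral_def by blast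
  have "tendsto_in_prob P ?f ?T"
  proof (rule AE_imp_tendsto_in_prob)
    show "?f k \<in> borel_measurable P" for k using 1 unfolding tendsto_in_prob_def by blast
    show "?T \<in> borel_measurable P" by (rule borel_measurable_parts_integral[OF m t H H'])
    show "AE \<omega> in P. (\<lambda>k. ?f k \<omega>) \<longlonglongrightarrow> ?T \<omega>"
      using prim AE_space
    proof eventually_elim
      case (elim \<omega>)
      note L = parts_integral_limit[OF W_cont[OF m elim(2), of "{0..t}"] elim(1) t g mesh]
      have eq: "?f k \<omega> = (1/2) *\<^sub>R (\<Sum>i<n k. (W m (\<tau> k (Suc i)) \<omega> - W m (\<tau> k i) \<omega>) *\<^sub>R H (\<tau> k i) \<omega>)
          + (1/2) *\<^sub>R (\<Sum>i<n k. (W m (\<tau> k (Suc i)) \<omega> - W m (\<tau> k i) \<omega>) *\<^sub>R H (\<tau> k (Suc i)) \<omega>)" for k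
        by (simp add: scaleR_sum_right sum.distrib[symmetric] scaleR_add_right mult.commute)
      have "(\<lambda>k. ?f k \<omega>) \<longlonglongrightarrow> (1/2) *\<^sub>R ?T \<omega> + (1/2) *\<^sub>R ?T \<omega>"
        unfolding eq by (intro tendsto_add tendsto_scaleR tendsto_const L) auto
      then show ?case by (simp flip: scaleR_add_left)
    qed
  qed
  from tendsto_in_prob_unique[OF 1 this] show ?thesis .
qed

text \<open>For a fixed simple approximation its grid is refined. Left sums of \<open>H\<close> on
  the refined grid converge pathwise to the integral by parts. Their difference to the simple
  integral is a simple integral of \<open>H - \<xi>\<close>, which
  \<open>simple_integral_tail\<close> controls by a Riemann sum of the approximation error. Refining
  to the limit with \<open>k\<close> fixed leaves a bound in terms of the very error that
  \<open>has_ito_integral\<close> sends to zero.\<close>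

lemma ito_integral_eq_parts:
  fixes H :: "real \<Rightarrow> 'a \<Rightarrow> 'b::euclidean_space"
  assumes m: "m \<in> {1..M}" and t: "0 \<le> t"
    and HF: "\<And>s. s \<in> {0..t} \<Longrightarrow> H s \<in> borel_measurable (F s)"
    and Hc: "\<And>\<omega>. \<omega> \<in> space P \<Longrightarrow> continuous_on {0..t} (\<lambda>s. H s \<omega>)"
    and H': "\<And>s. s \<in> {0..t} \<Longrightarrow> H' s \<in> borel_measurable P"
      "\<And>\<omega>. \<omega> \<in> space P \<Longrightarrow> continuous_on {0..t} (\<lambda>s. H' s \<omega>)"
    and prim: "AE \<omega> in P. primitive_on t (\<lambda>s. H s \<omega>) (\<lambda>s. H' s \<omega>)"
    and int: "has_ito_integral P F (W m) H t I"
  shows "AE \<omega> in P. I \<omega> = parts_integral (\<lambda>s. W m s \<omega>) (\<lambda>s. H s \<omega>) (\<lambda>s. H' s \<omega>) t"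
proof -
  have HP: "\<And>s. s \<in> {0..t} \<Longrightarrow> H s \<in> borel_measurable P" using HF measurable_F by blast
  let ?T = "\<lambda>\<omega>. parts_integral (\<lambda>s. W m s \<omega>) (\<lambda>s. H s \<omega>) (\<lambda>s. H' s \<omega>) t"
  have Tm[measurable]: "?T \<in> borel_measurable P" by (rule borel_measurable_parts_integral[OF m t HP H'])
  obtain n \<tau> \<xi> where simple: "\<And>k. is_simple F t (n k) (\<tau> k) (\<xi> k)"
    and approx: "\<And>\<epsilon>. \<epsilon> > 0 \<Longrightarrow> (\<lambda>k. measure P {\<omega>\<in>space P.
            (\<integral>\<^sup>+ s\<in>{0..t}. ennreal ((norm (H s \<omega> - simple_process (n k) (\<tau> k) (\<xi> k) s \<omega>))\<^sup>2) \<partial>lborel)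
              > ennreal \<epsilon>}) \<longlonglongrightarrow> 0"
    and lim: "tendsto_in_prob P (\<lambda>k. simple_integral (W m) (n k) (\<tau> k) (\<xi> k)) I"
    using int unfolding has_ito_integral_def by blast
  have sm[measurable]: "simple_integral (W m) (n k) (\<tau> k) (\<xi> k) \<in> borel_measurable P" for k
    using lim unfolding tendsto_in_prob_def by blast
  let ?A = "\<lambda>k \<omega>. \<integral>\<^sup>+ s\<in>{0..t}. ennreal ((norm (H s \<omega> - simple_process (n k) (\<tau> k) (\<xi> k) s \<omega>))\<^sup>2) \<partial>lborel"
  \<comment> \<open>No refinement parameter appears here: it is introduced inside the proof and
    tends to infinity while \<open>k\<close> stays fixed.\<close>
  have bound: "prob {\<omega> \<in> space P. norm (simple_integral (W m) (n k) (\<tau> k) (\<xi> k) \<omega> - ?T \<omega>) > 2 * \<epsilon>}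
      \<le> \<delta> / \<epsilon>\<^sup>2 + prob {\<omega> \<in> space P. ?A k \<omega> > ennreal (\<delta> / 2)}" if pos: "\<epsilon> > 0" "\<delta> > 0" for k \<epsilon> \<delta>
  proof -
    have g: "grid t (n k) (\<tau> k)" and xiF: "\<And>i. i < n k \<Longrightarrow> \<xi> k i \<in> borel_measurable (F (\<tau> k i))"
      using simple[of k] unfolding is_simple_def by auto
    have xiP: "\<xi> k i \<in> borel_measurable P" if "i < n k" for i using xiF[OF that] measurable_F by blast
    define N where "N K = n k * Suc K" for K
    define \<sigma> where "\<sigma> K = refine_grid (Suc K) (\<tau> k)" for K
    have gs: "grid t (N K) (\<sigma> K)" for K unfolding N_def \<sigma>_def by (rule grid_refine(1)[OF g]) simp
    have ms: "(\<lambda>K. mesh (N K) (\<sigma> K)) \<longlonglongrightarrow> 0" unfolding N_def \<sigma>_def by (rule refine_mesh_tendsto[OF g])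
    have sr: "\<sigma> K r \<in> {0..t}" if "r \<le> N K" for K r using grid_range[OF gs that] .
    have div: "r div Suc K < n k" if "r < N K" for r K
      using that unfolding N_def by (simp add: less_mult_imp_div_less del: mult_Suc_right)
    have tau_le: "\<tau> k (r div Suc K) \<le> \<sigma> K r" if "r < N K" for r K
    proof -
      have "0 \<le> \<tau> k (Suc (r div Suc K)) - \<tau> k (r div Suc K)"
        using grid_mono[OF g, of "r div Suc K" "Suc (r div Suc K)"] div[OF that] by simp
      then show ?thesis unfolding \<sigma>_def refine_grid_def by simp
    qed
    define R where "R K \<omega> = (\<Sum>r<N K. (W m (\<sigma> K (Suc r)) \<omega> - W m (\<sigma> K r) \<omega>) *\<^sub>R H (\<sigma> K r) \<omega>)" for K \<omega>
    define Q where "Q K \<omega> = (\<Sum>r<N K. (norm (H (\<sigma> K r) \<omega> - \<xi> k (r div Suc K) \<omega>))\<^sup>2 * (\<sigma> K (Suc r) - \<sigma> K r))" for K \<omega>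
    define Qi where "Qi \<omega> = (\<Sum>i<n k. integral {\<tau> k i..\<tau> k (Suc i)} (\<lambda>s. (norm (H s \<omega> - \<xi> k i \<omega>))\<^sup>2))" for \<omega>
    have Rm[measurable]: "R K \<in> borel_measurable P" for K
      unfolding R_def using sr[of _ K]
      by (intro borel_measurable_sum borel_measurable_scaleR borel_measurable_diff W_meas m HP) auto
    have Qm[measurable]: "Q K \<in> borel_measurable P" for K
      unfolding Q_def
    proof (intro borel_measurable_sum borel_measurable_times borel_measurable_power borel_measurable_const)
      fix r assume r: "r \<in> {..<N K}"
      have [measurable]: "H (\<sigma> K r) \<in> borel_measurable P" "\<xi> k (r div Suc K) \<in> borel_measurable P"
        using r sr[of r K] div[of r K] by (auto intro!: HP xiP)
      show "(\<lambda>\<omega>. norm (H (\<sigma> K r) \<omega> - \<xi> k (r div Suc K) \<omega>)) \<in> borel_measurable P" by measurable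
    qed
    have tt: "\<tau> k i \<le> \<tau> k (Suc i)" "\<tau> k i \<in> {0..t}" "\<tau> k (Suc i) \<in> {0..t}" if "i < n k" for i
      using that grid_range[OF g] grid_mono[OF g, of i "Suc i"] by auto
    have Qc: "continuous_on {\<tau> k i..\<tau> k (Suc i)} (\<lambda>s. (norm (H s \<omega> - \<xi> k i \<omega>))\<^sup>2)" if "i < n k" "\<omega> \<in> space P" for i \<omega>
      using tt[OF that(1)] by (intro continuous_intros continuous_on_subset[OF Hc[OF that(2)]]) auto
    have Qim[measurable]: "Qi \<in> borel_measurable P"
      unfolding Qi_def
    proof (intro borel_measurable_sum borel_measurable_time_integral)
      fix i s assume i: "i \<in> {..<n k}" and s: "s \<in> {\<tau> k i..\<tau> k (Suc i)}"
      have "s \<in> {0..t}" using s tt[of i] i by auto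
      then have [measurable]: "H s \<in> borel_measurable P" "\<xi> k i \<in> borel_measurable P"
        using HP xiP i by auto
      show "(\<lambda>\<omega>. (norm (H s \<omega> - \<xi> k i \<omega>))\<^sup>2) \<in> borel_measurable P" by measurable
    qed (use Qc in auto)
    have Rlim: "tendsto_in_prob P R ?T"
    proof (rule AE_imp_tendsto_in_prob)
      show "AE \<omega> in P. (\<lambda>K. R K \<omega>) \<longlonglongrightarrow> ?T \<omega>"
        using prim AE_space
      proof eventually_elim
        case (elim \<omega>)
        show ?case unfolding R_def
          by (rule parts_integral_limit[OF W_cont[OF m elim(2)] elim(1) t gs ms]) auto
      qed
    qed measurable
    have Qlim: "tendsto_in_prob P Q Qi"
    proof (rule AE_imp_tendsto_in_prob)
      show "AE \<omega> in P. (\<lambda>K. Q K \<omega>) \<longlonglongrightarrow> Qi \<omega>"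
      proof (rule AE_I2)
        fix \<omega> assume w: "\<omega> \<in> space P"
        show "(\<lambda>K. Q K \<omega>) \<longlonglongrightarrow> Qi \<omega>"
          unfolding Q_def Qi_def N_def \<sigma>_def
          by (rule refine_grid_quadratic_limit[OF g, of "\<lambda>i s. (norm (H s \<omega> - \<xi> k i \<omega>))\<^sup>2"]) (rule Qc[OF _ w])
      qed
    qed measurable
    let ?a = "\<lambda>K. prob {\<omega> \<in> space P. norm (R K \<omega> - ?T \<omega>) > \<epsilon>}"
    let ?b = "\<lambda>K. prob {\<omega> \<in> space P. norm (Q K \<omega> - Qi \<omega>) > \<delta> / 2}"
    \<comment> \<open>Clamping the time makes \<open>H\<close> jointly measurable and changes
      nothing where the indicator is nonzero.\<close>
    have Am[measurable]: "?A k \<in> borel_measurable P"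
    proof (rule lborel.borel_measurable_nn_integral)
      have "(\<lambda>(s, \<omega>). H (max 0 (min t s)) \<omega>) \<in> borel_measurable (borel \<Otimes>\<^sub>M P)"
        by (rule borel_measurable_caratheodory_interval[OF t HP Hc])
      from measurable_compose[OF measurable_pair_swap' this]
      have [measurable]: "(\<lambda>p. H (max 0 (min t (snd p))) (fst p)) \<in> borel_measurable (P \<Otimes>\<^sub>M lborel)"
        by (simp add: case_prod_beta' measurable_lborel1 cong: measurable_cong_sets sets_pair_measure_cong)
      have [measurable]: "(\<lambda>p. simple_process (n k) (\<tau> k) (\<xi> k) (snd p) (fst p)) \<in> borel_measurable (P \<Otimes>\<^sub>M lborel)"
        unfolding simple_process_def
      proof (intro borel_measurable_sum borel_measurable_scaleR)
        fix i assume "i \<in> {..<n k}"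
        then show "(\<lambda>p. \<xi> k i (fst p)) \<in> borel_measurable (P \<Otimes>\<^sub>M lborel)"
          using xiP by (intro measurable_compose[OF measurable_fst]) auto
      qed measurable
      have "(\<lambda>p. ennreal ((norm (H (max 0 (min t (snd p))) (fst p) - simple_process (n k) (\<tau> k) (\<xi> k) (snd p) (fst p)))\<^sup>2) * indicator {0..t} (snd p))
          \<in> borel_measurable (P \<Otimes>\<^sub>M lborel)" by measurable
      also have "(\<lambda>p. ennreal ((norm (H (max 0 (min t (snd p))) (fst p) - simple_process (n k) (\<tau> k) (\<xi> k) (snd p) (fst p)))\<^sup>2) * indicator {0..t} (snd p))
         = (\<lambda>p. ennreal ((norm (H (snd p) (fst p) - simple_process (n k) (\<tau> k) (\<xi> k) (snd p) (fst p)))\<^sup>2) * indicator {0..t} (snd p))"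
        by (auto simp: fun_eq_iff indicator_def)
      finally show "(\<lambda>(\<omega>, s). ennreal ((norm (H s \<omega> - simple_process (n k) (\<tau> k) (\<xi> k) s \<omega>))\<^sup>2) * indicator {0..t} s)
          \<in> borel_measurable (P \<Otimes>\<^sub>M lborel)" by (simp add: case_prod_beta')
    qed
    \<comment> \<open>Three sources of deviation: the refined sums against their limit, the refined
      integral of \<open>H - \<xi>\<close>, and the Riemann sum of the error against its limit.
      Halving \<open>\<delta>\<close> makes room for the last one.\<close>
    have K: "prob {\<omega> \<in> space P. norm (simple_integral (W m) (n k) (\<tau> k) (\<xi> k) \<omega> - ?T \<omega>) > 2 * \<epsilon>}
        \<le> ?a K + (\<delta> / \<epsilon>\<^sup>2 + (?b K + prob {\<omega> \<in> space P. ?A k \<omega> > ennreal (\<delta> / 2)}))" for K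
    proof -
      let ?D = "\<lambda>\<omega>. \<Sum>r<N K. (W m (\<sigma> K (Suc r)) \<omega> - W m (\<sigma> K r) \<omega>) *\<^sub>R (H (\<sigma> K r) \<omega> - \<xi> k (r div Suc K) \<omega>)"
      have D: "?D \<omega> = R K \<omega> - simple_integral (W m) (n k) (\<tau> k) (\<xi> k) \<omega>" for \<omega>
        unfolding R_def simple_integral_refine[OF zero_less_Suc[of K]] N_def \<sigma>_def
        by (simp only: scaleR_diff_right sum_subtractf)
      have Dm[measurable]: "?D \<in> borel_measurable P" unfolding D by measurable
      have tail: "prob {\<omega> \<in> space P. norm (?D \<omega>) > \<epsilon>} \<le> \<delta> / \<epsilon>\<^sup>2 + prob {\<omega> \<in> space P. Q K \<omega> > \<delta>}"
        unfolding Q_def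
      proof (rule simple_integral_tail[OF m _ _ _ pos])
        show "0 \<le> \<sigma> K 0" using sr[of 0] by simp
        show "\<And>i. i < N K \<Longrightarrow> \<sigma> K i < \<sigma> K (Suc i)" using gs[of K] by (simp add: grid_def)
        fix r assume r: "r < N K"
        show "(\<lambda>\<omega>. H (\<sigma> K r) \<omega> - \<xi> k (r div Suc K) \<omega>) \<in> borel_measurable (F (\<sigma> K r))"
          using HF[OF sr, of r K] r measurable_F_mono[OF xiF[OF div[OF r]] tau_le[OF r]]
          by (intro borel_measurable_diff) auto
      qed
      have "prob {\<omega> \<in> space P. norm (simple_integral (W m) (n k) (\<tau> k) (\<xi> k) \<omega> - ?T \<omega>) > 2 * \<epsilon>}
         \<le> prob ({\<omega> \<in> space P. norm (R K \<omega> - ?T \<omega>) > \<epsilon>} \<union> {\<omega> \<in> space P. norm (?D \<omega>) > \<epsilon>})"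
      proof (rule finite_measure_mono)
        show "{\<omega> \<in> space P. norm (simple_integral (W m) (n k) (\<tau> k) (\<xi> k) \<omega> - ?T \<omega>) > 2 * \<epsilon>}
          \<subseteq> {\<omega> \<in> space P. norm (R K \<omega> - ?T \<omega>) > \<epsilon>} \<union> {\<omega> \<in> space P. norm (?D \<omega>) > \<epsilon>}"
        proof (rule subsetI, rule ccontr)
          fix \<omega> assume a: "\<omega> \<in> {\<omega> \<in> space P. norm (simple_integral (W m) (n k) (\<tau> k) (\<xi> k) \<omega> - ?T \<omega>) > 2 * \<epsilon>}"
            "\<omega> \<notin> {\<omega> \<in> space P. norm (R K \<omega> - ?T \<omega>) > \<epsilon>} \<union> {\<omega> \<in> space P. norm (?D \<omega>) > \<epsilon>}"
          have "norm (simple_integral (W m) (n k) (\<tau> k) (\<xi> k) \<omega> - ?T \<omega>) \<le> norm (R K \<omega> - ?T \<omega>) + norm (?D \<omega>)"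
            unfolding D using norm_triangle_ineq4[of "R K \<omega> - ?T \<omega>" "R K \<omega> - simple_integral (W m) (n k) (\<tau> k) (\<xi> k) \<omega>"] by simp
          then show False using a by auto
        qed
      qed measurable
      also have "\<dots> \<le> ?a K + prob {\<omega> \<in> space P. norm (?D \<omega>) > \<epsilon>}" by (rule measure_Un_le) measurable
      finally have 1: "prob {\<omega> \<in> space P. norm (simple_integral (W m) (n k) (\<tau> k) (\<xi> k) \<omega> - ?T \<omega>) > 2 * \<epsilon>}
         \<le> ?a K + prob {\<omega> \<in> space P. norm (?D \<omega>) > \<epsilon>}" .
      have "prob {\<omega> \<in> space P. Q K \<omega> > \<delta>} \<le> prob ({\<omega> \<in> space P. norm (Q K \<omega> - Qi \<omega>) > \<delta> / 2} \<union> {\<omega> \<in> space P. ?A k \<omega> > ennreal (\<delta> / 2)})"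
      proof (rule finite_measure_mono)
        show "{\<omega> \<in> space P. Q K \<omega> > \<delta>} \<subseteq> {\<omega> \<in> space P. norm (Q K \<omega> - Qi \<omega>) > \<delta> / 2} \<union> {\<omega> \<in> space P. ?A k \<omega> > ennreal (\<delta> / 2)}"
        proof (rule subsetI, rule ccontr)
          fix \<omega> assume a: "\<omega> \<in> {\<omega> \<in> space P. Q K \<omega> > \<delta>}"
            "\<omega> \<notin> {\<omega> \<in> space P. norm (Q K \<omega> - Qi \<omega>) > \<delta> / 2} \<union> {\<omega> \<in> space P. ?A k \<omega> > ennreal (\<delta> / 2)}"
          then have w: "\<omega> \<in> space P" and 1: "Q K \<omega> > \<delta>" "norm (Q K \<omega> - Qi \<omega>) \<le> \<delta> / 2" and 2: "?A k \<omega> \<le> ennreal (\<delta> / 2)"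
            by auto
          have "ennreal (Qi \<omega>) \<le> ?A k \<omega>" unfolding Qi_def by (rule simple_process_error_ge[OF g Hc[OF w]])
          also note 2
          finally have "Qi \<omega> \<le> \<delta> / 2" using pos by (simp add: ennreal_le_iff)
          then show False using 1 abs_ge_self[of "Q K \<omega> - Qi \<omega>"] unfolding real_norm_def by linarith
        qed
      qed measurable
      also have "\<dots> \<le> ?b K + prob {\<omega> \<in> space P. ?A k \<omega> > ennreal (\<delta> / 2)}" by (rule measure_Un_le) measurable
      finally show ?thesis using tail 1 by linarith
    qed
    have "(\<lambda>K. ?a K + (\<delta> / \<epsilon>\<^sup>2 + (?b K + prob {\<omega> \<in> space P. ?A k \<omega> > ennreal (\<delta> / 2)})))
        \<longlonglongrightarrow> 0 + (\<delta> / \<epsilon>\<^sup>2 + (0 + prob {\<omega> \<in> space P. ?A k \<omega> > ennreal (\<delta> / 2)}))"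
    proof (intro tendsto_add tendsto_const)
      show "?a \<longlonglongrightarrow> 0" using Rlim pos unfolding tendsto_in_prob_def by blast
      have "\<delta> / 2 > 0" using pos by simp
      then show "?b \<longlonglongrightarrow> 0" using Qlim unfolding tendsto_in_prob_def by blast
    qed
    from LIMSEQ_le_const[OF this] K show ?thesis by auto
  qed
  have "tendsto_in_prob P (\<lambda>k. simple_integral (W m) (n k) (\<tau> k) (\<xi> k)) ?T"
    unfolding tendsto_in_prob_def
  proof (intro conjI allI impI sm Tm)
    fix \<epsilon> :: real assume e: "\<epsilon> > 0"
    let ?p = "\<lambda>k. prob {\<omega> \<in> space P. norm (simple_integral (W m) (n k) (\<tau> k) (\<xi> k) \<omega> - ?T \<omega>) > \<epsilon>}"
    show "?p \<longlonglongrightarrow> 0"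
    proof (rule LIMSEQ_I)
      fix r :: real assume r: "r > 0"
      \<comment> \<open>Chosen so that the term \<open>\<delta> / \<epsilon>\<^sup>2\<close> of
        \<open>bound\<close>, taken at half of \<open>\<epsilon>\<close>, is exactly
        \<open>r / 2\<close>.\<close>
      define \<delta> where "\<delta> = r / 2 * (\<epsilon> / 2)\<^sup>2"
      have d: "\<delta> > 0" "\<delta> / (\<epsilon> / 2)\<^sup>2 = r / 2" unfolding \<delta>_def using e r by auto
      have "\<delta> / 2 > 0" using d by simp
      from order_tendstoD(2)[OF approx[OF this], of "r / 2"] r
      obtain k0 where k0: "\<And>k. k \<ge> k0 \<Longrightarrow> prob {\<omega> \<in> space P. ?A k \<omega> > ennreal (\<delta> / 2)} < r / 2"
        unfolding eventually_sequentially by auto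
      have "norm (?p k - 0) < r" if "k \<ge> k0" for k
        using bound[of "\<epsilon> / 2" \<delta> k] e d k0[OF that] by simp
      then show "\<exists>k0. \<forall>k\<ge>k0. norm (?p k - 0) < r" by blast
    qed
  qed
  from tendsto_in_prob_unique[OF lim this] show ?thesis .
qed

end

subsection \<open>Pathwise form of the equation\<close>

text \<open>Integrating factor: the product of \<open>exp (- a * s)\<close> and one plus the
  integral of \<open>u\<close> is nonincreasing, because the sign of its derivative is that of the
  assumed inequality. The same constant \<open>a\<close> in both places gives a closed form.\<close>

lemma gronwall_integral:
  fixes u :: "real \<Rightarrow> real"
  assumes c: "continuous_on {0..T} u" and a: "0 \<le> a"
    and le: "\<And>t. t \<in> {0..T} \<Longrightarrow> u t \<le> a + a * integral {0..t} u" and t: "t \<in> {0..T}"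
  shows "u t \<le> a * exp (a * t)"
proof -
  define v where "v s = exp (- a * s) * (1 + integral {0..s} u)" for s
  have "v t \<le> v 0"
  proof (rule DERIV_nonpos_imp_decreasing_open[where f=v and a=0 and b=t])
    show "0 \<le> t" using t by simp
    show "continuous_on {0..t} v" unfolding v_def
      by (intro continuous_intros indefinite_integral_continuous_1 integrable_continuous_real
          continuous_on_subset[OF c]) (use t in auto)
    fix s assume s: "0 < s" "s < t"
    have "((\<lambda>s. integral {0..s} u) has_real_derivative u s) (at s within {0..T})"
      using s t by (intro integral_has_real_derivative c) auto
    then have d: "((\<lambda>s. integral {0..s} u) has_real_derivative u s) (at s)"
      using s t by (simp add: at_within_Icc_at)
    have "(v has_real_derivative exp (- a * s) * (u s - (a + a * integral {0..s} u))) (at s)"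
      unfolding v_def by (auto intro!: derivative_eq_intros d simp: algebra_simps)
    moreover have "exp (- a * s) * (u s - (a + a * integral {0..s} u)) \<le> 0"
      using le[of s] s t by (intro mult_nonneg_nonpos) auto
    ultimately show "\<exists>y. (v has_real_derivative y) (at s) \<and> y \<le> 0" by blast
  qed
  then have "exp (- a * t) * (1 + integral {0..t} u) \<le> 1" by (simp add: v_def)
  then have "exp (a * t) * (exp (- a * t) * (1 + integral {0..t} u)) \<le> exp (a * t) * 1"
    by (intro mult_left_mono) auto
  then have "1 + integral {0..t} u \<le> exp (a * t)"
    by (simp add: mult.assoc[symmetric] exp_add[symmetric])
  then have "a * (1 + integral {0..t} u) \<le> a * exp (a * t)" using a by (intro mult_left_mono)
  then show ?thesis using le[OF t] by (simp add: algebra_simps)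
qed

text \<open>The exceptional null sets at rational times have a null union; continuity extends the
  equality to all times.\<close>

lemma (in prob_space) AE_eq_on_interval:
  fixes f g :: "real \<Rightarrow> 'a \<Rightarrow> 'b::real_normed_vector"
  assumes T: "T > 0" and eq: "\<And>t. t \<in> {0..T} \<Longrightarrow> AE \<omega> in M. f t \<omega> = g t \<omega>"
    and c: "AE \<omega> in M. continuous_on {0..T} (\<lambda>t. f t \<omega>) \<and> continuous_on {0..T} (\<lambda>t. g t \<omega>)"
  shows "AE \<omega> in M. \<forall>t\<in>{0..T}. f t \<omega> = g t \<omega>"
proof -
  let ?S = "{0..T} \<inter> \<rat>"
  have "AE \<omega> in M. \<forall>t\<in>?S. f t \<omega> = g t \<omega>"
    using eq by (subst AE_ball_countable) (auto intro: countable_rat countable_Int2)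
  then show ?thesis using c
  proof eventually_elim
    case (elim \<omega>)
    have cl: "{0..T} \<subseteq> closure ?S"
    proof
      fix t assume t: "t \<in> {0..T}"
      show "t \<in> closure ?S" unfolding closure_approachable
      proof (intro allI impI)
        fix e :: real assume e: "e > 0"
        \<comment> \<open>\<open>T > 0\<close> makes this interval nondegenerate, so that it
          contains a rational.\<close>
        have "max 0 (t - e) < min T (t + e)" using t T e by auto
        from Rats_dense_in_real[OF this] obtain q where "q \<in> \<rat>" "max 0 (t - e) < q" "q < min T (t + e)" by blast
        then show "\<exists>y\<in>?S. dist y t < e" by (intro bexI[of _ q]) (auto simp: dist_real_def)
      qed
    qed
    have cl2: "closure ?S \<subseteq> {0..T}" by (intro closure_minimal) auto
    have "continuous_on (closure ?S) (\<lambda>t. f t \<omega> - g t \<omega>)"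
      using elim by (intro continuous_intros) (auto intro: continuous_on_subset[OF _ cl2])
    then have "f t \<omega> - g t \<omega> = 0" if "t \<in> {0..T}" for t
      by (rule continuous_constant_on_closure) (use elim cl that in auto)
    then show ?case by simp
  qed
qed

section \<open>Solutions along almost every path\<close>

locale separable_solution = wiener_setup P F M W
  for P :: "'a measure" and F M W +
  fixes calc :: calculus
    and g1 :: "nat \<Rightarrow> 'y::euclidean_space \<Rightarrow> 'x::euclidean_space" and g2 :: "'x \<Rightarrow> 'y"
    and x1 :: 'x and x2 :: 'y and T :: real
    and X1 :: "real \<Rightarrow> 'a \<Rightarrow> 'x" and X2 :: "real \<Rightarrow> 'a \<Rightarrow> 'y" and L :: real
  assumes T: "T > 0" and L: "L \<ge> 1"
    and g1: "\<And>m. m \<in> {0..M} \<Longrightarrow> taylor_bounded L (g1 m)"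
    and g2: "taylor_bounded L g2"
    and sol: "separable_sde_solution calc P F M W g1 g2 x1 x2 T X1 X2"
begin

lemma g1_smooth: "m \<in> {0..M} \<Longrightarrow> smooth_bounded_derivs (g1 m)"
  using g1 unfolding taylor_bounded_def by blast

lemma g2_smooth: "smooth_bounded_derivs g2"
  using g2 unfolding taylor_bounded_def by blast

lemma X_F: "t \<in> {0..T} \<Longrightarrow> X1 t \<in> borel_measurable (F t)" "t \<in> {0..T} \<Longrightarrow> X2 t \<in> borel_measurable (F t)"
  using sol unfolding separable_sde_solution_def by blast+

lemma X_P: "t \<in> {0..T} \<Longrightarrow> X1 t \<in> borel_measurable P" "t \<in> {0..T} \<Longrightarrow> X2 t \<in> borel_measurable P"
  using X_F measurable_F by blast+

lemma X_cont:
  assumes "\<omega> \<in> space P" "S \<subseteq> {0..T}"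
  shows "continuous_on S (\<lambda>t. X1 t \<omega>)" "continuous_on S (\<lambda>t. X2 t \<omega>)"
proof -
  have "continuous_on {0..T} (\<lambda>t. X1 t \<omega>) \<and> continuous_on {0..T} (\<lambda>t. X2 t \<omega>)"
    using sol assms(1) unfolding separable_sde_solution_def by blast
  then show "continuous_on S (\<lambda>t. X1 t \<omega>)" "continuous_on S (\<lambda>t. X2 t \<omega>)"
    using assms(2) by (auto intro: continuous_on_subset)
qed

lemma g_cont:
  assumes "\<omega> \<in> space P" "S \<subseteq> {0..T}"
  shows "continuous_on S (\<lambda>t. g2 (X1 t \<omega>))"
    and "m \<in> {0..M} \<Longrightarrow> continuous_on S (\<lambda>t. g1 m (X2 t \<omega>))"
  using X_cont[OF assms] smooth_continuous[OF g2_smooth, of UNIV] smooth_continuous[OF g1_smooth, of m UNIV]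
  by (auto intro: continuous_on_compose2)

text \<open>The time derivative of \<open>g1 m (X2 s)\<close> along a path, by the chain rule and
  the equation of the second block.\<close>

definition dG :: "nat \<Rightarrow> real \<Rightarrow> 'a \<Rightarrow> 'x" where
  "dG m s \<omega> = D1 (g1 m) (X2 s \<omega>) (g2 (X1 s \<omega>))"

lemma dG_cont: "\<omega> \<in> space P \<Longrightarrow> S \<subseteq> {0..T} \<Longrightarrow> m \<in> {0..M} \<Longrightarrow> continuous_on S (\<lambda>s. dG m s \<omega>)"
  unfolding dG_def by (intro continuous_on_D1 g1_smooth X_cont g_cont)

lemma dG_meas: "s \<in> {0..T} \<Longrightarrow> m \<in> {0..M} \<Longrightarrow> dG m s \<in> borel_measurable P"
  unfolding dG_def
  using X_P[of s] borel_measurable_D1_D2(1)[OF g2_smooth, of "X1 s" P "X1 s" "X1 s"]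
  by (intro borel_measurable_D1_D2(2)[OF g1_smooth]) auto

text \<open>\<open>X2\<close> is continuously differentiable along paths, so that every stochastic integral in the
  equation is a pathwise one.\<close>

definition good :: "'a \<Rightarrow> bool" where
  "good \<omega> \<longleftrightarrow> \<omega> \<in> space P \<and> (\<forall>m\<in>{1..M}. W m 0 \<omega> = 0) \<and> X1 0 \<omega> = x1 \<and> X2 0 \<omega> = x2 \<and>
     (\<forall>t\<in>{0..T}. X2 t \<omega> = x2 + integral {0..t} (\<lambda>s. g2 (X1 s \<omega>))) \<and>
     (\<forall>t\<in>{0..T}. X1 t \<omega> = x1 + integral {0..t} (\<lambda>s. g1 0 (X2 s \<omega>))
        + (\<Sum>m=1..M. parts_integral (\<lambda>s. W m s \<omega>) (\<lambda>s. g1 m (X2 s \<omega>)) (\<lambda>s. dG m s \<omega>) t))"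

lemma primitive_g1:
  assumes w: "\<omega> \<in> space P" and X2: "\<forall>t\<in>{0..T}. X2 t \<omega> = x2 + integral {0..t} (\<lambda>s. g2 (X1 s \<omega>))"
    and m: "m \<in> {0..M}" and t: "t \<in> {0..T}"
  shows "primitive_on t (\<lambda>s. g1 m (X2 s \<omega>)) (\<lambda>s. dG m s \<omega>)"
  unfolding primitive_on_def
proof (intro conjI ballI)
  show "continuous_on {0..t} (\<lambda>s. dG m s \<omega>)" using t by (intro dG_cont w m) auto
  fix s assume s: "s \<in> {0..t}"
  have "((\<lambda>s. dG m s \<omega>) has_integral g1 m (X2 s \<omega>) - g1 m (X2 0 \<omega>)) {0..s}"
  proof (rule fundamental_theorem_of_calculus)
    show "0 \<le> s" using s by simp
    fix r assume r: "r \<in> {0..s}"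
    have "((\<lambda>t. x2 + integral {0..t} (\<lambda>s. g2 (X1 s \<omega>))) has_vector_derivative 0 + g2 (X1 r \<omega>)) (at r within {0..T})"
      using r s t by (intro has_vector_derivative_add has_vector_derivative_const integral_has_vector_derivative g_cont w) auto
    then have "((\<lambda>t. x2 + integral {0..t} (\<lambda>s. g2 (X1 s \<omega>))) has_vector_derivative g2 (X1 r \<omega>)) (at r within {0..T})"
      by simp
    then have "((\<lambda>t. X2 t \<omega>) has_vector_derivative g2 (X1 r \<omega>)) (at r within {0..T})"
    proof (rule has_vector_derivative_transform[rotated 2])
      show "r \<in> {0..T}" using r s t by simp
      show "\<And>q. q \<in> {0..T} \<Longrightarrow> X2 q \<omega> = x2 + integral {0..q} (\<lambda>s. g2 (X1 s \<omega>))" using X2 by blast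
    qed
    then have "((\<lambda>t. X2 t \<omega>) has_derivative (\<lambda>h. h *\<^sub>R g2 (X1 r \<omega>))) (at r within {0..s})"
      unfolding has_vector_derivative_def by (rule has_derivative_subset) (use s t in auto)
    from has_derivative_compose[OF this smooth_deriv[OF g1_smooth[OF m]]]
    show "((\<lambda>s. g1 m (X2 s \<omega>)) has_vector_derivative dG m r \<omega>) (at r within {0..s})"
      unfolding has_vector_derivative_def dG_def
      using linear_cmul[OF smooth_linear[OF g1_smooth[OF m]]] by simp
  qed
  then show "g1 m (X2 s \<omega>) = g1 m (X2 0 \<omega>) + integral {0..s} (\<lambda>s. dG m s \<omega>)"
    by (simp add: integral_unique)
qed

text \<open>The equations hold almost surely at each fixed time, with a null set depending on the
  time. That dependence is removed for \<open>X2\<close> first, since the integrals in the equation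
  of \<open>X1\<close> can be identified only once \<open>X2\<close> is known to be differentiable
  at all times.\<close>

lemma AE_good: "AE \<omega> in P. good \<omega>"
proof -
  obtain I where
    I: "\<And>t m. t \<in> {0..T} \<Longrightarrow> m \<in> {1..M} \<Longrightarrow> has_stoch_integral calc P F (W m) (\<lambda>s \<omega>. g1 m (X2 s \<omega>)) t (I m t)"
    and X1: "\<And>t. t \<in> {0..T} \<Longrightarrow> AE \<omega> in P. X1 t \<omega> = x1 + integral {0..t} (\<lambda>s. g1 0 (X2 s \<omega>)) + (\<Sum>m=1..M. I m t \<omega>)"
    and X2: "\<And>t. t \<in> {0..T} \<Longrightarrow> AE \<omega> in P. X2 t \<omega> = x2 + integral {0..t} (\<lambda>s. g2 (X1 s \<omega>))"
    using sol unfolding separable_sde_solution_def by blast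
  have ic: "continuous_on {0..T} (\<lambda>t. integral {0..t} f)" if "continuous_on {0..T} f" for f :: "real \<Rightarrow> 'c::euclidean_space"
    using that by (intro indefinite_integral_continuous_1 integrable_continuous_real)
  have X2all: "AE \<omega> in P. \<forall>t\<in>{0..T}. X2 t \<omega> = x2 + integral {0..t} (\<lambda>s. g2 (X1 s \<omega>))"
    by (rule AE_eq_on_interval[OF T X2]) (auto intro!: AE_I2 continuous_intros ic X_cont g_cont)
  have eqI: "AE \<omega> in P. I m t \<omega> = parts_integral (\<lambda>s. W m s \<omega>) (\<lambda>s. g1 m (X2 s \<omega>)) (\<lambda>s. dG m s \<omega>) t"
    if m: "m \<in> {1..M}" and t: "t \<in> {0..T}" for m t
  proof -
    have m0: "m \<in> {0..M}" and t0: "0 \<le> t" using m t by auto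
    have HF: "(\<lambda>\<omega>. g1 m (X2 s \<omega>)) \<in> borel_measurable (F s)" if "s \<in> {0..t}" for s
      using X_F(2)[of s] that t by (intro borel_measurable_D1_D2(1)[OF g1_smooth[OF m0], of _ _ "X2 s" "X2 s"]) auto
    have prim: "AE \<omega> in P. primitive_on t (\<lambda>s. g1 m (X2 s \<omega>)) (\<lambda>s. dG m s \<omega>)"
      using X2all AE_space by eventually_elim (rule primitive_g1[OF _ _ m0 t])
    have c: "continuous_on {0..t} (\<lambda>s. g1 m (X2 s \<omega>))" "continuous_on {0..t} (\<lambda>s. dG m s \<omega>)" if "\<omega> \<in> space P" for \<omega>
      using that t m0 by (auto intro!: g_cont dG_cont)
    have d: "dG m s \<in> borel_measurable P" if "s \<in> {0..t}" for s using that t m0 by (intro dG_meas) auto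
    show ?thesis
    proof (cases calc)
      case Ito
      then show ?thesis
        using ito_integral_eq_parts[OF m t0 HF c(1) d c(2) prim] I[OF t m] by simp
    next
      case Stratonovich
      then show ?thesis
        using stratonovich_integral_eq_parts[OF m t0 measurable_F[OF HF] d c(2) prim] I[OF t m] by simp
    qed
  qed
  have X1t: "AE \<omega> in P. X1 t \<omega> = x1 + integral {0..t} (\<lambda>s. g1 0 (X2 s \<omega>))
        + (\<Sum>m=1..M. parts_integral (\<lambda>s. W m s \<omega>) (\<lambda>s. g1 m (X2 s \<omega>)) (\<lambda>s. dG m s \<omega>) t)" if t: "t \<in> {0..T}" for t
  proof -
    have "AE \<omega> in P. \<forall>m\<in>{1..M}. I m t \<omega> = parts_integral (\<lambda>s. W m s \<omega>) (\<lambda>s. g1 m (X2 s \<omega>)) (\<lambda>s. dG m s \<omega>) t"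
      using eqI[OF _ t] by (intro AE_finite_allI) auto
    then show ?thesis using X1[OF t] by eventually_elim simp
  qed
  have X1all: "AE \<omega> in P. \<forall>t\<in>{0..T}. X1 t \<omega> = x1 + integral {0..t} (\<lambda>s. g1 0 (X2 s \<omega>))
        + (\<Sum>m=1..M. parts_integral (\<lambda>s. W m s \<omega>) (\<lambda>s. g1 m (X2 s \<omega>)) (\<lambda>s. dG m s \<omega>) t)"
    by (rule AE_eq_on_interval[OF T X1t])
      (auto simp: parts_integral_def intro!: AE_I2 continuous_intros ic X_cont g_cont dG_cont W_cont)
  have W0: "AE \<omega> in P. \<forall>m\<in>{1..M}. W m 0 \<omega> = 0"
    using W_0 by (intro AE_finite_allI) auto
  have X0: "AE \<omega> in P. X1 0 \<omega> = x1 \<and> X2 0 \<omega> = x2"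
    using sol unfolding separable_sde_solution_def by blast
  show ?thesis
    using AE_space W0 X0 X2all X1all by eventually_elim (simp add: good_def)
qed

text \<open>Integration by parts centred at the start of the step: subtracting \<open>W m t\<close>
  inside the integral costs a multiple of an increment of \<open>g1 m (X2)\<close>, which the
  boundary terms absorb. Only increments of the driving paths within the step remain.\<close>

lemma good_step:
  assumes g: "good \<omega>" and t: "0 \<le> t" "t \<le> s" "s \<le> T"
  shows "X2 s \<omega> = X2 t \<omega> + integral {t..s} (\<lambda>u. g2 (X1 u \<omega>))"
    and "X1 s \<omega> = X1 t \<omega> + integral {t..s} (\<lambda>u. g1 0 (X2 u \<omega>))
      + (\<Sum>m=1..M. (W m s \<omega> - W m t \<omega>) *\<^sub>R g1 m (X2 s \<omega>) - integral {t..s} (\<lambda>u. (W m u \<omega> - W m t \<omega>) *\<^sub>R dG m u \<omega>))"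
proof -
  have w: "\<omega> \<in> space P" using g by (simp add: good_def)
  have comb: "integral {0..s} f = integral {0..t} f + integral {t..s} f" if "continuous_on {0..T} f" for f :: "real \<Rightarrow> 'c::euclidean_space"
    using t by (intro Henstock_Kurzweil_Integration.integral_combine[symmetric] integrable_continuous_real
        continuous_on_subset[OF that]) auto
  have X2: "X2 r \<omega> = x2 + integral {0..r} (\<lambda>s. g2 (X1 s \<omega>))" if "r \<in> {0..T}" for r
    using g that by (simp add: good_def)
  show "X2 s \<omega> = X2 t \<omega> + integral {t..s} (\<lambda>u. g2 (X1 u \<omega>))"
    using X2[of s] X2[of t] comb[OF g_cont(1)[OF w order_refl]] t by simp
  let ?p = "\<lambda>m. parts_integral (\<lambda>s. W m s \<omega>) (\<lambda>s. g1 m (X2 s \<omega>)) (\<lambda>s. dG m s \<omega>)"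
  have X1: "X1 r \<omega> = x1 + integral {0..r} (\<lambda>s. g1 0 (X2 s \<omega>)) + (\<Sum>m=1..M. ?p m r)" if "r \<in> {0..T}" for r
    using g that by (simp add: good_def)
  have inc: "?p m s - ?p m t = (W m s \<omega> - W m t \<omega>) *\<^sub>R g1 m (X2 s \<omega>) - integral {t..s} (\<lambda>u. (W m u \<omega> - W m t \<omega>) *\<^sub>R dG m u \<omega>)"
    if m: "m \<in> {1..M}" for m
  proof -
    have m0: "m \<in> {0..M}" using m by simp
    have prim: "primitive_on T (\<lambda>s. g1 m (X2 s \<omega>)) (\<lambda>s. dG m s \<omega>)"
      using primitive_g1[OF w _ m0, of T] g T unfolding good_def by simp
    have Wc: "continuous_on {0..T} (\<lambda>s. W m s \<omega>)" by (rule W_cont[OF m w]) auto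
    have c1: "(\<lambda>u. W m u \<omega> *\<^sub>R dG m u \<omega>) integrable_on {t..s}" and c2: "(\<lambda>u. W m t \<omega> *\<^sub>R dG m u \<omega>) integrable_on {t..s}"
      using t by (auto intro!: integrable_continuous_real continuous_intros dG_cont w m0 W_cont m)
    have "integral {t..s} (\<lambda>u. (W m u \<omega> - W m t \<omega>) *\<^sub>R dG m u \<omega>)
       = integral {t..s} (\<lambda>u. W m u \<omega> *\<^sub>R dG m u \<omega>) - W m t \<omega> *\<^sub>R (g1 m (X2 s \<omega>) - g1 m (X2 t \<omega>))"
      unfolding scaleR_left_diff_distrib Henstock_Kurzweil_Integration.integral_diff[OF c1 c2] integral_cmul
        primitive_on_diff[OF prim t] ..
    then show ?thesis
      unfolding parts_integral_increment[OF Wc prim t] by (simp add: algebra_simps)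
  qed
  have "X1 s \<omega> - X1 t \<omega> = integral {t..s} (\<lambda>u. g1 0 (X2 u \<omega>)) + (\<Sum>m=1..M. ?p m s - ?p m t)"
    using X1[of s] X1[of t] comb[OF g_cont(2)[OF w order_refl, of 0]] t
    by (simp add: sum_subtractf)
  also have "(\<Sum>m=1..M. ?p m s - ?p m t) = (\<Sum>m=1..M. (W m s \<omega> - W m t \<omega>) *\<^sub>R g1 m (X2 s \<omega>) - integral {t..s} (\<lambda>u. (W m u \<omega> - W m t \<omega>) *\<^sub>R dG m u \<omega>))"
    using inc by (intro sum.cong) auto
  finally show "X1 s \<omega> = X1 t \<omega> + integral {t..s} (\<lambda>u. g1 0 (X2 u \<omega>))
      + (\<Sum>m=1..M. (W m s \<omega> - W m t \<omega>) *\<^sub>R g1 m (X2 s \<omega>) - integral {t..s} (\<lambda>u. (W m u \<omega> - W m t \<omega>) *\<^sub>R dG m u \<omega>))"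
    by (simp add: algebra_simps)
qed

section \<open>A priori bound for the solution\<close>

definition rho :: "real \<Rightarrow> real \<Rightarrow> 'a \<Rightarrow> real" where
  "rho t h \<omega> = (\<Sum>m=1..M. osc (W m) t h \<omega>)"

lemma rho_ge:
  assumes "\<omega> \<in> space P" "0 \<le> t" "s \<in> {t..t+h}"
  shows "(\<Sum>m=1..M. \<bar>W m s \<omega> - W m t \<omega>\<bar>) \<le> rho t h \<omega>"
  unfolding rho_def
proof (rule sum_mono)
  fix m assume "m \<in> {1..M}"
  then show "\<bar>W m s \<omega> - W m t \<omega>\<bar> \<le> osc (W m) t h \<omega>"
    using assms by (intro osc_ge[where w="W m" and \<omega>=\<omega>, OF W_cont]) auto
qed

lemma rho_nonneg: "\<omega> \<in> space P \<Longrightarrow> 0 \<le> t \<Longrightarrow> 0 \<le> h \<Longrightarrow> 0 \<le> rho t h \<omega>"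
  unfolding rho_def
proof (rule sum_nonneg)
  fix m assume "m \<in> {1..M}" "\<omega> \<in> space P" "0 \<le> t" "0 \<le> h"
  then show "0 \<le> osc (W m) t h \<omega>"
    by (intro osc_nonneg[where w="W m" and \<omega>=\<omega>, OF W_cont]) auto
qed

lemma rho_ge1:
  assumes "\<omega> \<in> space P" "0 \<le> t" "s \<in> {t..t+h}" "m \<in> {1..M}"
  shows "\<bar>W m s \<omega> - W m t \<omega>\<bar> \<le> rho t h \<omega>"
  using rho_ge[OF assms(1-3)] member_le_sum[of m "{1..M}" "\<lambda>m. \<bar>W m s \<omega> - W m t \<omega>\<bar>"] assms(4) by simp

text \<open>The first factor is the sum of the coefficients in the linear integral inequality of
  \<open>solution_bound\<close>. In \<open>1 + T\<close>, the summand \<open>1\<close> absorbs the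
  prefactor of the exponential and \<open>T\<close> is the Gronwall exponent.\<close>

definition growth :: real where
  "growth = (1 + norm x1 + norm x2 + L * (1 + norm x2) + 2 * L + 2 * L\<^sup>2) * (1 + T)"

text \<open>After integration by parts the diffusion is estimated by values of the driving paths, so
  each path obeys a linear integral inequality with coefficient proportional to
  \<open>1 + R\<close>. Gronwall's inequality then yields an exponent linear in the oscillation;
  this is where the need for its exponential moments originates.\<close>

lemma solution_bound:
  assumes g: "good \<omega>" and t: "t \<in> {0..T}"
  shows "1 + norm (X1 t \<omega>) + norm (X2 t \<omega>) \<le> exp (growth * (1 + rho 0 T \<omega>))"
proof -
  have w: "\<omega> \<in> space P" using g by (simp add: good_def)
  define R where "R = rho 0 T \<omega>"
  define A where "A = 1 + norm x1 + norm x2 + L * (1 + norm x2) + 2 * L + 2 * L\<^sup>2"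
  define u where "u s = 1 + norm (X1 s \<omega>) + norm (X2 s \<omega>)" for s
  have R0: "R \<ge> 0" unfolding R_def using rho_nonneg[OF w, of 0 T] T by simp
  have A0: "A \<ge> 1" unfolding A_def using L by (simp add: add_nonneg_nonneg)
  have u1: "u s \<ge> 1" for s by (simp add: u_def)
  have uc: "continuous_on S u" if "S \<subseteq> {0..T}" for S
    unfolding u_def by (intro continuous_intros X_cont w that)
  have Lg2: "norm (g2 x) \<le> L * (1 + norm x)" for x using g2 unfolding taylor_bounded_def by blast
  have Lg1: "m \<in> {0..M} \<Longrightarrow> norm (g1 m y) \<le> L * (1 + norm y)" for m y using g1 unfolding taylor_bounded_def by blast
  have Ld1: "m \<in> {0..M} \<Longrightarrow> norm (D1 (g1 m) y v) \<le> L * norm v" for m y v using g1 unfolding taylor_bounded_def by blast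
  have WR: "(\<Sum>m=1..M. \<bar>W m s \<omega>\<bar>) \<le> R" if "s \<in> {0..T}" for s
    using rho_ge[OF w, of 0 s T] that g unfolding R_def good_def by simp
  have "u s \<le> A * (1 + R) + A * (1 + R) * integral {0..s} u" if s: "s \<in> {0..T}" for s
  proof -
    let ?I = "integral {0..s} u"
    have ui: "u integrable_on {0..s}" using s by (intro integrable_continuous_real uc) auto
    have I0: "?I \<ge> 0" using u1 order_trans[OF zero_le_one] by (intro Henstock_Kurzweil_Integration.integral_nonneg ui) auto
    have ib: "norm (integral {0..s} f) \<le> c * ?I"
      if "continuous_on {0..s} f" "\<And>r. r \<in> {0..s} \<Longrightarrow> norm (f r) \<le> c * u r" for f :: "real \<Rightarrow> 'c::euclidean_space" and c
      using Henstock_Kurzweil_Integration.integral_norm_bound_integral[of f "{0..s}" "\<lambda>r. c * u r"] that ui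
      by (simp add: integrable_continuous_real integrable_on_mult_right)
    have sub: "{0..s} \<subseteq> {0..T}" using s by auto
    have b2: "norm (integral {0..s} (\<lambda>r. g2 (X1 r \<omega>))) \<le> L * ?I"
    proof (rule ib)
      show "continuous_on {0..s} (\<lambda>r. g2 (X1 r \<omega>))" by (rule g_cont[OF w sub])
      show "norm (g2 (X1 r \<omega>)) \<le> L * u r" for r
      proof -
        have "L * (1 + norm (X1 r \<omega>)) \<le> L * u r" using L by (intro mult_left_mono) (auto simp: u_def)
        then show ?thesis using Lg2[of "X1 r \<omega>"] by linarith
      qed
    qed
    have b1: "norm (integral {0..s} (\<lambda>r. g1 0 (X2 r \<omega>))) \<le> L * ?I"
    proof (rule ib)
      show "continuous_on {0..s} (\<lambda>r. g1 0 (X2 r \<omega>))" by (rule g_cont[OF w sub]) simp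
      show "norm (g1 0 (X2 r \<omega>)) \<le> L * u r" for r
      proof -
        have "L * (1 + norm (X2 r \<omega>)) \<le> L * u r" using L by (intro mult_left_mono) (auto simp: u_def)
        then show ?thesis using Lg1[of 0 "X2 r \<omega>"] by simp
      qed
    qed
    have x2: "norm (X2 s \<omega>) \<le> norm x2 + L * ?I"
    proof -
      have "X2 s \<omega> = x2 + integral {0..s} (\<lambda>r. g2 (X1 r \<omega>))" using g s by (simp add: good_def)
      then show ?thesis using norm_triangle_ineq[of x2 "integral {0..s} (\<lambda>r. g2 (X1 r \<omega>))"] b2 by simp
    qed
    have "(\<Sum>m=1..M. W m s \<omega> *\<^sub>R g1 m (X2 s \<omega>) - integral {0..s} (\<lambda>r. W m r \<omega> *\<^sub>R dG m r \<omega>))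
       = (\<Sum>m=1..M. W m s \<omega> *\<^sub>R g1 m (X2 s \<omega>)) - integral {0..s} (\<lambda>r. \<Sum>m=1..M. W m r \<omega> *\<^sub>R dG m r \<omega>)"
      unfolding sum_subtractf
    proof (subst Henstock_Kurzweil_Integration.integral_sum)
      fix m assume m: "m \<in> {1..M}"
      then show "(\<lambda>r. W m r \<omega> *\<^sub>R dG m r \<omega>) integrable_on {0..s}"
        using sub by (intro integrable_continuous_real continuous_intros W_cont[OF m w] dG_cont w) auto
    qed simp_all
    moreover have "norm (\<Sum>m=1..M. W m s \<omega> *\<^sub>R g1 m (X2 s \<omega>)) \<le> R * (L * (1 + norm (X2 s \<omega>)))"
    proof -
      have "norm (\<Sum>m=1..M. W m s \<omega> *\<^sub>R g1 m (X2 s \<omega>)) \<le> (\<Sum>m=1..M. \<bar>W m s \<omega>\<bar> * (L * (1 + norm (X2 s \<omega>))))"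
        using Lg1 by (intro sum_norm_le) (auto intro!: mult_left_mono)
      also have "\<dots> \<le> R * (L * (1 + norm (X2 s \<omega>)))"
        unfolding sum_distrib_right[symmetric] using WR[OF s] L by (intro mult_right_mono mult_nonneg_nonneg) auto
      finally show ?thesis .
    qed
    moreover have "norm (integral {0..s} (\<lambda>r. \<Sum>m=1..M. W m r \<omega> *\<^sub>R dG m r \<omega>)) \<le> (R * L\<^sup>2) * ?I"
    proof (rule ib)
      show "continuous_on {0..s} (\<lambda>r. \<Sum>m=1..M. W m r \<omega> *\<^sub>R dG m r \<omega>)"
        using sub by (intro continuous_intros W_cont w dG_cont) auto
      fix r assume r: "r \<in> {0..s}"
      have "norm (dG m r \<omega>) \<le> L\<^sup>2 * u r" if "m \<in> {1..M}" for m
      proof -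
        have "norm (dG m r \<omega>) \<le> L * norm (g2 (X1 r \<omega>))" unfolding dG_def using that by (intro Ld1) auto
        also have "\<dots> \<le> L * (L * (1 + norm (X1 r \<omega>)))" using Lg2 L by (intro mult_left_mono) auto
        also have "\<dots> \<le> L * (L * u r)" using L by (intro mult_left_mono) (auto simp: u_def)
        finally show ?thesis by (simp add: power2_eq_square mult.assoc)
      qed
      then have "norm (\<Sum>m=1..M. W m r \<omega> *\<^sub>R dG m r \<omega>) \<le> (\<Sum>m=1..M. \<bar>W m r \<omega>\<bar> * (L\<^sup>2 * u r))"
        by (intro sum_norm_le) (auto intro!: mult_left_mono)
      also have "\<dots> \<le> R * (L\<^sup>2 * u r)"
        unfolding sum_distrib_right[symmetric] using WR[of r] r sub L u1[of r] by (intro mult_right_mono mult_nonneg_nonneg) auto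
      finally show "norm (\<Sum>m=1..M. W m r \<omega> *\<^sub>R dG m r \<omega>) \<le> (R * L\<^sup>2) * u r" by (simp add: mult.assoc)
    qed
    moreover have "X1 s \<omega> = x1 + integral {0..s} (\<lambda>r. g1 0 (X2 r \<omega>))
       + (\<Sum>m=1..M. W m s \<omega> *\<^sub>R g1 m (X2 s \<omega>) - integral {0..s} (\<lambda>r. W m r \<omega> *\<^sub>R dG m r \<omega>))"
      using g s unfolding good_def parts_integral_def by simp
    ultimately have "norm (X1 s \<omega>) \<le> norm x1 + L * ?I + (R * (L * (1 + norm (X2 s \<omega>))) + (R * L\<^sup>2) * ?I)"
      using b1 by (metis (no_types, lifting) add_mono norm_triangle_le norm_triangle_le_diff order_refl)
    also have "R * (L * (1 + norm (X2 s \<omega>))) \<le> R * (L * (1 + (norm x2 + L * ?I)))"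
      using x2 R0 L by (intro mult_left_mono) auto
    finally have x1: "norm (X1 s \<omega>) \<le> norm x1 + L * ?I + (R * (L * (1 + (norm x2 + L * ?I))) + (R * L\<^sup>2) * ?I)" by simp
    have "u s \<le> (1 + norm x1 + norm x2) + R * (L * (1 + norm x2)) + (2 * L) * ?I + (2 * L\<^sup>2) * (R * ?I)"
      using x1 x2 u_def[of s] by (simp add: algebra_simps power2_eq_square)
    also have "\<dots> \<le> A + R * A + A * ?I + A * (R * ?I)"
      using L R0 I0 by (intro add_mono mult_left_mono mult_right_mono) (auto simp: A_def add_nonneg_nonneg)
    finally show ?thesis by (simp add: algebra_simps)
  qed
  from gronwall_integral[OF uc[OF order_refl] _ this t]
  have "u t \<le> A * (1 + R) * exp (A * (1 + R) * t)" using A0 R0 by simp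
  also have "\<dots> \<le> exp (A * (1 + R)) * exp (A * (1 + R) * T)"
  proof (rule mult_mono)
    show "A * (1 + R) \<le> exp (A * (1 + R))" using exp_ge_add_one_self[of "A * (1 + R)"] by linarith
    show "exp (A * (1 + R) * t) \<le> exp (A * (1 + R) * T)" using A0 R0 t by (simp add: mult_left_mono)
  qed simp_all
  also have "\<dots> = exp (growth * (1 + rho 0 T \<omega>))"
    unfolding exp_add[symmetric] growth_def A_def[symmetric] R_def[symmetric] by (simp add: algebra_simps)
  finally show ?thesis by (simp add: u_def)
qed

end

context separable_solution
begin

subsection \<open>Order calculus for quantities attached to one step\<close>

text \<open>Dominates every random constant that depends on the whole path. The surplus
  \<open>2 + T\<close> over \<open>growth\<close> makes it dominate \<open>q\<close> as well, see
  \<open>q_le_big\<close>.\<close>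

definition big :: "'a \<Rightarrow> real" where
  "big \<omega> = exp ((growth + 2 + T) * (1 + rho 0 T \<omega>))"

text \<open>A random stand-in for \<open>sqrt h\<close>: it dominates the increments of the driving
  paths within the step, and its square dominates \<open>h\<close>, so its powers count half orders
  path by path.\<close>

definition q :: "real \<Rightarrow> real \<Rightarrow> 'a \<Rightarrow> real" where
  "q t h \<omega> = sqrt h + rho t h \<omega>"

definition admissible :: "real \<Rightarrow> real \<Rightarrow> 'a \<Rightarrow> bool" where
  "admissible t h \<omega> \<longleftrightarrow> good \<omega> \<and> 0 \<le> t \<and> 0 < h \<and> t + h \<le> T"

text \<open>\<open>ord k R\<close>: the quantity \<open>R\<close>, which depends on the step \<open>[t, t+h]\<close>, on \<open>\<omega>\<close> and on a time \<open>s\<close> in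
  the step, is of size \<open>h powr (k/2)\<close> in every \<open>L\<^sup>p\<close>.\<close>

definition ord :: "nat \<Rightarrow> (real \<Rightarrow> real \<Rightarrow> 'a \<Rightarrow> real \<Rightarrow> 'c::real_normed_vector) \<Rightarrow> bool" where
  "ord k R \<longleftrightarrow> (\<exists>K j. 0 \<le> K \<and> (\<forall>t h \<omega> s. admissible t h \<omega> \<longrightarrow> s \<in> {t..t+h} \<longrightarrow>
     norm (R t h \<omega> s) \<le> K * big \<omega> ^ j * q t h \<omega> ^ k))"

lemma growth_ge: "growth \<ge> 1"
proof -
  have "1 * 1 \<le> (1 + norm x1 + norm x2 + L * (1 + norm x2) + 2 * L + 2 * L\<^sup>2) * (1 + T)"
    using L T by (intro mult_mono) (auto simp: add_nonneg_nonneg)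
  then show ?thesis by (simp add: growth_def)
qed

lemma admissible_space: "admissible t h \<omega> \<Longrightarrow> \<omega> \<in> space P"
  by (simp add: admissible_def good_def)

lemma q_pos: "admissible t h \<omega> \<Longrightarrow> 0 < q t h \<omega>"
  using rho_nonneg[of \<omega> t h] unfolding q_def admissible_def good_def
  by (simp add: add_pos_nonneg)

lemma rho_le_q: "admissible t h \<omega> \<Longrightarrow> rho t h \<omega> \<le> q t h \<omega>"
  unfolding q_def admissible_def by simp

lemma h_le_q: "admissible t h \<omega> \<Longrightarrow> h \<le> (q t h \<omega>)\<^sup>2"
proof -
  assume a: "admissible t h \<omega>"
  have "(sqrt h)\<^sup>2 \<le> (q t h \<omega>)\<^sup>2"
    using a rho_nonneg[of \<omega> t h] unfolding q_def admissible_def good_def by (intro power_mono) auto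
  then show ?thesis using a by (simp add: admissible_def)
qed

lemma rho_le:
  assumes "\<omega> \<in> space P" "0 \<le> t" "0 \<le> h" "t + h \<le> T"
  shows "rho t h \<omega> \<le> 2 * rho 0 T \<omega>"
  unfolding rho_def sum_distrib_left
proof (rule sum_mono)
  fix m assume m: "m \<in> {1..M}"
  have o: "\<bar>W m s \<omega> - W m 0 \<omega>\<bar> \<le> osc (W m) 0 T \<omega>" if "s \<in> {0..T}" for s
    using that by (intro osc_ge[where w="W m" and \<omega>=\<omega>, OF W_cont[OF m assms(1)]]) auto
  show "osc (W m) t h \<omega> \<le> 2 * osc (W m) 0 T \<omega>"
  proof (rule osc_le[OF assms(3)])
    fix s assume "s \<in> {t..t+h}"
    then show "\<bar>W m s \<omega> - W m t \<omega>\<bar> \<le> 2 * osc (W m) 0 T \<omega>"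
      using o[of s] o[of t] assms by auto
  qed
qed

lemma big_ge_1: "\<omega> \<in> space P \<Longrightarrow> 1 \<le> big \<omega>"
  unfolding big_def using rho_nonneg[of \<omega> 0 T] T growth_ge by simp

lemma q_le_big: "admissible t h \<omega> \<Longrightarrow> q t h \<omega> \<le> big \<omega>"
proof -
  assume a: "admissible t h \<omega>"
  then have w: "\<omega> \<in> space P" and h: "0 \<le> t" "0 < h" "t + h \<le> T" by (auto simp: admissible_def good_def)
  have R: "0 \<le> rho 0 T \<omega>" using rho_nonneg[OF w, of 0 T] T by simp
  have "sqrt h \<le> 1 + h" using h by (intro real_le_lsqrt) (auto simp: power2_eq_square algebra_simps)
  then have "q t h \<omega> \<le> 1 + T + 2 * rho 0 T \<omega>"
    using rho_le[OF w, of t h] h unfolding q_def by linarith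
  also have "\<dots> \<le> 1 + (growth + 2 + T) * (1 + rho 0 T \<omega>)"
    using growth_ge R T by (simp add: algebra_simps add_nonneg_nonneg)
  also have "\<dots> \<le> big \<omega>" unfolding big_def by (rule exp_ge_add_one_self)
  finally show ?thesis .
qed

lemma solution_le_big:
  assumes "good \<omega>" "t \<in> {0..T}"
  shows "1 + norm (X1 t \<omega>) + norm (X2 t \<omega>) \<le> big \<omega>"
proof -
  have "0 \<le> rho 0 T \<omega>" using rho_nonneg[of \<omega> 0 T] assms T by (simp add: good_def)
  then have "exp (growth * (1 + rho 0 T \<omega>)) \<le> big \<omega>"
    unfolding big_def using T by (simp add: mult_right_mono)
  then show ?thesis using solution_bound[OF assms] by linarith
qed

section \<open>Rules for orders\<close>

lemma ordI:
  assumes "0 \<le> K" "\<And>t h \<omega> s. admissible t h \<omega> \<Longrightarrow> s \<in> {t..t+h} \<Longrightarrow> norm (R t h \<omega> s) \<le> K * big \<omega> ^ j * q t h \<omega> ^ k"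
  shows "ord k R"
  unfolding ord_def using assms by blast

lemma ordE:
  assumes "ord k R"
  obtains K j where "0 \<le> K"
    "\<And>t h \<omega> s. admissible t h \<omega> \<Longrightarrow> s \<in> {t..t+h} \<Longrightarrow> norm (R t h \<omega> s) \<le> K * big \<omega> ^ j * q t h \<omega> ^ k"
  using assms unfolding ord_def by blast

text \<open>Surplus powers of \<open>q\<close> are absorbed by further powers of \<open>big\<close>,
  whatever the size of the step.\<close>

lemma ord_weaken:
  assumes R: "ord k R" and "n \<le> k"
  shows "ord n R"
proof -
  obtain K j where K: "0 \<le> K"
    "\<And>t h \<omega> s. admissible t h \<omega> \<Longrightarrow> s \<in> {t..t+h} \<Longrightarrow> norm (R t h \<omega> s) \<le> K * big \<omega> ^ j * q t h \<omega> ^ k"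
    using ordE[OF R] by blast
  show ?thesis
  proof (rule ordI[OF K(1)])
    fix t h \<omega> s assume a: "admissible t h \<omega>" and s: "s \<in> {t..t+h}"
    have "q t h \<omega> ^ k = q t h \<omega> ^ (k - n) * q t h \<omega> ^ n" using assms(2) by (simp flip: power_add)
    also have "\<dots> \<le> big \<omega> ^ (k - n) * q t h \<omega> ^ n"
      using q_pos[OF a] q_le_big[OF a] by (intro mult_right_mono power_mono) auto
    finally have "K * big \<omega> ^ j * q t h \<omega> ^ k \<le> K * big \<omega> ^ j * (big \<omega> ^ (k - n) * q t h \<omega> ^ n)"
      using K(1) big_ge_1[OF admissible_space[OF a]] by (intro mult_left_mono) auto
    then show "norm (R t h \<omega> s) \<le> K * big \<omega> ^ (j + (k - n)) * q t h \<omega> ^ n"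
      using K(2)[OF a s] by (simp add: power_add mult.assoc)
  qed
qed

text \<open>The common source of the product rules: a bilinear estimate adds orders. The remaining
  domination and multiplication rules are instances.\<close>

lemma ord_dominated2:
  assumes R: "ord k R" and S: "ord l S" and n: "n \<le> k + l" and C: "0 \<le> C"
    and le: "\<And>t h \<omega> s. admissible t h \<omega> \<Longrightarrow> s \<in> {t..t+h} \<Longrightarrow> norm (Q t h \<omega> s) \<le> C * (norm (R t h \<omega> s) * norm (S t h \<omega> s))"
  shows "ord n Q"
proof -
  obtain K j where K: "0 \<le> K"
    "\<And>t h \<omega> s. admissible t h \<omega> \<Longrightarrow> s \<in> {t..t+h} \<Longrightarrow> norm (R t h \<omega> s) \<le> K * big \<omega> ^ j * q t h \<omega> ^ k"
    using ordE[OF R] by blast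
  obtain K' j' where K': "0 \<le> K'"
    "\<And>t h \<omega> s. admissible t h \<omega> \<Longrightarrow> s \<in> {t..t+h} \<Longrightarrow> norm (S t h \<omega> s) \<le> K' * big \<omega> ^ j' * q t h \<omega> ^ l"
    using ordE[OF S] by blast
  have "ord (k + l) Q"
  proof (rule ordI)
    show "0 \<le> C * K * K'" using C K K' by simp
    fix t h \<omega> s assume a: "admissible t h \<omega>" and s: "s \<in> {t..t+h}"
    have "C * (norm (R t h \<omega> s) * norm (S t h \<omega> s)) \<le> C * ((K * big \<omega> ^ j * q t h \<omega> ^ k) * (K' * big \<omega> ^ j' * q t h \<omega> ^ l))"
      using K(2)[OF a s] K'(2)[OF a s] C order_trans[OF norm_ge_zero K(2)[OF a s]] by (intro mult_left_mono mult_mono) auto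
    then show "norm (Q t h \<omega> s) \<le> (C * K * K') * big \<omega> ^ (j + j') * q t h \<omega> ^ (k + l)"
      using le[OF a s] by (simp add: power_add mult_ac)
  qed
  then show ?thesis using n by (rule ord_weaken)
qed

lemma ord_1: "ord 0 (\<lambda>t h \<omega> s. 1 :: real)"
  by (rule ordI[where K=1 and j=0]) auto

lemma ord_dominated:
  assumes R: "ord k R" and C: "0 \<le> C"
    and le: "\<And>t h \<omega> s. admissible t h \<omega> \<Longrightarrow> s \<in> {t..t+h} \<Longrightarrow> norm (Q t h \<omega> s) \<le> C * norm (R t h \<omega> s)"
  shows "ord k Q"
  using ord_dominated2[OF R ord_1, of k C Q] C le by simp

lemma ord_cong:
  assumes "ord k R" "\<And>t h \<omega> s. admissible t h \<omega> \<Longrightarrow> s \<in> {t..t+h} \<Longrightarrow> Q t h \<omega> s = R t h \<omega> s"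
  shows "ord k Q"
  using ord_dominated[OF assms(1), of 1 Q] assms(2) by simp

lemma ord_add:
  assumes R: "ord k R" and S: "ord k S"
  shows "ord k (\<lambda>t h \<omega> s. R t h \<omega> s + S t h \<omega> s)"
proof -
  obtain K j where K: "0 \<le> K"
    "\<And>t h \<omega> s. admissible t h \<omega> \<Longrightarrow> s \<in> {t..t+h} \<Longrightarrow> norm (R t h \<omega> s) \<le> K * big \<omega> ^ j * q t h \<omega> ^ k"
    using ordE[OF R] by blast
  obtain K' j' where K': "0 \<le> K'"
    "\<And>t h \<omega> s. admissible t h \<omega> \<Longrightarrow> s \<in> {t..t+h} \<Longrightarrow> norm (S t h \<omega> s) \<le> K' * big \<omega> ^ j' * q t h \<omega> ^ k"
    using ordE[OF S] by blast
  show ?thesis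
  proof (rule ordI)
    show "0 \<le> K + K'" using K K' by simp
    fix t h \<omega> s assume a: "admissible t h \<omega>" and s: "s \<in> {t..t+h}"
    note b = big_ge_1[OF admissible_space[OF a]]
    have "K * big \<omega> ^ j * q t h \<omega> ^ k \<le> K * big \<omega> ^ (j + j') * q t h \<omega> ^ k"
      "K' * big \<omega> ^ j' * q t h \<omega> ^ k \<le> K' * big \<omega> ^ (j + j') * q t h \<omega> ^ k"
      using K(1) K'(1) b q_pos[OF a] by (intro mult_right_mono mult_left_mono power_increasing; simp)+
    then show "norm (R t h \<omega> s + S t h \<omega> s) \<le> (K + K') * big \<omega> ^ (j + j') * q t h \<omega> ^ k"
      using K(2)[OF a s] K'(2)[OF a s] norm_triangle_ineq[of "R t h \<omega> s" "S t h \<omega> s"]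
      by (simp add: distrib_right)
  qed
qed

lemma ord_minus: "ord k R \<Longrightarrow> ord k (\<lambda>t h \<omega> s. - R t h \<omega> s)"
  by (rule ord_dominated[where C=1]) auto

lemma ord_diff: "ord k R \<Longrightarrow> ord k S \<Longrightarrow> ord k (\<lambda>t h \<omega> s. R t h \<omega> s - S t h \<omega> s)"
  using ord_add[OF _ ord_minus, of k R S] by simp

lemma ord_0: "ord k (\<lambda>t h \<omega> s. 0)"
  by (rule ordI[where K=0 and j=0]) auto

lemma ord_sum: "(\<And>m. m \<in> A \<Longrightarrow> ord k (R m)) \<Longrightarrow> ord k (\<lambda>t h \<omega> s. \<Sum>m\<in>A. R m t h \<omega> s)"
  by (induction A rule: infinite_finite_induct) (auto intro!: ord_0 ord_add)

lemma ord_scaleR: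
  "ord k r \<Longrightarrow> ord l R \<Longrightarrow> n \<le> k + l \<Longrightarrow> ord n (\<lambda>t h \<omega> s. r t h \<omega> s *\<^sub>R R t h \<omega> s)"
  by (rule ord_dominated2[where C=1]) auto

lemma ord_mult:
  "ord k r \<Longrightarrow> ord l R \<Longrightarrow> n \<le> k + l \<Longrightarrow> ord n (\<lambda>t h \<omega> s. r t h \<omega> s * R t h \<omega> s :: real)"
  by (rule ord_dominated2[where C=1]) (auto simp: abs_mult)

lemma ord_cmult: "ord k R \<Longrightarrow> ord k (\<lambda>t h \<omega> s. c *\<^sub>R R t h \<omega> s)"
  by (rule ord_dominated[where C="\<bar>c\<bar>"]) auto

lemma ord_at:
  assumes "ord k R" "\<And>t h \<omega>. admissible t h \<omega> \<Longrightarrow> p t h \<in> {t..t+h}"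
  shows "ord k (\<lambda>t h \<omega> s. R t h \<omega> (p t h))"
  using assms unfolding ord_def by metis

lemma ord_end: "ord k R \<Longrightarrow> ord k (\<lambda>t h \<omega> s. R t h \<omega> (t + h))"
  by (rule ord_at) (auto simp: admissible_def)

lemma ord_start: "ord k R \<Longrightarrow> ord k (\<lambda>t h \<omega> s. R t h \<omega> t)"
  by (rule ord_at[where p="\<lambda>t h. t"]) (auto simp: admissible_def)

text \<open>A function that is not integrable has integral \<open>0\<close>, so the bound holds for
  it as well, and orders of integrals can be computed free of integrability conditions.\<close>

lemma norm_integral_le:
  fixes f :: "real \<Rightarrow> 'c::euclidean_space"
  assumes "a \<le> b" "0 \<le> c" "\<And>x. x \<in> {a..b} \<Longrightarrow> norm (f x) \<le> c"
  shows "norm (integral {a..b} f) \<le> c * (b - a)"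
proof (cases "f integrable_on {a..b}")
  case True
  then show ?thesis
    using has_integral_bound_real[OF assms(2) finite.emptyI integrable_integral[OF True]] assms by auto
next
  case False
  then show ?thesis using assms by (simp add: not_integrable_integral)
qed

lemma ord_integral:
  fixes R :: "real \<Rightarrow> real \<Rightarrow> 'a \<Rightarrow> real \<Rightarrow> 'c::euclidean_space"
  assumes R: "ord k R" and n: "n \<le> k + 2"
  shows "ord n (\<lambda>t h \<omega> s. integral {t..s} (\<lambda>u. R t h \<omega> u))"
proof -
  obtain K j where K: "0 \<le> K"
    "\<And>t h \<omega> s. admissible t h \<omega> \<Longrightarrow> s \<in> {t..t+h} \<Longrightarrow> norm (R t h \<omega> s) \<le> K * big \<omega> ^ j * q t h \<omega> ^ k"
    using ordE[OF R] by blast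
  have "ord (k + 2) (\<lambda>t h \<omega> s. integral {t..s} (\<lambda>u. R t h \<omega> u))"
  proof (rule ordI[OF K(1)])
    fix t h \<omega> s assume a: "admissible t h \<omega>" and s: "s \<in> {t..t+h}"
    have c0: "0 \<le> K * big \<omega> ^ j * q t h \<omega> ^ k"
      using order_trans[OF norm_ge_zero K(2)[OF a s]] .
    have "norm (integral {t..s} (\<lambda>u. R t h \<omega> u)) \<le> K * big \<omega> ^ j * q t h \<omega> ^ k * (s - t)"
      by (rule norm_integral_le[OF _ c0]) (use s K(2)[OF a] in auto)
    also have "\<dots> \<le> K * big \<omega> ^ j * q t h \<omega> ^ k * (q t h \<omega>)\<^sup>2"
      using s h_le_q[OF a] by (intro mult_left_mono c0) auto
    finally show "norm (integral {t..s} (\<lambda>u. R t h \<omega> u)) \<le> K * big \<omega> ^ j * q t h \<omega> ^ (k + 2)"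
      by (simp only: power_add mult.assoc)
  qed
  then show ?thesis using n by (rule ord_weaken)
qed

lemma ord_D1:
  assumes "taylor_bounded L f" "ord k v"
  shows "ord k (\<lambda>t h \<omega> s. D1 f (x t h \<omega> s) (v t h \<omega> s))"
  by (rule ord_dominated[OF assms(2), of L]) (use assms(1) L in \<open>auto simp: taylor_bounded_def\<close>)

lemma ord_D2:
  assumes "taylor_bounded L f" "ord k v" "ord l w" "n \<le> k + l"
  shows "ord n (\<lambda>t h \<omega> s. D2 f (x t h \<omega> s) (v t h \<omega> s) (w t h \<omega> s))"
  by (rule ord_dominated2[OF assms(2,3,4), of L]) (use assms(1) L in \<open>auto simp: taylor_bounded_def mult.assoc\<close>)

lemma ord_lipschitz:
  assumes "taylor_bounded L f" "ord k (\<lambda>t h \<omega> s. x t h \<omega> s - y t h \<omega> s)"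
  shows "ord k (\<lambda>t h \<omega> s. f (x t h \<omega> s) - f (y t h \<omega> s))"
  by (rule ord_dominated[OF assms(2), of L]) (use assms(1) L in \<open>auto simp: taylor_bounded_def\<close>)

lemma ord_growth:
  assumes "taylor_bounded L f" "ord 0 x"
  shows "ord 0 (\<lambda>t h \<omega> s. f (x t h \<omega> s))"
proof -
  have "ord 0 (\<lambda>t h \<omega> s. f (x t h \<omega> s) - f 0)"
    using ord_lipschitz[OF assms(1), of 0 x "\<lambda>t h \<omega> s. 0"] assms(2) by simp
  moreover have "ord 0 (\<lambda>t h \<omega> s. f 0)" by (rule ord_dominated[OF ord_1, of "norm (f 0)"]) auto
  ultimately show ?thesis using ord_add by fastforce
qed

text \<open>The remainder terms of Taylor expansions, where the increment itself is only known up to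
  terms of higher order.\<close>

lemma ord_taylor1:
  assumes f: "taylor_bounded L f" and d: "ord d (\<lambda>t h \<omega> s. z t h \<omega> s - x t h \<omega> s)" "n \<le> d + d"
    and k: "ord n (\<lambda>t h \<omega> s. (z t h \<omega> s - x t h \<omega> s) - k t h \<omega> s)"
  shows "ord n (\<lambda>t h \<omega> s. f (z t h \<omega> s) - f (x t h \<omega> s) - D1 f (x t h \<omega> s) (k t h \<omega> s))"
proof -
  have rem: "ord n (\<lambda>t h \<omega> s. f (z t h \<omega> s) - f (x t h \<omega> s) - D1 f (x t h \<omega> s) (z t h \<omega> s - x t h \<omega> s))"
  proof (rule ord_dominated2[OF d(1) d(1) d(2), of L])
    fix t h \<omega> s
    have "norm (f (x t h \<omega> s + (z t h \<omega> s - x t h \<omega> s)) - f (x t h \<omega> s) - D1 f (x t h \<omega> s) (z t h \<omega> s - x t h \<omega> s)) \<le> L * (norm (z t h \<omega> s - x t h \<omega> s))\<^sup>2"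
      using f unfolding taylor_bounded_def by blast
    then show "norm (f (z t h \<omega> s) - f (x t h \<omega> s) - D1 f (x t h \<omega> s) (z t h \<omega> s - x t h \<omega> s)) \<le> L * (norm (z t h \<omega> s - x t h \<omega> s) * norm (z t h \<omega> s - x t h \<omega> s))"
      by (simp add: power2_eq_square)
  qed (use L in auto)
  have lin: "linear (D1 f x)" for x using f smooth_linear unfolding taylor_bounded_def by blast
  show ?thesis
    by (rule ord_cong[OF ord_add[OF rem ord_D1[OF f k, where x=x]]]) (simp add: linear_diff[OF lin])
qed

lemma ord_taylor2:
  assumes f: "taylor_bounded L f" and v: "ord 1 v" and k: "ord 2 k"
    and z: "ord 3 (\<lambda>t h \<omega> s. (z t h \<omega> s - x t h \<omega> s) - (v t h \<omega> s + k t h \<omega> s))"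
  shows "ord 3 (\<lambda>t h \<omega> s. f (z t h \<omega> s) - f (x t h \<omega> s) - D1 f (x t h \<omega> s) (v t h \<omega> s + k t h \<omega> s)
     - (1/2) *\<^sub>R D2 f (x t h \<omega> s) (v t h \<omega> s) (v t h \<omega> s))"
proof -
  let ?d = "\<lambda>t h \<omega> s. z t h \<omega> s - x t h \<omega> s"
  have dv: "ord 2 (\<lambda>t h \<omega> s. ?d t h \<omega> s - v t h \<omega> s)"
    by (rule ord_cong[OF ord_add[OF ord_weaken[OF z, of 2] k]]) auto
  have d: "ord 1 ?d"
    by (rule ord_cong[OF ord_add[OF ord_weaken[OF dv, of 1] v]]) auto
  have d2: "ord 2 (\<lambda>t h \<omega> s. norm (?d t h \<omega> s) * norm (?d t h \<omega> s))"
    by (rule ord_dominated2[OF d d, of 2 1]) auto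
  have rem: "ord 3 (\<lambda>t h \<omega> s. f (z t h \<omega> s) - f (x t h \<omega> s) - D1 f (x t h \<omega> s) (?d t h \<omega> s) - (1/2) *\<^sub>R D2 f (x t h \<omega> s) (?d t h \<omega> s) (?d t h \<omega> s))"
  proof (rule ord_dominated2[OF d d2, of 3 L])
    fix t h \<omega> s
    have "norm (f (x t h \<omega> s + ?d t h \<omega> s) - f (x t h \<omega> s) - D1 f (x t h \<omega> s) (?d t h \<omega> s) - (1/2) *\<^sub>R D2 f (x t h \<omega> s) (?d t h \<omega> s) (?d t h \<omega> s)) \<le> L * (norm (?d t h \<omega> s)) ^ 3"
      using f unfolding taylor_bounded_def by blast
    then show "norm (f (z t h \<omega> s) - f (x t h \<omega> s) - D1 f (x t h \<omega> s) (?d t h \<omega> s) - (1/2) *\<^sub>R D2 f (x t h \<omega> s) (?d t h \<omega> s) (?d t h \<omega> s)) \<le> L * (norm (?d t h \<omega> s) * norm (norm (?d t h \<omega> s) * norm (?d t h \<omega> s)))"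
      by (simp add: power3_eq_cube mult.assoc)
  qed (use L in auto)
  have lin: "linear (D1 f x)" for x using f smooth_linear unfolding taylor_bounded_def by blast
  have bil: "bilinear (D2 f x)" for x using f bilinear_D2 unfolding taylor_bounded_def by blast
  \<comment> \<open>The quadratic term may be taken at the leading part \<open>v\<close>: its change
    is D2 (d - v) d + D2 v (d - v), and each summand has one argument of order 2 and one of order
    1.\<close>
  have q1: "ord 3 (\<lambda>t h \<omega> s. D2 f (x t h \<omega> s) (?d t h \<omega> s - v t h \<omega> s) (?d t h \<omega> s))"
    by (rule ord_D2[OF f dv d]) simp
  have q2: "ord 3 (\<lambda>t h \<omega> s. D2 f (x t h \<omega> s) (v t h \<omega> s) (?d t h \<omega> s - v t h \<omega> s))"
    by (rule ord_D2[OF f v dv]) simp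
  show ?thesis
    by (rule ord_cong[OF ord_add[OF ord_add[OF rem ord_D1[OF f z, where x=x]] ord_cmult[OF ord_add[OF q1 q2], of "1/2"]]])
      (simp add: linear_diff[OF lin] bilinear_lsub[OF bil] bilinear_rsub[OF bil] scaleR_diff_right scaleR_add_right)
qed

end

text \<open>Vector algebra kept apart from the analysis. The first premise is
  \<open>J0_coeff\<close> applied to the terms linear in the noise; the multiples of
  \<open>A0\<close> agree because h^2/2 = (2h/3)(h/4) + (h/3) h.\<close>

lemma step_combination_2:
  fixes X' X f f11 f12 JA aA dA A0 I2 aa dd MM :: "'c::real_vector" and h :: real
  assumes "JA = (2*h/3) *\<^sub>R aA + (h/3) *\<^sub>R dA"
    and "MM = (1/2) *\<^sub>R I2 - (2*h/3) *\<^sub>R ((1/2) *\<^sub>R aa) - (h/3) *\<^sub>R ((1/2) *\<^sub>R dd)"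
  shows "X' - (X + (2*h/3) *\<^sub>R f11 + (h/3) *\<^sub>R f12) - MM
    = (X' - X - h *\<^sub>R f - (JA + (h\<^sup>2/2) *\<^sub>R A0) - (1/2) *\<^sub>R I2)
      - (2*h/3) *\<^sub>R (f11 - f - (aA + (h/4) *\<^sub>R A0) - (1/2) *\<^sub>R aa)
      - (h/3) *\<^sub>R (f12 - f - (dA + h *\<^sub>R A0) - (1/2) *\<^sub>R dd)"
proof -
  have f: "h *\<^sub>R f = (2*h/3) *\<^sub>R f + (h/3) *\<^sub>R f" by (simp flip: scaleR_add_left)
  have A: "(h\<^sup>2/2) *\<^sub>R A0 = (2*h/3) *\<^sub>R ((h/4) *\<^sub>R A0) + (h/3) *\<^sub>R (h *\<^sub>R A0)"
    by (simp flip: scaleR_add_left add: power2_eq_square)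
  show ?thesis
    unfolding f A assms by (simp only: scaleR_diff_right scaleR_add_right) (simp add: algebra_simps)
qed

text \<open>The premises are \<open>coeff_sum\<close> and \<open>coeff_b_J0\<close>. The first
  cancels the values \<open>G\<close> at the start of the step, the second the terms in
  \<open>U\<close>.\<close>

lemma step_combination_1:
  fixes g' K G gH U SJ SI Sa :: "'c::real_vector" and d a b J h :: real
  assumes "d = a + b" "h * d - J = b * (2*h/3)"
  shows "d *\<^sub>R g' - K - (a *\<^sub>R G + b *\<^sub>R gH) - (d *\<^sub>R SJ - SI - (b * (2*h/3)) *\<^sub>R Sa)
    = d *\<^sub>R (g' - G - (h *\<^sub>R U + SJ)) - (K - J *\<^sub>R U - SI) - b *\<^sub>R (gH - G - (2*h/3) *\<^sub>R (U + Sa))"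
proof -
  have U: "(d * h) *\<^sub>R U = J *\<^sub>R U + (b * (2*h/3)) *\<^sub>R U"
    using assms(2) by (simp flip: scaleR_add_left add: mult.commute)
  have G: "d *\<^sub>R G = a *\<^sub>R G + b *\<^sub>R G" using assms(1) by (simp add: scaleR_add_left)
  show ?thesis
    by (simp only: scaleR_diff_right scaleR_add_right scaleR_scaleR U G) (simp add: algebra_simps)
qed

context separable_solution
begin

subsection \<open>One step of the method started on the solution\<close>

definition st1 :: "real \<Rightarrow> real \<Rightarrow> 'a \<Rightarrow> 'x \<Rightarrow> 'y \<Rightarrow> 'x" where
  "st1 t h \<omega> u v = u + (h/4) *\<^sub>R g1 0 v + (\<Sum>m=1..M. coeff_a (W m) t h \<omega> *\<^sub>R g1 m v)"

definition st2 :: "real \<Rightarrow> real \<Rightarrow> 'a \<Rightarrow> 'x \<Rightarrow> 'y \<Rightarrow> 'y" where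
  "st2 t h \<omega> u v = v + (2*h/3) *\<^sub>R g2 (st1 t h \<omega> u v)"

text \<open>In the method the last stage of the first block coincides with its new value; this
  function stands for both.\<close>

definition st3 :: "real \<Rightarrow> real \<Rightarrow> 'a \<Rightarrow> 'x \<Rightarrow> 'y \<Rightarrow> 'x" where
  "st3 t h \<omega> u v = u + (h/4) *\<^sub>R g1 0 v + (3*h/4) *\<^sub>R g1 0 (st2 t h \<omega> u v)
     + (\<Sum>m=1..M. coeff_a (W m) t h \<omega> *\<^sub>R g1 m v + coeff_b (W m) t h \<omega> *\<^sub>R g1 m (st2 t h \<omega> u v))"

lemma sprk_step_stages:
  "sprk_step M W g1 g2 t h \<omega> (u, v) =
    (st3 t h \<omega> u v, v + (2*h/3) *\<^sub>R g2 (st1 t h \<omega> u v) + (h/3) *\<^sub>R g2 (st3 t h \<omega> u v))"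
  unfolding sprk_step_def Let_def st3_def st2_def st1_def by simp

lemma admissible_time:
  assumes "admissible t h \<omega>" "s \<in> {t..t+h}"
  shows "good \<omega>" "\<omega> \<in> space P" "0 \<le> t" "t \<le> s" "s \<le> T" "0 < h" "t \<in> {0..T}" "s \<in> {0..T}" "t + h \<le> T"
  using assms unfolding admissible_def good_def by auto

text \<open>This identity and the two that follow characterise the weights. Respectively they
  reproduce the increment itself, the time integral of the noise under the quadrature rule of the
  second block, and the integral of elapsed time against the noise, which is h dW - J0, at the node
  2h/3.\<close>

lemma coeff_sum: "coeff_a w t h \<omega> + coeff_b w t h \<omega> = dW w t h \<omega>"
  unfolding coeff_a_def coeff_b_def by simp

lemma J0_coeff: "h \<noteq> 0 \<Longrightarrow> J0 w t h \<omega> = (2*h/3) * coeff_a w t h \<omega> + (h/3) * dW w t h \<omega>"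
  unfolding coeff_a_def by (simp add: field_simps)

lemma coeff_b_J0: "h \<noteq> 0 \<Longrightarrow> h * dW w t h \<omega> - J0 w t h \<omega> = coeff_b w t h \<omega> * (2*h/3)"
  unfolding coeff_b_def by (simp add: field_simps)

text \<open>Since the modulus of \<open>J0\<close> is at most \<open>rho t h \<omega> * h\<close>,
  its contribution to either weight is at most 3/2 \<open>rho\<close>; adding 1/2 and 3/2 from dW
  gives 2 and 3.\<close>

lemma coeff_bounds:
  assumes w: "\<omega> \<in> space P" and t: "0 \<le> t" "0 < h" and m: "m \<in> {1..M}"
  shows "\<bar>dW (W m) t h \<omega>\<bar> \<le> rho t h \<omega>" "\<bar>J0 (W m) t h \<omega>\<bar> \<le> rho t h \<omega> * h"
    "\<bar>coeff_a (W m) t h \<omega>\<bar> \<le> 2 * rho t h \<omega>" "\<bar>coeff_b (W m) t h \<omega>\<bar> \<le> 3 * rho t h \<omega>"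
proof -
  show d: "\<bar>dW (W m) t h \<omega>\<bar> \<le> rho t h \<omega>"
    unfolding dW_def using t by (intro rho_ge1[OF w _ _ m]) auto
  have "norm (J0 (W m) t h \<omega>) \<le> rho t h \<omega> * (t + h - t)"
    unfolding J0_def using t rho_ge1[OF w t(1) _ m] rho_nonneg[OF w, of t h] by (intro norm_integral_le) auto
  then show J: "\<bar>J0 (W m) t h \<omega>\<bar> \<le> rho t h \<omega> * h" by simp
  have "\<bar>3 * J0 (W m) t h \<omega> / (2 * h)\<bar> = \<bar>J0 (W m) t h \<omega>\<bar> * (3 / (2 * h))" using t by (simp add: abs_mult)
  also have "\<dots> \<le> rho t h \<omega> * h * (3 / (2 * h))" using J t by (intro mult_right_mono) auto
  also have "\<dots> = 3/2 * rho t h \<omega>" using t by simp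
  finally have a: "\<bar>3 * J0 (W m) t h \<omega> / (2 * h)\<bar> \<le> 3/2 * rho t h \<omega>" .
  show "\<bar>coeff_a (W m) t h \<omega>\<bar> \<le> 2 * rho t h \<omega>" "\<bar>coeff_b (W m) t h \<omega>\<bar> \<le> 3 * rho t h \<omega>"
    unfolding coeff_a_def coeff_b_def using a d by linarith+
qed

section \<open>Orders of the basic quantities\<close>

lemma ord_h: "0 \<le> c \<Longrightarrow> ord 2 (\<lambda>t h \<omega> s. c * h)"
  by (rule ordI[where K=c and j=0]) (use h_le_q in \<open>auto simp: admissible_def intro!: mult_left_mono\<close>)

lemma ord_h': "ord 2 (\<lambda>t h \<omega> s. h)" "ord 2 (\<lambda>t h \<omega> s. 2*h/3)" "ord 2 (\<lambda>t h \<omega> s. h/3)" "ord 2 (\<lambda>t h \<omega> s. h/4)" "ord 2 (\<lambda>t h \<omega> s. 3*h/4)"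
  using ord_h[of 1] ord_h[of "2/3"] ord_h[of "1/3"] ord_h[of "1/4"] ord_h[of "3/4"] by simp_all

lemma ord_time: "ord 2 (\<lambda>t h \<omega> s. s - t)"
  by (rule ord_dominated[OF ord_h'(1), of 1]) auto

lemma ord_W: "m \<in> {1..M} \<Longrightarrow> ord 1 (\<lambda>t h \<omega> s. W m s \<omega> - W m t \<omega>)"
proof (rule ordI[where K=1 and j=0])
  fix t h \<omega> s assume m: "m \<in> {1..M}" and a: "admissible t h \<omega>" and s: "s \<in> {t..t+h}"
  show "norm (W m s \<omega> - W m t \<omega>) \<le> 1 * big \<omega> ^ 0 * q t h \<omega> ^ 1"
    using rho_ge1[OF admissible_time(2,3)[OF a s] s m] rho_le_q[OF a] by simp
qed simp

lemma ord_dW: "m \<in> {1..M} \<Longrightarrow> ord 1 (\<lambda>t h \<omega> s. dW (W m) t h \<omega>)"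
  using ord_end[OF ord_W] unfolding dW_def .

lemma ord_JJ: "m \<in> {1..M} \<Longrightarrow> ord 3 (\<lambda>t h \<omega> s. integral {t..s} (\<lambda>u. W m u \<omega> - W m t \<omega>))"
  by (rule ord_integral[OF ord_W]) auto

lemma ord_J0: "m \<in> {1..M} \<Longrightarrow> ord 3 (\<lambda>t h \<omega> s. J0 (W m) t h \<omega>)"
  using ord_end[OF ord_JJ] unfolding J0_def .

lemma ord_ab:
  assumes m: "m \<in> {1..M}"
  shows "ord 1 (\<lambda>t h \<omega> s. coeff_a (W m) t h \<omega>)" "ord 1 (\<lambda>t h \<omega> s. coeff_b (W m) t h \<omega>)"
proof -
  have r: "ord 1 (\<lambda>t h \<omega> s. rho t h \<omega>)"
    by (rule ordI[where K=1 and j=0]) (use rho_le_q rho_nonneg in \<open>auto simp: admissible_def good_def\<close>)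
  have p: "\<bar>rho t h \<omega>\<bar> = rho t h \<omega>" if "admissible t h \<omega>" for t h \<omega>
    using that rho_nonneg[of \<omega> t h] by (simp add: admissible_def good_def)
  show "ord 1 (\<lambda>t h \<omega> s. coeff_a (W m) t h \<omega>)"
    by (rule ord_dominated[OF r, of 2]) (use coeff_bounds(3)[OF _ _ _ m] p in \<open>auto simp: admissible_def good_def\<close>)
  show "ord 1 (\<lambda>t h \<omega> s. coeff_b (W m) t h \<omega>)"
    by (rule ord_dominated[OF r, of 3]) (use coeff_bounds(4)[OF _ _ _ m] p in \<open>auto simp: admissible_def good_def\<close>)
qed

lemma ord_X: "ord 0 (\<lambda>t h \<omega> s. X1 s \<omega>)" "ord 0 (\<lambda>t h \<omega> s. X2 s \<omega>)"
proof -
  have *: "norm (X1 s \<omega>) \<le> 1 * big \<omega> ^ 1 * q t h \<omega> ^ 0" "norm (X2 s \<omega>) \<le> 1 * big \<omega> ^ 1 * q t h \<omega> ^ 0"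
    if "admissible t h \<omega>" "s \<in> {t..t+h}" for t h \<omega> s
    using solution_le_big[OF admissible_time(1,8)[OF that]] norm_ge_zero[of "X1 s \<omega>"] norm_ge_zero[of "X2 s \<omega>"]
    unfolding power_one_right power_0 mult_1 mult_1_right by linarith+
  show "ord 0 (\<lambda>t h \<omega> s. X1 s \<omega>)" by (rule ordI[where K=1 and j=1, OF _ *(1)]) auto
  show "ord 0 (\<lambda>t h \<omega> s. X2 s \<omega>)" by (rule ordI[where K=1 and j=1, OF _ *(2)]) auto
qed

lemma ord_g:
  "ord 0 (\<lambda>t h \<omega> s. g2 (X1 s \<omega>))" "m \<in> {0..M} \<Longrightarrow> ord 0 (\<lambda>t h \<omega> s. g1 m (X2 s \<omega>))"
  "m \<in> {0..M} \<Longrightarrow> ord 0 (\<lambda>t h \<omega> s. g1 m (X2 t \<omega>))" "m \<in> {0..M} \<Longrightarrow> ord 0 (\<lambda>t h \<omega> s. dG m s \<omega>)"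
  "ord 0 (\<lambda>t h \<omega> s. g2 (X1 t \<omega>))"
proof -
  show 1: "ord 0 (\<lambda>t h \<omega> s. g2 (X1 s \<omega>))" by (rule ord_growth[OF g2 ord_X(1)])
  show "ord 0 (\<lambda>t h \<omega> s. g2 (X1 t \<omega>))" by (rule ord_start[OF 1])
  assume m: "m \<in> {0..M}"
  show 2: "ord 0 (\<lambda>t h \<omega> s. g1 m (X2 s \<omega>))" by (rule ord_growth[OF g1[OF m] ord_X(2)])
  show "ord 0 (\<lambda>t h \<omega> s. g1 m (X2 t \<omega>))" by (rule ord_start[OF 2])
  show "ord 0 (\<lambda>t h \<omega> s. dG m s \<omega>)" unfolding dG_def by (rule ord_D1[OF g1[OF m] 1])
qed

lemma g1m: "m \<in> {1..M} \<Longrightarrow> m \<in> {0..M}" by simp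

lemma has_integral_W:
  assumes "\<omega> \<in> space P" "0 \<le> t" "m \<in> {1..M}"
  shows "((\<lambda>u. W m u \<omega> - W m t \<omega>) has_integral integral {t..s} (\<lambda>u. W m u \<omega> - W m t \<omega>)) {t..s}"
    and "l \<in> {1..M} \<Longrightarrow> ((\<lambda>u. (W m u \<omega> - W m t \<omega>) * (W l u \<omega> - W l t \<omega>)) has_integral
      integral {t..s} (\<lambda>u. (W m u \<omega> - W m t \<omega>) * (W l u \<omega> - W l t \<omega>))) {t..s}"
  using assms by (auto intro!: integrable_integral integrable_continuous_real continuous_intros W_cont)

lemma has_integral_time: "t \<le> s \<Longrightarrow> ((\<lambda>u::real. u - t) has_integral (s - t)\<^sup>2/2) {t..s}"
proof -
  assume "t \<le> s"
  then have "((\<lambda>u. u - t) has_integral (s - t)\<^sup>2/2 - (t - t)\<^sup>2/2) {t..s}"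
    by (intro fundamental_theorem_of_calculus)
      (auto intro!: derivative_eq_intros simp: has_real_derivative_iff_has_vector_derivative[symmetric])
  then show ?thesis by simp
qed

lemma linear_D1:
  "linear (D1 g2 x)" "m \<in> {0..M} \<Longrightarrow> linear (D1 (g1 m) y)"
  using smooth_linear g2_smooth g1_smooth by blast+

section \<open>Expansion of the exact solution over one step\<close>

lemma ord_E1: "ord 2 (\<lambda>t h \<omega> s. X2 s \<omega> - X2 t \<omega>)"
proof (rule ord_cong[OF ord_integral[OF ord_g(1), of 2]])
  fix t h \<omega> s assume a: "admissible t h \<omega>" "s \<in> {t..t+h}"
  show "X2 s \<omega> - X2 t \<omega> = integral {t..s} (\<lambda>u. g2 (X1 u \<omega>))"
    unfolding good_step(1)[OF admissible_time(1,3,4,5)[OF a]] by simp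
qed simp

lemma ord_E1_end: "ord 2 (\<lambda>t h \<omega> s. X2 (t+h) \<omega> - X2 t \<omega>)"
  using ord_end[OF ord_E1] .

definition noise :: "real \<Rightarrow> 'a \<Rightarrow> real \<Rightarrow> 'x" where
  "noise t \<omega> s = (\<Sum>m=1..M. (W m s \<omega> - W m t \<omega>) *\<^sub>R g1 m (X2 t \<omega>))"

lemma ord_noise: "ord 1 (\<lambda>t h \<omega> s. noise t \<omega> s)"
  unfolding noise_def by (intro ord_sum ord_scaleR[OF ord_W ord_g(3)]) auto

lemma ord_drift: "ord 2 (\<lambda>t h \<omega> s. (s - t) *\<^sub>R g1 0 (X2 t \<omega>))"
  by (rule ord_scaleR[OF ord_time ord_g(3)]) auto

text \<open>Because \<open>X2\<close> changes by order h only, freezing it at \<open>t\<close> in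
  the diffusion coefficients costs order 3/2. Separability thus removes the double stochastic
  integrals of order h that a general system would produce.\<close>

lemma ord_E3: "ord 3 (\<lambda>t h \<omega> s. (X1 s \<omega> - X1 t \<omega>) - (noise t \<omega> s + (s - t) *\<^sub>R g1 0 (X2 t \<omega>)))"
proof (rule ord_cong)
  have g: "ord 2 (\<lambda>t h \<omega> s. g1 m (X2 s \<omega>) - g1 m (X2 t \<omega>))" if "m \<in> {0..M}" for m
    by (rule ord_lipschitz[OF g1[OF that] ord_E1])
  show "ord 3 (\<lambda>t h \<omega> s. integral {t..s} (\<lambda>u. g1 0 (X2 u \<omega>) - g1 0 (X2 t \<omega>)) +
     (\<Sum>m=1..M. (W m s \<omega> - W m t \<omega>) *\<^sub>R (g1 m (X2 s \<omega>) - g1 m (X2 t \<omega>)) - integral {t..s} (\<lambda>u. (W m u \<omega> - W m t \<omega>) *\<^sub>R dG m u \<omega>)))"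
  proof (intro ord_add ord_sum ord_diff)
    show "ord 3 (\<lambda>t h \<omega> s. integral {t..s} (\<lambda>u. g1 0 (X2 u \<omega>) - g1 0 (X2 t \<omega>)))"
      by (rule ord_integral[OF g]) auto
    fix m assume m: "m \<in> {1..M}"
    show "ord 3 (\<lambda>t h \<omega> s. (W m s \<omega> - W m t \<omega>) *\<^sub>R (g1 m (X2 s \<omega>) - g1 m (X2 t \<omega>)))"
      by (rule ord_scaleR[OF ord_W[OF m] g[OF g1m[OF m]]]) simp
    have "ord 1 (\<lambda>t h \<omega> s. (W m s \<omega> - W m t \<omega>) *\<^sub>R dG m s \<omega>)"
      by (rule ord_scaleR[OF ord_W[OF m] ord_g(4)[OF g1m[OF m]]]) simp
    then show "ord 3 (\<lambda>t h \<omega> s. integral {t..s} (\<lambda>u. (W m u \<omega> - W m t \<omega>) *\<^sub>R dG m u \<omega>))"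
      by (rule ord_integral) simp
  qed
  fix t h \<omega> s assume a: "admissible t h \<omega>" and s: "s \<in> {t..t+h}"
  note A = admissible_time[OF a s]
  have c: "(\<lambda>u. g1 0 (X2 u \<omega>)) integrable_on {t..s}"
    using A by (intro integrable_continuous_real g_cont) auto
  have "integral {t..s} (\<lambda>u. g1 0 (X2 u \<omega>) - g1 0 (X2 t \<omega>)) = integral {t..s} (\<lambda>u. g1 0 (X2 u \<omega>)) - (s - t) *\<^sub>R g1 0 (X2 t \<omega>)"
    using A c by (subst Henstock_Kurzweil_Integration.integral_diff) auto
  then show "(X1 s \<omega> - X1 t \<omega>) - (noise t \<omega> s + (s - t) *\<^sub>R g1 0 (X2 t \<omega>)) =
     integral {t..s} (\<lambda>u. g1 0 (X2 u \<omega>) - g1 0 (X2 t \<omega>)) +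
     (\<Sum>m=1..M. (W m s \<omega> - W m t \<omega>) *\<^sub>R (g1 m (X2 s \<omega>) - g1 m (X2 t \<omega>)) - integral {t..s} (\<lambda>u. (W m u \<omega> - W m t \<omega>) *\<^sub>R dG m u \<omega>))"
    unfolding noise_def good_step(2)[OF A(1,3,4,5)] by (simp add: sum_subtractf scaleR_diff_right)
qed

lemma ord_E2: "ord 2 (\<lambda>t h \<omega> s. (X1 s \<omega> - X1 t \<omega>) - noise t \<omega> s)" "ord 1 (\<lambda>t h \<omega> s. X1 s \<omega> - X1 t \<omega>)"
proof -
  show 2: "ord 2 (\<lambda>t h \<omega> s. (X1 s \<omega> - X1 t \<omega>) - noise t \<omega> s)"
    by (rule ord_cong[OF ord_add[OF ord_weaken[OF ord_E3, of 2] ord_drift]]) auto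
  show "ord 1 (\<lambda>t h \<omega> s. X1 s \<omega> - X1 t \<omega>)"
    by (rule ord_cong[OF ord_add[OF ord_weaken[OF 2, of 1] ord_noise]]) auto
qed

lemma ord_F2: "ord 2 (\<lambda>t h \<omega> s. g2 (X1 s \<omega>) - g2 (X1 t \<omega>) - D1 g2 (X1 t \<omega>) (noise t \<omega> s))"
  by (rule ord_taylor1[OF g2 ord_E2(2) _ ord_E2(1)]) simp

lemma ord_F3: "ord 3 (\<lambda>t h \<omega> s. g2 (X1 s \<omega>) - g2 (X1 t \<omega>)
    - D1 g2 (X1 t \<omega>) (noise t \<omega> s + (s - t) *\<^sub>R g1 0 (X2 t \<omega>)) - (1/2) *\<^sub>R D2 g2 (X1 t \<omega>) (noise t \<omega> s) (noise t \<omega> s))"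
  by (rule ord_taylor2[OF g2 ord_noise ord_drift ord_E3])

lemma D1_noise: "D1 g2 (X1 t \<omega>) (noise t \<omega> s) = (\<Sum>m=1..M. (W m s \<omega> - W m t \<omega>) *\<^sub>R D1 g2 (X1 t \<omega>) (g1 m (X2 t \<omega>)))"
  unfolding noise_def by (simp add: linear_sum[OF linear_D1(1)] linear_cmul[OF linear_D1(1)])

lemma integral_g2:
  assumes a: "admissible t h \<omega>" and s: "s \<in> {t..t+h}"
  shows "((\<lambda>u. g2 (X1 u \<omega>)) has_integral X2 s \<omega> - X2 t \<omega>) {t..s}"
proof -
  note A = admissible_time[OF a s]
  have "(\<lambda>u. g2 (X1 u \<omega>)) integrable_on {t..s}" using A by (intro integrable_continuous_real g_cont) auto
  then show ?thesis using good_step(1)[OF A(1,3,4,5)] by (simp add: has_integral_integral)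
qed

lemma ord_E4: "ord 3 (\<lambda>t h \<omega> s. (X2 s \<omega> - X2 t \<omega>) - (s - t) *\<^sub>R g2 (X1 t \<omega>))"
proof (rule ord_cong[OF ord_integral[OF ord_lipschitz[OF g2 ord_E2(2)], of 3]])
  fix t h \<omega> s assume a: "admissible t h \<omega>" and s: "s \<in> {t..t+h}"
  have "((\<lambda>u. g2 (X1 u \<omega>) - g2 (X1 t \<omega>)) has_integral (X2 s \<omega> - X2 t \<omega>) - (s - t) *\<^sub>R g2 (X1 t \<omega>)) {t..s}"
    using has_integral_diff[OF integral_g2[OF a s] has_integral_const_real[of "g2 (X1 t \<omega>)" t s]] s by simp
  then show "(X2 s \<omega> - X2 t \<omega>) - (s - t) *\<^sub>R g2 (X1 t \<omega>) = integral {t..s} (\<lambda>u. g2 (X1 u \<omega>) - g2 (X1 t \<omega>))"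
    by (simp add: integral_unique)
qed simp

text \<open>Integrating the first-order expansion \<open>ord_F2\<close> in time gains two half
  orders; the linear noise term becomes an integral of Wiener increments, equal to \<open>J0\<close>
  at the end of the step.\<close>

lemma ord_E5: "ord 4 (\<lambda>t h \<omega> s. (X2 s \<omega> - X2 t \<omega>) - ((s - t) *\<^sub>R g2 (X1 t \<omega>)
    + (\<Sum>m=1..M. integral {t..s} (\<lambda>u. W m u \<omega> - W m t \<omega>) *\<^sub>R D1 g2 (X1 t \<omega>) (g1 m (X2 t \<omega>)))))"
proof (rule ord_cong[OF ord_integral[OF ord_F2, of 4]])
  fix t h \<omega> s assume a: "admissible t h \<omega>" and s: "s \<in> {t..t+h}"
  note A = admissible_time[OF a s]
  have "((\<lambda>u. D1 g2 (X1 t \<omega>) (noise t \<omega> u)) has_integral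
      (\<Sum>m=1..M. integral {t..s} (\<lambda>u. W m u \<omega> - W m t \<omega>) *\<^sub>R D1 g2 (X1 t \<omega>) (g1 m (X2 t \<omega>)))) {t..s}"
    unfolding D1_noise by (intro has_integral_sum has_integral_scaleR_left has_integral_W A) auto
  from has_integral_diff[OF has_integral_diff[OF integral_g2[OF a s] has_integral_const_real[of "g2 (X1 t \<omega>)" t s]] this]
  have "((\<lambda>u. g2 (X1 u \<omega>) - g2 (X1 t \<omega>) - D1 g2 (X1 t \<omega>) (noise t \<omega> u)) has_integral
     (X2 s \<omega> - X2 t \<omega>) - (s - t) *\<^sub>R g2 (X1 t \<omega>) - (\<Sum>m=1..M. integral {t..s} (\<lambda>u. W m u \<omega> - W m t \<omega>) *\<^sub>R D1 g2 (X1 t \<omega>) (g1 m (X2 t \<omega>)))) {t..s}"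
    using A(4) by simp
  from integral_unique[OF this]
  show "(X2 s \<omega> - X2 t \<omega>) - ((s - t) *\<^sub>R g2 (X1 t \<omega>)
    + (\<Sum>m=1..M. integral {t..s} (\<lambda>u. W m u \<omega> - W m t \<omega>) *\<^sub>R D1 g2 (X1 t \<omega>) (g1 m (X2 t \<omega>))))
     = integral {t..s} (\<lambda>u. g2 (X1 u \<omega>) - g2 (X1 t \<omega>) - D1 g2 (X1 t \<omega>) (noise t \<omega> u))" by simp
qed simp

section \<open>Expansion of the stages started on the solution\<close>

abbreviation s1 where "s1 t h \<omega> \<equiv> st1 t h \<omega> (X1 t \<omega>) (X2 t \<omega>)"
abbreviation s2 where "s2 t h \<omega> \<equiv> st2 t h \<omega> (X1 t \<omega>) (X2 t \<omega>)"
abbreviation s3 where "s3 t h \<omega> \<equiv> st3 t h \<omega> (X1 t \<omega>) (X2 t \<omega>)"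

text \<open>The counterpart of \<open>noise\<close> at the first stage: the weight
  \<open>coeff_a\<close> stands where the exact expansion has an increment.\<close>

definition noise_a :: "real \<Rightarrow> real \<Rightarrow> 'a \<Rightarrow> 'x" where
  "noise_a t h \<omega> = (\<Sum>m=1..M. coeff_a (W m) t h \<omega> *\<^sub>R g1 m (X2 t \<omega>))"

lemma ord_noise_a: "ord 1 (\<lambda>t h \<omega> s. noise_a t h \<omega>)"
  unfolding noise_a_def by (intro ord_sum ord_scaleR[OF ord_ab(1) ord_g(3)]) auto

lemma ord_s1: "ord 2 (\<lambda>t h \<omega> s. (s1 t h \<omega> - X1 t \<omega>) - noise_a t h \<omega>)" "ord 1 (\<lambda>t h \<omega> s. s1 t h \<omega> - X1 t \<omega>)"
    "ord 0 (\<lambda>t h \<omega> s. g2 (s1 t h \<omega>))"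
proof -
  show 1: "ord 2 (\<lambda>t h \<omega> s. (s1 t h \<omega> - X1 t \<omega>) - noise_a t h \<omega>)"
    by (rule ord_cong[OF ord_scaleR[OF ord_h'(4) ord_g(3)[of 0]]]) (auto simp: st1_def noise_a_def)
  show 2: "ord 1 (\<lambda>t h \<omega> s. s1 t h \<omega> - X1 t \<omega>)"
    by (rule ord_cong[OF ord_add[OF ord_weaken[OF 1, of 1] ord_noise_a]]) auto
  have "ord 0 (\<lambda>t h \<omega> s. s1 t h \<omega>)"
    by (rule ord_cong[OF ord_add[OF ord_weaken[OF 2, of 0] ord_start[OF ord_X(1)]]]) auto
  then show "ord 0 (\<lambda>t h \<omega> s. g2 (s1 t h \<omega>))" by (rule ord_growth[OF g2])
qed

lemma ord_G1: "ord 2 (\<lambda>t h \<omega> s. g2 (s1 t h \<omega>) - g2 (X1 t \<omega>) - D1 g2 (X1 t \<omega>) (noise_a t h \<omega>))"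
  by (rule ord_taylor1[OF g2 ord_s1(2) _ ord_s1(1)]) simp

lemma ord_s2: "ord 2 (\<lambda>t h \<omega> s. s2 t h \<omega> - X2 t \<omega>)"
    "ord 3 (\<lambda>t h \<omega> s. (s2 t h \<omega> - X2 t \<omega>) - (2*h/3) *\<^sub>R g2 (X1 t \<omega>))"
    "ord 4 (\<lambda>t h \<omega> s. (s2 t h \<omega> - X2 t \<omega>) - (2*h/3) *\<^sub>R (g2 (X1 t \<omega>) + D1 g2 (X1 t \<omega>) (noise_a t h \<omega>)))"
proof -
  show "ord 2 (\<lambda>t h \<omega> s. s2 t h \<omega> - X2 t \<omega>)"
    by (rule ord_cong[OF ord_scaleR[OF ord_h'(2) ord_s1(3)]]) (auto simp: st2_def)
  show "ord 3 (\<lambda>t h \<omega> s. (s2 t h \<omega> - X2 t \<omega>) - (2*h/3) *\<^sub>R g2 (X1 t \<omega>))"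
    by (rule ord_cong[OF ord_scaleR[OF ord_h'(2) ord_lipschitz[OF g2 ord_s1(2)]]]) (auto simp: st2_def scaleR_diff_right)
  show "ord 4 (\<lambda>t h \<omega> s. (s2 t h \<omega> - X2 t \<omega>) - (2*h/3) *\<^sub>R (g2 (X1 t \<omega>) + D1 g2 (X1 t \<omega>) (noise_a t h \<omega>)))"
    by (rule ord_cong[OF ord_scaleR[OF ord_h'(2) ord_G1]]) (auto simp: st2_def scaleR_diff_right scaleR_add_right)
qed

lemma ord_H1: "ord 3 (\<lambda>t h \<omega> s. g2 (s1 t h \<omega>) - g2 (X1 t \<omega>)
    - D1 g2 (X1 t \<omega>) (noise_a t h \<omega> + (h/4) *\<^sub>R g1 0 (X2 t \<omega>)) - (1/2) *\<^sub>R D2 g2 (X1 t \<omega>) (noise_a t h \<omega>) (noise_a t h \<omega>))"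
proof (rule ord_taylor2[OF g2 ord_noise_a])
  show "ord 2 (\<lambda>t h \<omega> s. (h/4) *\<^sub>R g1 0 (X2 t \<omega>))" by (rule ord_scaleR[OF ord_h'(4) ord_g(3)]) auto
  show "ord 3 (\<lambda>t h \<omega> s. (s1 t h \<omega> - X1 t \<omega>) - (noise_a t h \<omega> + (h/4) *\<^sub>R g1 0 (X2 t \<omega>)))"
    \<comment> \<open>The first stage evaluates \<open>g1\<close> at \<open>X2 t\<close> alone, so
      its increment is exact and nothing remains.\<close>
    by (rule ord_cong[OF ord_0]) (auto simp: st1_def noise_a_def)
qed

text \<open>With all coefficients frozen at \<open>X2 t\<close>, the two evaluations in the last
  stage merge: the noise weights add up to dW, the drift weights to h/4 + 3h/4. Evaluating at
  \<open>s2\<close> instead adds terms of order 3/2 or higher.\<close>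

lemma ord_H3: "ord 3 (\<lambda>t h \<omega> s. g2 (s3 t h \<omega>) - g2 (X1 t \<omega>)
    - D1 g2 (X1 t \<omega>) (noise t \<omega> (t+h) + h *\<^sub>R g1 0 (X2 t \<omega>)) - (1/2) *\<^sub>R D2 g2 (X1 t \<omega>) (noise t \<omega> (t+h)) (noise t \<omega> (t+h)))"
proof (rule ord_taylor2[OF g2 ord_end[OF ord_noise]])
  show "ord 2 (\<lambda>t h \<omega> s. h *\<^sub>R g1 0 (X2 t \<omega>))" by (rule ord_scaleR[OF ord_h'(1) ord_g(3)]) auto
  have g: "ord 2 (\<lambda>t h \<omega> s. g1 m (s2 t h \<omega>) - g1 m (X2 t \<omega>))" if "m \<in> {0..M}" for m
    by (rule ord_lipschitz[OF g1[OF that] ord_s2(1)])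
  have "ord 3 (\<lambda>t h \<omega> s. (3*h/4) *\<^sub>R (g1 0 (s2 t h \<omega>) - g1 0 (X2 t \<omega>)) + (\<Sum>m=1..M. coeff_b (W m) t h \<omega> *\<^sub>R (g1 m (s2 t h \<omega>) - g1 m (X2 t \<omega>))))"
    by (intro ord_add ord_sum ord_scaleR[OF ord_h'(5) g] ord_scaleR[OF ord_ab(2) g]) auto
  then show "ord 3 (\<lambda>t h \<omega> s. (s3 t h \<omega> - X1 t \<omega>) - (noise t \<omega> (t+h) + h *\<^sub>R g1 0 (X2 t \<omega>)))"
  proof (rule ord_cong)
    fix t h \<omega> s
    have 1: "h *\<^sub>R g1 0 (X2 t \<omega>) = (h/4) *\<^sub>R g1 0 (X2 t \<omega>) + (3*h/4) *\<^sub>R g1 0 (X2 t \<omega>)"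
      by (simp flip: scaleR_add_left)
    have 2: "noise t \<omega> (t+h) = (\<Sum>m=1..M. coeff_a (W m) t h \<omega> *\<^sub>R g1 m (X2 t \<omega>) + coeff_b (W m) t h \<omega> *\<^sub>R g1 m (X2 t \<omega>))"
      unfolding noise_def dW_def[symmetric] coeff_sum[symmetric] by (simp add: scaleR_add_left)
    show "(s3 t h \<omega> - X1 t \<omega>) - (noise t \<omega> (t+h) + h *\<^sub>R g1 0 (X2 t \<omega>)) =
      (3*h/4) *\<^sub>R (g1 0 (s2 t h \<omega>) - g1 0 (X2 t \<omega>)) + (\<Sum>m=1..M. coeff_b (W m) t h \<omega> *\<^sub>R (g1 m (s2 t h \<omega>) - g1 m (X2 t \<omega>)))"
      unfolding 1 2 st3_def by (simp add: sum.distrib sum_subtractf scaleR_diff_right)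
  qed
qed

section \<open>Local error and its conditionally centred part\<close>

definition WW :: "nat \<Rightarrow> nat \<Rightarrow> real \<Rightarrow> real \<Rightarrow> 'a \<Rightarrow> real" where
  "WW m l t h \<omega> = integral {t..t+h} (\<lambda>u. (W m u \<omega> - W m t \<omega>) * (W l u \<omega> - W l t \<omega>))"

text \<open>The defects of the method on the double integrals of order \<open>h\<^sup>2\<close>. They do not vanish
  pathwise, but have conditional mean zero.\<close>

definition Q2 :: "nat \<Rightarrow> nat \<Rightarrow> real \<Rightarrow> real \<Rightarrow> 'a \<Rightarrow> real" where
  "Q2 m l t h \<omega> = (1/2) * (WW m l t h \<omega> - (2*h/3) * (coeff_a (W m) t h \<omega> * coeff_a (W l) t h \<omega>)
     - (h/3) * (dW (W m) t h \<omega> * dW (W l) t h \<omega>))"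

definition Q1 :: "nat \<Rightarrow> nat \<Rightarrow> real \<Rightarrow> real \<Rightarrow> 'a \<Rightarrow> real" where
  "Q1 m l t h \<omega> = dW (W m) t h \<omega> * J0 (W l) t h \<omega> - WW m l t h \<omega>
     - (2*h/3) * (coeff_b (W m) t h \<omega> * coeff_a (W l) t h \<omega>)"

text \<open>The second factor of a defect, determined at the start of the step. Separating it from
  the random coefficients, which involve only the increments of the step, is what lets conditional
  means be computed.\<close>

definition V2 :: "nat \<Rightarrow> nat \<Rightarrow> real \<Rightarrow> 'a \<Rightarrow> 'y" where
  "V2 m l t \<omega> = D2 g2 (X1 t \<omega>) (g1 m (X2 t \<omega>)) (g1 l (X2 t \<omega>))"

definition V1 :: "nat \<Rightarrow> nat \<Rightarrow> real \<Rightarrow> 'a \<Rightarrow> 'x" where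
  "V1 m l t \<omega> = D1 (g1 m) (X2 t \<omega>) (D1 g2 (X1 t \<omega>) (g1 l (X2 t \<omega>)))"

definition mart1 :: "real \<Rightarrow> real \<Rightarrow> 'a \<Rightarrow> 'x" where
  "mart1 t h \<omega> = (\<Sum>m=1..M. \<Sum>l=1..M. Q1 m l t h \<omega> *\<^sub>R V1 m l t \<omega>)"

definition mart2 :: "real \<Rightarrow> real \<Rightarrow> 'a \<Rightarrow> 'y" where
  "mart2 t h \<omega> = (\<Sum>m=1..M. \<Sum>l=1..M. Q2 m l t h \<omega> *\<^sub>R V2 m l t \<omega>)"

lemma D2_sums:
  "D2 g2 x (\<Sum>m=1..M. c m *\<^sub>R G m) (\<Sum>m=1..M. c m *\<^sub>R G m) = (\<Sum>m=1..M. \<Sum>l=1..M. (c m * c l) *\<^sub>R D2 g2 x (G m) (G l))"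
  unfolding bilinear_sum[OF bilinear_D2[OF g2_smooth]] sum.cartesian_product
  by (simp add: bilinear_lmul[OF bilinear_D2[OF g2_smooth]] bilinear_rmul[OF bilinear_D2[OF g2_smooth]] mult.commute)

text \<open>The second-order expansion of \<open>g2\<close> along the exact path is integrated in
  time and compared with those at two stages, weighted by 2h/3 and h/3. Terms linear in the noise
  cancel because these weights turn \<open>coeff_a\<close> and dW into \<open>J0\<close>, drift
  terms because (2/3)(1/4) + 1/3 = 1/2. The terms quadratic in the noise leave
  \<open>mart2\<close>.\<close>

lemma local_error_2:
  "ord 5 (\<lambda>t h \<omega> s. X2 (t+h) \<omega> - (X2 t \<omega> + (2*h/3) *\<^sub>R g2 (s1 t h \<omega>) + (h/3) *\<^sub>R g2 (s3 t h \<omega>)) - mart2 t h \<omega>)"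
proof (rule ord_cong)
  let ?E = "\<lambda>t \<omega> s. g2 (X1 s \<omega>) - g2 (X1 t \<omega>)
    - D1 g2 (X1 t \<omega>) (noise t \<omega> s + (s - t) *\<^sub>R g1 0 (X2 t \<omega>)) - (1/2) *\<^sub>R D2 g2 (X1 t \<omega>) (noise t \<omega> s) (noise t \<omega> s)"
  let ?F = "\<lambda>t h \<omega>. g2 (s1 t h \<omega>) - g2 (X1 t \<omega>)
    - D1 g2 (X1 t \<omega>) (noise_a t h \<omega> + (h/4) *\<^sub>R g1 0 (X2 t \<omega>)) - (1/2) *\<^sub>R D2 g2 (X1 t \<omega>) (noise_a t h \<omega>) (noise_a t h \<omega>)"
  let ?G = "\<lambda>t h \<omega>. g2 (s3 t h \<omega>) - g2 (X1 t \<omega>)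
    - D1 g2 (X1 t \<omega>) (noise t \<omega> (t+h) + h *\<^sub>R g1 0 (X2 t \<omega>)) - (1/2) *\<^sub>R D2 g2 (X1 t \<omega>) (noise t \<omega> (t+h)) (noise t \<omega> (t+h))"
  have I: "ord 5 (\<lambda>t h \<omega> s. integral {t..t+h} (?E t \<omega>))"
    by (rule ord_end[OF ord_integral[OF ord_F3]]) simp
  have J: "ord 5 (\<lambda>t h \<omega> s. (2*h/3) *\<^sub>R ?F t h \<omega>)" by (rule ord_scaleR[OF ord_h'(2) ord_H1]) simp
  have K: "ord 5 (\<lambda>t h \<omega> s. (h/3) *\<^sub>R ?G t h \<omega>)" by (rule ord_scaleR[OF ord_h'(3) ord_H3]) simp
  show "ord 5 (\<lambda>t h \<omega> s. integral {t..t+h} (?E t \<omega>) - (2*h/3) *\<^sub>R ?F t h \<omega> - (h/3) *\<^sub>R ?G t h \<omega>)"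
    by (rule ord_diff[OF ord_diff[OF I J] K])
  fix t h \<omega> s assume a: "admissible t h \<omega>" and "s \<in> {t..t+h}"
  have e: "t + h \<in> {t..t+h}" using a by (simp add: admissible_def)
  note A = admissible_time[OF a e]
  define Am where "Am m = D1 g2 (X1 t \<omega>) (g1 m (X2 t \<omega>))" for m
  define II where "II = (\<Sum>m=1..M. \<Sum>l=1..M. WW m l t h \<omega> *\<^sub>R V2 m l t \<omega>)"
  define aa where "aa = (\<Sum>m=1..M. \<Sum>l=1..M. (coeff_a (W m) t h \<omega> * coeff_a (W l) t h \<omega>) *\<^sub>R V2 m l t \<omega>)"
  define dd where "dd = (\<Sum>m=1..M. \<Sum>l=1..M. (dW (W m) t h \<omega> * dW (W l) t h \<omega>) *\<^sub>R V2 m l t \<omega>)"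
  define JA where "JA = (\<Sum>m=1..M. J0 (W m) t h \<omega> *\<^sub>R Am m)"
  define aA where "aA = (\<Sum>m=1..M. coeff_a (W m) t h \<omega> *\<^sub>R Am m)"
  define dA where "dA = (\<Sum>m=1..M. dW (W m) t h \<omega> *\<^sub>R Am m)"
  have D: "D1 g2 (X1 t \<omega>) (\<Sum>m=1..M. c m *\<^sub>R g1 m (X2 t \<omega>)) = (\<Sum>m=1..M. c m *\<^sub>R Am m)" for c
    unfolding Am_def by (simp add: linear_sum[OF linear_D1(1)] linear_cmul[OF linear_D1(1)])
  have Dadd: "D1 g2 (X1 t \<omega>) (v + c *\<^sub>R g1 0 (X2 t \<omega>)) = D1 g2 (X1 t \<omega>) v + c *\<^sub>R Am 0" for v c
    unfolding Am_def by (simp add: linear_add[OF linear_D1(1)] linear_cmul[OF linear_D1(1)])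
  have E: "?E t \<omega> u = g2 (X1 u \<omega>) - g2 (X1 t \<omega>) - ((\<Sum>m=1..M. (W m u \<omega> - W m t \<omega>) *\<^sub>R Am m) + (u - t) *\<^sub>R Am 0)
      - (1/2) *\<^sub>R (\<Sum>m=1..M. \<Sum>l=1..M. ((W m u \<omega> - W m t \<omega>) * (W l u \<omega> - W l t \<omega>)) *\<^sub>R V2 m l t \<omega>)" for u
    unfolding Dadd unfolding noise_def D D2_sums V2_def ..
  have F: "?F t h \<omega> = g2 (s1 t h \<omega>) - g2 (X1 t \<omega>) - (aA + (h/4) *\<^sub>R Am 0) - (1/2) *\<^sub>R aa"
    unfolding Dadd unfolding noise_a_def D D2_sums V2_def aA_def aa_def ..
  have G: "?G t h \<omega> = g2 (s3 t h \<omega>) - g2 (X1 t \<omega>) - (dA + h *\<^sub>R Am 0) - (1/2) *\<^sub>R dd"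
    unfolding Dadd unfolding noise_def D D2_sums V2_def dA_def dd_def dW_def ..
  have "((?E t \<omega>) has_integral (X2 (t+h) \<omega> - X2 t \<omega>) - (t + h - t) *\<^sub>R g2 (X1 t \<omega>) - (JA + ((t + h - t)\<^sup>2/2) *\<^sub>R Am 0) - (1/2) *\<^sub>R II) {t..t+h}"
    unfolding E
  proof (intro has_integral_diff has_integral_add has_integral_cmul)
    show "((\<lambda>u. g2 (X1 u \<omega>)) has_integral X2 (t+h) \<omega> - X2 t \<omega>) {t..t+h}" by (rule integral_g2[OF a e])
    show "((\<lambda>u. g2 (X1 t \<omega>)) has_integral (t + h - t) *\<^sub>R g2 (X1 t \<omega>)) {t..t+h}"
      using has_integral_const_real[of "g2 (X1 t \<omega>)" t "t+h"] A by simp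
    show "((\<lambda>u. \<Sum>m=1..M. (W m u \<omega> - W m t \<omega>) *\<^sub>R Am m) has_integral JA) {t..t+h}"
      unfolding JA_def J0_def by (intro has_integral_sum has_integral_scaleR_left has_integral_W A) auto
    show "((\<lambda>u. (u - t) *\<^sub>R Am 0) has_integral ((t + h - t)\<^sup>2/2) *\<^sub>R Am 0) {t..t+h}"
      using A by (intro has_integral_scaleR_left has_integral_time) auto
    show "((\<lambda>u. \<Sum>m=1..M. \<Sum>l=1..M. ((W m u \<omega> - W m t \<omega>) * (W l u \<omega> - W l t \<omega>)) *\<^sub>R V2 m l t \<omega>) has_integral II) {t..t+h}"
      unfolding II_def WW_def by (intro has_integral_sum has_integral_scaleR_left has_integral_W A) auto
  qed
  from integral_unique[OF this]
  have IE: "integral {t..t+h} (?E t \<omega>) = X2 (t+h) \<omega> - X2 t \<omega> - h *\<^sub>R g2 (X1 t \<omega>) - (JA + (h\<^sup>2/2) *\<^sub>R Am 0) - (1/2) *\<^sub>R II" by simp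
  have 1: "JA = (2*h/3) *\<^sub>R aA + (h/3) *\<^sub>R dA"
    unfolding JA_def aA_def dA_def scaleR_sum_right sum.distrib[symmetric]
    using A by (intro sum.cong refl) (simp add: J0_coeff[of h] scaleR_add_left)
  have 2: "mart2 t h \<omega> = (1/2) *\<^sub>R II - (2*h/3) *\<^sub>R ((1/2) *\<^sub>R aa) - (h/3) *\<^sub>R ((1/2) *\<^sub>R dd)"
    unfolding mart2_def II_def aa_def dd_def scaleR_sum_right sum_subtractf[symmetric] Q2_def
    by (intro sum.cong refl) (simp add: scaleR_diff_left[symmetric] right_diff_distrib)
  show "X2 (t+h) \<omega> - (X2 t \<omega> + (2*h/3) *\<^sub>R g2 (s1 t h \<omega>) + (h/3) *\<^sub>R g2 (s3 t h \<omega>)) - mart2 t h \<omega>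
    = integral {t..t+h} (?E t \<omega>) - (2*h/3) *\<^sub>R ?F t h \<omega> - (h/3) *\<^sub>R ?G t h \<omega>"
    unfolding IE F G by (rule step_combination_2[OF 1 2])
qed

text \<open>Integration by parts splits the diffusion into a boundary term at the end of the step
  and a time integral; the method replaces both by values at \<open>X2 t\<close> and
  \<open>s2\<close>. Factors of order 1 stand in front, so remainders of order 4 suffice for the
  boundary and stage terms, and of order 2 under the integral, which gains two half orders itself.
  The terms with one noise factor cancel by the identities of the weights; those with two leave
  \<open>mart1\<close>.\<close>

lemma local_error_1: "ord 5 (\<lambda>t h \<omega> s. X1 (t+h) \<omega> - s3 t h \<omega> - mart1 t h \<omega>)"
proof (rule ord_cong)
  let ?A = "\<lambda>l t \<omega>. D1 g2 (X1 t \<omega>) (g1 l (X2 t \<omega>))"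
  \<comment> \<open>Five remainders: \<open>?I0\<close> for the drift integral, \<open>?T1\<close>
    for the boundary term, \<open>?T2\<close> for the time integral produced by integration by
    parts, and \<open>?T3\<close> and \<open>?T4\<close> for drift and diffusion at the stage
    \<open>s2\<close>.\<close>
  let ?I0 = "\<lambda>t h \<omega>. integral {t..t+h} (\<lambda>u. g1 0 (X2 u \<omega>) - g1 0 (X2 t \<omega>) - D1 (g1 0) (X2 t \<omega>) ((u - t) *\<^sub>R g2 (X1 t \<omega>)))"
  let ?T1 = "\<lambda>m t h \<omega>. g1 m (X2 (t+h) \<omega>) - g1 m (X2 t \<omega>) - D1 (g1 m) (X2 t \<omega>) ((t + h - t) *\<^sub>R g2 (X1 t \<omega>)
     + (\<Sum>l=1..M. integral {t..t+h} (\<lambda>u. W l u \<omega> - W l t \<omega>) *\<^sub>R ?A l t \<omega>))"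
  let ?T2 = "\<lambda>m t h \<omega>. integral {t..t+h} (\<lambda>u. (W m u \<omega> - W m t \<omega>) *\<^sub>R (dG m u \<omega> - D1 (g1 m) (X2 t \<omega>) (g2 (X1 t \<omega>) + D1 g2 (X1 t \<omega>) (noise t \<omega> u))))"
  let ?T3 = "\<lambda>t h \<omega>. g1 0 (s2 t h \<omega>) - g1 0 (X2 t \<omega>) - D1 (g1 0) (X2 t \<omega>) ((2*h/3) *\<^sub>R g2 (X1 t \<omega>))"
  let ?T4 = "\<lambda>m t h \<omega>. g1 m (s2 t h \<omega>) - g1 m (X2 t \<omega>) - D1 (g1 m) (X2 t \<omega>) ((2*h/3) *\<^sub>R (g2 (X1 t \<omega>) + D1 g2 (X1 t \<omega>) (noise_a t h \<omega>)))"
  have I0: "ord 5 (\<lambda>t h \<omega> s. ?I0 t h \<omega>)"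
    by (rule ord_end[OF ord_integral[OF ord_taylor1[OF g1 ord_E1 _ ord_E4]]]) auto
  have T1: "ord 4 (\<lambda>t h \<omega> s. ?T1 m t h \<omega>)" if "m \<in> {0..M}" for m
    by (rule ord_taylor1[OF g1[OF that] ord_E1_end _ ord_end[OF ord_E5]]) auto
  have T2: "ord 5 (\<lambda>t h \<omega> s. ?T2 m t h \<omega>)" if m: "m \<in> {1..M}" for m
  proof -
    note m0 = g1m[OF m]
    have a: "ord 2 (\<lambda>t h \<omega> s. dG m s \<omega> - D1 (g1 m) (X2 t \<omega>) (g2 (X1 s \<omega>)))"
      by (rule ord_dominated2[OF ord_E1 ord_g(1), of 2 L])
        (use g1[OF m0] L in \<open>auto simp: taylor_bounded_def dG_def mult.assoc\<close>)
    have b: "ord 2 (\<lambda>t h \<omega> s. D1 (g1 m) (X2 t \<omega>) (g2 (X1 s \<omega>) - g2 (X1 t \<omega>) - D1 g2 (X1 t \<omega>) (noise t \<omega> s)))"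
      by (rule ord_D1[OF g1[OF m0] ord_F2])
    have c: "ord 2 (\<lambda>t h \<omega> s. dG m s \<omega> - D1 (g1 m) (X2 t \<omega>) (g2 (X1 t \<omega>) + D1 g2 (X1 t \<omega>) (noise t \<omega> s)))"
      by (rule ord_cong[OF ord_add[OF a b]]) (simp add: linear_diff[OF linear_D1(2)[OF m0]] linear_add[OF linear_D1(2)[OF m0]])
    show ?thesis
      by (rule ord_end[OF ord_integral[OF ord_scaleR[OF ord_W[OF m] c, of 3]]]) auto
  qed
  have T3: "ord 3 (\<lambda>t h \<omega> s. ?T3 t h \<omega>)"
    by (rule ord_taylor1[OF g1 ord_s2(1) _ ord_s2(2)]) auto
  have T4: "ord 4 (\<lambda>t h \<omega> s. ?T4 m t h \<omega>)" if "m \<in> {0..M}" for m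
    by (rule ord_taylor1[OF g1[OF that] ord_s2(1) _ ord_s2(3)]) auto
  show "ord 5 (\<lambda>t h \<omega> s. (?I0 t h \<omega> - (3*h/4) *\<^sub>R ?T3 t h \<omega>) + (\<Sum>m=1..M. dW (W m) t h \<omega> *\<^sub>R ?T1 m t h \<omega> - ?T2 m t h \<omega> - coeff_b (W m) t h \<omega> *\<^sub>R ?T4 m t h \<omega>))"
    by (intro ord_add ord_diff ord_sum I0 ord_scaleR[OF ord_h'(5) T3] ord_scaleR[OF ord_dW T1] T2 ord_scaleR[OF ord_ab(2) T4]) auto
  fix t h \<omega> s assume a: "admissible t h \<omega>" and "s \<in> {t..t+h}"
  have e: "t + h \<in> {t..t+h}" using a by (simp add: admissible_def)
  note A = admissible_time[OF a e]
  define D0 where "D0 = D1 (g1 0) (X2 t \<omega>) (g2 (X1 t \<omega>))"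
  define U where "U m = D1 (g1 m) (X2 t \<omega>) (g2 (X1 t \<omega>))" for m
  define K where "K m = integral {t..t+h} (\<lambda>u. (W m u \<omega> - W m t \<omega>) *\<^sub>R dG m u \<omega>)" for m
  define SJ where "SJ m = (\<Sum>l=1..M. J0 (W l) t h \<omega> *\<^sub>R V1 m l t \<omega>)" for m
  define SI where "SI m = (\<Sum>l=1..M. WW m l t h \<omega> *\<^sub>R V1 m l t \<omega>)" for m
  define Sa where "Sa m = (\<Sum>l=1..M. coeff_a (W l) t h \<omega> *\<^sub>R V1 m l t \<omega>)" for m
  define Ig where "Ig = integral {t..t+h} (\<lambda>u. g1 0 (X2 u \<omega>))"
  have DV: "D1 (g1 m) (X2 t \<omega>) (\<Sum>l=1..M. c l *\<^sub>R ?A l t \<omega>) = (\<Sum>l=1..M. c l *\<^sub>R V1 m l t \<omega>)" if "m \<in> {1..M}" for m c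
    unfolding V1_def by (simp add: linear_sum[OF linear_D1(2)[OF g1m[OF that]]] linear_cmul[OF linear_D1(2)[OF g1m[OF that]]])
  have e0: "?I0 t h \<omega> = Ig - h *\<^sub>R g1 0 (X2 t \<omega>) - (h\<^sup>2/2) *\<^sub>R D0"
  proof -
    have "((\<lambda>u. g1 0 (X2 u \<omega>) - g1 0 (X2 t \<omega>) - (u - t) *\<^sub>R D0) has_integral
      Ig - (t + h - t) *\<^sub>R g1 0 (X2 t \<omega>) - ((t + h - t)\<^sup>2/2) *\<^sub>R D0) {t..t+h}"
    proof (intro has_integral_diff)
      show "((\<lambda>u. g1 0 (X2 u \<omega>)) has_integral Ig) {t..t+h}"
        unfolding Ig_def using A by (intro integrable_integral integrable_continuous_real g_cont) auto
      show "((\<lambda>u. g1 0 (X2 t \<omega>)) has_integral (t + h - t) *\<^sub>R g1 0 (X2 t \<omega>)) {t..t+h}"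
        using has_integral_const_real[of "g1 0 (X2 t \<omega>)" t "t+h"] A by simp
      show "((\<lambda>u. (u - t) *\<^sub>R D0) has_integral ((t + h - t)\<^sup>2/2) *\<^sub>R D0) {t..t+h}"
        using A by (intro has_integral_scaleR_left has_integral_time) auto
    qed
    from integral_unique[OF this] show ?thesis
      unfolding D0_def by (simp add: linear_cmul[OF linear_D1(2)])
  qed
  have e3: "?T3 t h \<omega> = g1 0 (s2 t h \<omega>) - g1 0 (X2 t \<omega>) - (2*h/3) *\<^sub>R D0"
    unfolding D0_def by (simp add: linear_cmul[OF linear_D1(2)])
  have e1: "?T1 m t h \<omega> = g1 m (X2 (t+h) \<omega>) - g1 m (X2 t \<omega>) - (h *\<^sub>R U m + SJ m)" if m: "m \<in> {1..M}" for m
    unfolding U_def SJ_def J0_def linear_add[OF linear_D1(2)[OF g1m[OF m]]] DV[OF m] linear_cmul[OF linear_D1(2)[OF g1m[OF m]]] by simp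
  have e4: "?T4 m t h \<omega> = g1 m (s2 t h \<omega>) - g1 m (X2 t \<omega>) - (2*h/3) *\<^sub>R (U m + Sa m)" if m: "m \<in> {1..M}" for m
  proof -
    have "D1 g2 (X1 t \<omega>) (noise_a t h \<omega>) = (\<Sum>l=1..M. coeff_a (W l) t h \<omega> *\<^sub>R ?A l t \<omega>)"
      unfolding noise_a_def by (simp add: linear_sum[OF linear_D1(1)] linear_cmul[OF linear_D1(1)])
    then show ?thesis
      unfolding U_def Sa_def by (simp only: linear_cmul[OF linear_D1(2)[OF g1m[OF m]]] linear_add[OF linear_D1(2)[OF g1m[OF m]]] DV[OF m])
  qed
  have e2: "?T2 m t h \<omega> = K m - J0 (W m) t h \<omega> *\<^sub>R U m - SI m" if m: "m \<in> {1..M}" for m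
  proof -
    have "((\<lambda>u. (W m u \<omega> - W m t \<omega>) *\<^sub>R dG m u \<omega> - (W m u \<omega> - W m t \<omega>) *\<^sub>R U m
       - (\<Sum>l=1..M. ((W m u \<omega> - W m t \<omega>) * (W l u \<omega> - W l t \<omega>)) *\<^sub>R V1 m l t \<omega>)) has_integral
       K m - J0 (W m) t h \<omega> *\<^sub>R U m - SI m) {t..t+h}"
    proof (intro has_integral_diff)
      show "((\<lambda>u. (W m u \<omega> - W m t \<omega>) *\<^sub>R dG m u \<omega>) has_integral K m) {t..t+h}"
        unfolding K_def using A m by (intro integrable_integral integrable_continuous_real continuous_intros W_cont dG_cont) auto
      show "((\<lambda>u. (W m u \<omega> - W m t \<omega>) *\<^sub>R U m) has_integral J0 (W m) t h \<omega> *\<^sub>R U m) {t..t+h}"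
        unfolding J0_def by (intro has_integral_scaleR_left has_integral_W A m)
      show "((\<lambda>u. \<Sum>l=1..M. ((W m u \<omega> - W m t \<omega>) * (W l u \<omega> - W l t \<omega>)) *\<^sub>R V1 m l t \<omega>) has_integral SI m) {t..t+h}"
        unfolding SI_def WW_def by (intro has_integral_sum has_integral_scaleR_left has_integral_W A m) auto
    qed
    moreover have "(W m u \<omega> - W m t \<omega>) *\<^sub>R (dG m u \<omega> - D1 (g1 m) (X2 t \<omega>) (g2 (X1 t \<omega>) + D1 g2 (X1 t \<omega>) (noise t \<omega> u)))
      = (W m u \<omega> - W m t \<omega>) *\<^sub>R dG m u \<omega> - (W m u \<omega> - W m t \<omega>) *\<^sub>R U m
       - (\<Sum>l=1..M. ((W m u \<omega> - W m t \<omega>) * (W l u \<omega> - W l t \<omega>)) *\<^sub>R V1 m l t \<omega>)" for u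
      unfolding D1_noise linear_add[OF linear_D1(2)[OF g1m[OF m]]] DV[OF m] U_def
      by (simp only: scaleR_diff_right scaleR_add_right scaleR_sum_right scaleR_scaleR diff_diff_eq)
    ultimately show ?thesis by (simp only: integral_unique)
  qed
  have Xeq: "X1 (t+h) \<omega> = X1 t \<omega> + Ig + (\<Sum>m=1..M. dW (W m) t h \<omega> *\<^sub>R g1 m (X2 (t+h) \<omega>) - K m)"
    unfolding good_step(2)[OF A(1,3,4,5)] Ig_def K_def dW_def ..
  have Meq: "mart1 t h \<omega> = (\<Sum>m=1..M. dW (W m) t h \<omega> *\<^sub>R SJ m - SI m - (coeff_b (W m) t h \<omega> * (2*h/3)) *\<^sub>R Sa m)"
    unfolding mart1_def SJ_def SI_def Sa_def scaleR_sum_right sum_subtractf[symmetric] Q1_def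
    by (intro sum.cong refl) (simp add: scaleR_diff_left mult_ac)
  \<comment> \<open>The weight 3h/4 at the node 2h/3 yields h^2/2, so the quadrature is exact for
    functions linear in time.\<close>
  have drift: "Ig - (h/4) *\<^sub>R g1 0 (X2 t \<omega>) - (3*h/4) *\<^sub>R g1 0 (s2 t h \<omega>) = ?I0 t h \<omega> - (3*h/4) *\<^sub>R ?T3 t h \<omega>"
  proof -
    have 1: "h *\<^sub>R g1 0 (X2 t \<omega>) = (h/4) *\<^sub>R g1 0 (X2 t \<omega>) + (3*h/4) *\<^sub>R g1 0 (X2 t \<omega>)" by (simp flip: scaleR_add_left)
    have 2: "(3*h/4) *\<^sub>R ((2*h/3) *\<^sub>R D0) = (h\<^sup>2/2) *\<^sub>R D0" by (simp add: power2_eq_square)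
    show ?thesis unfolding e0 e3 1 scaleR_diff_right 2 by simp
  qed
  have "X1 (t+h) \<omega> - s3 t h \<omega> - mart1 t h \<omega> = (Ig - (h/4) *\<^sub>R g1 0 (X2 t \<omega>) - (3*h/4) *\<^sub>R g1 0 (s2 t h \<omega>))
     + (\<Sum>m=1..M. dW (W m) t h \<omega> *\<^sub>R g1 m (X2 (t+h) \<omega>) - K m - (coeff_a (W m) t h \<omega> *\<^sub>R g1 m (X2 t \<omega>) + coeff_b (W m) t h \<omega> *\<^sub>R g1 m (s2 t h \<omega>))
        - (dW (W m) t h \<omega> *\<^sub>R SJ m - SI m - (coeff_b (W m) t h \<omega> * (2*h/3)) *\<^sub>R Sa m))"
    unfolding Xeq Meq st3_def by (simp only: sum_subtractf) (simp add: algebra_simps)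
  also have "(\<Sum>m=1..M. dW (W m) t h \<omega> *\<^sub>R g1 m (X2 (t+h) \<omega>) - K m - (coeff_a (W m) t h \<omega> *\<^sub>R g1 m (X2 t \<omega>) + coeff_b (W m) t h \<omega> *\<^sub>R g1 m (s2 t h \<omega>))
        - (dW (W m) t h \<omega> *\<^sub>R SJ m - SI m - (coeff_b (W m) t h \<omega> * (2*h/3)) *\<^sub>R Sa m))
     = (\<Sum>m=1..M. dW (W m) t h \<omega> *\<^sub>R ?T1 m t h \<omega> - ?T2 m t h \<omega> - coeff_b (W m) t h \<omega> *\<^sub>R ?T4 m t h \<omega>)"
  proof (rule sum.cong[OF refl])
    fix m assume m: "m \<in> {1..M}"
    show "dW (W m) t h \<omega> *\<^sub>R g1 m (X2 (t+h) \<omega>) - K m - (coeff_a (W m) t h \<omega> *\<^sub>R g1 m (X2 t \<omega>) + coeff_b (W m) t h \<omega> *\<^sub>R g1 m (s2 t h \<omega>))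
        - (dW (W m) t h \<omega> *\<^sub>R SJ m - SI m - (coeff_b (W m) t h \<omega> * (2*h/3)) *\<^sub>R Sa m)
      = dW (W m) t h \<omega> *\<^sub>R ?T1 m t h \<omega> - ?T2 m t h \<omega> - coeff_b (W m) t h \<omega> *\<^sub>R ?T4 m t h \<omega>"
      unfolding e1[OF m] e2[OF m] e4[OF m]
      by (rule step_combination_1[OF coeff_sum[symmetric] coeff_b_J0]) (use A in simp)
  qed
  finally show "X1 (t+h) \<omega> - s3 t h \<omega> - mart1 t h \<omega> =
    (?I0 t h \<omega> - (3*h/4) *\<^sub>R ?T3 t h \<omega>) + (\<Sum>m=1..M. dW (W m) t h \<omega> *\<^sub>R ?T1 m t h \<omega> - ?T2 m t h \<omega> - coeff_b (W m) t h \<omega> *\<^sub>R ?T4 m t h \<omega>)"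
    unfolding drift .
qed

lemma ord_mart: "ord 4 (\<lambda>t h \<omega> s. mart1 t h \<omega>)" "ord 4 (\<lambda>t h \<omega> s. mart2 t h \<omega>)"
proof -
  have WW: "ord 4 (\<lambda>t h \<omega> s. WW m l t h \<omega>)" if "m \<in> {1..M}" "l \<in> {1..M}" for m l
    unfolding WW_def by (rule ord_end[OF ord_integral[OF ord_mult[OF ord_W ord_W, of _ _ 2]]]) (use that in auto)
  have aa: "ord 2 (\<lambda>t h \<omega> s. coeff_a (W m) t h \<omega> * coeff_a (W l) t h \<omega>)"
    "ord 2 (\<lambda>t h \<omega> s. coeff_b (W m) t h \<omega> * coeff_a (W l) t h \<omega>)"
    "ord 2 (\<lambda>t h \<omega> s. dW (W m) t h \<omega> * dW (W l) t h \<omega>)"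
    "ord 4 (\<lambda>t h \<omega> s. dW (W m) t h \<omega> * J0 (W l) t h \<omega>)" if "m \<in> {1..M}" "l \<in> {1..M}" for m l
    using that by (auto intro!: ord_mult[OF ord_ab(1) ord_ab(1)] ord_mult[OF ord_ab(2) ord_ab(1)] ord_mult[OF ord_dW ord_dW] ord_mult[OF ord_dW ord_J0])
  have Q1: "ord 4 (\<lambda>t h \<omega> s. Q1 m l t h \<omega>)" if "m \<in> {1..M}" "l \<in> {1..M}" for m l
    unfolding Q1_def by (intro ord_diff aa WW that ord_mult[OF ord_h'(2) aa(2)]) auto
  have Q2: "ord 4 (\<lambda>t h \<omega> s. Q2 m l t h \<omega>)" if "m \<in> {1..M}" "l \<in> {1..M}" for m l
    unfolding Q2_def using ord_cmult[of 4 "\<lambda>t h \<omega> s. WW m l t h \<omega> - (2*h/3) * (coeff_a (W m) t h \<omega> * coeff_a (W l) t h \<omega>)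
     - (h/3) * (dW (W m) t h \<omega> * dW (W l) t h \<omega>)" "1/2"] ord_diff[OF ord_diff[OF WW[OF that] ord_mult[OF ord_h'(2) aa(1)[OF that]]] ord_mult[OF ord_h'(3) aa(3)[OF that]]]
    by simp
  have V1: "ord 0 (\<lambda>t h \<omega> s. V1 m l t \<omega>)" if "m \<in> {1..M}" "l \<in> {1..M}" for m l
    unfolding V1_def by (rule ord_D1[OF g1 ord_D1[OF g2 ord_g(3)]]) (use that in auto)
  have V2: "ord 0 (\<lambda>t h \<omega> s. V2 m l t \<omega>)" if "m \<in> {1..M}" "l \<in> {1..M}" for m l
    unfolding V2_def by (rule ord_D2[OF g2 ord_g(3) ord_g(3)]) (use that in auto)
  show "ord 4 (\<lambda>t h \<omega> s. mart1 t h \<omega>)"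
    unfolding mart1_def by (intro ord_sum ord_scaleR[OF Q1 V1]) auto
  show "ord 4 (\<lambda>t h \<omega> s. mart2 t h \<omega>)"
    unfolding mart2_def by (intro ord_sum ord_scaleR[OF Q2 V2]) auto
qed

end

subsection \<open>Stability of one step\<close>

text \<open>A second difference: along the segment from \<open>x\<close> to \<open>y\<close>, the
  derivative of f(z + k) - f(z) is a difference of first derivatives at distance \<open>k\<close>,
  which the Lipschitz bound for \<open>D1\<close> controls.\<close>

lemma mixed_difference_bound:
  assumes "taylor_bounded L f"
  shows "norm ((f (y + k) - f y) - (f (x + k) - f x)) \<le> L * norm k * norm (y - x)"
proof -
  have f: "smooth_bounded_derivs f" using assms by (simp add: taylor_bounded_def)
  have lip: "norm (D1 f (z + k) v - D1 f z v) \<le> L * norm k * norm v" for z v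
    using assms unfolding taylor_bounded_def by (metis add_diff_cancel_left')
  let ?p = "\<lambda>t. f ((x + k) + t *\<^sub>R (y - x)) - f (x + t *\<^sub>R (y - x))"
  have "norm (?p 1 - ?p 0) \<le> L * norm k * norm (y - x)"
  proof (rule unit_interval_bound)
    fix t :: real
    show "(?p has_vector_derivative D1 f ((x + k) + t *\<^sub>R (y - x)) (y - x) - D1 f (x + t *\<^sub>R (y - x)) (y - x)) (at t)"
      by (intro has_vector_derivative_diff smooth_line_deriv f)
    show "norm (D1 f ((x + k) + t *\<^sub>R (y - x)) (y - x) - D1 f (x + t *\<^sub>R (y - x)) (y - x)) \<le> L * norm k * norm (y - x)"
      using lip[of "x + t *\<^sub>R (y - x)" "y - x"] by (simp add: add_ac)
  qed
  then show ?thesis by (simp add: add_ac)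
qed

lemma norm_square_add_le:
  fixes a b c :: "'c::real_inner"
  shows "(norm (a + b + c))\<^sup>2 \<le> 3 * ((norm a)\<^sup>2 + (norm b)\<^sup>2 + (norm c)\<^sup>2)"
proof -
  have "(norm (a + b + c))\<^sup>2 \<le> (norm a + norm b + norm c)\<^sup>2"
    by (intro power_mono norm_triangle_le add_right_mono norm_triangle_ineq) auto
  also have "\<dots> \<le> 3 * ((norm a)\<^sup>2 + (norm b)\<^sup>2 + (norm c)\<^sup>2)"
    using sum_squares_bound[of "norm a" "norm b"] sum_squares_bound[of "norm a" "norm c"] sum_squares_bound[of "norm b" "norm c"]
    by (simp add: power2_eq_square algebra_simps)
  finally show ?thesis .
qed

text \<open>The product \<open>e r\<close> is split by Young's inequality with weight \<open>h\<close>.\<close>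

lemma perturbed_square:
  fixes e n r m :: "'c::real_inner"
  assumes h: "0 < h" and e: "norm e \<le> E" and r: "norm r \<le> \<alpha> * E + \<beta>" and n: "norm n \<le> \<nu> * E" and m: "norm m \<le> \<mu>"
    and pos: "0 \<le> \<alpha>" "0 \<le> \<beta>" "0 \<le> \<nu>"
  shows "(norm (e + n + r - m))\<^sup>2 \<le> (norm e)\<^sup>2 + 2 * (e \<bullet> n) - 2 * (e \<bullet> m)
    + E\<^sup>2 * (2 * \<alpha> + h + 3 * \<nu>\<^sup>2 + 6 * \<alpha>\<^sup>2) + (\<beta>\<^sup>2 / h + 6 * \<beta>\<^sup>2 + 3 * \<mu>\<^sup>2)"
proof -
  have E0: "0 \<le> E" using e norm_ge_zero order_trans by blast
  have "(norm (e + n + r - m))\<^sup>2 = (norm e)\<^sup>2 + 2 * (e \<bullet> n) - 2 * (e \<bullet> m) + 2 * (e \<bullet> r) + (norm (n + r + - m))\<^sup>2"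
    unfolding power2_norm_eq_inner by (simp add: inner_add_left inner_add_right inner_diff_left inner_diff_right inner_commute)
  moreover have "2 * (e \<bullet> r) \<le> E\<^sup>2 * (2 * \<alpha> + h) + \<beta>\<^sup>2 / h"
  proof -
    have "e \<bullet> r \<le> norm e * norm r" by (rule norm_cauchy_schwarz)
    also have "\<dots> \<le> E * (\<alpha> * E + \<beta>)" using e r E0 by (intro mult_mono) auto
    finally have 1: "2 * (e \<bullet> r) \<le> 2 * \<alpha> * E\<^sup>2 + 2 * E * \<beta>" by (simp add: power2_eq_square algebra_simps)
    have "2 * (sqrt h * E) * (\<beta> / sqrt h) \<le> (sqrt h * E)\<^sup>2 + (\<beta> / sqrt h)\<^sup>2" by (rule sum_squares_bound)
    then have "2 * E * \<beta> \<le> h * E\<^sup>2 + \<beta>\<^sup>2 / h" using h by (simp add: power_mult_distrib power_divide field_simps)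
    with 1 show ?thesis by (simp add: algebra_simps)
  qed
  moreover have "(norm (n + r + - m))\<^sup>2 \<le> E\<^sup>2 * (3 * \<nu>\<^sup>2 + 6 * \<alpha>\<^sup>2) + (6 * \<beta>\<^sup>2 + 3 * \<mu>\<^sup>2)"
  proof -
    have "(norm n)\<^sup>2 \<le> (\<nu> * E)\<^sup>2" "(norm r)\<^sup>2 \<le> (\<alpha> * E + \<beta>)\<^sup>2" "(norm m)\<^sup>2 \<le> \<mu>\<^sup>2"
      using n r m by (intro power_mono; simp)+
    moreover have "(\<alpha> * E + \<beta>)\<^sup>2 \<le> 2 * (\<alpha> * E)\<^sup>2 + 2 * \<beta>\<^sup>2"
      using sum_squares_bound[of "\<alpha> * E" \<beta>] by (simp add: power2_sum)
    ultimately show ?thesis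
      using norm_square_add_le[of n r "- m"] by (simp add: power_mult_distrib algebra_simps)
  qed
  ultimately show ?thesis by (simp add: algebra_simps)
qed

text \<open>An increment bounded both by \<open>r\<^sup>2\<close> and by \<open>r\<^sup>2 E\<close> with random constant \<open>b\<close>: trading one bound
  for the other removes \<open>b\<close> from the factor of \<open>E\<close>, so that \<open>E\<close> and \<open>b\<close> need not be independent.\<close>

lemma interpolated_bound:
  fixes b r E :: real
  assumes "0 \<le> b" "0 \<le> r" "0 \<le> E" "z \<le> b * r\<^sup>2 * E" "z \<le> b * r\<^sup>2"
  shows "r * z \<le> r\<^sup>2 * E + b ^ 3 * r ^ 5"
proof (cases "b * r \<le> 1")
  case True
  have "r * z \<le> r * (b * r\<^sup>2 * E)" using assms by (intro mult_left_mono)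
  also have "\<dots> = (b * r) * (r\<^sup>2 * E)" by (simp add: power2_eq_square)
  also have "\<dots> \<le> 1 * (r\<^sup>2 * E)" using True assms by (intro mult_right_mono) auto
  finally show ?thesis using assms by (simp add: add_increasing2)
next
  case False
  have "r * z \<le> r * (b * r\<^sup>2)" using assms by (intro mult_left_mono)
  \<comment> \<open>Here b r > 1, so two additional factors b r only enlarge the right-hand
    side.\<close>
  also have "\<dots> \<le> r * (b * r\<^sup>2) * (b * r)\<^sup>2"
  proof -
    have "1 \<le> (b * r)\<^sup>2" using False by (intro one_le_power) simp
    then have "r * (b * r\<^sup>2) * 1 \<le> r * (b * r\<^sup>2) * (b * r)\<^sup>2"
      using assms by (intro mult_left_mono) auto
    then show ?thesis by simp
  qed
  also have "\<dots> = b ^ 3 * r ^ 5" by (simp add: power2_eq_square power3_eq_cube eval_nat_numeral)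
  finally show ?thesis using assms by (simp add: add_increasing)
qed

context separable_solution
begin

text \<open>The only part of the propagated error of relative size \<open>sqrt h\<close>. For
  \<open>v\<close> known at time \<open>t\<close> it is a combination of increments with
  coefficients known at \<open>t\<close>, so it has conditional mean zero and enters the mean square
  through its own square, which is of relative size h.\<close>

definition mart_noise :: "real \<Rightarrow> real \<Rightarrow> 'a \<Rightarrow> 'y \<Rightarrow> 'x" where
  "mart_noise t h \<omega> v = (\<Sum>m=1..M. dW (W m) t h \<omega> *\<^sub>R (g1 m v - g1 m (X2 t \<omega>)))"

lemma g_lipschitz:
  "norm (g2 u - g2 u') \<le> L * norm (u - u')" "m \<in> {0..M} \<Longrightarrow> norm (g1 m v - g1 m v') \<le> L * norm (v - v')"
proof -
  show "norm (g2 u - g2 u') \<le> L * norm (u - u')" using g2 unfolding taylor_bounded_def by simp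
  assume "m \<in> {0..M}"
  then show "norm (g1 m v - g1 m v') \<le> L * norm (v - v')" using g1[of m] unfolding taylor_bounded_def by simp
qed

lemma mart_noise_bound:
  assumes a: "admissible t h \<omega>"
  shows "norm (mart_noise t h \<omega> v) \<le> L * q t h \<omega> * norm (v - X2 t \<omega>)"
proof -
  have e: "t + h \<in> {t..t+h}" using a by (simp add: admissible_def)
  note A = admissible_time[OF a e]
  have "norm (mart_noise t h \<omega> v) \<le> (\<Sum>m=1..M. \<bar>dW (W m) t h \<omega>\<bar> * (L * norm (v - X2 t \<omega>)))"
    unfolding mart_noise_def
  proof (rule sum_norm_le)
    fix m assume "m \<in> {1..M}"
    then show "norm (dW (W m) t h \<omega> *\<^sub>R (g1 m v - g1 m (X2 t \<omega>))) \<le> \<bar>dW (W m) t h \<omega>\<bar> * (L * norm (v - X2 t \<omega>))"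
      unfolding norm_scaleR by (intro mult_left_mono g_lipschitz(2)) auto
  qed
  also have "\<dots> = (\<Sum>m=1..M. \<bar>W m (t+h) \<omega> - W m t \<omega>\<bar>) * (L * norm (v - X2 t \<omega>))"
    by (simp add: sum_distrib_right dW_def)
  also have "\<dots> \<le> q t h \<omega> * (L * norm (v - X2 t \<omega>))"
    using rho_ge[OF A(2,3) e] rho_le_q[OF a] L by (intro mult_right_mono) auto
  finally show ?thesis by (simp add: mult_ac)
qed

text \<open>Lipschitz bounds passed from stage to stage; with p = 1 + q each stage adds a factor
  p^2, as h is at most p^2 and the weights are of size p. The random factor is a polynomial in
  \<open>q\<close> and does not involve \<open>big\<close>, so it depends on the current step
  alone.\<close>

lemma stage_differences:
  obtains C where "C \<ge> 0"
    "\<And>t h \<omega> u v E. admissible t h \<omega> \<Longrightarrow> norm (u - X1 t \<omega>) \<le> E \<Longrightarrow> norm (v - X2 t \<omega>) \<le> E \<Longrightarrow>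
      norm (st1 t h \<omega> u v - s1 t h \<omega>) \<le> C * (1 + q t h \<omega>) ^ 6 * E \<and>
      norm (st2 t h \<omega> u v - s2 t h \<omega>) \<le> C * (1 + q t h \<omega>) ^ 6 * E \<and>
      norm (st3 t h \<omega> u v - s3 t h \<omega>) \<le> C * (1 + q t h \<omega>) ^ 6 * E"
proof -
  define c1 where "c1 = 1 + L + 2 * real M * L"
  define c2 where "c2 = 1 + L * c1"
  define c3 where "c3 = 1 + L + L * c2 + 2 * real M * L + 3 * real M * L * c2"
  have c: "c1 \<ge> 0" "c2 \<ge> 0" "c3 \<ge> 0" unfolding c3_def c2_def c1_def using L by (simp_all add: add_nonneg_nonneg)
  show thesis
  proof (rule that[of "c1 + c2 + c3"])
    show "0 \<le> c1 + c2 + c3" using c by simp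
    fix t h \<omega> u v E
    assume a: "admissible t h \<omega>" and u: "norm (u - X1 t \<omega>) \<le> E" and v: "norm (v - X2 t \<omega>) \<le> E"
    have e: "t + h \<in> {t..t+h}" using a by (simp add: admissible_def)
    note A = admissible_time[OF a e]
    define r where "r = q t h \<omega>"
    define p where "p = 1 + r"
    have r0: "0 \<le> r" unfolding r_def using q_pos[OF a] by simp
    have p1: "1 \<le> p" "r \<le> p" unfolding p_def using r0 by auto
    have E0: "0 \<le> E" using u norm_ge_zero order_trans by blast
    have h: "0 \<le> h" "h \<le> r\<^sup>2" unfolding r_def using A h_le_q[OF a] by auto
    have hp: "h \<le> p ^ 2" using h p1 r0 by (meson order_trans power_mono)
    have pm: "p ^ i \<le> p ^ j" if "i \<le> j" for i j using p1 that by (intro power_increasing) auto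
    have pp: "1 \<le> p ^ i" for i using p1 by (simp add: one_le_power)
    have ab: "\<bar>coeff_a (W m) t h \<omega>\<bar> \<le> 2 * p" "\<bar>coeff_b (W m) t h \<omega>\<bar> \<le> 3 * p" if "m \<in> {1..M}" for m
      using coeff_bounds(3,4)[OF A(2,3,6) that] rho_le_q[OF a] p1 unfolding r_def[symmetric] by linarith+
    have G: "norm (g1 m v - g1 m (X2 t \<omega>)) \<le> L * E" if "m \<in> {0..M}" for m
    proof -
      have "L * norm (v - X2 t \<omega>) \<le> L * E" using v L by (intro mult_left_mono) auto
      then show ?thesis using g_lipschitz(2)[OF that, of v "X2 t \<omega>"] by linarith
    qed
    have hG: "norm ((h/4) *\<^sub>R (g1 0 v - g1 0 (X2 t \<omega>))) \<le> p ^ 2 * (L * E)"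
    proof -
      have "norm ((h/4) *\<^sub>R (g1 0 v - g1 0 (X2 t \<omega>))) = h/4 * norm (g1 0 v - g1 0 (X2 t \<omega>))" using h by simp
      also have "\<dots> \<le> p ^ 2 * (L * E)" using G[of 0] hp h E0 L by (intro mult_mono) auto
      finally show ?thesis .
    qed
    have aG: "norm (\<Sum>m=1..M. coeff_a (W m) t h \<omega> *\<^sub>R (g1 m v - g1 m (X2 t \<omega>))) \<le> real M * (2 * p * (L * E))"
    proof -
      have "norm (\<Sum>m=1..M. coeff_a (W m) t h \<omega> *\<^sub>R (g1 m v - g1 m (X2 t \<omega>))) \<le> (\<Sum>m=1..M. 2 * p * (L * E))"
        using ab(1) G p1 by (intro sum_norm_le) (auto intro!: mult_mono)
      then show ?thesis by simp
    qed
    have "st1 t h \<omega> u v - s1 t h \<omega> = (u - X1 t \<omega>) + (h/4) *\<^sub>R (g1 0 v - g1 0 (X2 t \<omega>))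
       + (\<Sum>m=1..M. coeff_a (W m) t h \<omega> *\<^sub>R (g1 m v - g1 m (X2 t \<omega>)))"
      unfolding st1_def by (simp add: scaleR_diff_right sum_subtractf)
    then have "norm (st1 t h \<omega> u v - s1 t h \<omega>) \<le> E + p ^ 2 * (L * E) + real M * (2 * p * (L * E))"
      using u hG aG by (metis (no_types, lifting) add_mono norm_triangle_mono)
    also have "\<dots> \<le> p ^ 2 * E + p ^ 2 * (L * E) + real M * (2 * p ^ 2 * (L * E))"
      using pm[of 1 2] pp[of 2] E0 L by (intro add_mono mult_left_mono mult_right_mono mult_le_cancel_right1[THEN iffD2]) auto
    also have "\<dots> = c1 * p ^ 2 * E" unfolding c1_def by (simp add: algebra_simps)
    finally have d1: "norm (st1 t h \<omega> u v - s1 t h \<omega>) \<le> c1 * p ^ 2 * E" .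
    have d2: "norm (st2 t h \<omega> u v - s2 t h \<omega>) \<le> c2 * p ^ 4 * E"
    proof -
      have "st2 t h \<omega> u v - s2 t h \<omega> = (v - X2 t \<omega>) + (2*h/3) *\<^sub>R (g2 (st1 t h \<omega> u v) - g2 (s1 t h \<omega>))"
        unfolding st2_def by (simp add: scaleR_diff_right)
      moreover have "norm ((2*h/3) *\<^sub>R (g2 (st1 t h \<omega> u v) - g2 (s1 t h \<omega>))) \<le> p ^ 2 * (L * (c1 * p ^ 2 * E))"
      proof -
        have "norm (g2 (st1 t h \<omega> u v) - g2 (s1 t h \<omega>)) \<le> L * (c1 * p ^ 2 * E)"
          using g_lipschitz(1) mult_left_mono[OF d1, of L] L by (meson order_trans zero_le_one)
        then have "2*h/3 * norm (g2 (st1 t h \<omega> u v) - g2 (s1 t h \<omega>)) \<le> p ^ 2 * (L * (c1 * p ^ 2 * E))"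
          using hp h by (intro mult_mono) auto
        then show ?thesis using h by simp
      qed
      ultimately have "norm (st2 t h \<omega> u v - s2 t h \<omega>) \<le> E + p ^ 2 * (L * (c1 * p ^ 2 * E))"
        using v by (metis norm_triangle_mono)
      also have "\<dots> \<le> p ^ 4 * E + p ^ 2 * (L * (c1 * p ^ 2 * E))"
        using mult_right_mono[OF pp[of 4] E0] by simp
      also have "\<dots> = c2 * p ^ 4 * E" unfolding c2_def by (simp add: algebra_simps flip: power_add)
      finally show ?thesis .
    qed
    have d3: "norm (st3 t h \<omega> u v - s3 t h \<omega>) \<le> c3 * p ^ 6 * E"
    proof -
      let ?S = "\<lambda>m. g1 m (st2 t h \<omega> u v) - g1 m (s2 t h \<omega>)"
      have S: "norm (?S m) \<le> L * (c2 * p ^ 4 * E)" if "m \<in> {0..M}" for m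
        using g_lipschitz(2)[OF that] mult_left_mono[OF d2, of L] L by (meson order_trans zero_le_one)
      have "st3 t h \<omega> u v - s3 t h \<omega> = ((st1 t h \<omega> u v - s1 t h \<omega>) + (3*h/4) *\<^sub>R ?S 0) + (\<Sum>m=1..M. coeff_b (W m) t h \<omega> *\<^sub>R ?S m)"
        unfolding st3_def st1_def by (simp add: scaleR_diff_right sum_subtractf sum.distrib)
      moreover have "norm ((3*h/4) *\<^sub>R ?S 0) \<le> p ^ 2 * (L * (c2 * p ^ 4 * E))"
      proof -
        have "3*h/4 * norm (?S 0) \<le> p ^ 2 * (L * (c2 * p ^ 4 * E))" using S[of 0] hp h by (intro mult_mono) auto
        then show ?thesis using h by simp
      qed
      moreover have "norm (\<Sum>m=1..M. coeff_b (W m) t h \<omega> *\<^sub>R ?S m) \<le> real M * (3 * p * (L * (c2 * p ^ 4 * E)))"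
      proof -
        have "norm (\<Sum>m=1..M. coeff_b (W m) t h \<omega> *\<^sub>R ?S m) \<le> (\<Sum>m=1..M. 3 * p * (L * (c2 * p ^ 4 * E)))"
          using ab(2) S p1 by (intro sum_norm_le) (auto intro!: mult_mono)
        then show ?thesis by simp
      qed
      ultimately have "norm (st3 t h \<omega> u v - s3 t h \<omega>) \<le> c1 * p ^ 2 * E + p ^ 2 * (L * (c2 * p ^ 4 * E)) + real M * (3 * p * (L * (c2 * p ^ 4 * E)))"
        using d1 by (metis (no_types, lifting) norm_triangle_mono)
      also have "\<dots> = c1 * E * p ^ 2 + L * c2 * E * p ^ 6 + 3 * real M * L * c2 * E * p ^ 5"
        by (simp add: algebra_simps eval_nat_numeral)
      also have "\<dots> \<le> c1 * E * p ^ 6 + L * c2 * E * p ^ 6 + 3 * real M * L * c2 * E * p ^ 6"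
        using pm[of 2 6] pm[of 5 6] c L E0 by (intro add_mono mult_left_mono) auto
      also have "\<dots> = c3 * p ^ 6 * E" unfolding c3_def c1_def by (simp add: algebra_simps)
      finally show ?thesis .
    qed
    have w: "x \<le> (c1 + c2 + c3) * p ^ 6 * E" if "x \<le> ci * p ^ i * E" "i \<le> 6" "ci \<ge> 0" "ci \<le> c1 + c2 + c3" for x ci i
    proof -
      have "ci * p ^ i * E \<le> (c1 + c2 + c3) * p ^ 6 * E"
        using that pm[of i 6] E0 c p1 by (intro mult_right_mono mult_mono) auto
      then show ?thesis using that by linarith
    qed
    show "norm (st1 t h \<omega> u v - s1 t h \<omega>) \<le> (c1 + c2 + c3) * (1 + q t h \<omega>) ^ 6 * E \<and>
      norm (st2 t h \<omega> u v - s2 t h \<omega>) \<le> (c1 + c2 + c3) * (1 + q t h \<omega>) ^ 6 * E \<and>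
      norm (st3 t h \<omega> u v - s3 t h \<omega>) \<le> (c1 + c2 + c3) * (1 + q t h \<omega>) ^ 6 * E"
      using w[OF d1] w[OF d2] w[OF d3] c unfolding p_def r_def by simp
  qed
qed

text \<open>After removal of the initial error and of \<open>mart_noise\<close>, the propagated
  error is of relative size q^2. The second stage brings in the path-dependent constant
  \<open>big\<close>; \<open>interpolated_bound\<close> moves it into the additive term, leaving a
  polynomial in \<open>q\<close> in front of \<open>E\<close>.\<close>

lemma step_differences:
  obtains C K j where "C \<ge> 0" "K \<ge> 0"
    "\<And>t h \<omega> u v E. admissible t h \<omega> \<Longrightarrow> norm (u - X1 t \<omega>) \<le> E \<Longrightarrow> norm (v - X2 t \<omega>) \<le> E \<Longrightarrow>
      norm ((st3 t h \<omega> u v - s3 t h \<omega>) - ((u - X1 t \<omega>) + mart_noise t h \<omega> v))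
        \<le> C * (1 + q t h \<omega>) ^ 7 * (q t h \<omega>)\<^sup>2 * E + K * big \<omega> ^ j * q t h \<omega> ^ 5 \<and>
      norm ((2*h/3) *\<^sub>R (g2 (st1 t h \<omega> u v) - g2 (s1 t h \<omega>)) + (h/3) *\<^sub>R (g2 (st3 t h \<omega> u v) - g2 (s3 t h \<omega>)))
        \<le> C * (1 + q t h \<omega>) ^ 7 * (q t h \<omega>)\<^sup>2 * E"
proof -
  obtain C where C: "C \<ge> 0"
    and D: "\<And>t h \<omega> u v E. admissible t h \<omega> \<Longrightarrow> norm (u - X1 t \<omega>) \<le> E \<Longrightarrow> norm (v - X2 t \<omega>) \<le> E \<Longrightarrow>
      norm (st1 t h \<omega> u v - s1 t h \<omega>) \<le> C * (1 + q t h \<omega>) ^ 6 * E \<and>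
      norm (st2 t h \<omega> u v - s2 t h \<omega>) \<le> C * (1 + q t h \<omega>) ^ 6 * E \<and>
      norm (st3 t h \<omega> u v - s3 t h \<omega>) \<le> C * (1 + q t h \<omega>) ^ 6 * E"
    using stage_differences by blast
  obtain K j where K: "K \<ge> 0"
    and k': "\<And>t h \<omega> s. admissible t h \<omega> \<Longrightarrow> s \<in> {t..t+h} \<Longrightarrow> norm (s2 t h \<omega> - X2 t \<omega>) \<le> K * big \<omega> ^ j * (q t h \<omega>)\<^sup>2"
    using ordE[OF ord_s2(1)] by blast
  define C' where "C' = L + L * C + 3 * real M * (L * (L * C)) + 6 * real M * L + L * C"
  show thesis
  proof (rule that[of C' "6 * real M * L * K ^ 3" "3 * j"])
    show "C' \<ge> 0" unfolding C'_def using C L by (simp add: add_nonneg_nonneg)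
    show "6 * real M * L * K ^ 3 \<ge> 0" using K L by simp
    fix t h \<omega> u v E
    assume a: "admissible t h \<omega>" and u: "norm (u - X1 t \<omega>) \<le> E" and v: "norm (v - X2 t \<omega>) \<le> E"
    have e: "t + h \<in> {t..t+h}" using a by (simp add: admissible_def)
    note A = admissible_time[OF a e]
    define r where "r = q t h \<omega>"
    define p where "p = 1 + r"
    define b where "b = K * big \<omega> ^ j"
    define d where "d = C * p ^ 6 * E"
    have r0: "0 \<le> r" unfolding r_def using q_pos[OF a] by simp
    have p1: "1 \<le> p" "r \<le> p" unfolding p_def using r0 by auto
    have E0: "0 \<le> E" using u norm_ge_zero order_trans by blast
    have b0: "0 \<le> b" unfolding b_def using K big_ge_1[OF A(2)] by simp
    have h: "0 \<le> h" "h \<le> r\<^sup>2" unfolding r_def using A h_le_q[OF a] by auto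
    have pm: "p ^ i \<le> p ^ j" if "i \<le> j" for i j using p1 that by (intro power_increasing) auto
    have d0: "0 \<le> d" unfolding d_def using C p1 E0 by simp
    have D': "norm (st1 t h \<omega> u v - s1 t h \<omega>) \<le> d" "norm (st2 t h \<omega> u v - s2 t h \<omega>) \<le> d" "norm (st3 t h \<omega> u v - s3 t h \<omega>) \<le> d"
      using D[OF a u v] unfolding d_def p_def r_def by auto
    have Lm: "x \<le> L * y \<Longrightarrow> y \<le> z \<Longrightarrow> x \<le> L * z" for x y z :: real
      using L mult_left_mono[of y z L] by linarith
    have g2d: "norm (g2 (st1 t h \<omega> u v) - g2 (s1 t h \<omega>)) \<le> L * d" "norm (g2 (st3 t h \<omega> u v) - g2 (s3 t h \<omega>)) \<le> L * d"
      using Lm[OF g_lipschitz(1) D'(1)] Lm[OF g_lipschitz(1) D'(3)] .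
    have rd: "r\<^sup>2 * (L * d) = L * C * (p ^ 6 * r\<^sup>2 * E)" unfolding d_def by simp
    have p67: "p ^ 6 * r\<^sup>2 * E \<le> p ^ 7 * r\<^sup>2 * E" using pm[of 6 7] E0 by (intro mult_right_mono) auto
    have p07: "r\<^sup>2 * E \<le> p ^ 7 * r\<^sup>2 * E" using pm[of 0 7] E0 mult_right_mono[of 1 "p ^ 7" "r\<^sup>2 * E"] by (simp add: mult.assoc)
    have pos7: "0 \<le> p ^ 7 * r\<^sup>2 * E" using p1 E0 by simp
    have second: "norm ((2*h/3) *\<^sub>R (g2 (st1 t h \<omega> u v) - g2 (s1 t h \<omega>)) + (h/3) *\<^sub>R (g2 (st3 t h \<omega> u v) - g2 (s3 t h \<omega>))) \<le> L * C * (p ^ 7 * r\<^sup>2 * E)"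
    proof -
      have "norm ((2*h/3) *\<^sub>R (g2 (st1 t h \<omega> u v) - g2 (s1 t h \<omega>))) \<le> 2*h/3 * (L * d)"
        "norm ((h/3) *\<^sub>R (g2 (st3 t h \<omega> u v) - g2 (s3 t h \<omega>))) \<le> h/3 * (L * d)"
        using g2d h by (simp_all add: mult_left_mono)
      then have "norm ((2*h/3) *\<^sub>R (g2 (st1 t h \<omega> u v) - g2 (s1 t h \<omega>)) + (h/3) *\<^sub>R (g2 (st3 t h \<omega> u v) - g2 (s3 t h \<omega>))) \<le> 2*h/3 * (L * d) + h/3 * (L * d)"
        by (rule norm_triangle_mono)
      also have "\<dots> = h * (L * d)" by (simp add: algebra_simps)
      also have "\<dots> \<le> r\<^sup>2 * (L * d)" using h L d0 by (intro mult_right_mono) auto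
      also have "\<dots> \<le> L * C * (p ^ 7 * r\<^sup>2 * E)" unfolding rd using p67 L C by (intro mult_left_mono) auto
      finally show ?thesis .
    qed
    let ?Z = "\<lambda>m. (g1 m (st2 t h \<omega> u v) - g1 m (s2 t h \<omega>)) - (g1 m v - g1 m (X2 t \<omega>))"
    have G0: "norm (g1 0 v - g1 0 (X2 t \<omega>)) \<le> L * E" by (rule Lm[OF g_lipschitz(2) v]) simp
    have S0: "norm (g1 0 (st2 t h \<omega> u v) - g1 0 (s2 t h \<omega>)) \<le> L * d" by (rule Lm[OF g_lipschitz(2) D'(2)]) simp
    have bZ: "norm (coeff_b (W m) t h \<omega> *\<^sub>R ?Z m) \<le> 3 * (L * (L * C)) * (p ^ 7 * r\<^sup>2 * E) + 6 * L * (p ^ 7 * r\<^sup>2 * E) + 6 * L * (b ^ 3 * r ^ 5)"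
      if m: "m \<in> {1..M}" for m
    proof -
      note m0 = g1m[OF m]
      define k where "k = st2 t h \<omega> u v - v"
      define k0 where "k0 = s2 t h \<omega> - X2 t \<omega>"
      have kk: "norm (k - k0) \<le> r\<^sup>2 * (L * d)"
      proof -
        have "k - k0 = (2*h/3) *\<^sub>R (g2 (st1 t h \<omega> u v) - g2 (s1 t h \<omega>))"
          unfolding k_def k0_def st2_def by (simp add: scaleR_diff_right)
        then have "norm (k - k0) = 2*h/3 * norm (g2 (st1 t h \<omega> u v) - g2 (s1 t h \<omega>))" using h by simp
        also have "\<dots> \<le> r\<^sup>2 * (L * d)" using g2d(1) h by (intro mult_mono) auto
        finally show ?thesis .
      qed
      \<comment> \<open>The increment \<open>k\<close> of the second stage is compared with its
        counterpart \<open>k0\<close> started on the solution. The last bracket is a second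
        difference with common increment \<open>k0\<close>, bounded in terms of
        \<open>norm k0\<close> both with and without a factor \<open>E\<close>.\<close>
      have Z: "?Z m = (g1 m (v + k) - g1 m (v + k0)) + ((g1 m (v + k0) - g1 m v) - (g1 m (X2 t \<omega> + k0) - g1 m (X2 t \<omega>)))"
        unfolding k_def k0_def by simp
      have n1: "norm (g1 m (v + k) - g1 m (v + k0)) \<le> L * (r\<^sup>2 * (L * d))"
        using Lm[OF g_lipschitz(2)[OF m0, of "v + k" "v + k0"]] kk by simp
      have k0b: "norm k0 \<le> b * r\<^sup>2" using k'[OF a e] unfolding k0_def b_def r_def .
      define z where "z = norm ((g1 m (v + k0) - g1 m v) - (g1 m (X2 t \<omega> + k0) - g1 m (X2 t \<omega>)))"
      have "z \<le> L * norm k0 * norm (v - X2 t \<omega>)" unfolding z_def by (rule mixed_difference_bound[OF g1[OF m0]])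
      also have "\<dots> \<le> L * (b * r\<^sup>2) * E" using k0b v L b0 by (intro mult_mono) auto
      finally have "z \<le> L * (b * r\<^sup>2 * E)" by (simp add: mult_ac)
      moreover have "0 \<le> L * (b * r\<^sup>2 * E)" using L b0 E0 by simp
      moreover have "(b * r\<^sup>2 * E) * (2 * L) = 2 * (L * (b * r\<^sup>2 * E))" by simp
      ultimately have "z \<le> (b * r\<^sup>2 * E) * (2 * L)" by linarith
      \<comment> \<open>Dividing by \<open>2 * L\<close> brings both bounds to the common form
        required by \<open>interpolated_bound\<close>; the 2 is due to the bound without
        \<open>E\<close>, a sum of two Lipschitz estimates.\<close>
      then have z1: "z / (2 * L) \<le> b * r\<^sup>2 * E" using L by (simp only: pos_divide_le_eq)
      have a1: "norm (g1 m (v + k0) - g1 m v) \<le> L * norm k0"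
        using g_lipschitz(2)[OF m0, of "v + k0" v] by simp
      have a2: "norm (g1 m (X2 t \<omega> + k0) - g1 m (X2 t \<omega>)) \<le> L * norm k0"
        using g_lipschitz(2)[OF m0, of "X2 t \<omega> + k0" "X2 t \<omega>"] by simp
      have a3: "L * norm k0 \<le> L * (b * r\<^sup>2)" using k0b L by (intro mult_left_mono) auto
      have a4: "z \<le> norm (g1 m (v + k0) - g1 m v) + norm (g1 m (X2 t \<omega> + k0) - g1 m (X2 t \<omega>))"
        unfolding z_def by (rule norm_triangle_ineq4)
      have "(b * r\<^sup>2) * (2 * L) = 2 * (L * (b * r\<^sup>2))" by simp
      with a1 a2 a3 a4 have "z \<le> (b * r\<^sup>2) * (2 * L)" by linarith
      then have z2: "z / (2 * L) \<le> b * r\<^sup>2" using L by (simp only: pos_divide_le_eq)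
      have "r * (z / (2 * L)) \<le> r\<^sup>2 * E + b ^ 3 * r ^ 5" by (rule interpolated_bound[OF b0 r0 E0 z1 z2])
      then have "2 * L * (r * (z / (2 * L))) \<le> 2 * L * (r\<^sup>2 * E + b ^ 3 * r ^ 5)"
        using L by (intro mult_left_mono) auto
      then have rz: "r * z \<le> 2 * L * (r\<^sup>2 * E + b ^ 3 * r ^ 5)" using L by simp
      have "norm (coeff_b (W m) t h \<omega> *\<^sub>R ?Z m) \<le> (3 * r) * (L * (r\<^sup>2 * (L * d)) + z)"
      proof -
        have "\<bar>coeff_b (W m) t h \<omega>\<bar> \<le> 3 * r" using coeff_bounds(4)[OF A(2,3,6) m] rho_le_q[OF a] unfolding r_def by linarith
        moreover have "norm (?Z m) \<le> L * (r\<^sup>2 * (L * d)) + z"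
          unfolding Z z_def using n1 by (intro norm_triangle_le add_right_mono)
        ultimately show ?thesis using r0 unfolding norm_scaleR by (intro mult_mono) auto
      qed
      also have "\<dots> = 3 * (L * (L * C)) * (r * p ^ 6 * r\<^sup>2 * E) + 3 * (r * z)" unfolding d_def by (simp add: algebra_simps)
      also have "\<dots> \<le> 3 * (L * (L * C)) * (p ^ 7 * r\<^sup>2 * E) + 3 * (2 * L * (p ^ 7 * r\<^sup>2 * E + b ^ 3 * r ^ 5))"
      proof (intro add_mono mult_left_mono)
        have "r * p ^ 6 \<le> p ^ 7" using p1 r0 mult_right_mono[of r p "p ^ 6"] by (simp add: eval_nat_numeral)
        then show "r * p ^ 6 * r\<^sup>2 * E \<le> p ^ 7 * r\<^sup>2 * E" using E0 by (intro mult_right_mono) auto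
        have "2 * L * (r\<^sup>2 * E + b ^ 3 * r ^ 5) \<le> 2 * L * (p ^ 7 * r\<^sup>2 * E + b ^ 3 * r ^ 5)"
          using p07 L by (intro mult_left_mono add_right_mono) auto
        then show "r * z \<le> 2 * L * (p ^ 7 * r\<^sup>2 * E + b ^ 3 * r ^ 5)" using rz by linarith
      qed (use L C in auto)
      finally show ?thesis by (simp add: algebra_simps)
    qed
    have first: "norm ((st3 t h \<omega> u v - s3 t h \<omega>) - ((u - X1 t \<omega>) + mart_noise t h \<omega> v))
       \<le> (L + L * C) * (p ^ 7 * r\<^sup>2 * E) + real M * (3 * (L * (L * C)) * (p ^ 7 * r\<^sup>2 * E) + 6 * L * (p ^ 7 * r\<^sup>2 * E) + 6 * L * (b ^ 3 * r ^ 5))"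
    proof -
      have mn: "mart_noise t h \<omega> v = (\<Sum>m=1..M. coeff_a (W m) t h \<omega> *\<^sub>R (g1 m v - g1 m (X2 t \<omega>)) + coeff_b (W m) t h \<omega> *\<^sub>R (g1 m v - g1 m (X2 t \<omega>)))"
        unfolding mart_noise_def coeff_sum[symmetric] by (simp only: scaleR_add_left)
      have "(st3 t h \<omega> u v - s3 t h \<omega>) - ((u - X1 t \<omega>) + mart_noise t h \<omega> v)
        = ((h/4) *\<^sub>R (g1 0 v - g1 0 (X2 t \<omega>)) + (3*h/4) *\<^sub>R (g1 0 (st2 t h \<omega> u v) - g1 0 (s2 t h \<omega>))) + (\<Sum>m=1..M. coeff_b (W m) t h \<omega> *\<^sub>R ?Z m)"
        unfolding mn st3_def by (simp add: scaleR_diff_right sum_subtractf sum.distrib)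
      moreover have "norm ((h/4) *\<^sub>R (g1 0 v - g1 0 (X2 t \<omega>)) + (3*h/4) *\<^sub>R (g1 0 (st2 t h \<omega> u v) - g1 0 (s2 t h \<omega>))) \<le> r\<^sup>2 * (L * E) + r\<^sup>2 * (L * d)"
      proof (rule norm_triangle_mono)
        have "h/4 * norm (g1 0 v - g1 0 (X2 t \<omega>)) \<le> r\<^sup>2 * (L * E)" using G0 h by (intro mult_mono) auto
        then show "norm ((h/4) *\<^sub>R (g1 0 v - g1 0 (X2 t \<omega>))) \<le> r\<^sup>2 * (L * E)" using h by simp
        have "3*h/4 * norm (g1 0 (st2 t h \<omega> u v) - g1 0 (s2 t h \<omega>)) \<le> r\<^sup>2 * (L * d)" using S0 h by (intro mult_mono) auto
        then show "norm ((3*h/4) *\<^sub>R (g1 0 (st2 t h \<omega> u v) - g1 0 (s2 t h \<omega>))) \<le> r\<^sup>2 * (L * d)" using h by simp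
      qed
      moreover have "r\<^sup>2 * (L * E) + r\<^sup>2 * (L * d) \<le> (L + L * C) * (p ^ 7 * r\<^sup>2 * E)"
      proof -
        have "L * (r\<^sup>2 * E) \<le> L * (p ^ 7 * r\<^sup>2 * E)" "L * C * (p ^ 6 * r\<^sup>2 * E) \<le> L * C * (p ^ 7 * r\<^sup>2 * E)"
          using p07 p67 L C by (intro mult_left_mono; simp)+
        then show ?thesis unfolding rd distrib_right by (simp add: mult_ac)
      qed
      moreover have "norm (\<Sum>m=1..M. coeff_b (W m) t h \<omega> *\<^sub>R ?Z m)
        \<le> (\<Sum>m=1..M. 3 * (L * (L * C)) * (p ^ 7 * r\<^sup>2 * E) + 6 * L * (p ^ 7 * r\<^sup>2 * E) + 6 * L * (b ^ 3 * r ^ 5))"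
        by (rule sum_norm_le) (rule bZ)
      ultimately show ?thesis by (simp add: norm_triangle_mono[THEN order_trans])
    qed
    have b3: "b ^ 3 = K ^ 3 * big \<omega> ^ (3 * j)" unfolding b_def by (simp add: power_mult_distrib flip: power_mult add: mult.commute)
    have "(L + L * C) * (p ^ 7 * r\<^sup>2 * E) + real M * (3 * (L * (L * C)) * (p ^ 7 * r\<^sup>2 * E) + 6 * L * (p ^ 7 * r\<^sup>2 * E) + 6 * L * (b ^ 3 * r ^ 5))
      = (C' - L * C) * (p ^ 7 * r\<^sup>2 * E) + 6 * real M * L * (b ^ 3 * r ^ 5)"
      unfolding C'_def by (simp add: algebra_simps)
    also have "\<dots> \<le> C' * (p ^ 7 * r\<^sup>2 * E) + 6 * real M * L * (b ^ 3 * r ^ 5)"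
      using pos7 L C by (intro add_right_mono mult_right_mono) auto
    finally have 1: "(L + L * C) * (p ^ 7 * r\<^sup>2 * E) + real M * (3 * (L * (L * C)) * (p ^ 7 * r\<^sup>2 * E) + 6 * L * (p ^ 7 * r\<^sup>2 * E) + 6 * L * (b ^ 3 * r ^ 5))
      \<le> C' * p ^ 7 * r\<^sup>2 * E + 6 * real M * L * K ^ 3 * big \<omega> ^ (3 * j) * r ^ 5"
      unfolding b3 by (simp add: mult_ac)
    have 2: "L * C * (p ^ 7 * r\<^sup>2 * E) \<le> C' * p ^ 7 * r\<^sup>2 * E"
    proof -
      have "L * C \<le> C'" unfolding C'_def using L C by (simp add: add_nonneg_nonneg)
      then have "L * C * (p ^ 7 * r\<^sup>2 * E) \<le> C' * (p ^ 7 * r\<^sup>2 * E)" using pos7 by (rule mult_right_mono)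
      then show ?thesis by (simp add: mult_ac)
    qed
    show "norm ((st3 t h \<omega> u v - s3 t h \<omega>) - ((u - X1 t \<omega>) + mart_noise t h \<omega> v))
        \<le> C' * (1 + q t h \<omega>) ^ 7 * (q t h \<omega>)\<^sup>2 * E + 6 * real M * L * K ^ 3 * big \<omega> ^ (3 * j) * q t h \<omega> ^ 5 \<and>
      norm ((2*h/3) *\<^sub>R (g2 (st1 t h \<omega> u v) - g2 (s1 t h \<omega>)) + (h/3) *\<^sub>R (g2 (st3 t h \<omega> u v) - g2 (s3 t h \<omega>)))
        \<le> C' * (1 + q t h \<omega>) ^ 7 * (q t h \<omega>)\<^sup>2 * E"
      using first second 1 2 unfolding p_def r_def by linarith
  qed
qed

end

text \<open>A sum is at most its number of terms times its largest term, so its exponential is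
  dominated by one of the exponentials on the right; the summand 1 covers the empty set. It reduces
  exponentials of \<open>rho\<close> to those of single processes.\<close>

lemma exp_sum_le:
  fixes x :: "'i \<Rightarrow> real"
  assumes "finite A" "0 \<le> c" "\<And>i. i \<in> A \<Longrightarrow> 0 \<le> x i"
  shows "exp (c * sum x A) \<le> 1 + (\<Sum>i\<in>A. exp (c * real (card A) * x i))"
proof (cases "A = {}")
  case False
  define k where "k = Max (x ` A)"
  have "k \<in> x ` A" unfolding k_def using assms(1) False by (intro Max_in) auto
  then obtain i where i: "i \<in> A" "x i = k" by blast
  have "sum x A \<le> real (card A) * k"
    using assms(1) by (intro sum_bounded_above) (auto simp: k_def)
  then have "exp (c * sum x A) \<le> exp (c * real (card A) * x i)"
    using assms(2) i by (simp add: mult_left_mono mult.assoc)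
  also have "\<dots> \<le> (\<Sum>i\<in>A. exp (c * real (card A) * x i))"
    using i assms(1) by (intro member_le_sum) auto
  finally show ?thesis by linarith
qed simp

context separable_solution
begin

text \<open>The square of the error recursion, with three inner products left unestimated because
  they will have mean zero. In front of the squared error stands a function of the current step of
  size h, whereas \<open>big\<close> multiplies quantities of size h^4 only. The quotient
  \<open>q t h \<omega> ^ 10 / h\<close> stems from Young's inequality in
  \<open>perturbed_square\<close>.\<close>

lemma one_step_square:
  obtains K j where "K \<ge> 0"
    "\<And>t h \<omega> u v. admissible t h \<omega> \<Longrightarrow>
      (norm (sprk_step M W g1 g2 t h \<omega> (u, v) - (X1 (t+h) \<omega>, X2 (t+h) \<omega>)))\<^sup>2
      \<le> (norm ((u, v) - (X1 t \<omega>, X2 t \<omega>)))\<^sup>2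
        + 2 * ((u - X1 t \<omega>) \<bullet> mart_noise t h \<omega> v) - 2 * ((u - X1 t \<omega>) \<bullet> mart1 t h \<omega>) - 2 * ((v - X2 t \<omega>) \<bullet> mart2 t h \<omega>)
        + K * ((norm ((u, v) - (X1 t \<omega>, X2 t \<omega>)))\<^sup>2 * ((q t h \<omega>)\<^sup>2 * (1 + q t h \<omega>) ^ 16))
        + K * (big \<omega> ^ j * (q t h \<omega> ^ 10 / h + q t h \<omega> ^ 10 + q t h \<omega> ^ 8))"
proof -
  obtain C Kd jd where C: "C \<ge> 0" and Kd: "Kd \<ge> 0"
    and D: "\<And>t h \<omega> u v E. admissible t h \<omega> \<Longrightarrow> norm (u - X1 t \<omega>) \<le> E \<Longrightarrow> norm (v - X2 t \<omega>) \<le> E \<Longrightarrow>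
      norm ((st3 t h \<omega> u v - s3 t h \<omega>) - ((u - X1 t \<omega>) + mart_noise t h \<omega> v))
        \<le> C * (1 + q t h \<omega>) ^ 7 * (q t h \<omega>)\<^sup>2 * E + Kd * big \<omega> ^ jd * q t h \<omega> ^ 5 \<and>
      norm ((2*h/3) *\<^sub>R (g2 (st1 t h \<omega> u v) - g2 (s1 t h \<omega>)) + (h/3) *\<^sub>R (g2 (st3 t h \<omega> u v) - g2 (s3 t h \<omega>)))
        \<le> C * (1 + q t h \<omega>) ^ 7 * (q t h \<omega>)\<^sup>2 * E"
    using step_differences by blast
  obtain K1 j1 where K1: "K1 \<ge> 0" and l1: "\<And>t h \<omega> s. admissible t h \<omega> \<Longrightarrow> s \<in> {t..t+h} \<Longrightarrow>
     norm (X1 (t+h) \<omega> - s3 t h \<omega> - mart1 t h \<omega>) \<le> K1 * big \<omega> ^ j1 * q t h \<omega> ^ 5"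
    using ordE[OF local_error_1] by blast
  obtain K2 j2 where K2: "K2 \<ge> 0" and l2: "\<And>t h \<omega> s. admissible t h \<omega> \<Longrightarrow> s \<in> {t..t+h} \<Longrightarrow>
     norm (X2 (t+h) \<omega> - (X2 t \<omega> + (2*h/3) *\<^sub>R g2 (s1 t h \<omega>) + (h/3) *\<^sub>R g2 (s3 t h \<omega>)) - mart2 t h \<omega>) \<le> K2 * big \<omega> ^ j2 * q t h \<omega> ^ 5"
    using ordE[OF local_error_2] by blast
  obtain K3 j3 where K3: "K3 \<ge> 0" and m1: "\<And>t h \<omega> s. admissible t h \<omega> \<Longrightarrow> s \<in> {t..t+h} \<Longrightarrow>
     norm (mart1 t h \<omega>) \<le> K3 * big \<omega> ^ j3 * q t h \<omega> ^ 4"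
    using ordE[OF ord_mart(1)] by blast
  obtain K4 j4 where K4: "K4 \<ge> 0" and m2: "\<And>t h \<omega> s. admissible t h \<omega> \<Longrightarrow> s \<in> {t..t+h} \<Longrightarrow>
     norm (mart2 t h \<omega>) \<le> K4 * big \<omega> ^ j4 * q t h \<omega> ^ 4"
    using ordE[OF ord_mart(2)] by blast
  define J where "J = jd + j1 + j2 + j3 + j4"
  define Ks where "Ks = Kd + K1 + K2 + K3 + K4"
  define K where "K = 2 * (2 * C + 1 + 3 * L\<^sup>2 + 6 * C\<^sup>2) + 12 * Ks\<^sup>2"
  show thesis
  proof (rule that[of K "2 * J"])
    show "K \<ge> 0" unfolding K_def using C by (simp add: add_nonneg_nonneg)
    fix t h \<omega> u v assume a: "admissible t h \<omega>"
    have e: "t + h \<in> {t..t+h}" using a by (simp add: admissible_def)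
    note A = admissible_time[OF a e]
    define r where "r = q t h \<omega>"
    define b where "b = big \<omega>"
    define E where "E = norm ((u, v) - (X1 t \<omega>, X2 t \<omega>))"
    define \<alpha> where "\<alpha> = C * (1 + r) ^ 7 * r\<^sup>2"
    define \<beta> where "\<beta> = Ks * b ^ J * r ^ 5"
    define \<mu> where "\<mu> = Ks * b ^ J * r ^ 4"
    have r0: "0 \<le> r" unfolding r_def using q_pos[OF a] by simp
    have b1: "1 \<le> b" unfolding b_def using big_ge_1[OF A(2)] .
    have h: "0 < h" "h \<le> r\<^sup>2" unfolding r_def using A h_le_q[OF a] by auto
    have E1: "norm (u - X1 t \<omega>) \<le> E" "norm (v - X2 t \<omega>) \<le> E" unfolding E_def
      using norm_fst_le[of "u - X1 t \<omega>" "v - X2 t \<omega>"] norm_snd_le[of "v - X2 t \<omega>" "u - X1 t \<omega>"] by simp_all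
    have E2: "E\<^sup>2 = (norm (u - X1 t \<omega>))\<^sup>2 + (norm (v - X2 t \<omega>))\<^sup>2" unfolding E_def by (simp add: norm_Pair)
    have E0: "0 \<le> E" unfolding E_def by simp
    have Ks: "0 \<le> Ks" unfolding Ks_def using Kd K1 K2 K3 K4 by simp
    have bJ: "k * b ^ i \<le> k * b ^ J" if "i \<le> J" "0 \<le> k" for k i
      using that b1 by (intro mult_left_mono power_increasing) auto
    have \<alpha>0: "0 \<le> \<alpha>" unfolding \<alpha>_def using C r0 by simp
    have \<beta>0: "0 \<le> \<beta>" unfolding \<beta>_def using Ks r0 b1 by simp
    have le5: "(Kd * b ^ jd + K1 * b ^ j1) * r ^ 5 \<le> \<beta>" "K2 * b ^ j2 * r ^ 5 \<le> \<beta>"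
      "K3 * b ^ j3 * r ^ 4 \<le> \<mu>" "K4 * b ^ j4 * r ^ 4 \<le> \<mu>"
    proof -
      have "Kd * b ^ J + K1 * b ^ J \<le> Ks * b ^ J" "K2 * b ^ J \<le> Ks * b ^ J" "K3 * b ^ J \<le> Ks * b ^ J" "K4 * b ^ J \<le> Ks * b ^ J"
        unfolding distrib_right[symmetric] Ks_def using Kd K1 K2 K3 K4 b1 by (intro mult_right_mono; simp)+
      then have "Kd * b ^ jd + K1 * b ^ j1 \<le> Ks * b ^ J" "K2 * b ^ j2 \<le> Ks * b ^ J" "K3 * b ^ j3 \<le> Ks * b ^ J" "K4 * b ^ j4 \<le> Ks * b ^ J"
        using bJ[of jd Kd] bJ[of j1 K1] bJ[of j2 K2] bJ[of j3 K3] bJ[of j4 K4] Kd K1 K2 K3 K4 unfolding J_def by linarith+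
      then show "(Kd * b ^ jd + K1 * b ^ j1) * r ^ 5 \<le> \<beta>" "K2 * b ^ j2 * r ^ 5 \<le> \<beta>"
        "K3 * b ^ j3 * r ^ 4 \<le> \<mu>" "K4 * b ^ j4 * r ^ 4 \<le> \<mu>"
        unfolding \<beta>_def \<mu>_def using r0 by (intro mult_right_mono; simp)+
    qed
    define R1 where "R1 = ((st3 t h \<omega> u v - s3 t h \<omega>) - ((u - X1 t \<omega>) + mart_noise t h \<omega> v)) - (X1 (t+h) \<omega> - s3 t h \<omega> - mart1 t h \<omega>)"
    define R2 where "R2 = ((2*h/3) *\<^sub>R (g2 (st1 t h \<omega> u v) - g2 (s1 t h \<omega>)) + (h/3) *\<^sub>R (g2 (st3 t h \<omega> u v) - g2 (s3 t h \<omega>)))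
      - (X2 (t+h) \<omega> - (X2 t \<omega> + (2*h/3) *\<^sub>R g2 (s1 t h \<omega>) + (h/3) *\<^sub>R g2 (s3 t h \<omega>)) - mart2 t h \<omega>)"
    note D' = D[OF a E1, folded r_def b_def, folded \<alpha>_def]
    note l' = l1[OF a e, folded r_def b_def] l2[OF a e, folded r_def b_def] m1[OF a e, folded r_def b_def] m2[OF a e, folded r_def b_def]
    have R1: "norm R1 \<le> \<alpha> * E + \<beta>"
    proof -
      have "norm R1 \<le> (\<alpha> * E + Kd * b ^ jd * r ^ 5) + K1 * b ^ j1 * r ^ 5"
        unfolding R1_def by (rule order_trans[OF norm_triangle_ineq4 add_mono[OF conjunct1[OF D'] l'(1)]])
      then show ?thesis using le5(1) by (simp add: distrib_right)
    qed
    have R2: "norm R2 \<le> \<alpha> * E + \<beta>"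
    proof -
      have "norm R2 \<le> \<alpha> * E + K2 * b ^ j2 * r ^ 5"
        unfolding R2_def by (rule order_trans[OF norm_triangle_ineq4 add_mono[OF conjunct2[OF D'] l'(2)]])
      then show ?thesis using le5(2) by simp
    qed
    have mn: "norm (mart_noise t h \<omega> v) \<le> (L * r) * E"
    proof -
      have "(L * r) * norm (v - X2 t \<omega>) \<le> (L * r) * E" using E1(2) L r0 by (intro mult_left_mono) auto
      then show ?thesis using mart_noise_bound[OF a, of v] unfolding r_def by linarith
    qed
    have M1: "norm (mart1 t h \<omega>) \<le> \<mu>" and M2: "norm (mart2 t h \<omega>) \<le> \<mu>" using l'(3,4) le5(3,4) by linarith+
    have Lr: "0 \<le> L * r" using L r0 by simp
    have e1: "st3 t h \<omega> u v - X1 (t+h) \<omega> = (u - X1 t \<omega>) + mart_noise t h \<omega> v + R1 - mart1 t h \<omega>" unfolding R1_def by simp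
    have e2: "(v + (2*h/3) *\<^sub>R g2 (st1 t h \<omega> u v) + (h/3) *\<^sub>R g2 (st3 t h \<omega> u v)) - X2 (t+h) \<omega> = (v - X2 t \<omega>) + 0 + R2 - mart2 t h \<omega>"
      unfolding R2_def by (simp add: scaleR_diff_right)
    have sq: "(norm (sprk_step M W g1 g2 t h \<omega> (u, v) - (X1 (t+h) \<omega>, X2 (t+h) \<omega>)))\<^sup>2
       = (norm ((u - X1 t \<omega>) + mart_noise t h \<omega> v + R1 - mart1 t h \<omega>))\<^sup>2 + (norm ((v - X2 t \<omega>) + 0 + R2 - mart2 t h \<omega>))\<^sup>2"
      unfolding sprk_step_stages diff_Pair e1 e2 by (simp add: norm_Pair)
    have p1: "(norm ((u - X1 t \<omega>) + mart_noise t h \<omega> v + R1 - mart1 t h \<omega>))\<^sup>2 \<le> (norm (u - X1 t \<omega>))\<^sup>2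
       + 2 * ((u - X1 t \<omega>) \<bullet> mart_noise t h \<omega> v) - 2 * ((u - X1 t \<omega>) \<bullet> mart1 t h \<omega>)
       + E\<^sup>2 * (2 * \<alpha> + h + 3 * (L * r)\<^sup>2 + 6 * \<alpha>\<^sup>2) + (\<beta>\<^sup>2 / h + 6 * \<beta>\<^sup>2 + 3 * \<mu>\<^sup>2)"
      by (rule perturbed_square[OF h(1) E1(1) R1 mn M1 \<alpha>0 \<beta>0 Lr])
    \<comment> \<open>Noise enters through the first block only, so \<open>0\<close> stands in the
      place of \<open>mart_noise\<close>.\<close>
    have p2: "(norm ((v - X2 t \<omega>) + 0 + R2 - mart2 t h \<omega>))\<^sup>2 \<le> (norm (v - X2 t \<omega>))\<^sup>2
       + 2 * ((v - X2 t \<omega>) \<bullet> 0) - 2 * ((v - X2 t \<omega>) \<bullet> mart2 t h \<omega>)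
       + E\<^sup>2 * (2 * \<alpha> + h + 3 * (L * r)\<^sup>2 + 6 * \<alpha>\<^sup>2) + (\<beta>\<^sup>2 / h + 6 * \<beta>\<^sup>2 + 3 * \<mu>\<^sup>2)"
      by (rule perturbed_square[OF h(1) E1(2) R2 _ M2 \<alpha>0 \<beta>0 Lr]) (use Lr E0 in simp)
    have c1: "2 * (E\<^sup>2 * (2 * \<alpha> + h + 3 * (L * r)\<^sup>2 + 6 * \<alpha>\<^sup>2)) \<le> K * (E\<^sup>2 * (r\<^sup>2 * (1 + r) ^ 16))"
    proof -
      \<comment> \<open>The exponent 16 comes from the square of \<open>\<alpha>\<close>, a multiple
        of r^4 (1 + r)^14, in which two factors r are bounded by 1 + r.\<close>
      define P where "P = r\<^sup>2 * (1 + r) ^ 16"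
      have rp: "r\<^sup>2 * (1 + r) ^ i \<le> P" if "i \<le> 16" for i
        unfolding P_def using that r0 by (intro mult_left_mono power_increasing) auto
      have "\<alpha> = C * (r\<^sup>2 * (1 + r) ^ 7)" unfolding \<alpha>_def by simp
      then have a1: "\<alpha> \<le> C * P" using rp[of 7] C by (simp add: mult_left_mono)
      have "\<alpha>\<^sup>2 = C\<^sup>2 * ((r\<^sup>2 * (1 + r) ^ 14) * r\<^sup>2)" unfolding \<alpha>_def by (simp add: power_mult_distrib power2_eq_square flip: power_add)
      also have "\<dots> \<le> C\<^sup>2 * ((r\<^sup>2 * (1 + r) ^ 14) * (1 + r)\<^sup>2)"
        using r0 by (intro mult_left_mono power_mono) auto
      also have "(r\<^sup>2 * (1 + r) ^ 14) * (1 + r)\<^sup>2 = P" unfolding P_def by (simp flip: power_add add: mult.assoc)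
      finally have a2: "\<alpha>\<^sup>2 \<le> C\<^sup>2 * P" .
      have a3: "h \<le> P" using h(2) rp[of 0] by simp
      have a4: "(L * r)\<^sup>2 \<le> L\<^sup>2 * P" using rp[of 0] by (simp add: power_mult_distrib mult_left_mono)
      have P0: "0 \<le> P" unfolding P_def using r0 by simp
      have "2 * (2 * \<alpha> + h + 3 * (L * r)\<^sup>2 + 6 * \<alpha>\<^sup>2) \<le> 2 * (2 * (C * P) + P + 3 * (L\<^sup>2 * P) + 6 * (C\<^sup>2 * P))"
        by (intro mult_left_mono add_mono a1 a2 a3 a4) simp_all
      also have "\<dots> = (2 * (2 * C + 1 + 3 * L\<^sup>2 + 6 * C\<^sup>2)) * P" by (simp add: algebra_simps)
      also have "\<dots> \<le> K * P" unfolding K_def using P0 by (intro mult_right_mono) auto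
      finally have "E\<^sup>2 * (2 * (2 * \<alpha> + h + 3 * (L * r)\<^sup>2 + 6 * \<alpha>\<^sup>2)) \<le> E\<^sup>2 * (K * P)" by (intro mult_left_mono) auto
      then show ?thesis unfolding P_def by (simp only: mult.left_commute[of 2 "E\<^sup>2"] mult.left_commute[of K "E\<^sup>2"])
    qed
    have c2: "2 * (\<beta>\<^sup>2 / h + 6 * \<beta>\<^sup>2 + 3 * \<mu>\<^sup>2) \<le> K * (b ^ (2 * J) * (r ^ 10 / h + r ^ 10 + r ^ 8))"
    proof -
      have b2: "\<beta>\<^sup>2 = Ks\<^sup>2 * b ^ (2 * J) * r ^ 10" unfolding \<beta>_def by (simp add: power_mult_distrib flip: power_mult add: mult.commute)
      have m2: "\<mu>\<^sup>2 = Ks\<^sup>2 * b ^ (2 * J) * r ^ 8" unfolding \<mu>_def by (simp add: power_mult_distrib flip: power_mult add: mult.commute)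
      define y where "y = b ^ (2 * J) * (r ^ 10 / h + r ^ 10 + r ^ 8)"
      have y: "0 \<le> b ^ (2 * J) * (r ^ 10 / h)" "0 \<le> b ^ (2 * J) * r ^ 10" "0 \<le> b ^ (2 * J) * r ^ 8" using b1 r0 h by auto
      have y0: "0 \<le> y" using y unfolding y_def distrib_left by simp
      have "2 * (\<beta>\<^sup>2 / h + 6 * \<beta>\<^sup>2 + 3 * \<mu>\<^sup>2) = Ks\<^sup>2 * (2 * (b ^ (2 * J) * (r ^ 10 / h)) + 12 * (b ^ (2 * J) * r ^ 10) + 6 * (b ^ (2 * J) * r ^ 8))"
        unfolding b2 m2 by (simp add: algebra_simps)
      also have "\<dots> \<le> Ks\<^sup>2 * (12 * y)"
      proof (rule mult_left_mono)
        have lin: "2 * A + 12 * B + 6 * C \<le> 12 * (A + B + C)" if "0 \<le> A" "0 \<le> B" "0 \<le> C" for A B C :: real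
          using that by simp
        show "2 * (b ^ (2 * J) * (r ^ 10 / h)) + 12 * (b ^ (2 * J) * r ^ 10) + 6 * (b ^ (2 * J) * r ^ 8) \<le> 12 * y"
          unfolding y_def distrib_left[of "b ^ (2 * J)"] by (rule lin[OF y])
      qed simp
      also have "\<dots> \<le> K * y"
      proof -
        have "12 * Ks\<^sup>2 \<le> K" unfolding K_def using C by (simp add: add_nonneg_nonneg)
        from mult_right_mono[OF this y0] show ?thesis by simp
      qed
      finally show ?thesis unfolding y_def .
    qed
    have lin: "A + B \<le> e1 + e2 + 2 * i1 - 2 * i2 - 2 * i3 + k1 + k2"
      if "A \<le> e1 + 2 * i1 - 2 * i2 + c + d" "B \<le> e2 + 2 * 0 - 2 * i3 + c + d" "2 * c \<le> k1" "2 * d \<le> k2"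
      for A B e1 e2 i1 i2 i3 c d k1 k2 :: real using that by linarith
    show "(norm (sprk_step M W g1 g2 t h \<omega> (u, v) - (X1 (t+h) \<omega>, X2 (t+h) \<omega>)))\<^sup>2
      \<le> (norm ((u, v) - (X1 t \<omega>, X2 t \<omega>)))\<^sup>2
        + 2 * ((u - X1 t \<omega>) \<bullet> mart_noise t h \<omega> v) - 2 * ((u - X1 t \<omega>) \<bullet> mart1 t h \<omega>) - 2 * ((v - X2 t \<omega>) \<bullet> mart2 t h \<omega>)
        + K * ((norm ((u, v) - (X1 t \<omega>, X2 t \<omega>)))\<^sup>2 * ((q t h \<omega>)\<^sup>2 * (1 + q t h \<omega>) ^ 16))
        + K * (big \<omega> ^ (2 * J) * (q t h \<omega> ^ 10 / h + q t h \<omega> ^ 10 + q t h \<omega> ^ 8))"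
      unfolding sq r_def[symmetric] b_def[symmetric] E_def[symmetric] E2
      by (rule lin[OF p1[unfolded E2] p2[unfolded E2 inner_zero_right] c1[unfolded E2] c2])
  qed
qed

subsection \<open>Moments of one step\<close>

lemma rho_meas: "0 \<le> t \<Longrightarrow> 0 \<le> h \<Longrightarrow> rho t h \<in> borel_measurable P"
  unfolding rho_def by (intro borel_measurable_sum osc_meas) auto

text \<open>Brownian scaling: with the oscillation measured in units of \<open>sqrt h\<close>, the
  factor \<open>h\<close> in the exponent of \<open>weighted_osc\<close> cancels, and the constant
  is uniform over all steps and weights.\<close>

lemma weighted_rho:
  assumes p: "0 \<le> p"
  obtains C where "C \<ge> 0"
    "\<And>t h \<xi>. 0 \<le> t \<Longrightarrow> 0 < h \<Longrightarrow> \<xi> \<in> borel_measurable (F t) \<Longrightarrow> integrable P \<xi> \<Longrightarrow> (\<And>\<omega>. 0 \<le> \<xi> \<omega>) \<Longrightarrow>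
      integrable P (\<lambda>\<omega>. \<xi> \<omega> * exp (p * (rho t h \<omega> / sqrt h))) \<and>
      expectation (\<lambda>\<omega>. \<xi> \<omega> * exp (p * (rho t h \<omega> / sqrt h))) \<le> C * expectation \<xi>"
proof (rule that[of "1 + (\<Sum>m=1..M. 16 * exp ((p * real M)\<^sup>2 / 2))"])
  show "0 \<le> 1 + (\<Sum>m=1..M. 16 * exp ((p * real M)\<^sup>2 / 2))" by (simp add: add_nonneg_nonneg)
  fix t h :: real and \<xi> :: "'a \<Rightarrow> real"
  assume t: "0 \<le> t" "0 < h" and xi: "\<xi> \<in> borel_measurable (F t)" "integrable P \<xi>" "\<And>\<omega>. 0 \<le> \<xi> \<omega>"
  define c where "c = p / sqrt h * real M"
  have c: "0 \<le> c" unfolding c_def using p t by simp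
  have h0: "0 \<le> h" using t by simp
  have c2: "c\<^sup>2 * h / 2 = (p * real M)\<^sup>2 / 2" unfolding c_def using t by (simp add: power_mult_distrib power_divide)
  have W: "integrable P (\<lambda>\<omega>. \<xi> \<omega> * exp (c * osc (W m) t h \<omega>))"
    "expectation (\<lambda>\<omega>. \<xi> \<omega> * exp (c * osc (W m) t h \<omega>)) \<le> 16 * exp ((p * real M)\<^sup>2 / 2) * expectation \<xi>" if "m \<in> {1..M}" for m
    using weighted_osc[OF t(1) h0 xi that c] unfolding c2 by auto
  have dom: "integrable P (\<lambda>\<omega>. \<xi> \<omega> + (\<Sum>m=1..M. \<xi> \<omega> * exp (c * osc (W m) t h \<omega>)))"
    using xi(2) W(1) by (intro Bochner_Integration.integrable_add Bochner_Integration.integrable_sum) auto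
  have le: "\<xi> \<omega> * exp (p * (rho t h \<omega> / sqrt h)) \<le> \<xi> \<omega> + (\<Sum>m=1..M. \<xi> \<omega> * exp (c * osc (W m) t h \<omega>))" if w: "\<omega> \<in> space P" for \<omega>
  proof -
    have "exp (p * (rho t h \<omega> / sqrt h)) = exp ((p / sqrt h) * (\<Sum>m=1..M. osc (W m) t h \<omega>))" unfolding rho_def by simp
    also have "\<dots> \<le> 1 + (\<Sum>m=1..M. exp ((p / sqrt h) * real (card {1..M}) * osc (W m) t h \<omega>))"
    proof (rule exp_sum_le)
      fix m assume m: "m \<in> {1..M}"
      show "0 \<le> osc (W m) t h \<omega>" by (rule osc_nonneg[where w="W m" and \<omega>=\<omega>, OF W_cont[OF m w] h0]) (use t in auto)
    qed (use p t in auto)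
    also have "\<dots> = 1 + (\<Sum>m=1..M. exp (c * osc (W m) t h \<omega>))" unfolding c_def by simp
    finally have "\<xi> \<omega> * exp (p * (rho t h \<omega> / sqrt h)) \<le> \<xi> \<omega> * (1 + (\<Sum>m=1..M. exp (c * osc (W m) t h \<omega>)))"
      using xi(3) by (rule mult_left_mono)
    then show ?thesis by (simp add: distrib_left sum_distrib_left)
  qed
  have [measurable]: "\<xi> \<in> borel_measurable P" "rho t h \<in> borel_measurable P"
    using measurable_F xi(1) rho_meas[OF t(1) h0] by blast+
  have int: "integrable P (\<lambda>\<omega>. \<xi> \<omega> * exp (p * (rho t h \<omega> / sqrt h)))"
  proof (rule Bochner_Integration.integrable_bound[OF dom])
    show "AE \<omega> in P. norm (\<xi> \<omega> * exp (p * (rho t h \<omega> / sqrt h))) \<le> norm (\<xi> \<omega> + (\<Sum>m=1..M. \<xi> \<omega> * exp (c * osc (W m) t h \<omega>)))"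
    proof (rule AE_I2)
      fix \<omega> assume "\<omega> \<in> space P"
      from le[OF this] xi(3)[of \<omega>]
      show "norm (\<xi> \<omega> * exp (p * (rho t h \<omega> / sqrt h))) \<le> norm (\<xi> \<omega> + (\<Sum>m=1..M. \<xi> \<omega> * exp (c * osc (W m) t h \<omega>)))" by simp
    qed
  qed measurable
  have "expectation (\<lambda>\<omega>. \<xi> \<omega> * exp (p * (rho t h \<omega> / sqrt h))) \<le> expectation (\<lambda>\<omega>. \<xi> \<omega> + (\<Sum>m=1..M. \<xi> \<omega> * exp (c * osc (W m) t h \<omega>)))"
    using le by (intro integral_mono int dom) auto
  also have "\<dots> = expectation \<xi> + (\<Sum>m=1..M. expectation (\<lambda>\<omega>. \<xi> \<omega> * exp (c * osc (W m) t h \<omega>)))"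
    using xi(2) W(1) by (subst Bochner_Integration.integral_add) (auto intro!: Bochner_Integration.integrable_sum Bochner_Integration.integral_sum)
  also have "\<dots> \<le> expectation \<xi> + (\<Sum>m=1..M. 16 * exp ((p * real M)\<^sup>2 / 2) * expectation \<xi>)"
    using W(2) by (intro add_left_mono sum_mono)
  also have "\<dots> = (1 + (\<Sum>m=1..M. 16 * exp ((p * real M)\<^sup>2 / 2))) * expectation \<xi>"
    unfolding distrib_right sum_distrib_right by simp
  finally show "integrable P (\<lambda>\<omega>. \<xi> \<omega> * exp (p * (rho t h \<omega> / sqrt h))) \<and>
      expectation (\<lambda>\<omega>. \<xi> \<omega> * exp (p * (rho t h \<omega> / sqrt h))) \<le> (1 + (\<Sum>m=1..M. 16 * exp ((p * real M)\<^sup>2 / 2))) * expectation \<xi>"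
    using int by simp
qed

text \<open>In the scaled variable \<open>x\<close> one has q = sqrt h (1 + x), and 1 + x \<le> exp
  x turns powers into exponentials. For \<open>h \<le> 1\<close>, 1 + q is at most 2 (1 + x), whence
  the factor 2^16; the exponent 18 is 2 + 16, and 10 is the largest power in the last sum.\<close>

lemma q_powers:
  assumes w: "\<omega> \<in> space P" and t: "0 \<le> t" "0 < h" "h \<le> 1"
  defines "x \<equiv> rho t h \<omega> / sqrt h"
  shows "0 \<le> x" "q t h \<omega> = sqrt h * (1 + x)" "(q t h \<omega>)\<^sup>2 * (1 + q t h \<omega>) ^ 16 \<le> 2 ^ 16 * h * exp (18 * x)"
    "q t h \<omega> ^ 10 / h + q t h \<omega> ^ 10 + q t h \<omega> ^ 8 \<le> 3 * h ^ 4 * exp (10 * x)"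
proof -
  show x0: "0 \<le> x" unfolding x_def using rho_nonneg[OF w t(1)] t by simp
  show q: "q t h \<omega> = sqrt h * (1 + x)" unfolding q_def x_def using t by (simp add: distrib_left)
  have x1: "1 + x \<le> exp x" by (rule exp_ge_add_one_self)
  have sh: "sqrt h \<le> 1" "0 \<le> sqrt h" using t by simp_all
  have q1: "q t h \<omega> \<le> 1 + x" unfolding q using sh x0 by (simp add: mult_left_le_one_le)
  have xe: "(1 + x) ^ k \<le> exp (real k * x)" for k
    using power_mono[OF x1, of k] x0 by (simp add: exp_of_nat_mult)
  have qk: "q t h \<omega> ^ (2 * k) \<le> h ^ k * exp (real (2 * k) * x)" for k
  proof -
    have "q t h \<omega> ^ (2 * k) = h ^ k * (1 + x) ^ (2 * k)"
      unfolding q power_mult_distrib power_mult using t by simp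
    also have "\<dots> \<le> h ^ k * exp (real (2 * k) * x)" using t by (intro mult_left_mono xe) auto
    finally show ?thesis .
  qed
  have q0: "0 \<le> q t h \<omega>" unfolding q using sh x0 by simp
  have "1 + q t h \<omega> \<le> 2 * (1 + x)" using add_mono[OF q1 x0] by simp
  then have "(1 + q t h \<omega>) ^ 16 \<le> (2 * (1 + x)) ^ 16" using q0 by (intro power_mono) auto
  also have "\<dots> \<le> 2 ^ 16 * exp (16 * x)" unfolding power_mult_distrib using xe[of 16] by (intro mult_left_mono) auto
  finally have "(q t h \<omega>)\<^sup>2 * (1 + q t h \<omega>) ^ 16 \<le> (h * exp (2 * x)) * (2 ^ 16 * exp (16 * x))"
    using qk[of 1] q0 t by (intro mult_mono) auto
  also have "\<dots> = 2 ^ 16 * h * exp (18 * x)" by (simp flip: exp_add)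
  finally show "(q t h \<omega>)\<^sup>2 * (1 + q t h \<omega>) ^ 16 \<le> 2 ^ 16 * h * exp (18 * x)" .
  have q10: "q t h \<omega> ^ 10 \<le> h ^ 5 * exp (10 * x)" using qk[of 5] by simp
  have q8: "q t h \<omega> ^ 8 \<le> h ^ 4 * exp (10 * x)"
  proof -
    have "h ^ 4 * exp (8 * x) \<le> h ^ 4 * exp (10 * x)" using x0 t by (intro mult_left_mono) auto
    then show ?thesis using qk[of 4] by simp
  qed
  have "q t h \<omega> ^ 10 / h \<le> (h ^ 5 * exp (10 * x)) / h" using q10 t by (intro divide_right_mono) auto
  also have "\<dots> = h ^ 4 * exp (10 * x)" using t by (simp add: eval_nat_numeral)
  finally have q9: "q t h \<omega> ^ 10 / h \<le> h ^ 4 * exp (10 * x)" .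
  have "h ^ 5 \<le> h ^ 4" using t by (intro power_decreasing) auto
  then have "h ^ 5 * exp (10 * x) \<le> h ^ 4 * exp (10 * x)" by (intro mult_right_mono) auto
  then show "q t h \<omega> ^ 10 / h + q t h \<omega> ^ 10 + q t h \<omega> ^ 8 \<le> 3 * h ^ 4 * exp (10 * x)"
    using q8 q9 q10 by linarith
qed

lemma q_meas: "0 \<le> t \<Longrightarrow> 0 \<le> h \<Longrightarrow> q t h \<in> borel_measurable P"
proof -
  assume "0 \<le> t" "0 \<le> h"
  then have [measurable]: "rho t h \<in> borel_measurable P" by (rule rho_meas)
  show ?thesis unfolding q_def by measurable
qed

lemma big_meas: "big \<in> borel_measurable P"
proof -
  have [measurable]: "rho 0 T \<in> borel_measurable P" using rho_meas[of 0 T] T by simp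
  show ?thesis unfolding big_def by measurable
qed

text \<open>A power of \<open>big\<close> is an exponential of the oscillation over the whole
  interval: \<open>weighted_rho\<close> for the single step from 0 to \<open>T\<close> with constant
  weight, the factor \<open>sqrt T\<close> undoing the scaling.\<close>

lemma big_integrable: "integrable P (\<lambda>\<omega>. big \<omega> ^ j)"
proof -
  define c where "c = real j * (growth + 2 + T)"
  have c: "0 \<le> c * sqrt T" unfolding c_def using growth_ge T by simp
  obtain C where C: "C \<ge> 0" and w: "\<And>t h \<xi>. 0 \<le> t \<Longrightarrow> 0 < h \<Longrightarrow> \<xi> \<in> borel_measurable (F t) \<Longrightarrow> integrable P \<xi> \<Longrightarrow> (\<And>\<omega>. 0 \<le> \<xi> \<omega>) \<Longrightarrow>
      integrable P (\<lambda>\<omega>. \<xi> \<omega> * exp (c * sqrt T * (rho t h \<omega> / sqrt h))) \<and>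
      expectation (\<lambda>\<omega>. \<xi> \<omega> * exp (c * sqrt T * (rho t h \<omega> / sqrt h))) \<le> C * expectation \<xi>"
    using weighted_rho[OF c] by blast
  have "integrable P (\<lambda>\<omega>. 1 * exp (c * sqrt T * (rho 0 T \<omega> / sqrt T))) \<and>
      expectation (\<lambda>\<omega>. 1 * exp (c * sqrt T * (rho 0 T \<omega> / sqrt T))) \<le> C * expectation (\<lambda>_. 1)"
    by (rule w) (use T in simp_all)
  moreover have eq: "c * sqrt T * (rho 0 T \<omega> / sqrt T) = c * rho 0 T \<omega>" for \<omega> using T by simp
  ultimately have "integrable P (\<lambda>\<omega>. exp (c * rho 0 T \<omega>))" unfolding eq mult_1 by blast
  then have "integrable P (\<lambda>\<omega>. exp c * exp (c * rho 0 T \<omega>))"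
    by (rule Bochner_Integration.integrable_mult_right)
  also have "(\<lambda>\<omega>. exp c * exp (c * rho 0 T \<omega>)) = (\<lambda>\<omega>. big \<omega> ^ j)"
  proof
    fix \<omega>
    have "c + c * rho 0 T \<omega> = real j * ((growth + 2 + T) * (1 + rho 0 T \<omega>))"
      unfolding c_def mult.assoc by (simp only: distrib_left mult_1_right)
    then show "exp c * exp (c * rho 0 T \<omega>) = big \<omega> ^ j"
      unfolding big_def by (simp only: exp_add[symmetric] exp_of_nat_mult[symmetric])
  qed
  finally show ?thesis .
qed

text \<open>In conditional mean given \<open>F t\<close> the step factor is of size h. The weight
  \<open>\<xi>\<close> will be the squared error at time \<open>t\<close>; the bound for weighted
  exponentials separates it from the oscillation after \<open>t\<close>.\<close>

lemma step_weight_bound: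
  obtains C where "C \<ge> 0"
    "\<And>t h \<xi>. 0 \<le> t \<Longrightarrow> 0 < h \<Longrightarrow> h \<le> 1 \<Longrightarrow> \<xi> \<in> borel_measurable (F t) \<Longrightarrow> integrable P \<xi> \<Longrightarrow> (\<And>\<omega>. 0 \<le> \<xi> \<omega>) \<Longrightarrow>
      integrable P (\<lambda>\<omega>. \<xi> \<omega> * ((q t h \<omega>)\<^sup>2 * (1 + q t h \<omega>) ^ 16)) \<and>
      expectation (\<lambda>\<omega>. \<xi> \<omega> * ((q t h \<omega>)\<^sup>2 * (1 + q t h \<omega>) ^ 16)) \<le> C * h * expectation \<xi>"
proof -
  obtain C where C: "C \<ge> 0" and w: "\<And>t h \<xi>. 0 \<le> t \<Longrightarrow> 0 < h \<Longrightarrow> \<xi> \<in> borel_measurable (F t) \<Longrightarrow> integrable P \<xi> \<Longrightarrow> (\<And>\<omega>. 0 \<le> \<xi> \<omega>) \<Longrightarrow>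
      integrable P (\<lambda>\<omega>. \<xi> \<omega> * exp (18 * (rho t h \<omega> / sqrt h))) \<and>
      expectation (\<lambda>\<omega>. \<xi> \<omega> * exp (18 * (rho t h \<omega> / sqrt h))) \<le> C * expectation \<xi>"
    using weighted_rho[of 18] by auto
  show thesis
  proof (rule that[of "2 ^ 16 * C"])
    show "0 \<le> 2 ^ 16 * C" using C by simp
    fix t h :: real and \<xi> :: "'a \<Rightarrow> real"
    assume t: "0 \<le> t" "0 < h" "h \<le> 1" and xi: "\<xi> \<in> borel_measurable (F t)" "integrable P \<xi>" "\<And>\<omega>. 0 \<le> \<xi> \<omega>"
    note b = w[OF t(1,2) xi]
    have [measurable]: "\<xi> \<in> borel_measurable P" "q t h \<in> borel_measurable P"
      using measurable_F xi(1) q_meas[of t h] t by auto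
    have le: "\<xi> \<omega> * ((q t h \<omega>)\<^sup>2 * (1 + q t h \<omega>) ^ 16) \<le> 2 ^ 16 * h * (\<xi> \<omega> * exp (18 * (rho t h \<omega> / sqrt h)))" if "\<omega> \<in> space P" for \<omega>
      using mult_left_mono[OF q_powers(3)[OF that t] xi(3)[of \<omega>]] by (simp add: mult_ac)
    have nn: "0 \<le> \<xi> \<omega> * ((q t h \<omega>)\<^sup>2 * (1 + q t h \<omega>) ^ 16)" for \<omega>
      using xi(3)[of \<omega>] zero_le_even_power[of 16 "1 + q t h \<omega>"] by simp
    have dom: "integrable P (\<lambda>\<omega>. 2 ^ 16 * h * (\<xi> \<omega> * exp (18 * (rho t h \<omega> / sqrt h))))" using b by simp
    have int: "integrable P (\<lambda>\<omega>. \<xi> \<omega> * ((q t h \<omega>)\<^sup>2 * (1 + q t h \<omega>) ^ 16))"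
    proof (rule Bochner_Integration.integrable_bound[OF dom])
      show "AE \<omega> in P. norm (\<xi> \<omega> * ((q t h \<omega>)\<^sup>2 * (1 + q t h \<omega>) ^ 16)) \<le> norm (2 ^ 16 * h * (\<xi> \<omega> * exp (18 * (rho t h \<omega> / sqrt h))))"
        using le nn by (intro AE_I2) (smt (verit) real_norm_def)
    qed measurable
    have "expectation (\<lambda>\<omega>. \<xi> \<omega> * ((q t h \<omega>)\<^sup>2 * (1 + q t h \<omega>) ^ 16)) \<le> expectation (\<lambda>\<omega>. 2 ^ 16 * h * (\<xi> \<omega> * exp (18 * (rho t h \<omega> / sqrt h))))"
      by (rule integral_mono[OF int dom le])
    also have "\<dots> = 2 ^ 16 * h * expectation (\<lambda>\<omega>. \<xi> \<omega> * exp (18 * (rho t h \<omega> / sqrt h)))" by simp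
    also have "\<dots> \<le> 2 ^ 16 * h * (C * expectation \<xi>)" using b t by (intro mult_left_mono) auto
    finally show "integrable P (\<lambda>\<omega>. \<xi> \<omega> * ((q t h \<omega>)\<^sup>2 * (1 + q t h \<omega>) ^ 16)) \<and>
      expectation (\<lambda>\<omega>. \<xi> \<omega> * ((q t h \<omega>)\<^sup>2 * (1 + q t h \<omega>) ^ 16)) \<le> 2 ^ 16 * C * h * expectation \<xi>"
      using int by (simp add: mult_ac)
  qed
qed

text \<open>\<open>big\<close> sees the whole path, the current step included. The inequality x y
  \<le> x^2 + y^2 separates the two factors at the price of doubled exponents: \<open>2 * j\<close>
  for \<open>big\<close> and 20 for the scaled oscillation.\<close>

lemma step_remainder_bound:
  obtains C where "C \<ge> 0"
    "\<And>t h. 0 \<le> t \<Longrightarrow> 0 < h \<Longrightarrow> h \<le> 1 \<Longrightarrow>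
      integrable P (\<lambda>\<omega>. big \<omega> ^ j * (q t h \<omega> ^ 10 / h + q t h \<omega> ^ 10 + q t h \<omega> ^ 8)) \<and>
      expectation (\<lambda>\<omega>. big \<omega> ^ j * (q t h \<omega> ^ 10 / h + q t h \<omega> ^ 10 + q t h \<omega> ^ 8)) \<le> C * h ^ 4"
proof -
  obtain C where C: "C \<ge> 0" and w: "\<And>t h \<xi>. 0 \<le> t \<Longrightarrow> 0 < h \<Longrightarrow> \<xi> \<in> borel_measurable (F t) \<Longrightarrow> integrable P \<xi> \<Longrightarrow> (\<And>\<omega>. 0 \<le> \<xi> \<omega>) \<Longrightarrow>
      integrable P (\<lambda>\<omega>. \<xi> \<omega> * exp (20 * (rho t h \<omega> / sqrt h))) \<and>
      expectation (\<lambda>\<omega>. \<xi> \<omega> * exp (20 * (rho t h \<omega> / sqrt h))) \<le> C * expectation \<xi>"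
    using weighted_rho[of 20] by auto
  define B where "B = expectation (\<lambda>\<omega>. big \<omega> ^ (2 * j))"
  have B0: "0 \<le> B" unfolding B_def by (intro integral_nonneg_AE AE_I2) (simp add: big_def)
  show thesis
  proof (rule that[of "3 * (B + C)"])
    show "0 \<le> 3 * (B + C)" using C B0 by simp
    fix t h :: real
    assume t: "0 \<le> t" "0 < h" "h \<le> 1"
    have b: "integrable P (\<lambda>\<omega>. exp (20 * (rho t h \<omega> / sqrt h)))" "expectation (\<lambda>\<omega>. exp (20 * (rho t h \<omega> / sqrt h))) \<le> C"
    proof -
      have "integrable P (\<lambda>\<omega>. 1 * exp (20 * (rho t h \<omega> / sqrt h))) \<and>
        expectation (\<lambda>\<omega>. 1 * exp (20 * (rho t h \<omega> / sqrt h))) \<le> C * expectation (\<lambda>_. 1)"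
        by (rule w[OF t(1,2)]) simp_all
      then show "integrable P (\<lambda>\<omega>. exp (20 * (rho t h \<omega> / sqrt h)))" "expectation (\<lambda>\<omega>. exp (20 * (rho t h \<omega> / sqrt h))) \<le> C"
        by (simp_all only: mult_1 lebesgue_integral_const prob_space) (simp add: prob_space)
    qed
    have [measurable]: "big \<in> borel_measurable P" "q t h \<in> borel_measurable P"
      using big_meas q_meas[of t h] t by auto
    let ?f = "\<lambda>\<omega>. big \<omega> ^ j * (q t h \<omega> ^ 10 / h + q t h \<omega> ^ 10 + q t h \<omega> ^ 8)"
    let ?g = "\<lambda>\<omega>. 3 * h ^ 4 * (big \<omega> ^ (2 * j) + exp (20 * (rho t h \<omega> / sqrt h)))"
    have le: "?f \<omega> \<le> ?g \<omega>" if "\<omega> \<in> space P" for \<omega>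
    proof -
      let ?x = "rho t h \<omega> / sqrt h"
      have "?f \<omega> \<le> big \<omega> ^ j * (3 * h ^ 4 * exp (10 * ?x))"
        using q_powers(4)[OF that t] by (intro mult_left_mono) (simp_all add: big_def)
      then have 1: "?f \<omega> \<le> 3 * h ^ 4 * (big \<omega> ^ j * exp (10 * ?x))" by (simp only: mult_ac)
      have "big \<omega> ^ j * exp (10 * ?x) \<le> (big \<omega> ^ j)\<^sup>2 + (exp (10 * ?x))\<^sup>2"
      proof -
        have "a * b \<le> a\<^sup>2 + b\<^sup>2" if "0 \<le> a" "0 \<le> b" for a b :: real
          using sum_squares_bound[of a b] mult_nonneg_nonneg[OF that] by linarith
        then show ?thesis by (simp add: big_def)
      qed
      also have "(big \<omega> ^ j)\<^sup>2 = big \<omega> ^ (2 * j)" by (simp flip: power_mult add: mult.commute)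
      also have "(exp (10 * ?x))\<^sup>2 = exp (20 * ?x)" by (simp flip: exp_double)
      finally have "3 * h ^ 4 * (big \<omega> ^ j * exp (10 * ?x)) \<le> ?g \<omega>" using t by (intro mult_left_mono) auto
      with 1 show ?thesis by (rule order_trans)
    qed
    have nn: "0 \<le> ?f \<omega>" for \<omega>
      using t by (intro mult_nonneg_nonneg add_nonneg_nonneg divide_nonneg_pos) (auto simp: big_def)
    have dom: "integrable P ?g" using b(1) big_integrable[of "2 * j"] by simp
    have int: "integrable P ?f"
    proof (rule Bochner_Integration.integrable_bound[OF dom])
      show "AE \<omega> in P. norm (?f \<omega>) \<le> norm (?g \<omega>)"
        using le nn by (intro AE_I2) (smt (verit) real_norm_def)
    qed measurable
    have "expectation ?f \<le> expectation ?g" by (rule integral_mono[OF int dom le])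
    also have "\<dots> = 3 * h ^ 4 * (B + expectation (\<lambda>\<omega>. exp (20 * (rho t h \<omega> / sqrt h))))"
      unfolding B_def using b(1) big_integrable[of "2 * j"] by simp
    also have "\<dots> \<le> 3 * h ^ 4 * (B + C)" using b(2) t by (intro mult_left_mono add_left_mono) auto
    also have "\<dots> = 3 * (B + C) * h ^ 4" by (simp only: mult_ac)
    finally show "integrable P ?f \<and> expectation ?f \<le> 3 * (B + C) * h ^ 4" using int by blast
  qed
qed

end

context separable_solution
begin

subsection \<open>Conditional means of the iterated integrals\<close>

lemma has_bochner_integral_time:
  fixes Z :: "real \<Rightarrow> 'a \<Rightarrow> real"
  assumes "\<And>s. s \<in> {a..b} \<Longrightarrow> Z s \<in> borel_measurable P"
    and "\<And>\<omega>. \<omega> \<in> space P \<Longrightarrow> continuous_on {a..b} (\<lambda>s. Z s \<omega>)"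
    and "integrable P G" "\<And>s \<omega>. s \<in> {a..b} \<Longrightarrow> \<omega> \<in> space P \<Longrightarrow> \<bar>Z s \<omega>\<bar> \<le> G \<omega>"
    and E: "\<And>s. s \<in> {a..b} \<Longrightarrow> expectation (Z s) = c s" and I: "(c has_integral v) {a..b}"
  shows "has_bochner_integral P (\<lambda>\<omega>. integral {a..b} (\<lambda>s. Z s \<omega>)) v"
proof -
  have "integral {a..b} (\<lambda>s. expectation (Z s)) = v"
    using has_integral_eq[of "{a..b}" c "\<lambda>s. expectation (Z s)" v] E I by (simp add: integral_unique)
  then show ?thesis
    using expectation_time_integral[OF assms(1-4)] by (simp add: has_bochner_integral_iff)
qed

text \<open>The dominating variable for the applications of Fubini's theorem below: products of two
  increments within the step are at most the square of \<open>rho\<close>.\<close>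

lemma square_moments:
  assumes t: "0 \<le> t" "0 < h" and xi: "\<xi> \<in> borel_measurable (F t)" "integrable P \<xi>"
  shows "integrable P (\<lambda>\<omega>. \<bar>\<xi> \<omega>\<bar> * (rho t h \<omega>)\<^sup>2)"
proof -
  obtain C where w: "\<And>t h \<xi>. 0 \<le> t \<Longrightarrow> 0 < h \<Longrightarrow> \<xi> \<in> borel_measurable (F t) \<Longrightarrow> integrable P \<xi> \<Longrightarrow> (\<And>\<omega>. 0 \<le> \<xi> \<omega>) \<Longrightarrow>
      integrable P (\<lambda>\<omega>. \<xi> \<omega> * exp (2 * (rho t h \<omega> / sqrt h))) \<and>
      expectation (\<lambda>\<omega>. \<xi> \<omega> * exp (2 * (rho t h \<omega> / sqrt h))) \<le> C * expectation \<xi>"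
    by (rule weighted_rho[of 2], simp, blast)
  have "(\<lambda>\<omega>. \<bar>\<xi> \<omega>\<bar>) \<in> borel_measurable (F t)" using xi(1) by measurable
  from w[OF t this] have int: "integrable P (\<lambda>\<omega>. \<bar>\<xi> \<omega>\<bar> * exp (2 * (rho t h \<omega> / sqrt h)))" using xi(2) by simp
  have [measurable]: "\<xi> \<in> borel_measurable P" "rho t h \<in> borel_measurable P"
    using measurable_F xi(1) rho_meas[of t h] t by auto
  show ?thesis
  proof (rule Bochner_Integration.integrable_bound)
    show "integrable P (\<lambda>\<omega>. h * (\<bar>\<xi> \<omega>\<bar> * exp (2 * (rho t h \<omega> / sqrt h))))"
      using int by (rule Bochner_Integration.integrable_mult_right)
    show "AE \<omega> in P. norm (\<bar>\<xi> \<omega>\<bar> * (rho t h \<omega>)\<^sup>2) \<le> norm (h * (\<bar>\<xi> \<omega>\<bar> * exp (2 * (rho t h \<omega> / sqrt h))))"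
    proof (rule AE_I2)
      fix \<omega> assume w: "\<omega> \<in> space P"
      define x where "x = rho t h \<omega> / sqrt h"
      have x0: "0 \<le> x" unfolding x_def using rho_nonneg[OF w t(1)] t by simp
      have "(rho t h \<omega>)\<^sup>2 = h * x\<^sup>2" unfolding x_def using t by (simp add: power_divide)
      also have "\<dots> \<le> h * (exp x)\<^sup>2"
        using t x0 exp_ge_add_one_self[of x] by (intro mult_left_mono power_mono) linarith+
      also have "(exp x)\<^sup>2 = exp (2 * x)" by (simp only: exp_double)
      finally have "\<bar>\<xi> \<omega>\<bar> * (rho t h \<omega>)\<^sup>2 \<le> \<bar>\<xi> \<omega>\<bar> * (h * exp (2 * x))" by (intro mult_left_mono) auto
      then show "norm (\<bar>\<xi> \<omega>\<bar> * (rho t h \<omega>)\<^sup>2) \<le> norm (h * (\<bar>\<xi> \<omega>\<bar> * exp (2 * (rho t h \<omega> / sqrt h))))"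
        unfolding x_def[symmetric] using t by (simp add: abs_mult mult_ac)
    qed
  qed measurable
qed

text \<open>For \<open>s \<le> u\<close> the increment up to \<open>u\<close> is split at
  \<open>s\<close>: the part after \<open>s\<close> has mean zero against weights known at
  \<open>s\<close>, the rest is \<open>weighted_increment_product\<close>. Exchanging the two
  processes settles the other case, so the Brownian covariance appears.\<close>

lemma product_moment:
  assumes t: "0 \<le> t" "t \<le> s" "t \<le> u" and xi: "\<xi> \<in> borel_measurable (F t)" "integrable P \<xi>"
    and m: "m \<in> {1..M}" "l \<in> {1..M}"
  shows "has_bochner_integral P (\<lambda>\<omega>. \<xi> \<omega> * ((W m s \<omega> - W m t \<omega>) * (W l u \<omega> - W l t \<omega>)))
    (of_bool (m = l) * expectation \<xi> * (min s u - t))"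
proof -
  have *: "has_bochner_integral P (\<lambda>\<omega>. \<xi> \<omega> * ((W m s \<omega> - W m t \<omega>) * (W l u \<omega> - W l t \<omega>)))
    (of_bool (m = l) * expectation \<xi> * (s - t))"
    if su: "s \<le> u" and t: "0 \<le> t" "t \<le> s" and m: "m \<in> {1..M}" "l \<in> {1..M}" for s u m l
  proof -
    note D = weighted_increment_product[OF t xi m]
    have s0: "0 \<le> s" using t by simp
    have eF: "(\<lambda>\<omega>. \<xi> \<omega> * (W m s \<omega> - W m t \<omega>)) \<in> borel_measurable (F s)"
      using measurable_F_mono[OF xi(1) t(2)] W_F_le[OF m(1) s0, of s] W_F_le[OF m(1) t(1), of s] t by measurable
    note E = weighted_increment(1,2)[OF s0 su eF weighted_increment(1)[OF t xi m(1)] m(2)]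
    have eq: "\<xi> \<omega> * ((W m s \<omega> - W m t \<omega>) * (W l u \<omega> - W l t \<omega>)) =
      \<xi> \<omega> * ((W m s \<omega> - W m t \<omega>) * (W l s \<omega> - W l t \<omega>)) + \<xi> \<omega> * (W m s \<omega> - W m t \<omega>) * (W l u \<omega> - W l s \<omega>)" for \<omega>
      by (simp add: algebra_simps)
    show ?thesis unfolding eq has_bochner_integral_iff using D E by simp
  qed
  show ?thesis
  proof (cases "s \<le> u")
    case True
    then show ?thesis using *[OF True t(1,2) m] by (simp add: min_def)
  next
    case False
    then have "has_bochner_integral P (\<lambda>\<omega>. \<xi> \<omega> * ((W l u \<omega> - W l t \<omega>) * (W m s \<omega> - W m t \<omega>)))
      (of_bool (l = m) * expectation \<xi> * (u - t))" using *[of u s l m] t m by simp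
    then show ?thesis using False by (simp add: mult_ac min_def eq_commute[of l m])
  qed
qed

lemma has_integral_min:
  assumes "t \<le> s" "s \<le> t + h"
  shows "((\<lambda>u::real. min s u - t) has_integral h * (s - t) - (s - t)\<^sup>2/2) {t..t+h}"
proof -
  have 1: "((\<lambda>u. min s u - t) has_integral (s - t)\<^sup>2/2) {t..s}"
    by (rule has_integral_eq[OF _ has_integral_time[OF assms(1)]]) (auto simp: min_def)
  have 2: "((\<lambda>u. min s u - t) has_integral (t + h - s) * (s - t)) {s..t+h}"
  proof (rule has_integral_eq)
    show "((\<lambda>_. s - t) has_integral (t + h - s) * (s - t)) {s..t+h}"
      using has_integral_const_real[of "s - t" s "t+h"] assms by simp
  qed (auto simp: min_def)
  have "((\<lambda>u. min s u - t) has_integral (s - t)\<^sup>2/2 + (t + h - s) * (s - t)) {t..t+h}"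
    by (rule has_integral_combine[OF assms 1 2])
  moreover have "(s - t)\<^sup>2/2 + (t + h - s) * (s - t) = h * (s - t) - (s - t)\<^sup>2/2"
    by (simp add: power2_eq_square field_simps)
  ultimately show ?thesis by simp
qed

text \<open>The covariance \<open>min s u - t\<close> is integrated along the diagonal for
  \<open>WW\<close>, in one time for a product with \<open>J0\<close>, and in both times for two of
  them. The claim with free \<open>s\<close> is the intermediate stage: \<open>s = t + h\<close>
  gives the moment with dW, and integration in \<open>s\<close> the last one. The weight
  \<open>\<xi>\<close> makes all of them conditional on \<open>F t\<close>.\<close>

lemma iterated_moments:
  assumes t: "0 \<le> t" "0 < h" and xi: "\<xi> \<in> borel_measurable (F t)" "integrable P \<xi>"
    and m: "m \<in> {1..M}" "l \<in> {1..M}"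
  defines "\<kappa> \<equiv> of_bool (m = l) * expectation \<xi>"
  shows "has_bochner_integral P (\<lambda>\<omega>. \<xi> \<omega> * (dW (W m) t h \<omega> * dW (W l) t h \<omega>)) (\<kappa> * h)"
    and "has_bochner_integral P (\<lambda>\<omega>. \<xi> \<omega> * WW m l t h \<omega>) (\<kappa> * (h\<^sup>2/2))"
    and "s \<in> {t..t+h} \<Longrightarrow> has_bochner_integral P (\<lambda>\<omega>. \<xi> \<omega> * ((W m s \<omega> - W m t \<omega>) * J0 (W l) t h \<omega>)) (\<kappa> * (h * (s - t) - (s - t)\<^sup>2/2))"
    and "has_bochner_integral P (\<lambda>\<omega>. \<xi> \<omega> * (dW (W m) t h \<omega> * J0 (W l) t h \<omega>)) (\<kappa> * (h\<^sup>2/2))"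
    and "has_bochner_integral P (\<lambda>\<omega>. \<xi> \<omega> * (J0 (W m) t h \<omega> * J0 (W l) t h \<omega>)) (\<kappa> * (h ^ 3/3))"
proof -
  have h0: "0 \<le> h" using t by simp
  have mom: "has_bochner_integral P (\<lambda>\<omega>. \<xi> \<omega> * ((W m s \<omega> - W m t \<omega>) * (W l u \<omega> - W l t \<omega>))) (\<kappa> * (min s u - t))"
    if "s \<in> {t..t+h}" "u \<in> {t..t+h}" for s u
    unfolding \<kappa>_def using that by (intro product_moment t xi m) auto
  have [measurable]: "\<xi> \<in> borel_measurable P" using measurable_F xi(1) by blast
  have Wm: "(\<lambda>\<omega>. W i s \<omega> - W i t \<omega>) \<in> borel_measurable P" if "s \<in> {t..t+h}" "i \<in> {1..M}" for i s
    using that t by (intro borel_measurable_diff W_meas) auto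
  have Wc: "continuous_on {t..t+h} (\<lambda>s. W i s \<omega> - W i t \<omega>)" if "\<omega> \<in> space P" "i \<in> {1..M}" for i \<omega>
    using that t by (intro continuous_intros W_cont) auto
  have Wb: "\<bar>W i s \<omega> - W i t \<omega>\<bar> \<le> rho t h \<omega>" if "s \<in> {t..t+h}" "i \<in> {1..M}" "\<omega> \<in> space P" for i s \<omega>
    by (rule rho_ge1[OF that(3) t(1) that(1,2)])
  have r0: "0 \<le> rho t h \<omega>" if "\<omega> \<in> space P" for \<omega> using rho_nonneg[OF that t(1) h0] .
  have Jm: "J0 (W i) t h \<in> borel_measurable P" if "i \<in> {1..M}" for i
    unfolding J0_def using Wm Wc that by (intro borel_measurable_time_integral) auto
  have G: "integrable P (\<lambda>\<omega>. \<bar>\<xi> \<omega>\<bar> * (rho t h \<omega>)\<^sup>2)" by (rule square_moments[OF t xi])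
  have Gh: "integrable P (\<lambda>\<omega>. h * (\<bar>\<xi> \<omega>\<bar> * (rho t h \<omega>)\<^sup>2))" using G by (rule Bochner_Integration.integrable_mult_right)
  have bnd: "\<bar>\<xi> \<omega> * (a * b)\<bar> \<le> c * (\<bar>\<xi> \<omega>\<bar> * (rho t h \<omega>)\<^sup>2)"
    if "\<omega> \<in> space P" "\<bar>a\<bar> \<le> rho t h \<omega>" "\<bar>b\<bar> \<le> c * rho t h \<omega>" for a b c \<omega>
  proof -
    have "\<bar>a * b\<bar> \<le> rho t h \<omega> * (c * rho t h \<omega>)" unfolding abs_mult using that r0 by (intro mult_mono) auto
    then have "\<bar>\<xi> \<omega>\<bar> * \<bar>a * b\<bar> \<le> \<bar>\<xi> \<omega>\<bar> * (rho t h \<omega> * (c * rho t h \<omega>))" by (intro mult_left_mono) auto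
    then show ?thesis by (simp add: abs_mult power2_eq_square mult_ac)
  qed
  have Jb: "\<bar>J0 (W i) t h \<omega>\<bar> \<le> h * rho t h \<omega>" if "i \<in> {1..M}" "\<omega> \<in> space P" for i \<omega>
    using coeff_bounds(2)[OF that(2) t that(1)] by (simp add: mult.commute)
  have e: "t + h \<in> {t..t+h}" using t by simp
  show "has_bochner_integral P (\<lambda>\<omega>. \<xi> \<omega> * (dW (W m) t h \<omega> * dW (W l) t h \<omega>)) (\<kappa> * h)"
    using mom[OF e e] unfolding dW_def by simp
  have tm: "((\<lambda>s. \<kappa> * (s - t)) has_integral \<kappa> * (h\<^sup>2/2)) {t..t+h}"
    using has_integral_mult_right[OF has_integral_time[of t "t+h"], of \<kappa>] h0 by simp
  have "has_bochner_integral P (\<lambda>\<omega>. integral {t..t+h} (\<lambda>s. \<xi> \<omega> * ((W m s \<omega> - W m t \<omega>) * (W l s \<omega> - W l t \<omega>)))) (\<kappa> * (h\<^sup>2/2))"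
  proof (rule has_bochner_integral_time[OF _ _ G _ _ tm])
    fix s assume s: "s \<in> {t..t+h}"
    note [measurable] = Wm[OF s m(1)] Wm[OF s m(2)]
    show "(\<lambda>\<omega>. \<xi> \<omega> * ((W m s \<omega> - W m t \<omega>) * (W l s \<omega> - W l t \<omega>))) \<in> borel_measurable P" by measurable
    show "expectation (\<lambda>\<omega>. \<xi> \<omega> * ((W m s \<omega> - W m t \<omega>) * (W l s \<omega> - W l t \<omega>))) = \<kappa> * (s - t)"
      using mom[OF s s] by (simp add: has_bochner_integral_iff)
    fix \<omega> assume w: "\<omega> \<in> space P"
    show "\<bar>\<xi> \<omega> * ((W m s \<omega> - W m t \<omega>) * (W l s \<omega> - W l t \<omega>))\<bar> \<le> \<bar>\<xi> \<omega>\<bar> * (rho t h \<omega>)\<^sup>2"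
      using bnd[OF w Wb[OF s m(1) w], of "W l s \<omega> - W l t \<omega>" 1] Wb[OF s m(2) w] by simp
  next
    fix \<omega> assume w: "\<omega> \<in> space P"
    show "continuous_on {t..t+h} (\<lambda>s. \<xi> \<omega> * ((W m s \<omega> - W m t \<omega>) * (W l s \<omega> - W l t \<omega>)))"
      by (intro continuous_intros Wc w m)
  qed
  then show "has_bochner_integral P (\<lambda>\<omega>. \<xi> \<omega> * WW m l t h \<omega>) (\<kappa> * (h\<^sup>2/2))"
    unfolding WW_def by simp
  show J1: "has_bochner_integral P (\<lambda>\<omega>. \<xi> \<omega> * ((W m s \<omega> - W m t \<omega>) * J0 (W l) t h \<omega>)) (\<kappa> * (h * (s - t) - (s - t)\<^sup>2/2))"
    if s: "s \<in> {t..t+h}" for s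
  proof -
    have ti: "((\<lambda>u. \<kappa> * (min s u - t)) has_integral \<kappa> * (h * (s - t) - (s - t)\<^sup>2/2)) {t..t+h}"
      using s by (intro has_integral_mult_right has_integral_min) auto
    have "has_bochner_integral P (\<lambda>\<omega>. integral {t..t+h} (\<lambda>u. \<xi> \<omega> * ((W m s \<omega> - W m t \<omega>) * (W l u \<omega> - W l t \<omega>)))) (\<kappa> * (h * (s - t) - (s - t)\<^sup>2/2))"
    proof (rule has_bochner_integral_time[OF _ _ G _ _ ti])
      fix u assume u: "u \<in> {t..t+h}"
      note [measurable] = Wm[OF s m(1)] Wm[OF u m(2)]
      show "(\<lambda>\<omega>. \<xi> \<omega> * ((W m s \<omega> - W m t \<omega>) * (W l u \<omega> - W l t \<omega>))) \<in> borel_measurable P" by measurable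
      show "expectation (\<lambda>\<omega>. \<xi> \<omega> * ((W m s \<omega> - W m t \<omega>) * (W l u \<omega> - W l t \<omega>))) = \<kappa> * (min s u - t)"
        using mom[OF s u] by (simp add: has_bochner_integral_iff)
      fix \<omega> assume w: "\<omega> \<in> space P"
      show "\<bar>\<xi> \<omega> * ((W m s \<omega> - W m t \<omega>) * (W l u \<omega> - W l t \<omega>))\<bar> \<le> \<bar>\<xi> \<omega>\<bar> * (rho t h \<omega>)\<^sup>2"
        using bnd[OF w Wb[OF s m(1) w], of "W l u \<omega> - W l t \<omega>" 1] Wb[OF u m(2) w] by simp
    next
      fix \<omega> assume w: "\<omega> \<in> space P"
      show "continuous_on {t..t+h} (\<lambda>u. \<xi> \<omega> * ((W m s \<omega> - W m t \<omega>) * (W l u \<omega> - W l t \<omega>)))"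
        by (intro continuous_intros Wc w m)
    qed
    then show ?thesis unfolding J0_def by simp
  qed
  show "has_bochner_integral P (\<lambda>\<omega>. \<xi> \<omega> * (dW (W m) t h \<omega> * J0 (W l) t h \<omega>)) (\<kappa> * (h\<^sup>2/2))"
    using J1[OF e] unfolding dW_def by (simp add: power2_eq_square)
  have ti: "((\<lambda>s. \<kappa> * (h * (s - t) - (s - t)\<^sup>2/2)) has_integral \<kappa> * (h ^ 3/3)) {t..t+h}"
  proof (rule has_integral_mult_right)
    have "((\<lambda>s. h * (s - t) - (s - t)\<^sup>2/2) has_integral
      (h * ((t + h - t)\<^sup>2/2) - (t + h - t) ^ 3/6) - (h * ((t - t)\<^sup>2/2) - (t - t) ^ 3/6)) {t..t+h}"
      using h0 by (intro fundamental_theorem_of_calculus)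
        (auto intro!: derivative_eq_intros simp: has_real_derivative_iff_has_vector_derivative[symmetric] power2_eq_square)
    then show "((\<lambda>s. h * (s - t) - (s - t)\<^sup>2/2) has_integral h ^ 3/3) {t..t+h}"
      by (simp add: power2_eq_square power3_eq_cube mult.assoc)
  qed
  have "has_bochner_integral P (\<lambda>\<omega>. integral {t..t+h} (\<lambda>s. \<xi> \<omega> * ((W m s \<omega> - W m t \<omega>) * J0 (W l) t h \<omega>))) (\<kappa> * (h ^ 3/3))"
  proof (rule has_bochner_integral_time[OF _ _ Gh _ _ ti])
    fix s assume s: "s \<in> {t..t+h}"
    note [measurable] = Wm[OF s m(1)] Jm[OF m(2)]
    show "(\<lambda>\<omega>. \<xi> \<omega> * ((W m s \<omega> - W m t \<omega>) * J0 (W l) t h \<omega>)) \<in> borel_measurable P" by measurable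
    show "expectation (\<lambda>\<omega>. \<xi> \<omega> * ((W m s \<omega> - W m t \<omega>) * J0 (W l) t h \<omega>)) = \<kappa> * (h * (s - t) - (s - t)\<^sup>2/2)"
      using J1[OF s] by (simp add: has_bochner_integral_iff)
    fix \<omega> assume w: "\<omega> \<in> space P"
    show "\<bar>\<xi> \<omega> * ((W m s \<omega> - W m t \<omega>) * J0 (W l) t h \<omega>)\<bar> \<le> h * (\<bar>\<xi> \<omega>\<bar> * (rho t h \<omega>)\<^sup>2)"
      by (rule bnd[OF w Wb[OF s m(1) w] Jb[OF m(2) w]])
  next
    fix \<omega> assume w: "\<omega> \<in> space P"
    show "continuous_on {t..t+h} (\<lambda>s. \<xi> \<omega> * ((W m s \<omega> - W m t \<omega>) * J0 (W l) t h \<omega>))"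
      by (intro continuous_intros Wc w m)
  qed
  then show "has_bochner_integral P (\<lambda>\<omega>. \<xi> \<omega> * (J0 (W m) t h \<omega> * J0 (W l) t h \<omega>)) (\<kappa> * (h ^ 3/3))"
    unfolding J0_def[of "W m"] by simp
qed

text \<open>Up to the factor \<open>\<kappa>\<close>, dW dW has mean h, dW J0 and \<open>WW\<close>
  have mean h^2/2, and J0 J0 has mean h^3/3. Hence a product of two \<open>coeff_a\<close> has mean
  h/4, and \<open>coeff_b\<close> times \<open>coeff_a\<close> has mean 0. The defects average to
  h^2/2 - h^2/2 - 0 and to half of h^2/2 - h^2/6 - h^2/3.\<close>

lemma coefficient_moments:
  assumes t: "0 \<le> t" "0 < h" and xi: "\<xi> \<in> borel_measurable (F t)" "integrable P \<xi>"
    and m: "m \<in> {1..M}" "l \<in> {1..M}"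
  shows "has_bochner_integral P (\<lambda>\<omega>. \<xi> \<omega> * Q1 m l t h \<omega>) 0" "has_bochner_integral P (\<lambda>\<omega>. \<xi> \<omega> * Q2 m l t h \<omega>) 0"
proof -
  define \<kappa> where "\<kappa> = of_bool (m = l) * expectation \<xi>"
  have k: "of_bool (l = m) * expectation \<xi> = \<kappa>" unfolding \<kappa>_def by (simp add: eq_commute)
  note I = iterated_moments[OF t xi m, folded \<kappa>_def]
  \<comment> \<open>Expanding the weights also produces dW J0 with the two indices
    exchanged.\<close>
  note I' = iterated_moments(4)[OF t xi m(2,1), unfolded k]
  let ?ww = "\<lambda>\<omega>. \<xi> \<omega> * (dW (W m) t h \<omega> * dW (W l) t h \<omega>)" and ?I = "\<lambda>\<omega>. \<xi> \<omega> * WW m l t h \<omega>"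
    and ?wJ = "\<lambda>\<omega>. \<xi> \<omega> * (dW (W m) t h \<omega> * J0 (W l) t h \<omega>)" and ?Jw = "\<lambda>\<omega>. \<xi> \<omega> * (dW (W l) t h \<omega> * J0 (W m) t h \<omega>)"
    and ?JJ = "\<lambda>\<omega>. \<xi> \<omega> * (J0 (W m) t h \<omega> * J0 (W l) t h \<omega>)"
  have lin: "has_bochner_integral P (\<lambda>\<omega>. c1 * ?ww \<omega> + c2 * ?I \<omega> + c3 * ?wJ \<omega> + c4 * ?Jw \<omega> + c5 * ?JJ \<omega>)
     (c1 * (\<kappa> * h) + c2 * (\<kappa> * (h\<^sup>2/2)) + c3 * (\<kappa> * (h\<^sup>2/2)) + c4 * (\<kappa> * (h\<^sup>2/2)) + c5 * (\<kappa> * (h ^ 3/3)))" for c1 c2 c3 c4 c5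
    by (intro has_bochner_integral_add has_bochner_integral_mult_right I(1,2,4,5) I')
  have h: "h \<noteq> 0" using t by simp
  have "\<xi> \<omega> * Q1 m l t h \<omega> = (h/2) * ?ww \<omega> + (-1) * ?I \<omega> + (-1/2) * ?wJ \<omega> + (-1/2) * ?Jw \<omega> + (3/(2*h)) * ?JJ \<omega>" for \<omega>
    unfolding Q1_def coeff_a_def coeff_b_def using h by (simp add: field_simps)
  moreover have "(h/2) * (\<kappa> * h) + (-1) * (\<kappa> * (h\<^sup>2/2)) + (-1/2) * (\<kappa> * (h\<^sup>2/2)) + (-1/2) * (\<kappa> * (h\<^sup>2/2)) + (3/(2*h)) * (\<kappa> * (h ^ 3/3)) = 0"
    using h by (simp add: field_simps power2_eq_square power3_eq_cube)
  ultimately show "has_bochner_integral P (\<lambda>\<omega>. \<xi> \<omega> * Q1 m l t h \<omega>) 0"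
    using lin[of "h/2" "-1" "-1/2" "-1/2" "3/(2*h)"] by simp
  have "\<xi> \<omega> * Q2 m l t h \<omega> = (-h/4) * ?ww \<omega> + (1/2) * ?I \<omega> + (1/4) * ?wJ \<omega> + (1/4) * ?Jw \<omega> + (-3/(4*h)) * ?JJ \<omega>" for \<omega>
    unfolding Q2_def coeff_a_def using h by (simp add: field_simps)
  moreover have "(-h/4) * (\<kappa> * h) + (1/2) * (\<kappa> * (h\<^sup>2/2)) + (1/4) * (\<kappa> * (h\<^sup>2/2)) + (1/4) * (\<kappa> * (h\<^sup>2/2)) + (-3/(4*h)) * (\<kappa> * (h ^ 3/3)) = 0"
    using h by (simp add: field_simps power2_eq_square power3_eq_cube)
  ultimately show "has_bochner_integral P (\<lambda>\<omega>. \<xi> \<omega> * Q2 m l t h \<omega>) 0"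
    using lin[of "-h/4" "1/2" "1/4" "1/4" "-3/(4*h)"] by simp
qed

subsection \<open>Mean square error\<close>

lemma stages_meas:
  assumes t: "0 \<le> t" "0 \<le> h" and u: "u \<in> borel_measurable (F t)" and v: "v \<in> borel_measurable (F t)"
  shows "(\<lambda>\<omega>. st1 t h \<omega> (u \<omega>) (v \<omega>)) \<in> borel_measurable (F (t+h))"
    and "(\<lambda>\<omega>. st3 t h \<omega> (u \<omega>) (v \<omega>)) \<in> borel_measurable (F (t+h))"
    and "(\<lambda>\<omega>. v \<omega> + (2*h/3) *\<^sub>R g2 (st1 t h \<omega> (u \<omega>) (v \<omega>)) + (h/3) *\<^sub>R g2 (st3 t h \<omega> (u \<omega>) (v \<omega>))) \<in> borel_measurable (F (t+h))"
proof -
  have th: "t \<le> t + h" using t by simp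
  have [measurable]: "u \<in> borel_measurable (F (t+h))" "v \<in> borel_measurable (F (t+h))"
    using measurable_F_mono[OF u th] measurable_F_mono[OF v th] .
  have [measurable]: "g2 \<in> borel_measurable borel"
    using smooth_continuous[OF g2_smooth] by (rule borel_measurable_continuous_onI)
  have g1m: "g1 m \<in> borel_measurable borel" if "m \<in> {0..M}" for m
    using smooth_continuous[OF g1_smooth[OF that]] by (rule borel_measurable_continuous_onI)
  have [measurable]: "g1 0 \<in> borel_measurable borel" by (rule g1m) simp
  have W: "W m s \<in> borel_measurable (F (t+h))" if "m \<in> {1..M}" "s \<in> {t..t+h}" for m s
    using that t by (intro W_F_le) auto
  have dWm: "dW (W m) t h \<in> borel_measurable (F (t+h))" if "m \<in> {1..M}" for m
    unfolding dW_def using W that t by (intro borel_measurable_diff) auto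
  have J0m: "J0 (W m) t h \<in> borel_measurable (F (t+h))" if "m \<in> {1..M}" for m
    unfolding J0_def
  proof (rule borel_measurable_time_integral)
    show "(\<lambda>\<omega>. W m s \<omega> - W m t \<omega>) \<in> borel_measurable (F (t+h))" if "s \<in> {t..t+h}" for s
      using W[OF \<open>m \<in> {1..M}\<close>] that t by (intro borel_measurable_diff) auto
    show "continuous_on {t..t+h} (\<lambda>s. W m s \<omega> - W m t \<omega>)" if "\<omega> \<in> space (F (t+h))" for \<omega>
      using that t \<open>m \<in> {1..M}\<close> unfolding space_F by (intro continuous_intros W_cont) auto
  qed
  have ab: "coeff_a (W m) t h \<in> borel_measurable (F (t+h))" "coeff_b (W m) t h \<in> borel_measurable (F (t+h))" if "m \<in> {1..M}" for m
  proof -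
    note [measurable] = dWm[OF that] J0m[OF that]
    show "coeff_a (W m) t h \<in> borel_measurable (F (t+h))" "coeff_b (W m) t h \<in> borel_measurable (F (t+h))"
      unfolding coeff_a_def coeff_b_def by measurable
  qed
  have S: "(\<lambda>\<omega>. \<Sum>m=1..M. coeff_a (W m) t h \<omega> *\<^sub>R g1 m (v \<omega>)) \<in> borel_measurable (F (t+h))"
    by (intro borel_measurable_sum borel_measurable_scaleR ab measurable_compose[OF _ g1m]) auto
  show 1[measurable]: "(\<lambda>\<omega>. st1 t h \<omega> (u \<omega>) (v \<omega>)) \<in> borel_measurable (F (t+h))"
    using S unfolding st1_def by measurable
  have 2[measurable]: "(\<lambda>\<omega>. st2 t h \<omega> (u \<omega>) (v \<omega>)) \<in> borel_measurable (F (t+h))"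
    unfolding st2_def by measurable
  have S': "(\<lambda>\<omega>. \<Sum>m=1..M. coeff_a (W m) t h \<omega> *\<^sub>R g1 m (v \<omega>) + coeff_b (W m) t h \<omega> *\<^sub>R g1 m (st2 t h \<omega> (u \<omega>) (v \<omega>))) \<in> borel_measurable (F (t+h))"
    by (intro borel_measurable_sum borel_measurable_add borel_measurable_scaleR ab measurable_compose[OF _ g1m]) auto
  show 3[measurable]: "(\<lambda>\<omega>. st3 t h \<omega> (u \<omega>) (v \<omega>)) \<in> borel_measurable (F (t+h))"
    using S' unfolding st3_def by measurable
  show "(\<lambda>\<omega>. v \<omega> + (2*h/3) *\<^sub>R g2 (st1 t h \<omega> (u \<omega>) (v \<omega>)) + (h/3) *\<^sub>R g2 (st3 t h \<omega> (u \<omega>) (v \<omega>))) \<in> borel_measurable (F (t+h))"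
    by measurable
qed

lemma V_facts:
  assumes t: "0 \<le> t" "t < T" and m: "m \<in> {1..M}" "l \<in> {1..M}"
  shows "V1 m l t \<in> borel_measurable (F t)" "V2 m l t \<in> borel_measurable (F t)"
    "integrable P (\<lambda>\<omega>. (norm (V1 m l t \<omega>))\<^sup>2)" "integrable P (\<lambda>\<omega>. (norm (V2 m l t \<omega>))\<^sup>2)"
proof -
  have tT: "t \<in> {0..T}" using t by auto
  note X = X_F[OF tT]
  have g: "(\<lambda>\<omega>. g1 i (X2 t \<omega>)) \<in> borel_measurable (F t)" if "i \<in> {1..M}" for i
    by (rule borel_measurable_D1_D2(1)[OF g1_smooth[OF g1m[OF that]] X(2) X(2) X(2)])
  show V1F: "V1 m l t \<in> borel_measurable (F t)"
    unfolding V1_def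
    by (rule borel_measurable_D1_D2(2)[OF g1_smooth[OF g1m[OF m(1)]] X(2) borel_measurable_D1_D2(2)[OF g2_smooth X(1) g[OF m(2)] X(1)] X(2)])
  show V2F: "V2 m l t \<in> borel_measurable (F t)"
    unfolding V2_def by (rule borel_measurable_D1_D2(3)[OF g2_smooth X(1) g[OF m(1)] g[OF m(2)]])
  have o1: "ord 0 (\<lambda>t h \<omega> s. V1 m l t \<omega>)"
    unfolding V1_def by (rule ord_D1[OF g1[OF g1m[OF m(1)]] ord_D1[OF g2 ord_g(3)[OF g1m[OF m(2)]]]])
  have o2: "ord 0 (\<lambda>t h \<omega> s. V2 m l t \<omega>)"
    unfolding V2_def by (rule ord_D2[OF g2 ord_g(3)[OF g1m[OF m(1)]] ord_g(3)[OF g1m[OF m(2)]]]) simp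
  have sq: "integrable P (\<lambda>\<omega>. (norm (V t \<omega>))\<^sup>2)" if o: "ord 0 (\<lambda>t h \<omega> s. V t \<omega>)" and V: "V t \<in> borel_measurable (F t)"
    for V :: "real \<Rightarrow> 'a \<Rightarrow> 'c::euclidean_space"
  proof -
    obtain K j where K: "K \<ge> 0" "\<And>t h \<omega> s. admissible t h \<omega> \<Longrightarrow> s \<in> {t..t+h} \<Longrightarrow> norm (V t \<omega>) \<le> K * big \<omega> ^ j * q t h \<omega> ^ 0"
      using ordE[OF o] by blast
    have [measurable]: "V t \<in> borel_measurable P" using V measurable_F by blast
    show ?thesis
    proof (rule Bochner_Integration.integrable_bound)
      show "integrable P (\<lambda>\<omega>. K\<^sup>2 * big \<omega> ^ (2 * j))" using big_integrable by simp
      show "AE \<omega> in P. norm ((norm (V t \<omega>))\<^sup>2) \<le> norm (K\<^sup>2 * big \<omega> ^ (2 * j))"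
        using AE_good
      proof eventually_elim
        case (elim \<omega>)
        \<comment> \<open>An order bound refers to a step. For a quantity attached to the time
          \<open>t\<close>, any step starting there will do, such as the whole remaining interval;
          it is nonempty because \<open>t < T\<close>.\<close>
        have "admissible t (T - t) \<omega>" using elim t by (simp add: admissible_def)
        from K(2)[OF this, of t] t have "norm (V t \<omega>) \<le> K * big \<omega> ^ j" by simp
        then have "(norm (V t \<omega>))\<^sup>2 \<le> (K * big \<omega> ^ j)\<^sup>2" by (intro power_mono) auto
        also have "\<dots> = K\<^sup>2 * big \<omega> ^ (2 * j)" by (simp add: power_mult_distrib flip: power_mult add: mult.commute)
        finally show ?case by (simp add: big_def)
      qed
    qed measurable
  qed
  show "integrable P (\<lambda>\<omega>. (norm (V1 m l t \<omega>))\<^sup>2)" by (rule sq[OF o1 V1F])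
  show "integrable P (\<lambda>\<omega>. (norm (V2 m l t \<omega>))\<^sup>2)" by (rule sq[OF o2 V2F])
qed

lemma inner_integrable:
  fixes a b :: "'a \<Rightarrow> 'c::euclidean_space"
  assumes [measurable]: "a \<in> borel_measurable P" "b \<in> borel_measurable P"
    and "integrable P (\<lambda>\<omega>. (norm (a \<omega>))\<^sup>2)" "integrable P (\<lambda>\<omega>. (norm (b \<omega>))\<^sup>2)"
  shows "integrable P (\<lambda>\<omega>. a \<omega> \<bullet> b \<omega>)"
proof (rule Bochner_Integration.integrable_bound)
  show "integrable P (\<lambda>\<omega>. (norm (a \<omega>))\<^sup>2 + (norm (b \<omega>))\<^sup>2)" using assms(3,4) by simp
  have "\<bar>a \<omega> \<bullet> b \<omega>\<bar> \<le> (norm (a \<omega>))\<^sup>2 + (norm (b \<omega>))\<^sup>2" for \<omega>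
  proof -
    have "0 \<le> norm (a \<omega>) * norm (b \<omega>)" by simp
    then show ?thesis
      using Cauchy_Schwarz_ineq2[of "a \<omega>" "b \<omega>"] sum_squares_bound[of "norm (a \<omega>)" "norm (b \<omega>)"] by linarith
  qed
  then show "AE \<omega> in P. norm (a \<omega> \<bullet> b \<omega>) \<le> norm ((norm (a \<omega>))\<^sup>2 + (norm (b \<omega>))\<^sup>2)" by simp
qed measurable

text \<open>Expectations in \<open>one_step_square\<close>: the three inner products vanish, since
  current error and coefficients are known at \<open>t\<close>, and the factor of the squared error
  averages to O(h). Integrability of the new error follows from domination by the integrable
  right-hand side.\<close>

lemma mean_square_step:
  obtains C where "C \<ge> 0"
    "\<And>t h u v. 0 \<le> t \<Longrightarrow> 0 < h \<Longrightarrow> h \<le> 1 \<Longrightarrow> t + h \<le> T \<Longrightarrow> u \<in> borel_measurable (F t) \<Longrightarrow> v \<in> borel_measurable (F t) \<Longrightarrow>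
      integrable P (\<lambda>\<omega>. (norm ((u \<omega>, v \<omega>) - (X1 t \<omega>, X2 t \<omega>)))\<^sup>2) \<Longrightarrow>
      integrable P (\<lambda>\<omega>. (norm (sprk_step M W g1 g2 t h \<omega> (u \<omega>, v \<omega>) - (X1 (t+h) \<omega>, X2 (t+h) \<omega>)))\<^sup>2) \<and>
      expectation (\<lambda>\<omega>. (norm (sprk_step M W g1 g2 t h \<omega> (u \<omega>, v \<omega>) - (X1 (t+h) \<omega>, X2 (t+h) \<omega>)))\<^sup>2)
        \<le> (1 + C * h) * expectation (\<lambda>\<omega>. (norm ((u \<omega>, v \<omega>) - (X1 t \<omega>, X2 t \<omega>)))\<^sup>2) + C * h ^ 4"
proof -
  obtain K j where K: "K \<ge> 0" and step: "\<And>t h \<omega> u v. admissible t h \<omega> \<Longrightarrow>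
      (norm (sprk_step M W g1 g2 t h \<omega> (u, v) - (X1 (t+h) \<omega>, X2 (t+h) \<omega>)))\<^sup>2
      \<le> (norm ((u, v) - (X1 t \<omega>, X2 t \<omega>)))\<^sup>2
        + 2 * ((u - X1 t \<omega>) \<bullet> mart_noise t h \<omega> v) - 2 * ((u - X1 t \<omega>) \<bullet> mart1 t h \<omega>) - 2 * ((v - X2 t \<omega>) \<bullet> mart2 t h \<omega>)
        + K * ((norm ((u, v) - (X1 t \<omega>, X2 t \<omega>)))\<^sup>2 * ((q t h \<omega>)\<^sup>2 * (1 + q t h \<omega>) ^ 16))
        + K * (big \<omega> ^ j * (q t h \<omega> ^ 10 / h + q t h \<omega> ^ 10 + q t h \<omega> ^ 8))"
    using one_step_square by blast
  obtain C1 where C1: "C1 \<ge> 0" and w1: "\<And>t h \<xi>. 0 \<le> t \<Longrightarrow> 0 < h \<Longrightarrow> h \<le> 1 \<Longrightarrow> \<xi> \<in> borel_measurable (F t) \<Longrightarrow> integrable P \<xi> \<Longrightarrow> (\<And>\<omega>. 0 \<le> \<xi> \<omega>) \<Longrightarrow>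
      integrable P (\<lambda>\<omega>. \<xi> \<omega> * ((q t h \<omega>)\<^sup>2 * (1 + q t h \<omega>) ^ 16)) \<and>
      expectation (\<lambda>\<omega>. \<xi> \<omega> * ((q t h \<omega>)\<^sup>2 * (1 + q t h \<omega>) ^ 16)) \<le> C1 * h * expectation \<xi>"
    using step_weight_bound by blast
  obtain C2 where C2: "C2 \<ge> 0" and w2: "\<And>t h. 0 \<le> t \<Longrightarrow> 0 < h \<Longrightarrow> h \<le> 1 \<Longrightarrow>
      integrable P (\<lambda>\<omega>. big \<omega> ^ j * (q t h \<omega> ^ 10 / h + q t h \<omega> ^ 10 + q t h \<omega> ^ 8)) \<and>
      expectation (\<lambda>\<omega>. big \<omega> ^ j * (q t h \<omega> ^ 10 / h + q t h \<omega> ^ 10 + q t h \<omega> ^ 8)) \<le> C2 * h ^ 4"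
    using step_remainder_bound[of j] by blast
  show thesis
  proof (rule that[of "K * C1 + K * C2"])
    show "0 \<le> K * C1 + K * C2" using K C1 C2 by simp
    fix t h :: real and u :: "'a \<Rightarrow> 'x" and v :: "'a \<Rightarrow> 'y"
    assume t: "0 \<le> t" "0 < h" "h \<le> 1" "t + h \<le> T" and uF: "u \<in> borel_measurable (F t)" and vF: "v \<in> borel_measurable (F t)"
      and e2: "integrable P (\<lambda>\<omega>. (norm ((u \<omega>, v \<omega>) - (X1 t \<omega>, X2 t \<omega>)))\<^sup>2)"
    have h0: "0 \<le> h" and tT: "t \<in> {0..T}" "t < T" "t + h \<in> {0..T}" "t \<le> t + h" using t by auto
    define E where "E \<omega> = (norm ((u \<omega>, v \<omega>) - (X1 t \<omega>, X2 t \<omega>)))\<^sup>2" for \<omega>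
    define a where "a \<omega> = u \<omega> - X1 t \<omega>" for \<omega>
    define b where "b \<omega> = v \<omega> - X2 t \<omega>" for \<omega>
    have aF: "a \<in> borel_measurable (F t)" and bF: "b \<in> borel_measurable (F t)"
      unfolding a_def b_def using uF vF X_F[OF tT(1)] by (auto intro: borel_measurable_diff)
    have [measurable]: "a \<in> borel_measurable P" "b \<in> borel_measurable P" using aF bF measurable_F by blast+
    have Eab: "E \<omega> = (norm (a \<omega>))\<^sup>2 + (norm (b \<omega>))\<^sup>2" for \<omega> unfolding E_def a_def b_def by (simp add: norm_Pair)
    have Ei: "integrable P E" using e2 unfolding E_def .
    have EF: "E \<in> borel_measurable (F t)" unfolding Eab[abs_def] using aF bF by measurable
    have E0: "0 \<le> E \<omega>" for \<omega> unfolding E_def by simp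
    have a2: "integrable P (\<lambda>\<omega>. (norm (a \<omega>))\<^sup>2)" and b2: "integrable P (\<lambda>\<omega>. (norm (b \<omega>))\<^sup>2)"
      by (rule Bochner_Integration.integrable_bound[OF Ei]; simp add: Eab)+
    define N where "N \<omega> = a \<omega> \<bullet> mart_noise t h \<omega> (v \<omega>)" for \<omega>
    define A1 where "A1 \<omega> = a \<omega> \<bullet> mart1 t h \<omega>" for \<omega>
    define A2 where "A2 \<omega> = b \<omega> \<bullet> mart2 t h \<omega>" for \<omega>
    have N: "has_bochner_integral P N 0"
    proof -
      \<comment> \<open>Known at time \<open>t\<close> and integrable as an inner product of square
        integrable variables, hence an admissible weight for the increment.\<close>
      define G where "G m \<omega> = a \<omega> \<bullet> (g1 m (v \<omega>) - g1 m (X2 t \<omega>))" for m \<omega>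
      have G: "has_bochner_integral P (\<lambda>\<omega>. G m \<omega> * dW (W m) t h \<omega>) 0" if m: "m \<in> {1..M}" for m
      proof -
        have dF: "(\<lambda>\<omega>. g1 m (v \<omega>) - g1 m (X2 t \<omega>)) \<in> borel_measurable (F t)"
          by (intro borel_measurable_diff borel_measurable_D1_D2(1)[OF g1_smooth[OF g1m[OF m]] vF vF vF]
            borel_measurable_D1_D2(1)[OF g1_smooth[OF g1m[OF m]] X_F(2) X_F(2) X_F(2)] tT)
        then have dP[measurable]: "(\<lambda>\<omega>. g1 m (v \<omega>) - g1 m (X2 t \<omega>)) \<in> borel_measurable P" by (rule measurable_F)
        have d2: "integrable P (\<lambda>\<omega>. (norm (g1 m (v \<omega>) - g1 m (X2 t \<omega>)))\<^sup>2)"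
        proof (rule Bochner_Integration.integrable_bound)
          show "integrable P (\<lambda>\<omega>. L\<^sup>2 * (norm (b \<omega>))\<^sup>2)" using b2 by simp
          have "(norm (g1 m (v \<omega>) - g1 m (X2 t \<omega>)))\<^sup>2 \<le> (L * norm (b \<omega>))\<^sup>2" for \<omega>
            unfolding b_def by (intro power_mono g_lipschitz(2) g1m m) auto
          then show "AE \<omega> in P. norm ((norm (g1 m (v \<omega>) - g1 m (X2 t \<omega>)))\<^sup>2) \<le> norm (L\<^sup>2 * (norm (b \<omega>))\<^sup>2)"
            by (simp add: power_mult_distrib)
        qed measurable
        have GF: "G m \<in> borel_measurable (F t)" unfolding G_def using aF dF by measurable
        have Gi: "integrable P (G m)" unfolding G_def by (rule inner_integrable[OF _ _ a2 d2]) measurable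
        show ?thesis
          using weighted_increment(1,2)[OF t(1) tT(4) GF Gi m] unfolding dW_def by (simp add: has_bochner_integral_iff)
      qed
      have "has_bochner_integral P (\<lambda>\<omega>. \<Sum>m=1..M. G m \<omega> * dW (W m) t h \<omega>) (\<Sum>m=1..M. 0)"
        by (rule has_bochner_integral_sum) (rule G)
      moreover have "(\<lambda>\<omega>. \<Sum>m=1..M. G m \<omega> * dW (W m) t h \<omega>) = N"
        unfolding N_def mart_noise_def G_def inner_sum_right by (simp add: mult.commute)
      ultimately show ?thesis by simp
    qed
    have A1: "has_bochner_integral P A1 0"
    proof -
      have "has_bochner_integral P (\<lambda>\<omega>. (a \<omega> \<bullet> V1 m l t \<omega>) * Q1 m l t h \<omega>) 0" if m: "m \<in> {1..M}" "l \<in> {1..M}" for m l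
      proof (rule coefficient_moments(1)[OF t(1,2) _ _ m])
        note V = V_facts[OF t(1) tT(2) m]
        show "(\<lambda>\<omega>. a \<omega> \<bullet> V1 m l t \<omega>) \<in> borel_measurable (F t)" using aF V(1) by measurable
        show "integrable P (\<lambda>\<omega>. a \<omega> \<bullet> V1 m l t \<omega>)" by (rule inner_integrable[OF _ measurable_F[OF V(1)] a2 V(3)]) measurable
      qed
      then have "has_bochner_integral P (\<lambda>\<omega>. \<Sum>m=1..M. \<Sum>l=1..M. (a \<omega> \<bullet> V1 m l t \<omega>) * Q1 m l t h \<omega>) (\<Sum>m=1..M. \<Sum>l=1..M. 0)"
        by (intro has_bochner_integral_sum)
      moreover have "(\<lambda>\<omega>. \<Sum>m=1..M. \<Sum>l=1..M. (a \<omega> \<bullet> V1 m l t \<omega>) * Q1 m l t h \<omega>) = A1"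
        unfolding A1_def mart1_def inner_sum_right by (simp add: mult.commute)
      ultimately show ?thesis by simp
    qed
    have A2: "has_bochner_integral P A2 0"
    proof -
      have "has_bochner_integral P (\<lambda>\<omega>. (b \<omega> \<bullet> V2 m l t \<omega>) * Q2 m l t h \<omega>) 0" if m: "m \<in> {1..M}" "l \<in> {1..M}" for m l
      proof (rule coefficient_moments(2)[OF t(1,2) _ _ m])
        note V = V_facts[OF t(1) tT(2) m]
        show "(\<lambda>\<omega>. b \<omega> \<bullet> V2 m l t \<omega>) \<in> borel_measurable (F t)" using bF V(2) by measurable
        show "integrable P (\<lambda>\<omega>. b \<omega> \<bullet> V2 m l t \<omega>)" by (rule inner_integrable[OF _ measurable_F[OF V(2)] b2 V(4)]) measurable
      qed
      then have "has_bochner_integral P (\<lambda>\<omega>. \<Sum>m=1..M. \<Sum>l=1..M. (b \<omega> \<bullet> V2 m l t \<omega>) * Q2 m l t h \<omega>) (\<Sum>m=1..M. \<Sum>l=1..M. 0)"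
        by (intro has_bochner_integral_sum)
      moreover have "(\<lambda>\<omega>. \<Sum>m=1..M. \<Sum>l=1..M. (b \<omega> \<bullet> V2 m l t \<omega>) * Q2 m l t h \<omega>) = A2"
        unfolding A2_def mart2_def inner_sum_right by (simp add: mult.commute)
      ultimately show ?thesis by simp
    qed
    define \<Phi> where "\<Phi> \<omega> = E \<omega> * ((q t h \<omega>)\<^sup>2 * (1 + q t h \<omega>) ^ 16)" for \<omega>
    define \<Psi> where "\<Psi> \<omega> = big \<omega> ^ j * (q t h \<omega> ^ 10 / h + q t h \<omega> ^ 10 + q t h \<omega> ^ 8)" for \<omega>
    have Phi: "integrable P \<Phi>" "expectation \<Phi> \<le> C1 * h * expectation E"
      using w1[OF t(1,2,3) EF Ei E0] unfolding \<Phi>_def by auto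
    have Psi: "integrable P \<Psi>" "expectation \<Psi> \<le> C2 * h ^ 4"
      using w2[OF t(1,2,3)] unfolding \<Psi>_def by auto
    define Rh where "Rh \<omega> = E \<omega> + 2 * N \<omega> - 2 * A1 \<omega> - 2 * A2 \<omega> + K * \<Phi> \<omega> + K * \<Psi> \<omega>" for \<omega>
    have Rh: "has_bochner_integral P Rh (expectation E + 2 * 0 - 2 * 0 - 2 * 0 + K * expectation \<Phi> + K * expectation \<Psi>)"
      unfolding Rh_def using Ei Phi(1) Psi(1)
      by (intro has_bochner_integral_add has_bochner_integral_diff has_bochner_integral_mult_right N A1 A2 has_bochner_integral_integrable)
    define E' where "E' \<omega> = (norm (sprk_step M W g1 g2 t h \<omega> (u \<omega>, v \<omega>) - (X1 (t+h) \<omega>, X2 (t+h) \<omega>)))\<^sup>2" for \<omega>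
    have le: "AE \<omega> in P. E' \<omega> \<le> Rh \<omega>"
      using AE_good
    proof eventually_elim
      case (elim \<omega>)
      have "admissible t h \<omega>" using elim t by (simp add: admissible_def)
      from step[OF this] show ?case
        unfolding E'_def Rh_def E_def N_def A1_def A2_def \<Phi>_def \<Psi>_def a_def b_def .
    qed
    have [measurable]: "E' \<in> borel_measurable P"
    proof -
      note S = stages_meas[OF t(1) h0 uF vF]
      note [measurable] = measurable_F[OF S(2)] measurable_F[OF S(3)] X_P[OF tT(3)]
      have "(\<lambda>\<omega>. (norm (st3 t h \<omega> (u \<omega>) (v \<omega>) - X1 (t+h) \<omega>))\<^sup>2 + (norm ((v \<omega> + (2*h/3) *\<^sub>R g2 (st1 t h \<omega> (u \<omega>) (v \<omega>)) + (h/3) *\<^sub>R g2 (st3 t h \<omega> (u \<omega>) (v \<omega>))) - X2 (t+h) \<omega>))\<^sup>2) \<in> borel_measurable P"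
        by measurable
      also have "(\<lambda>\<omega>. (norm (st3 t h \<omega> (u \<omega>) (v \<omega>) - X1 (t+h) \<omega>))\<^sup>2 + (norm ((v \<omega> + (2*h/3) *\<^sub>R g2 (st1 t h \<omega> (u \<omega>) (v \<omega>)) + (h/3) *\<^sub>R g2 (st3 t h \<omega> (u \<omega>) (v \<omega>))) - X2 (t+h) \<omega>))\<^sup>2) = E'"
        unfolding E'_def sprk_step_stages diff_Pair norm_Pair by simp
      finally show ?thesis .
    qed
    have E'i: "integrable P E'"
    proof (rule Bochner_Integration.integrable_bound)
      show "integrable P Rh" using Rh by (simp add: has_bochner_integral_iff)
      show "AE \<omega> in P. norm (E' \<omega>) \<le> norm (Rh \<omega>)"
        using le by eventually_elim (simp add: E'_def)
    qed measurable
    have "expectation E' \<le> expectation Rh"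
      using Rh le E'i by (intro integral_mono_AE) (auto simp: has_bochner_integral_iff)
    also have "\<dots> = expectation E + K * expectation \<Phi> + K * expectation \<Psi>"
      using Rh by (simp add: has_bochner_integral_iff)
    also have "\<dots> \<le> expectation E + K * (C1 * h * expectation E) + K * (C2 * h ^ 4)"
      using Phi(2) Psi(2) K by (intro add_mono mult_left_mono order_refl)
    also have "\<dots> \<le> (1 + (K * C1 + K * C2) * h) * expectation E + (K * C1 + K * C2) * h ^ 4"
    proof -
      have "0 \<le> expectation E" using E0 by (intro integral_nonneg_AE) auto
      then have "0 \<le> K * C2 * h * expectation E" "0 \<le> K * C1 * h ^ 4" using K C1 C2 h0 by simp_all
      then show ?thesis by (simp add: algebra_simps)
    qed
    finally show "integrable P (\<lambda>\<omega>. (norm (sprk_step M W g1 g2 t h \<omega> (u \<omega>, v \<omega>) - (X1 (t+h) \<omega>, X2 (t+h) \<omega>)))\<^sup>2) \<and>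
      expectation (\<lambda>\<omega>. (norm (sprk_step M W g1 g2 t h \<omega> (u \<omega>, v \<omega>) - (X1 (t+h) \<omega>, X2 (t+h) \<omega>)))\<^sup>2)
        \<le> (1 + (K * C1 + K * C2) * h) * expectation (\<lambda>\<omega>. (norm ((u \<omega>, v \<omega>) - (X1 t \<omega>, X2 t \<omega>)))\<^sup>2) + (K * C1 + K * C2) * h ^ 4"
      using E'i unfolding E'_def E_def by blast
  qed
qed

text \<open>Discrete Gronwall argument on an arbitrary grid: each step contributes at most a
  multiple of d^3 h with \<open>d\<close> the mesh, and the step lengths add up to at most
  \<open>T\<close>. The square root of d^3 is the order 3/2.\<close>

lemma strong_order_sprk: "strong_order P T (\<lambda>t \<omega>. (X1 t \<omega>, X2 t \<omega>)) (sprk M W g1 g2 (x1, x2)) (3/2)"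
proof -
  obtain C where C: "C \<ge> 0" and step: "\<And>t h u v. 0 \<le> t \<Longrightarrow> 0 < h \<Longrightarrow> h \<le> 1 \<Longrightarrow> t + h \<le> T \<Longrightarrow> u \<in> borel_measurable (F t) \<Longrightarrow> v \<in> borel_measurable (F t) \<Longrightarrow>
      integrable P (\<lambda>\<omega>. (norm ((u \<omega>, v \<omega>) - (X1 t \<omega>, X2 t \<omega>)))\<^sup>2) \<Longrightarrow>
      integrable P (\<lambda>\<omega>. (norm (sprk_step M W g1 g2 t h \<omega> (u \<omega>, v \<omega>) - (X1 (t+h) \<omega>, X2 (t+h) \<omega>)))\<^sup>2) \<and>
      expectation (\<lambda>\<omega>. (norm (sprk_step M W g1 g2 t h \<omega> (u \<omega>, v \<omega>) - (X1 (t+h) \<omega>, X2 (t+h) \<omega>)))\<^sup>2)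
        \<le> (1 + C * h) * expectation (\<lambda>\<omega>. (norm ((u \<omega>, v \<omega>) - (X1 t \<omega>, X2 t \<omega>)))\<^sup>2) + C * h ^ 4"
    using mean_square_step by blast
  \<comment> \<open>The inductive bound \<open>exp (C * \<tau> n) * C * d ^ 3 * \<tau> n\<close> at
    the final time, without its power of \<open>d\<close>.\<close>
  define D where "D = exp (C * T) * C * T"
  have D0: "0 \<le> D" unfolding D_def using C T by simp
  show ?thesis
    unfolding strong_order_def
  proof (rule exI[of _ "sqrt D"], rule exI[of _ 1], intro conjI allI impI)
    show "(0::real) < 1" by simp
    fix N \<tau> assume gm: "grid T N \<tau> \<and> mesh N \<tau> \<le> 1"
    then have g: "grid T N \<tau>" and m1: "mesh N \<tau> \<le> 1" by auto
    define d where "d = mesh N \<tau>"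
    have d0: "0 \<le> d" unfolding d_def by (rule mesh_nonneg)
    define e where "e n \<omega> = (norm (sprk M W g1 g2 (x1, x2) \<tau> n \<omega> - (X1 (\<tau> n) \<omega>, X2 (\<tau> n) \<omega>)))\<^sup>2" for n \<omega>
    \<comment> \<open>Adaptedness of the approximation belongs to the induction, since
      \<open>mean_square_step\<close> asks for starting values known at the beginning of the
      step.\<close>
    have main: "(\<lambda>\<omega>. fst (sprk M W g1 g2 (x1, x2) \<tau> n \<omega>)) \<in> borel_measurable (F (\<tau> n)) \<and>
       (\<lambda>\<omega>. snd (sprk M W g1 g2 (x1, x2) \<tau> n \<omega>)) \<in> borel_measurable (F (\<tau> n)) \<and>
       integrable P (e n) \<and> expectation (e n) \<le> exp (C * \<tau> n) * C * d ^ 3 * \<tau> n" if "n \<le> N" for n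
      using that
    proof (induction n)
      case 0
      have t0: "\<tau> 0 = 0" using g by (simp add: grid_def)
      \<comment> \<open>The method starts exactly at the initial values, whereas the solution
        attains them almost surely.\<close>
      have "AE \<omega> in P. e 0 \<omega> = 0"
        using AE_good by eventually_elim (simp add: e_def t0 good_def)
      moreover have [measurable]: "e 0 \<in> borel_measurable P"
      proof -
        have [measurable]: "X1 0 \<in> borel_measurable P" "X2 0 \<in> borel_measurable P" using X_P[of 0] T by auto
        have "(\<lambda>\<omega>. (norm (x1 - X1 0 \<omega>))\<^sup>2 + (norm (x2 - X2 0 \<omega>))\<^sup>2) \<in> borel_measurable P" by measurable
        then show ?thesis unfolding e_def t0 sprk.simps diff_Pair norm_Pair by simp
      qed
      ultimately have "has_bochner_integral P (e 0) 0"
        using has_bochner_integral_cong_AE[of "e 0" P "\<lambda>_. 0" 0] has_bochner_integral_zero by auto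
      then show ?case by (simp add: has_bochner_integral_iff t0)
    next
      case (Suc n)
      then have n: "n < N" by simp
      note IH = Suc.IH[OF less_imp_le[OF n]]
      define h where "h = \<tau> (Suc n) - \<tau> n"
      have h: "0 < h" "h \<le> d" unfolding h_def d_def using g n grid_gap_le_mesh[OF n] by (auto simp: grid_def)
      have h1: "h \<le> 1" using h m1 unfolding d_def by simp
      have tn: "0 \<le> \<tau> n" "\<tau> n + h \<le> T" "\<tau> (Suc n) = \<tau> n + h"
        using grid_range[OF g, of n] grid_range[OF g, of "Suc n"] n unfolding h_def by auto
      let ?u = "\<lambda>\<omega>. fst (sprk M W g1 g2 (x1, x2) \<tau> n \<omega>)" and ?v = "\<lambda>\<omega>. snd (sprk M W g1 g2 (x1, x2) \<tau> n \<omega>)"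
      have uF: "?u \<in> borel_measurable (F (\<tau> n))" and vF: "?v \<in> borel_measurable (F (\<tau> n))" using IH by auto
      have Y: "sprk M W g1 g2 (x1, x2) \<tau> (Suc n) \<omega> = sprk_step M W g1 g2 (\<tau> n) h \<omega> (?u \<omega>, ?v \<omega>)" for \<omega>
        by (simp add: h_def)
      have en: "(\<lambda>\<omega>. (norm ((?u \<omega>, ?v \<omega>) - (X1 (\<tau> n) \<omega>, X2 (\<tau> n) \<omega>)))\<^sup>2) = e n"
        unfolding e_def by simp
      have eS: "(\<lambda>\<omega>. (norm (sprk_step M W g1 g2 (\<tau> n) h \<omega> (?u \<omega>, ?v \<omega>) - (X1 (\<tau> n + h) \<omega>, X2 (\<tau> n + h) \<omega>)))\<^sup>2) = e (Suc n)"
        unfolding e_def Y tn(3) ..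
      have S: "integrable P (e (Suc n)) \<and> expectation (e (Suc n)) \<le> (1 + C * h) * expectation (e n) + C * h ^ 4"
        using step[OF tn(1) h(1) h1 tn(2) uF vF] IH unfolding en eS by blast
      have IH_le: "expectation (e n) \<le> exp (C * \<tau> n) * C * d ^ 3 * \<tau> n" using IH by blast
      have IH_ge: "0 \<le> expectation (e n)" by (rule Bochner_Integration.integral_nonneg) (simp add: e_def)
      have "expectation (e (Suc n)) \<le> (1 + C * h) * expectation (e n) + C * h ^ 4" using S by blast
      also have "\<dots> \<le> exp (C * h) * (exp (C * \<tau> n) * C * d ^ 3 * \<tau> n) + exp (C * (\<tau> n + h)) * C * d ^ 3 * h"
      proof (rule add_mono)
        have "0 \<le> exp (C * \<tau> n) * C * d ^ 3 * \<tau> n" using C d0 tn by simp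
        then show "(1 + C * h) * expectation (e n) \<le> exp (C * h) * (exp (C * \<tau> n) * C * d ^ 3 * \<tau> n)"
          using IH_le IH_ge exp_ge_add_one_self[of "C * h"] by (intro mult_mono) simp_all
        have "h ^ 4 = h ^ 3 * h" by (simp add: eval_nat_numeral)
        also have "\<dots> \<le> d ^ 3 * h" using h by (intro mult_right_mono power_mono) auto
        finally have "C * h ^ 4 \<le> C * (d ^ 3 * h)" using C by (intro mult_left_mono)
        also have "\<dots> \<le> exp (C * (\<tau> n + h)) * (C * (d ^ 3 * h))"
        proof -
          have "1 \<le> exp (C * (\<tau> n + h))" "0 \<le> C * (d ^ 3 * h)" using C tn h d0 by simp_all
          then show ?thesis using mult_right_mono[of 1 "exp (C * (\<tau> n + h))" "C * (d ^ 3 * h)"] by simp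
        qed
        finally show "C * h ^ 4 \<le> exp (C * (\<tau> n + h)) * C * d ^ 3 * h" by (simp only: mult.assoc)
      qed
      also have "\<dots> = exp (C * \<tau> (Suc n)) * C * d ^ 3 * \<tau> (Suc n)"
      proof -
        have "exp (C * (\<tau> n + h)) = exp (C * h) * exp (C * \<tau> n)" by (simp add: distrib_left exp_add)
        then show ?thesis unfolding tn(3) by (simp add: algebra_simps)
      qed
      finally have "expectation (e (Suc n)) \<le> exp (C * \<tau> (Suc n)) * C * d ^ 3 * \<tau> (Suc n)" .
      moreover have "(\<lambda>\<omega>. fst (sprk M W g1 g2 (x1, x2) \<tau> (Suc n) \<omega>)) \<in> borel_measurable (F (\<tau> (Suc n)))"
        "(\<lambda>\<omega>. snd (sprk M W g1 g2 (x1, x2) \<tau> (Suc n) \<omega>)) \<in> borel_measurable (F (\<tau> (Suc n)))"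
        unfolding Y tn(3) sprk_step_stages fst_conv snd_conv
        using stages_meas(2,3)[OF tn(1) less_imp_le[OF h(1)] uF vF] by blast+
      ultimately show ?case using S by blast
    qed
    have bound: "expectation (e n) \<le> D * d ^ 3" if "n \<le> N" for n
    proof -
      have tn: "0 \<le> \<tau> n" "\<tau> n \<le> T" using grid_range[OF g that] by auto
      have "exp (C * \<tau> n) * C * d ^ 3 * \<tau> n \<le> exp (C * T) * C * d ^ 3 * T"
        using tn C d0 by (intro mult_mono mult_nonneg_nonneg) (auto intro: mult_left_mono)
      then show ?thesis using main[OF that] unfolding D_def by (simp add: mult_ac)
    qed
    fix n
    show "n \<le> N \<Longrightarrow> integrable P (\<lambda>\<omega>. (norm (sprk M W g1 g2 (x1, x2) \<tau> n \<omega> - (X1 (\<tau> n) \<omega>, X2 (\<tau> n) \<omega>)))\<^sup>2)"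
      using main[of n] unfolding e_def by blast
    have sq: "sqrt (D * d ^ 3) = sqrt D * d powr (3/2)"
    proof -
      have "sqrt (d ^ 3) = d powr (3/2)"
      proof (cases "d = 0")
        case False
        then have "d > 0" using d0 by simp
        have "(d powr (3/2))\<^sup>2 = d powr (3/2 + 3/2)" unfolding powr_add power2_eq_square ..
        also have "\<dots> = d ^ 3" using powr_realpow[OF \<open>d > 0\<close>, of 3] by simp
        finally show ?thesis by (intro real_sqrt_unique) simp_all
      qed simp
      then show ?thesis by (simp add: real_sqrt_mult)
    qed
    show "(MAX n\<in>{..N}. sqrt (expectation (\<lambda>\<omega>. (norm (sprk M W g1 g2 (x1, x2) \<tau> n \<omega> - (X1 (\<tau> n) \<omega>, X2 (\<tau> n) \<omega>)))\<^sup>2)))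
      \<le> sqrt D * mesh N \<tau> powr (3/2)"
      unfolding e_def[symmetric] d_def[symmetric] sq[symmetric]
      using bound by (intro Max.boundedI) (auto intro!: real_sqrt_le_mono)
  qed
qed

end

theorem mainTheorem5:
  fixes P :: "'a measure" and F :: "real \<Rightarrow> 'a measure"
    and M :: nat and W :: "nat \<Rightarrow> real \<Rightarrow> 'a \<Rightarrow> real"
    and g1 :: "nat \<Rightarrow> 'y::euclidean_space \<Rightarrow> 'x::euclidean_space" and g2 :: "'x \<Rightarrow> 'y"
    and x1 :: 'x and x2 :: 'y and T :: real
    and X1 :: "real \<Rightarrow> 'a \<Rightarrow> 'x" and X2 :: "real \<Rightarrow> 'a \<Rightarrow> 'y"
    and calc :: calculus
  assumes "independent_wiener_processes P M W"
    and "wiener_filtration P F M W"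
    and "T > 0"
    and "\<And>m. m \<in> {0..M} \<Longrightarrow> smooth_bounded_derivs (g1 m)"
    and "smooth_bounded_derivs g2"
    and "separable_sde_solution calc P F M W g1 g2 x1 x2 T X1 X2"
  shows "strong_order P T (\<lambda>t \<omega>. (X1 t \<omega>, X2 t \<omega>)) (sprk M W g1 g2 (x1, x2)) (3/2)"
proof -
  have "\<forall>m\<in>{0..M}. \<exists>L. taylor_bounded L (g1 m)"
    using assms(4) smooth_imp_taylor_bounded by metis
  then obtain L1 where L1: "\<And>m. m \<in> {0..M} \<Longrightarrow> taylor_bounded (L1 m) (g1 m)" by metis
  obtain L2 where L2: "taylor_bounded L2 g2" using smooth_imp_taylor_bounded[OF assms(5)] by blast
  \<comment> \<open>Absolute values make the sum dominate each single constant, and the summand 1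
    ensures \<open>L \<ge> 1\<close>.\<close>
  define L where "L = 1 + \<bar>L2\<bar> + (\<Sum>m\<in>{0..M}. \<bar>L1 m\<bar>)"
  have "0 \<le> (\<Sum>m\<in>{0..M}. \<bar>L1 m\<bar>)" by (intro sum_nonneg) auto
  then have L: "1 \<le> L" "L2 \<le> L" unfolding L_def by linarith+
  have "L1 m \<le> L" if "m \<in> {0..M}" for m
    using member_le_sum[OF that, of "\<lambda>m. \<bar>L1 m\<bar>"] unfolding L_def by simp
  then interpret separable_solution P F M W calc g1 g2 x1 x2 T X1 X2 L
    using assms L L1 L2 by unfold_locales (auto intro: taylor_bounded_mono)
  show ?thesis by (rule strong_order_sprk)
qed

end
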